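(* Let $g\in H^{7/2}(\Gamma)$ be fixed, with $\int_\Gamma g\,ds=0$, and assume that the inflow and outflow boundaries are well separated: $\mathrm{dist}(\Gamma_{\mathrm{in}},\Gamma_{\mathrm{out}}):=\inf_{(x,y)\in\Gamma_{\mathrm{in}}\times\Gamma_{\mathrm{out}}}|x-y|>0$. Let $U^\delta$ be noisy data as in the context. Then for every $\varepsilon\in(0,1)$ there exists a unique $\gamma_\varepsilon^\delta\in V$ solving the regularized transport problem $$\nabla U^\delta\cdot\nabla\gamma+\Big(\tfrac12\Delta U^\delta+\varepsilon\Big)\gamma=0\ \text{ in }\Omega,\qquad \gamma=\gamma_0\ \text{ on }\Gamma_{\mathrm{in}},$$ understood in the weak sense: $a(\gamma_\varepsilon^\delta,w)=\int_\Gamma(\beta\cdot\nu)^{\ominus}\gamma_0\,w\,ds$ for all $w\in V$.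
   Context: Let $\Omega\subset\mathbb{R}^n$, $n=2,3$, be a $C^6$-smooth bounded domain with boundary $\Gamma$, outward unit normal $\nu$ and diameter $d$. For $\eta\in(0,d)$ let $\Omega_\eta=\{x\in\Omega:\mathrm{dist}(x,\Gamma)>\eta\}$. Fix $\sigma_0\in W^{2,\infty}(\Omega)$ and $0<k_1<k_2$, and let $\Sigma=\{\sigma\in W^{2,\infty}(\Omega):\sigma=\sigma_0\text{ in }\Omega\setminus\overline{\Omega_\eta},\ k_1\le\sigma,\ \|\sigma\|_{W^{2,\infty}(\Omega)}\le k_2\}$. Let $\sigma\in\Sigma$ and let $u_\sigma$ be the unique solution of $\mathrm{div}(\sigma\nabla u)=0$ in $\Omega$, $\sigma\partial_\nu u=g$ on $\Gamma$, $\int_\Omega u\,dx=0$; it is taken to belong to $H^5(\Omega)$. Put $\gamma_0=\sqrt{\sigma_0}$. Noisy data: $\delta\in(0,1)$ and $U^\delta\in H^5(\Omega)$ satisfies $\|U^\delta-u_\sigma\|_{H^5(\Omega)}\le\delta\|u_\sigma\|_{H^5(\Omega)}$, $\int_\Omega U^\delta dx=0$, and $\sigma_0\partial_\nu U^\delta=g$ on $\Gamma$. Inflow and outflow boundaries: $\Gamma_{\mathrm{in}}=\{x\in\Gamma:\nabla u_\sigma\cdot\nu<0\}=\{g<0\}$, $\Gamma_{\mathrm{out}}=\{x\in\Gamma:\nabla u_\sigma\cdot\nu>0\}=\{g>0\}$. Write $\beta=\nabla U^\delta$, $\mu_\varepsilon=\frac12\Delta U^\delta+\varepsilon$, and $r^{\ominus}=\frac12(|r|-r)$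 for $r\in\mathbb{R}$. The graph space is $V=\{v\in L^2(\Omega):\beta\cdot\nabla v\in L^2(\Omega)\}$ with norm $\|v\|_V^2=\|v\|_{L^2(\Omega)}^2+\|\beta\cdot\nabla v\|_{L^2(\Omega)}^2$. Elements of $V$ have traces in $L^2(|\beta\cdot\nu|,\Gamma)=\{v\text{ measurable on }\Gamma:\int_\Gamma|\beta\cdot\nu|v^2ds<\infty\}$ (continuous extension of the restriction to $\Gamma$). For $v,w\in V$, $$a(v,w)=\int_\Omega(\beta\cdot\nabla v+\mu_\varepsilon v)w\,dx+\int_\Gamma(\beta\cdot\nu)^{\ominus}vw\,ds.$$ *)

theory Defs
  imports "HOL-Probability.Essential_Supremum"
begin

section \<open>Smooth functions and multi-indices\<close>

fun partials :: "'n::finite list \<Rightarrow> (real ^ 'n \<Rightarrow> real) \<Rightarrow> real ^ 'n \<Rightarrow> real" where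
  "partials [] f = f"
| "partials (i # is) f = (\<lambda>x. frechet_derivative (partials is f) (at x) (axis i 1))"

definition C_k :: "nat \<Rightarrow> (real ^ 'n::finite \<Rightarrow> real) \<Rightarrow> bool" where
  "C_k k f \<longleftrightarrow>
     (\<forall>is. length is < k \<longrightarrow> (\<forall>x. partials is f differentiable (at x))) \<and>
     (\<forall>is. length is \<le> k \<longrightarrow> continuous_on UNIV (partials is f))"

definition C_inf :: "(real ^ 'n::finite \<Rightarrow> real) \<Rightarrow> bool" where
  "C_inf f \<longleftrightarrow> (\<forall>k. C_k k f)"

definition grad :: "(real ^ 'n::finite \<Rightarrow> real) \<Rightarrow> real ^ 'n \<Rightarrow> real ^ 'n" where
  "grad f x = (\<chi> i. partials [i] f x)"

definition test_functions :: "(real ^ 'n::finite) set \<Rightarrow> (real ^ 'n \<Rightarrow> real) set" where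
  "test_functions \<Omega> =
     {\<phi>. C_inf \<phi> \<and> compact (closure {x. \<phi> x \<noteq> 0}) \<and> closure {x. \<phi> x \<noteq> 0} \<subseteq> \<Omega>}"

definition mi_order :: "('n::finite \<Rightarrow> nat) \<Rightarrow> nat" where
  "mi_order \<alpha> = (\<Sum>i\<in>UNIV. \<alpha> i)"

definition mi_unit :: "'n \<Rightarrow> 'n \<Rightarrow> nat" where
  "mi_unit i = (\<lambda>j. if j = i then 1 else 0)"


section \<open>Weak derivatives and Sobolev spaces on an open set\<close>

text \<open>Elements of Lebesgue and Sobolev spaces are represented by functions; two functions
  represent the same element iff they agree almost everywhere.\<close>

definition square_integrable :: "'a measure \<Rightarrow> ('a \<Rightarrow> real) \<Rightarrow> bool" where
  "square_integrable M f \<longleftrightarrow> f \<in> borel_measurable M \<and> integrable M (\<lambda>x. (f x)\<^sup>2)"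

definition norm_L2 :: "'a measure \<Rightarrow> ('a \<Rightarrow> real) \<Rightarrow> real" where
  "norm_L2 M f = sqrt (\<integral>x. (f x)\<^sup>2 \<partial>M)"

definition loc_integrable :: "(real ^ 'n::finite) set \<Rightarrow> (real ^ 'n \<Rightarrow> real) \<Rightarrow> bool" where
  "loc_integrable \<Omega> f \<longleftrightarrow> (\<forall>K. compact K \<and> K \<subseteq> \<Omega> \<longrightarrow> f absolutely_integrable_on K)"

text \<open>The list \<open>is\<close> below enumerates the directions of the multi-index \<open>\<alpha>\<close> in any order,
  the order being irrelevant for smooth \<open>\<phi>\<close>.\<close>

definition has_weak_deriv ::
  "(real ^ 'n::finite) set \<Rightarrow> ('n \<Rightarrow> nat) \<Rightarrow> (real ^ 'n \<Rightarrow> real) \<Rightarrow> (real ^ 'n \<Rightarrow> real) \<Rightarrow> bool" where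
  "has_weak_deriv \<Omega> \<alpha> u v \<longleftrightarrow>
     loc_integrable \<Omega> u \<and> loc_integrable \<Omega> v \<and>
     (\<forall>\<phi>\<in>test_functions \<Omega>. \<forall>is. (\<forall>i. count_list is i = \<alpha> i) \<longrightarrow>
        (\<integral>x. u x * partials is \<phi> x \<partial>lebesgue_on \<Omega>) =
        (- 1) ^ mi_order \<alpha> * (\<integral>x. v x * \<phi> x \<partial>lebesgue_on \<Omega>))"

definition weak_deriv ::
  "(real ^ 'n::finite) set \<Rightarrow> ('n \<Rightarrow> nat) \<Rightarrow> (real ^ 'n \<Rightarrow> real) \<Rightarrow> real ^ 'n \<Rightarrow> real" where
  "weak_deriv \<Omega> \<alpha> u = (SOME v. has_weak_deriv \<Omega> \<alpha> u v)"

definition weak_grad ::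
  "(real ^ 'n::finite) set \<Rightarrow> (real ^ 'n \<Rightarrow> real) \<Rightarrow> real ^ 'n \<Rightarrow> real ^ 'n" where
  "weak_grad \<Omega> u x = (\<chi> i. weak_deriv \<Omega> (mi_unit i) u x)"

definition weak_div ::
  "(real ^ 'n::finite) set \<Rightarrow> (real ^ 'n \<Rightarrow> real ^ 'n) \<Rightarrow> real ^ 'n \<Rightarrow> real" where
  "weak_div \<Omega> F x = (\<Sum>i\<in>UNIV. weak_deriv \<Omega> (mi_unit i) (\<lambda>y. F y $ i) x)"

definition weak_laplacian ::
  "(real ^ 'n::finite) set \<Rightarrow> (real ^ 'n \<Rightarrow> real) \<Rightarrow> real ^ 'n \<Rightarrow> real" where
  "weak_laplacian \<Omega> u = weak_div \<Omega> (weak_grad \<Omega> u)"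

definition sobolev_H :: "nat \<Rightarrow> (real ^ 'n::finite) set \<Rightarrow> (real ^ 'n \<Rightarrow> real) set" where
  "sobolev_H k \<Omega> =
     {u. \<forall>\<alpha>. mi_order \<alpha> \<le> k \<longrightarrow>
        (\<exists>v. has_weak_deriv \<Omega> \<alpha> u v \<and> square_integrable (lebesgue_on \<Omega>) v)}"

definition norm_H :: "nat \<Rightarrow> (real ^ 'n::finite) set \<Rightarrow> (real ^ 'n \<Rightarrow> real) \<Rightarrow> real" where
  "norm_H k \<Omega> u =
     sqrt (\<Sum>\<alpha> | mi_order \<alpha> \<le> k. (norm_L2 (lebesgue_on \<Omega>) (weak_deriv \<Omega> \<alpha> u))\<^sup>2)"

definition norm_W_inf :: "nat \<Rightarrow> (real ^ 'n::finite) set \<Rightarrow> (real ^ 'n \<Rightarrow> real) \<Rightarrow> ereal" where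
  "norm_W_inf k \<Omega> u =
     (SUP \<alpha>\<in>{\<alpha>. mi_order \<alpha> \<le> k}. esssup (lebesgue_on \<Omega>) (\<lambda>x. ereal \<bar>weak_deriv \<Omega> \<alpha> u x\<bar>))"

definition sobolev_W_inf :: "nat \<Rightarrow> (real ^ 'n::finite) set \<Rightarrow> (real ^ 'n \<Rightarrow> real) set" where
  "sobolev_W_inf k \<Omega> =
     {u. (\<forall>\<alpha>. mi_order \<alpha> \<le> k \<longrightarrow> (\<exists>v. has_weak_deriv \<Omega> \<alpha> u v)) \<and> norm_W_inf k \<Omega> u < \<infinity>}"

text \<open>Sobolev-Slobodeckij space of order \<open>m + s\<close>, with \<open>0 < s < 1\<close>.\<close>

definition slobodeckij_H ::
  "nat \<Rightarrow> real \<Rightarrow> (real ^ 'n::finite) set \<Rightarrow> (real ^ 'n \<Rightarrow> real) set" where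
  "slobodeckij_H m s \<Omega> =
     {u \<in> sobolev_H m \<Omega>. \<forall>\<alpha>. mi_order \<alpha> = m \<longrightarrow>
        (\<integral>\<^sup>+x. \<integral>\<^sup>+y. ennreal ((weak_deriv \<Omega> \<alpha> u x - weak_deriv \<Omega> \<alpha> u y)\<^sup>2
             / dist x y powr (real CARD('n) + 2 * s)) \<partial>lebesgue_on \<Omega> \<partial>lebesgue_on \<Omega>) < \<infinity>}"


section \<open>Smooth domains, surface measure and outward normal\<close>

text \<open>Inside \<open>B\<close>, \<open>\<Omega>\<close> is the part lying above a \<open>C\<^sup>k\<close> graph over the hyperplane orthogonal to
  the unit vector \<open>e\<close>. A function on that hyperplane is represented by a function on the
  whole space that is invariant under translations along \<open>e\<close>.\<close>

definition graph_chart ::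
  "nat \<Rightarrow> (real ^ 'n::finite) set \<Rightarrow> real ^ 'n \<Rightarrow> (real ^ 'n \<Rightarrow> real) \<Rightarrow> (real ^ 'n) set \<Rightarrow> bool" where
  "graph_chart k \<Omega> e \<phi> B \<longleftrightarrow>
     norm e = 1 \<and> C_k k \<phi> \<and> (\<forall>x t. \<phi> (x + t *\<^sub>R e) = \<phi> x) \<and>
     \<Omega> \<inter> B = {x \<in> B. \<phi> x < x \<bullet> e}"

definition graph_point ::
  "real ^ 'n::finite \<Rightarrow> (real ^ 'n \<Rightarrow> real) \<Rightarrow> real ^ 'n \<Rightarrow> real ^ 'n" where
  "graph_point e \<phi> y = y + (\<phi> y - y \<bullet> e) *\<^sub>R e"

definition C_k_bounded_domain :: "nat \<Rightarrow> (real ^ 'n::finite) set \<Rightarrow> bool" where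
  "C_k_bounded_domain k \<Omega> \<longleftrightarrow>
     open \<Omega> \<and> connected \<Omega> \<and> \<Omega> \<noteq> {} \<and> bounded \<Omega> \<and>
     (\<forall>x\<in>frontier \<Omega>. \<exists>r>0. \<exists>e \<phi>. graph_chart k \<Omega> e \<phi> (ball x r))"

text \<open>The surface measure is determined by the usual formula
  \<open>\<integral> sqrt (1 + |\<nabla>\<phi>|\<^sup>2) dy'\<close> in every local graph. The integral over the \<open>(n-1)\<close>-dimensional
  hyperplane orthogonal to \<open>e\<close> is written as an \<open>n\<close>-dimensional one over the slab
  \<open>0 \<le> y \<bullet> e \<le> 1\<close> of height one, the integrand being invariant along \<open>e\<close>.\<close>

definition is_surface_measure :: "(real ^ 'n::finite) set \<Rightarrow> (real ^ 'n) measure \<Rightarrow> bool" where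
  "is_surface_measure \<Omega> S \<longleftrightarrow>
     sets S = sets (restrict_space borel (frontier \<Omega>)) \<and>
     (\<forall>x r e \<phi>. graph_chart 1 \<Omega> e \<phi> (ball x r) \<longrightarrow>
        (\<forall>A\<in>sets S. A \<subseteq> ball x r \<longrightarrow>
           emeasure S A =
             (\<integral>\<^sup>+y. ennreal (sqrt (1 + (norm (grad \<phi> y))\<^sup>2))
                  * indicator {y. 0 \<le> y \<bullet> e \<and> y \<bullet> e \<le> 1 \<and> graph_point e \<phi> y \<in> A} y \<partial>lborel)))"

definition surface_measure :: "(real ^ 'n::finite) set \<Rightarrow> (real ^ 'n) measure" where
  "surface_measure \<Omega> = (THE S. is_surface_measure \<Omega> S)"

definition outward_normal :: "(real ^ 'n::finite) set \<Rightarrow> real ^ 'n \<Rightarrow> real ^ 'n" where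
  "outward_normal \<Omega> x = (THE \<nu>. norm \<nu> = 1 \<and>
     (\<forall>w. w \<bullet> \<nu> < 0 \<longrightarrow> (\<forall>\<^sub>F t in at_right 0. x + t *\<^sub>R w \<in> \<Omega>)) \<and>
     (\<forall>w. w \<bullet> \<nu> > 0 \<longrightarrow> (\<forall>\<^sub>F t in at_right 0. x + t *\<^sub>R w \<notin> \<Omega>)))"

text \<open>\<open>H\<^bsup>m+s\<^esup>\<close> of a \<open>C\<^sup>k\<close> boundary (\<open>m + s \<le> k\<close>), defined through local graphs. The pulled back
  function lives on an \<open>(n-1)\<close>-dimensional disc; it is regarded as a function on the cylinder of
  height one over that disc, constant along the axis. This does not change the meaning, since
  integrating \<open>|x - y|\<^bsup>-(n+2s)\<^esup>\<close> over the two axial variables gives a kernel comparable with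
  \<open>|x' - y'|\<^bsup>-(n-1+2s)\<^esup>\<close>.\<close>

definition boundary_H ::
  "nat \<Rightarrow> nat \<Rightarrow> real \<Rightarrow> (real ^ 'n::finite) set \<Rightarrow> (real ^ 'n \<Rightarrow> real) set" where
  "boundary_H k m s \<Omega> =
     {g. g \<in> borel_measurable (surface_measure \<Omega>) \<and>
        (\<forall>x\<in>frontier \<Omega>. \<exists>r>0. \<exists>\<rho>>0. \<exists>e \<phi>. graph_chart k \<Omega> e \<phi> (ball x r) \<and>
           (let Z = {y. norm ((y - x) - ((y - x) \<bullet> e) *\<^sub>R e) < \<rho> \<and> 0 < y \<bullet> e \<and> y \<bullet> e < 1}
            in graph_point e \<phi> ` Z \<subseteq> ball x r \<and> (\<lambda>y. g (graph_point e \<phi> y)) \<in> slobodeckij_H m s Z))}"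


section \<open>Traces\<close>

text \<open>The trace is the continuous extension, from \<open>H\<^sup>1(\<Omega>)\<close> to \<open>L\<^sup>2(\<Gamma>)\<close>, of the restriction to the
  boundary \<open>\<Gamma>\<close> of functions that are smooth up to the boundary.\<close>

definition is_bdry_trace ::
  "(real ^ 'n::finite) set \<Rightarrow> (real ^ 'n \<Rightarrow> real) \<Rightarrow> (real ^ 'n \<Rightarrow> real) \<Rightarrow> bool" where
  "is_bdry_trace \<Omega> v t \<longleftrightarrow>
     v \<in> sobolev_H 1 \<Omega> \<and> square_integrable (surface_measure \<Omega>) t \<and>
     (\<exists>f. (\<forall>k. C_inf (f k)) \<and>
          (\<lambda>k. norm_H 1 \<Omega> (\<lambda>x. f k x - v x)) \<longlonglongrightarrow> 0 \<and>
          (\<lambda>k. norm_L2 (surface_measure \<Omega>) (\<lambda>x. f k x - t x)) \<longlonglongrightarrow> 0)"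

definition bdry_trace ::
  "(real ^ 'n::finite) set \<Rightarrow> (real ^ 'n \<Rightarrow> real) \<Rightarrow> real ^ 'n \<Rightarrow> real" where
  "bdry_trace \<Omega> v = (SOME t. is_bdry_trace \<Omega> v t)"

definition normal_trace ::
  "(real ^ 'n::finite) set \<Rightarrow> (real ^ 'n \<Rightarrow> real ^ 'n) \<Rightarrow> real ^ 'n \<Rightarrow> real" where
  "normal_trace \<Omega> \<beta> x = (\<chi> i. bdry_trace \<Omega> (\<lambda>y. \<beta> y $ i) x) \<bullet> outward_normal \<Omega> x"

definition normal_deriv ::
  "(real ^ 'n::finite) set \<Rightarrow> (real ^ 'n \<Rightarrow> real) \<Rightarrow> real ^ 'n \<Rightarrow> real" where
  "normal_deriv \<Omega> u = normal_trace \<Omega> (weak_grad \<Omega> u)"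


section \<open>The elliptic problem and the admissible coefficients\<close>

definition inner_domain :: "real \<Rightarrow> (real ^ 'n::finite) set \<Rightarrow> (real ^ 'n) set" where
  "inner_domain \<eta> \<Omega> = {x \<in> \<Omega>. infdist x (frontier \<Omega>) > \<eta>}"

definition admissible ::
  "(real ^ 'n::finite) set \<Rightarrow> real \<Rightarrow> (real ^ 'n \<Rightarrow> real) \<Rightarrow> real \<Rightarrow> real \<Rightarrow> (real ^ 'n \<Rightarrow> real) set" where
  "admissible \<Omega> \<eta> \<sigma>0 k1 k2 =
     {\<sigma> \<in> sobolev_W_inf 2 \<Omega>.
        (AE x in lebesgue_on (\<Omega> - closure (inner_domain \<eta> \<Omega>)). \<sigma> x = \<sigma>0 x) \<and>
        (AE x in lebesgue_on \<Omega>. k1 \<le> \<sigma> x) \<and>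
        norm_W_inf 2 \<Omega> \<sigma> \<le> ereal k2}"

text \<open>\<open>div (\<sigma> \<nabla>u) = 0\<close> is meant in the sense of distributions, and \<open>\<sigma> \<partial>\<^sub>\<nu>u = g\<close> in the sense of
  traces, which exist for \<open>u\<close> in \<open>H\<^sup>2\<close>.\<close>

definition solves_neumann ::
  "(real ^ 'n::finite) set \<Rightarrow> (real ^ 'n \<Rightarrow> real) \<Rightarrow> (real ^ 'n \<Rightarrow> real) \<Rightarrow> (real ^ 'n \<Rightarrow> real) \<Rightarrow> bool" where
  "solves_neumann \<Omega> \<sigma> g u \<longleftrightarrow>
     (\<forall>\<phi>\<in>test_functions \<Omega>. (\<integral>x. \<sigma> x * (weak_grad \<Omega> u x \<bullet> grad \<phi> x) \<partial>lebesgue_on \<Omega>) = 0) \<and>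
     (AE x in surface_measure \<Omega>. bdry_trace \<Omega> \<sigma> x * normal_deriv \<Omega> u x = g x) \<and>
     (\<integral>x. u x \<partial>lebesgue_on \<Omega>) = 0"

definition noisy_data ::
  "(real ^ 'n::finite) set \<Rightarrow> (real ^ 'n \<Rightarrow> real) \<Rightarrow> (real ^ 'n \<Rightarrow> real) \<Rightarrow> (real ^ 'n \<Rightarrow> real)
     \<Rightarrow> real \<Rightarrow> (real ^ 'n \<Rightarrow> real) \<Rightarrow> bool" where
  "noisy_data \<Omega> \<sigma>0 g u \<delta> U \<longleftrightarrow>
     U \<in> sobolev_H 5 \<Omega> \<and>
     norm_H 5 \<Omega> (\<lambda>x. U x - u x) \<le> \<delta> * norm_H 5 \<Omega> u \<and>
     (\<integral>x. U x \<partial>lebesgue_on \<Omega>) = 0 \<and>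
     (AE x in surface_measure \<Omega>. bdry_trace \<Omega> \<sigma>0 x * normal_deriv \<Omega> U x = g x)"

definition inflow :: "(real ^ 'n::finite) set \<Rightarrow> (real ^ 'n \<Rightarrow> real) \<Rightarrow> (real ^ 'n) set" where
  "inflow \<Omega> g = {x \<in> frontier \<Omega>. g x < 0}"

definition outflow :: "(real ^ 'n::finite) set \<Rightarrow> (real ^ 'n \<Rightarrow> real) \<Rightarrow> (real ^ 'n) set" where
  "outflow \<Omega> g = {x \<in> frontier \<Omega>. g x > 0}"

text \<open>Unlike \<^const>\<open>setdist\<close>, this is \<open>\<infinity>\<close> if one of the sets is empty.\<close>

definition inf_dist_sets :: "'a::metric_space set \<Rightarrow> 'a set \<Rightarrow> ereal" where
  "inf_dist_sets A B = (INF (x, y)\<in>A \<times> B. ereal (dist x y))"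


section \<open>The graph space and the bilinear form of the transport problem\<close>

definition neg_part :: "real \<Rightarrow> real" where
  "neg_part r = (\<bar>r\<bar> - r) / 2"

text \<open>\<open>f\<close> is the distribution \<open>\<beta> \<cdot> \<nabla>v\<close>, that is, the functional
  \<open>\<phi> \<mapsto> - \<integral> v div (\<phi> \<beta>)\<close>.\<close>

definition has_advection ::
  "(real ^ 'n::finite) set \<Rightarrow> (real ^ 'n \<Rightarrow> real ^ 'n) \<Rightarrow> (real ^ 'n \<Rightarrow> real) \<Rightarrow> (real ^ 'n \<Rightarrow> real) \<Rightarrow> bool" where
  "has_advection \<Omega> \<beta> v f \<longleftrightarrow>
     loc_integrable \<Omega> f \<and>
     (\<forall>\<phi>\<in>test_functions \<Omega>.
        (\<integral>x. f x * \<phi> x \<partial>lebesgue_on \<Omega>) =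
        - (\<integral>x. v x * (\<beta> x \<bullet> grad \<phi> x + weak_div \<Omega> \<beta> x * \<phi> x) \<partial>lebesgue_on \<Omega>))"

definition advection ::
  "(real ^ 'n::finite) set \<Rightarrow> (real ^ 'n \<Rightarrow> real ^ 'n) \<Rightarrow> (real ^ 'n \<Rightarrow> real) \<Rightarrow> real ^ 'n \<Rightarrow> real" where
  "advection \<Omega> \<beta> v = (SOME f. has_advection \<Omega> \<beta> v f)"

definition graph_space ::
  "(real ^ 'n::finite) set \<Rightarrow> (real ^ 'n \<Rightarrow> real ^ 'n) \<Rightarrow> (real ^ 'n \<Rightarrow> real) set" where
  "graph_space \<Omega> \<beta> =
     {v. square_integrable (lebesgue_on \<Omega>) v \<and>
         (\<exists>f. has_advection \<Omega> \<beta> v f \<and> square_integrable (lebesgue_on \<Omega>) f)}"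

definition graph_norm ::
  "(real ^ 'n::finite) set \<Rightarrow> (real ^ 'n \<Rightarrow> real ^ 'n) \<Rightarrow> (real ^ 'n \<Rightarrow> real) \<Rightarrow> real" where
  "graph_norm \<Omega> \<beta> v =
     sqrt ((norm_L2 (lebesgue_on \<Omega>) v)\<^sup>2 + (norm_L2 (lebesgue_on \<Omega>) (advection \<Omega> \<beta> v))\<^sup>2)"

text \<open>The measure \<open>|\<beta> \<cdot> \<nu>| ds\<close>, and the trace of \<open>V\<close> into its \<open>L\<^sup>2\<close> space, again as the
  continuous extension of the restriction to the boundary.\<close>

definition flux_measure ::
  "(real ^ 'n::finite) set \<Rightarrow> (real ^ 'n \<Rightarrow> real ^ 'n) \<Rightarrow> (real ^ 'n) measure" where
  "flux_measure \<Omega> \<beta> = density (surface_measure \<Omega>) (\<lambda>x. ennreal \<bar>normal_trace \<Omega> \<beta> x\<bar>)"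

definition is_graph_trace ::
  "(real ^ 'n::finite) set \<Rightarrow> (real ^ 'n \<Rightarrow> real ^ 'n) \<Rightarrow> (real ^ 'n \<Rightarrow> real) \<Rightarrow> (real ^ 'n \<Rightarrow> real) \<Rightarrow> bool" where
  "is_graph_trace \<Omega> \<beta> v t \<longleftrightarrow>
     v \<in> graph_space \<Omega> \<beta> \<and> square_integrable (flux_measure \<Omega> \<beta>) t \<and>
     (\<exists>f. (\<forall>k. C_inf (f k)) \<and>
          (\<lambda>k. graph_norm \<Omega> \<beta> (\<lambda>x. f k x - v x)) \<longlonglongrightarrow> 0 \<and>
          (\<lambda>k. norm_L2 (flux_measure \<Omega> \<beta>) (\<lambda>x. f k x - t x)) \<longlonglongrightarrow> 0)"

definition graph_trace ::
  "(real ^ 'n::finite) set \<Rightarrow> (real ^ 'n \<Rightarrow> real ^ 'n) \<Rightarrow> (real ^ 'n \<Rightarrow> real) \<Rightarrow> real ^ 'n \<Rightarrow> real" where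
  "graph_trace \<Omega> \<beta> v = (SOME t. is_graph_trace \<Omega> \<beta> v t)"

definition transport_form ::
  "(real ^ 'n::finite) set \<Rightarrow> (real ^ 'n \<Rightarrow> real ^ 'n) \<Rightarrow> (real ^ 'n \<Rightarrow> real)
     \<Rightarrow> (real ^ 'n \<Rightarrow> real) \<Rightarrow> (real ^ 'n \<Rightarrow> real) \<Rightarrow> real" where
  "transport_form \<Omega> \<beta> \<mu> v w =
     (\<integral>x. (advection \<Omega> \<beta> v x + \<mu> x * v x) * w x \<partial>lebesgue_on \<Omega>) +
     (\<integral>x. neg_part (normal_trace \<Omega> \<beta> x) * graph_trace \<Omega> \<beta> v x * graph_trace \<Omega> \<beta> w x
        \<partial>surface_measure \<Omega>)"

text \<open>\<open>\<gamma>\<^sub>0\<close> stands for the boundary values of the inflow datum.\<close>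

definition weak_transport_solution ::
  "(real ^ 'n::finite) set \<Rightarrow> (real ^ 'n \<Rightarrow> real ^ 'n) \<Rightarrow> (real ^ 'n \<Rightarrow> real)
     \<Rightarrow> (real ^ 'n \<Rightarrow> real) \<Rightarrow> (real ^ 'n \<Rightarrow> real) \<Rightarrow> bool" where
  "weak_transport_solution \<Omega> \<beta> \<mu> \<gamma>\<^sub>0 \<gamma> \<longleftrightarrow>
     \<gamma> \<in> graph_space \<Omega> \<beta> \<and>
     (\<forall>w\<in>graph_space \<Omega> \<beta>.
        transport_form \<Omega> \<beta> \<mu> \<gamma> w =
        (\<integral>x. neg_part (normal_trace \<Omega> \<beta> x) * \<gamma>\<^sub>0 x * graph_trace \<Omega> \<beta> w x \<partial>surface_measure \<Omega>))"

end

(* Friedrichs' argument. Near the boundary the domain satisfies a cone condition, so mollifiers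
   supported in the cone approximate v and all of its weak directional derivatives at once by
   functions that are smooth up to the boundary. Green's formula for such functions determines the
   traces. A cutoff xi with xi = 1 on the inflow and xi = 0 on the outflow boundary exists by the
   separation hypothesis, and |b.n| = b.n (1 - 2 xi) turns Green's formula for v^2 into a bound for the trace
   of v in L^2(|b.n|) by the graph norm; by density the traces and the energy identity extend to V.
   As mu - (div b)/2 = eps, the form a is coercive, which gives uniqueness. For existence, the
   adjoint w |-> -b.grad w + (mu - div b) w is bounded below on smooth functions vanishing on the
   outflow boundary, so the Riesz theorem represents the right-hand side by some gamma; testing with
   functions of compact support gives the equation, and then Green's formula the inflow condition.
   As U is in H^5, the derivatives of div grad U up to second order are in L^2; by a Sobolev
   embedding in dimension at most 3, grad U is Lipschitz and div grad U is bounded. *)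
theory Submission imports Defs
begin

text \<open>The trace argument for H^1 bounds a boundary integral by all first derivatives. On the
  graph space only the derivative along the field is controlled, so the boundary weight has to come
  from the field itself and its sign has to extend smoothly; that extension is what the separation
  of inflow and outflow provides. The datum g decides the sign of b.n because the trace of
  \<open>\<sigma>0\<close> is bounded below by \<open>k1\<close>. Mollification does not commute
  with b.grad. Since the commutator kernel has mean zero, u(x) can be subtracted, which leaves
  differences u(x + y) - u(x) against a weight of bounded mass: the Lipschitz bound L |y| cancels
  the scale of the gradient of the kernel. That bound is used for y in the cone and almost
  everywhere, so no continuous representative of b enters. Traces, weak derivatives and advections
  are values of \<open>SOME\<close>, reachable only through uniqueness; for traces this is Green's
  formula. The surface measure is a value of \<open>THE\<close>, so it has to be constructed; that
  charts agree on overlaps follows from the divergence theorem in each chart, not from a change of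
  variables.\<close>

notation LIMSEQ (infix "---->" 60)

section \<open>Smooth functions\<close>

definition pd :: "'n::finite => (real ^ 'n => real) => real ^ 'n => real" where
 "pd i f = (%x. frechet_derivative f (at x) (axis i 1))"

declare partials.simps(2) [simp del]

lemma partials_Cons [simp]: "partials (i # is) f = pd i (partials is f)"
 by (simp add: pd_def partials.simps(2))

lemma partials_snoc: "partials (is @ [i]) f = partials is (pd i f)"
 by (induction "is") auto

lemma grad_nth [simp]: "grad f x $ i = pd i f x"
 by (simp add: grad_def)

lemma pd_eq: "(f has_derivative f') (at x) ==> pd i f x = f' (axis i 1)"
 unfolding pd_def using frechet_derivative_at by metis

lemma differentiable_has_grad:
 assumes "f differentiable at x"
 shows "(f has_derivative (%h. grad f x \<bullet> h)) (at x)"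
proof -
 let ?f = "frechet_derivative f (at x)"
 have d: "(f has_derivative ?f) (at x)" using assms frechet_derivative_works by blast
 then have lin: "linear ?f" using has_derivative_linear by blast
 have "?f h = grad f x \<bullet> h" for h
 proof -
  have "?f h = ?f (\<Sum>i\<in>UNIV. (h $ i) *\<^sub>R axis i 1)"
   using basis_expansion[of h] by (simp add: scalar_mult_eq_scaleR)
  also have "... = (\<Sum>i\<in>UNIV. (h $ i) * ?f (axis i 1))"
   using lin by (simp add: linear_sum linear_cmul)
  also have "... = grad f x \<bullet> h" by (simp add: inner_vec_def pd_def mult.commute)
  finally show ?thesis .
 qed
 then have "?f = (%h. grad f x \<bullet> h)" by (rule ext)
 with d show ?thesis by metis
qed

lemma C_k_0: "C_k 0 f \<longleftrightarrow> continuous_on UNIV f"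
 by (auto simp: C_k_def)

text \<open>The head of the list in \<open>partials\<close> acts last. Splitting the list at its
  other end leaves a statement about \<open>pd i f\<close>, so that inductions on k can generalise
  over the function.\<close>

lemma C_k_Suc:
 "C_k (Suc k) f \<longleftrightarrow> (ALL x. f differentiable (at x)) & (ALL i. C_k k (pd i f))"
proof
 assume L: "C_k (Suc k) f"
 have "f differentiable (at x)" for x
  using L[unfolded C_k_def, THEN conjunct1, rule_format, of "[]" x] by simp
 moreover have "C_k k (pd i f)" for i
  unfolding C_k_def
 proof (intro conjI allI impI)
  fix "is" :: "'a list" and x
  assume "length is < k"
  then show "partials is (pd i f) differentiable (at x)"
   using L[unfolded C_k_def, THEN conjunct1, rule_format, of "is @ [i]" x] by (simp add: partials_snoc)
 next
  fix "is" :: "'a list"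
  assume "length is <= k"
  then show "continuous_on UNIV (partials is (pd i f))"
   using L[unfolded C_k_def, THEN conjunct2, rule_format, of "is @ [i]"] by (simp add: partials_snoc)
 qed
 ultimately show "(ALL x. f differentiable (at x)) & (ALL i. C_k k (pd i f))" by blast
next
 assume R: "(ALL x. f differentiable (at x)) & (ALL i. C_k k (pd i f))"
 show "C_k (Suc k) f"
  unfolding C_k_def
 proof (intro conjI allI impI)
  fix "is" :: "'a list" and x
  assume l: "length is < Suc k"
  show "partials is f differentiable (at x)"
  proof (cases "is" rule: rev_cases)
   case (snoc js i)
   then show ?thesis using l R by (auto simp: partials_snoc C_k_def)
  qed (use R in simp)
 next
  fix "is" :: "'a list"
  assume l: "length is <= Suc k"
  show "continuous_on UNIV (partials is f)"
  proof (cases "is" rule: rev_cases)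
   case Nil
   then show ?thesis using R
    by (simp add: continuous_on_eq_continuous_within differentiable_imp_continuous_within)
  next
   case (snoc js i)
   then show ?thesis using l R by (auto simp: partials_snoc C_k_def)
  qed
 qed
qed

lemma C_k_mono: "C_k k f ==> j <= k ==> C_k j f"
 unfolding C_k_def by auto

lemma C_k_continuous: "C_k k f ==> continuous_on UNIV f"
 using C_k_mono[of k f 0] by (simp add: C_k_0)

text \<open>Induction on k for all members of \<open>X\<close> at once. To prove smoothness it then
  suffices to exhibit a family closed under \<open>pd\<close>, without a formula for the higher
  derivatives.\<close>

lemma C_inf_coinduct:
 assumes "f \<in> X" "!!f x. f \<in> X ==> f differentiable (at x)" "!!f i. f \<in> X ==> pd i f \<in> X"
 shows "C_inf f"
proof -
 have "ALL f:X. C_k k f" for k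
 proof (induction k)
  case 0
  then show ?case using assms(2)
   by (simp add: C_k_0 continuous_on_eq_continuous_within differentiable_imp_continuous_within)
 qed (use assms in "auto simp: C_k_Suc")
 then show ?thesis using assms(1) by (simp add: C_inf_def)
qed

lemma C_inf_differentiable: "C_inf f ==> f differentiable (at x)"
 unfolding C_inf_def using C_k_Suc[of 0 f] by metis

lemma C_inf_pd: "C_inf f ==> C_inf (pd i f)"
 unfolding C_inf_def by (metis C_k_Suc)

lemma C_inf_partials: "C_inf f ==> C_inf (partials is f)"
 by (induction "is") (auto intro: C_inf_pd)

lemma C_inf_continuous: "C_inf f ==> continuous_on S f"
 unfolding C_inf_def using C_k_continuous continuous_on_subset by blast

lemma C_inf_borel [measurable_dest]: "C_inf f ==> f \<in> borel_measurable borel"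
 by (simp add: C_inf_continuous borel_measurable_continuous_onI)

lemma C_inf_has_grad: "C_inf f ==> (f has_derivative (%h. grad f x \<bullet> h)) (at x)"
 by (simp add: C_inf_differentiable differentiable_has_grad)

lemma pd_const [simp]: "pd i (%x. c) = (%x. 0)"
 by (rule ext) (rule pd_eq, simp)

lemma pd_add:
 "f differentiable (at x) ==> g differentiable (at x) ==> pd i (%x. f x + g x) x = pd i f x + pd i g x"
 by (subst pd_eq[OF has_derivative_add[OF differentiable_has_grad differentiable_has_grad]])
  (auto simp: inner_axis)

lemma pd_mult:
 "f differentiable (at x) ==> g differentiable (at x) ==>
  pd i (%x. f x * g x) x = pd i f x * g x + f x * pd i g x"
 by (subst pd_eq[OF has_derivative_mult[OF differentiable_has_grad differentiable_has_grad]])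
  (auto simp: inner_axis)

lemma pd_chain:
 "f differentiable (at x) ==> (h has_real_derivative h') (at (f x)) ==>
  ((%x. h (f x)) has_derivative (%v. h' * (grad f x \<bullet> v))) (at x)"
 using has_derivative_compose[OF differentiable_has_grad, of f x h "(*) h'"]
 by (simp add: has_field_derivative_def)

lemma pd_affine:
 assumes "f differentiable (at (a + c *\<^sub>R x))"
 shows "((%x. f (a + c *\<^sub>R x)) has_derivative (%v. grad f (a + c *\<^sub>R x) \<bullet> (c *\<^sub>R v))) (at x)"
proof -
 have "((%x. a + c *\<^sub>R x) has_derivative (%v. c *\<^sub>R v)) (at x)"
  by (auto intro!: derivative_eq_intros)
 from has_derivative_compose[OF this, of f "%h. grad f (a + c *\<^sub>R x) \<bullet> h"]
 show ?thesis using differentiable_has_grad[OF assms] by simp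
qed

lemma C_k_add: "C_k k f ==> C_k k g ==> C_k k (%x. f x + g x)"
proof (induction k arbitrary: f g)
 case (Suc k)
 then have *: "pd i (%x. f x + g x) = (%x. pd i f x + pd i g x)" for i
  by (intro ext pd_add) (auto simp: C_k_Suc)
 show ?case using Suc by (auto simp: C_k_Suc *)
qed (auto simp: C_k_0 intro: continuous_intros)

lemma C_k_mult: "C_k k f ==> C_k k g ==> C_k k (%x. f x * g x)"
proof (induction k arbitrary: f g)
 case (Suc k)
 then have *: "pd i (%x. f x * g x) = (%x. pd i f x * g x + f x * pd i g x)" for i
  by (intro ext pd_mult) (auto simp: C_k_Suc)
 have "C_k k f" "C_k k g" using Suc.prems C_k_mono by (meson le_SucI order_refl)+
 then show ?case using Suc by (auto simp: C_k_Suc * intro!: C_k_add)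
qed (auto simp: C_k_0 intro: continuous_intros)

lemma C_inf_const [simp, intro]: "C_inf (%x. c)"
 by (rule C_inf_coinduct[of _ "range (%c x. c)"]) auto

lemma C_inf_add [intro]: "C_inf f ==> C_inf g ==> C_inf (%x. f x + g x)"
 by (simp add: C_inf_def C_k_add)

lemma C_inf_mult [intro]: "C_inf f ==> C_inf g ==> C_inf (%x. f x * g x)"
 by (simp add: C_inf_def C_k_mult)

lemma C_inf_minus [intro]: "C_inf f ==> C_inf (%x. - f x)"
 using C_inf_mult[of "%x. -1" f] by simp

lemma C_inf_diff [intro]: "C_inf f ==> C_inf g ==> C_inf (%x. f x - g x)"
 using C_inf_add[of f "%x. - g x"] by auto

lemma C_inf_sum [intro]: "(!!i. i \<in> I ==> C_inf (f i)) ==> C_inf (%x. \<Sum>i\<in>I. f i x)"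
 by (induction I rule: infinite_finite_induct) auto

lemma C_inf_prod [intro]: "(!!i. i \<in> I ==> C_inf (f i)) ==> C_inf (%x. \<Prod>i\<in>I. f i x)"
 by (induction I rule: infinite_finite_induct) auto

lemma C_inf_power [intro]: "C_inf f ==> C_inf (%x. f x ^ m)"
 by (induction m) auto

lemma C_inf_inner [intro]: "C_inf (%x. x \<bullet> a)"
proof -
 have *: "((%x. x \<bullet> a + c) has_derivative (%h. h \<bullet> a)) (at x)" for a x :: "real ^ 'n" and c
  by (auto intro!: derivative_eq_intros)
 have p: "pd i (%x. x \<bullet> a + c) = (%x. x \<bullet> 0 + a $ i)" for a :: "real ^ 'n" and c i
  by (rule ext) (simp add: pd_eq[OF *] inner_axis')
 have "C_inf (%x. x \<bullet> a + 0)"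
 proof (rule C_inf_coinduct[of _ "{%x. x \<bullet> a + c | a c. True}"])
  show "(%x. x \<bullet> a + 0) \<in> {%x. x \<bullet> a + c | a c. True}" by blast
 next
  fix f :: "real ^ 'n => real" and x assume "f \<in> {%x. x \<bullet> a + c | a c. True}"
  then show "f differentiable (at x)" using * unfolding differentiable_def by blast
 next
  fix f :: "real ^ 'n => real" and i assume "f \<in> {%x. x \<bullet> a + c | a c. True}"
  then obtain a c where "f = (%x. x \<bullet> a + c)" by blast
  then have "pd i f = (%x. x \<bullet> 0 + a $ i)" using p by metis
  then show "pd i f \<in> {%x. x \<bullet> a + c | a c. True}" by blast
 qed
 then show ?thesis by simp
qed

lemma pd_add' [simp]: "C_inf f ==> C_inf g ==> pd i (%x. f x + g x) = (%x. pd i f x + pd i g x)"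
 by (auto simp: fun_eq_iff pd_add C_inf_differentiable)

lemma pd_mult' [simp]:
 "C_inf f ==> C_inf g ==> pd i (%x. f x * g x) = (%x. pd i f x * g x + f x * pd i g x)"
 by (auto simp: fun_eq_iff pd_mult C_inf_differentiable)

lemma pd_minus' [simp]: "C_inf f ==> pd i (%x. - f x) = (%x. - pd i f x)"
 using pd_mult'[of "%x. -1" f i] by simp

lemma pd_diff' [simp]: "C_inf f ==> C_inf g ==> pd i (%x. f x - g x) = (%x. pd i f x - pd i g x)"
 using pd_add'[of f "%x. - g x" i] by (simp add: C_inf_minus)

lemma pd_sum' [simp]:
 "(!!j. j \<in> I ==> C_inf (f j)) ==> pd i (%x. \<Sum>j\<in>I. f j x) = (%x. \<Sum>j\<in>I. pd i (f j) x)"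
 by (induction I rule: infinite_finite_induct) (auto simp: C_inf_sum)

lemma C_inf_affine: "C_inf f ==> C_inf (%x. f (a + c *\<^sub>R x))"
proof -
 assume f: "C_inf f"
 show ?thesis
 \<comment> \<open>The scalar \<open>d\<close> collects the powers of \<open>c\<close> that the
   chain rule produces; it keeps the family closed under \<open>pd\<close>.\<close>
 proof (rule C_inf_coinduct[of _ "{%x. d * f (a + c *\<^sub>R x) | d f. C_inf f}"])
  show "(%x. f (a + c *\<^sub>R x)) \<in> {%x. d * f (a + c *\<^sub>R x) | d f. C_inf f}"
   using f by (auto intro!: exI[of _ 1] exI[of _ f])
 next
  fix h x assume "h \<in> {%x. d * f (a + c *\<^sub>R x) | d f. C_inf f}"
  then obtain d f where h: "h = (%x. d * f (a + c *\<^sub>R x))" and f: "C_inf f" by auto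
  show "h differentiable (at x)"
   unfolding h by (intro differentiable_mult differentiable_const)
    (use pd_affine[OF C_inf_differentiable[OF f]] in "auto simp: differentiable_def")
 next
  fix h i assume "h \<in> {%x. d * f (a + c *\<^sub>R x) | d f. C_inf f}"
  then obtain d f where h: "h = (%x. d * f (a + c *\<^sub>R x))" and f: "C_inf f" by auto
  have "pd i h x = (d * c) * pd i f (a + c *\<^sub>R x)" for x
   unfolding h
   by (subst pd_eq[OF has_derivative_mult_right[OF pd_affine[OF C_inf_differentiable[OF f]]]])
    (auto simp: inner_axis)
  then show "pd i h \<in> {%x. d * f (a + c *\<^sub>R x) | d f. C_inf f}"
   using C_inf_pd[OF f] by (intro CollectI exI[of _ "d * c"] exI[of _ "pd i f"]) (auto simp: fun_eq_iff)
 qed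
qed

text \<open>The powers of 1/t make the family closed under differentiation.
  \<open>exp_cusp 0\<close> is the classical flat function; with values in [0, 1) and limit 1 at
  infinity it serves for bumps as well as for smoothed indicators.\<close>

definition exp_cusp :: "nat => real => real" where
 "exp_cusp m t = (if t > 0 then exp (- (1 / t)) / t ^ m else 0)"

lemma exp_cusp_deriv:
 "(exp_cusp m has_real_derivative (exp_cusp (m + 2) t - m * exp_cusp (m + 1) t)) (at t)"
proof -
 consider "t > 0" | "t < 0" | "t = 0" by linarith
 then show ?thesis
 proof cases
  case 1
  have "((%t. exp (- (1 / t)) / t ^ m) has_real_derivative (exp_cusp (m + 2) t - m * exp_cusp (m + 1) t)) (at t)"
  proof (cases m)
   case 0
   then show ?thesis using 1
    by (auto intro!: derivative_eq_intros simp: exp_cusp_def power2_eq_square divide_simps)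
  next
   case (Suc k)
   show ?thesis unfolding Suc using 1
    by (auto intro!: derivative_eq_intros simp: exp_cusp_def power2_eq_square divide_simps)
     (cases k; auto simp: algebra_simps)
  qed
  then show ?thesis
   by (rule has_field_derivative_transform_within_open[where S="{0<..}"])
    (use 1 in "auto simp: exp_cusp_def")
 next
  case 2
  have "((%t. 0) has_real_derivative 0) (at t)" by simp
  then have "(exp_cusp m has_real_derivative 0) (at t)"
   by (rule has_field_derivative_transform_within_open[where S="{..<0}"])
    (use 2 in "auto simp: exp_cusp_def")
  then show ?thesis using 2 by (simp add: exp_cusp_def)
 next
  case 3
  have "((%h. exp_cusp m h / h) \<longlongrightarrow> 0) (at 0)"
  proof (rule filterlim_split_at)
   show "((%h. exp_cusp m h / h) \<longlongrightarrow> 0) (at_left 0)"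
    by (rule tendsto_eventually) (auto simp: eventually_at_filter exp_cusp_def)
   \<comment> \<open>With s = 1/h the right difference quotient at 0 is s^(m+1) / exp s.\<close>
   have "((%h. inverse h ^ Suc m / exp (inverse h)) \<longlongrightarrow> (0::real)) (at_right 0)"
    by (rule filterlim_compose[OF tendsto_power_div_exp_0 filterlim_inverse_at_top_right])
   then show "((%h. exp_cusp m h / h) \<longlongrightarrow> 0) (at_right 0)"
    by (rule Lim_transform_eventually)
     (auto simp: eventually_at_filter exp_cusp_def exp_minus field_simps)
  qed
  then show ?thesis using 3 by (simp add: DERIV_def exp_cusp_def)
 qed
qed

lemma C_inf_exp_cusp:
 fixes s :: "real ^ 'n::finite => real"
 assumes "C_inf s"
 shows "C_inf (%x. exp_cusp m (s x))"
proof -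
 \<comment> \<open>The factor \<open>q\<close> is there for the induction: the derivative of
   \<open>q x * exp_cusp m (s x)\<close> is a sum of three terms of the same shape, with other
   smooth factors and indices m, m + 1 and m + 2.\<close>
 have key: "\<forall>(q :: real ^ 'n => real) m. C_inf q --> C_k k (%x. q x * exp_cusp m (s x))" for k
 proof (induction k)
  case 0
  have "continuous_on UNIV (%x. q x * exp_cusp m (s x))" if "C_inf q" for q :: "real ^ 'n => real" and m
  proof -
   have "continuous_on UNIV (exp_cusp m)"
    using exp_cusp_deriv DERIV_isCont continuous_at_imp_continuous_on by blast
   then have "continuous_on UNIV (%x. exp_cusp m (s x))"
    by (rule continuous_on_compose2[OF _ C_inf_continuous[OF assms]]) auto
   then show ?thesis
    by (rule continuous_on_mult[OF C_inf_continuous[OF that]])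
  qed
  then show ?case by (simp add: C_k_0)
 next
  case (Suc k)
  show ?case
  proof (intro allI impI)
   fix q :: "real ^ 'n => real" and m assume q: "C_inf q"
   let ?e = "%x. exp_cusp m (s x)"
   have e: "(?e has_derivative (%v. (exp_cusp (m + 2) (s x) - m * exp_cusp (m + 1) (s x)) * (grad s x \<bullet> v))) (at x)" for x
    by (rule pd_chain[OF C_inf_differentiable[OF assms] exp_cusp_deriv])
   have de: "?e differentiable (at x)" for x using e differentiable_def by blast
   have p: "pd i (%x. q x * ?e x) = (%x. (pd i q x * exp_cusp m (s x) + (q x * pd i s x) * exp_cusp (m + 2) (s x))
     + (q x * pd i s x * (- real m)) * exp_cusp (m + 1) (s x))" for i
   proof
    fix x
    show "pd i (%x. q x * ?e x) x = (pd i q x * exp_cusp m (s x) + (q x * pd i s x) * exp_cusp (m + 2) (s x))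
     + (q x * pd i s x * (- real m)) * exp_cusp (m + 1) (s x)"
     unfolding pd_mult[OF C_inf_differentiable[OF q] de] pd_eq[OF e]
     by (simp add: inner_axis algebra_simps)
   qed
   have IH: "C_k k (%x. q' x * exp_cusp m' (s x))" if "C_inf q'" for q' :: "real ^ 'n => real" and m'
    using Suc that by blast
   have "C_k k (pd i (%x. q x * ?e x))" for i
    unfolding p by (rule C_k_add[OF C_k_add[OF IH IH] IH]) (intro C_inf_mult C_inf_pd q assms C_inf_const)+
   moreover have "(%x. q x * ?e x) differentiable (at x)" for x
    by (rule differentiable_mult[OF C_inf_differentiable[OF q] de])
   ultimately show "C_k (Suc k) (%x. q x * ?e x)"
    unfolding C_k_Suc by blast
  qed
 qed
 have "C_k k (%x. exp_cusp m (s x))" for k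
  using key[of k, rule_format, OF C_inf_const[of 1], of m] by simp
 then show ?thesis by (simp add: C_inf_def)
qed

lemma C_inf_inner_self:
 fixes a :: "real ^ 'n::finite"
 shows "C_inf (%x. (x - a) \<bullet> (x - a))"
proof -
 have eq: "(%x::real^'n. (x - a) \<bullet> (x - a)) = (%x. \<Sum>i\<in>UNIV. (x \<bullet> axis i 1 - a $ i) * (x \<bullet> axis i 1 - a $ i))"
  by (rule ext, simp only: inner_axis) (simp add: inner_vec_def)
 show ?thesis unfolding eq by (intro C_inf_sum C_inf_mult C_inf_diff C_inf_inner C_inf_const)
qed

lemma bump_exists:
 fixes a :: "real ^ 'n::finite"
 assumes "r > 0"
 obtains b where "C_inf b" "!!x. 0 <= b x" "!!x. b x < 1" "!!x. b x > 0 \<longleftrightarrow> x \<in> ball a r"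
proof
 let ?b = "%x::real^'n. exp_cusp 0 (r\<^sup>2 - (x - a) \<bullet> (x - a))"
 show "C_inf ?b" by (intro C_inf_exp_cusp C_inf_diff C_inf_const C_inf_inner_self)
 show "0 <= ?b x" "?b x < 1" for x by (auto simp: exp_cusp_def)
 show "?b x > 0 \<longleftrightarrow> x \<in> ball a r" for x
  using assms power_strict_mono[of "norm (x - a)" r 2] power2_less_imp_less[of "norm (x - a)" r]
  by (auto simp: exp_cusp_def dist_norm norm_minus_commute dot_square_norm)
qed

section \<open>The space of square integrable functions\<close>

lemma sqint_mult:
 assumes "square_integrable M f" "square_integrable M g"
 shows "integrable M (%x. f x * g x)"
proof (rule Bochner_Integration.integrable_bound)
 show "integrable M (%x. (f x)\<^sup>2 + (g x)\<^sup>2)"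
  using assms by (simp add: square_integrable_def)
 have "\<bar>a * b\<bar> <= a\<^sup>2 + b\<^sup>2" for a b :: real
  using sum_squares_bound[of "\<bar>a\<bar>" "\<bar>b\<bar>"] zero_le_power2[of a] zero_le_power2[of b]
  unfolding abs_mult power2_abs by linarith
 then show "AE x in M. norm (f x * g x) <= norm ((f x)\<^sup>2 + (g x)\<^sup>2)" by simp
qed (use assms in "auto simp: square_integrable_def")

lemma sqint_cmult: "square_integrable M f ==> square_integrable M (%x. c * f x)"
 by (auto simp: square_integrable_def power_mult_distrib)

lemma sqint_zero [simp]: "square_integrable M (%x. 0)"
 by (simp add: square_integrable_def)

lemma sqint_add:
 assumes "square_integrable M f" "square_integrable M g"
 shows "square_integrable M (%x. f x + g x)"
proof -
 have "integrable M (%x. (f x)\<^sup>2 + (g x)\<^sup>2 + 2 * (f x * g x))"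
  using assms sqint_mult[OF assms] by (simp add: square_integrable_def)
 then show ?thesis using assms by (auto simp: square_integrable_def power2_sum mult.assoc)
qed

lemma sqint_lin:
 "square_integrable M f ==> square_integrable M g ==> square_integrable M (%x. a * f x + b * g x)"
 by (intro sqint_add sqint_cmult)

lemma sqint_diff:
 "square_integrable M f ==> square_integrable M g ==> square_integrable M (%x. f x - g x)"
 using sqint_lin[of M f g 1 "-1"] by simp

lemma sqint_sum:
 "(!!i. i \<in> I ==> square_integrable M (f i)) ==> square_integrable M (%x. \<Sum>i\<in>I. f i x)"
 by (induction I rule: infinite_finite_induct) (auto intro: sqint_add)

lemma sqint_bound:
 assumes "square_integrable M f" "g \<in> borel_measurable M" "AE x in M. \<bar>g x\<bar> <= C * \<bar>f x\<bar>"
 shows "square_integrable M g"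
proof -
 have "integrable M (%x. (g x)\<^sup>2)"
 proof (rule Bochner_Integration.integrable_bound)
  show "integrable M (%x. C\<^sup>2 * (f x)\<^sup>2)" using assms by (simp add: square_integrable_def)
  show "AE x in M. norm ((g x)\<^sup>2) <= norm (C\<^sup>2 * (f x)\<^sup>2)"
   using assms(3)
  proof eventually_elim
   case (elim x)
   then have "\<bar>g x\<bar>\<^sup>2 <= (C * \<bar>f x\<bar>)\<^sup>2" by (intro power_mono) auto
   then show ?case by (simp add: power_mult_distrib)
  qed
 qed (use assms in simp)
 then show ?thesis using assms by (simp add: square_integrable_def)
qed

lemma sqint_mult_bounded:
 assumes "square_integrable M f" "g \<in> borel_measurable M" "AE x in M. \<bar>g x\<bar> <= C"
 shows "square_integrable M (%x. g x * f x)"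
 by (rule sqint_bound[OF assms(1), where C=C])
  (use assms in "auto simp: square_integrable_def abs_mult intro!: mult_right_mono")

lemma sqint_cong_AE:
 assumes "square_integrable M f" "g \<in> borel_measurable M" "AE x in M. f x = g x"
 shows "square_integrable M g"
 by (rule sqint_bound[OF assms(1,2), where C=1]) (use assms(3) in auto)

lemma sqint_bounded_fun:
 assumes "finite_measure M" "g \<in> borel_measurable M" "AE x in M. \<bar>g x\<bar> <= C"
 shows "square_integrable M g"
proof -
 interpret finite_measure M by fact
 have "square_integrable M (%x. 1)" by (simp add: square_integrable_def)
 then show ?thesis by (rule sqint_bound[where C=C]) (use assms in auto)
qed

lemma norm_L2_nonneg [simp]: "0 <= norm_L2 M f"
 by (simp add: norm_L2_def)

lemma norm_L2_sq: "(norm_L2 M f)\<^sup>2 = (LINT x|M. (f x)\<^sup>2)"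
 by (simp add: norm_L2_def)

lemma norm_L2_minus: "norm_L2 M (%x. f x - g x) = norm_L2 M (%x. g x - f x)"
 by (simp add: norm_L2_def power2_commute)

lemma integral_sq_lin:
 assumes "square_integrable M f" "square_integrable M g"
 shows "(LINT x|M. (a * f x + b * g x)\<^sup>2) =
  a\<^sup>2 * (LINT x|M. (f x)\<^sup>2) + 2 * a * b * (LINT x|M. f x * g x) + b\<^sup>2 * (LINT x|M. (g x)\<^sup>2)"
proof -
 have "(LINT x|M. (a * f x + b * g x)\<^sup>2) =
   (LINT x|M. (a\<^sup>2 * (f x)\<^sup>2 + (2 * a * b) * (f x * g x)) + b\<^sup>2 * (g x)\<^sup>2)"
  by (rule Bochner_Integration.integral_cong) (auto simp: power2_eq_square algebra_simps)
 also have "... = a\<^sup>2 * (LINT x|M. (f x)\<^sup>2) + 2 * a * b * (LINT x|M. f x * g x) + b\<^sup>2 * (LINT x|M. (g x)\<^sup>2)"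
  using assms sqint_mult[OF assms] by (simp add: square_integrable_def)
 finally show ?thesis .
qed

text \<open>The case c = 0 is included. With a = 0 the conclusion is b = 0, which is how the Euler
  equation of a minimisation problem is read off later.\<close>

lemma nonneg_quadratic_discriminant:
 fixes a b c :: real
 assumes c: "0 <= c" and q: "!!t. 0 <= a + 2 * t * b + t\<^sup>2 * c"
 shows "b\<^sup>2 <= a * c"
proof (cases "c = 0")
 case True
 have "b = 0"
 proof (rule ccontr)
  assume "b ~= 0"
  then show False using q[of "- (a + 1) / (2 * b)"] True by (simp add: field_simps)
 qed
 then show ?thesis using True by simp
next
 case False
 have "a + 2 * (- b / c) * b + (- b / c)\<^sup>2 * c = a - b\<^sup>2 / c"
  using False by (simp add: power2_eq_square)
 then have "b\<^sup>2 / c <= a" using q[of "- b / c"] by linarith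
 then show ?thesis using False c by (simp add: pos_divide_le_eq)
qed

lemma Cauchy_Schwarz_L2:
 assumes "square_integrable M f" "square_integrable M g"
 shows "\<bar>\<integral>x. f x * g x \<partial>M\<bar> <= norm_L2 M f * norm_L2 M g"
proof -
 let ?A = "\<integral>x. (f x)\<^sup>2 \<partial>M" and ?B = "\<integral>x. f x * g x \<partial>M" and ?C = "\<integral>x. (g x)\<^sup>2 \<partial>M"
 have C: "0 <= ?C" and A: "0 <= ?A" by simp_all
 have q: "0 <= ?A + 2 * t * ?B + t\<^sup>2 * ?C" for t
 proof -
  have "0 <= (LINT x|M. (1 * f x + t * g x)\<^sup>2)" by simp
  then show ?thesis unfolding integral_sq_lin[OF assms, of 1 t] by simp
 qed
 have "?B\<^sup>2 <= ?A * ?C" by (rule nonneg_quadratic_discriminant[OF C q])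
 then have "sqrt (?B\<^sup>2) <= sqrt (?A * ?C)" by (rule real_sqrt_le_mono)
 then show ?thesis by (simp add: norm_L2_def real_sqrt_mult)
qed

lemma norm_L2_triangle:
 assumes "square_integrable M f" "square_integrable M g"
 shows "norm_L2 M (%x. f x + g x) <= norm_L2 M f + norm_L2 M g"
proof (rule power2_le_imp_le)
 have "(norm_L2 M (%x. f x + g x))\<^sup>2 = (norm_L2 M f)\<^sup>2 + 2 * (LINT x|M. f x * g x) + (norm_L2 M g)\<^sup>2"
  using integral_sq_lin[OF assms, of 1 1] by (simp add: norm_L2_sq)
 also have "... <= (norm_L2 M f + norm_L2 M g)\<^sup>2"
  using Cauchy_Schwarz_L2[OF assms] by (simp add: power2_sum)
 finally show "(norm_L2 M (%x. f x + g x))\<^sup>2 <= (norm_L2 M f + norm_L2 M g)\<^sup>2" .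
qed simp

lemma norm_L2_cmult: "norm_L2 M (%x. c * f x) = \<bar>c\<bar> * norm_L2 M f"
 by (simp add: norm_L2_def power_mult_distrib real_sqrt_mult)

lemma norm_L2_triangle3:
 assumes "square_integrable M f" "square_integrable M g" "square_integrable M h"
 shows "norm_L2 M (%x. f x - h x) <= norm_L2 M (%x. f x - g x) + norm_L2 M (%x. g x - h x)"
 using norm_L2_triangle[OF sqint_diff[OF assms(1,2)] sqint_diff[OF assms(2,3)]] by simp

lemma norm_L2_mono_AE:
 assumes "square_integrable M g" "f \<in> borel_measurable M" "AE x in M. \<bar>f x\<bar> <= C * \<bar>g x\<bar>" "0 <= C"
 shows "norm_L2 M f <= C * norm_L2 M g"
proof -
 have f: "square_integrable M f" by (rule sqint_bound[OF assms(1,2,3)])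
 have "(LINT x|M. (f x)\<^sup>2) <= (LINT x|M. C\<^sup>2 * (g x)\<^sup>2)"
 proof (rule integral_mono_AE)
  show "AE x in M. (f x)\<^sup>2 <= C\<^sup>2 * (g x)\<^sup>2"
   using assms(3)
  proof eventually_elim
   case (elim x)
   then have "\<bar>f x\<bar>\<^sup>2 <= (C * \<bar>g x\<bar>)\<^sup>2" by (intro power_mono) auto
   then show ?case by (simp add: power_mult_distrib)
  qed
 qed (use f assms in "auto simp: square_integrable_def")
 then have "sqrt (LINT x|M. (f x)\<^sup>2) <= sqrt (C\<^sup>2 * (LINT x|M. (g x)\<^sup>2))" by simp
 then show ?thesis using assms(4) by (simp add: norm_L2_def real_sqrt_mult)
qed

lemma integral_L2_tendsto:
 assumes f: "!!k. square_integrable M (f k)" "square_integrable M f0" "(%k. norm_L2 M (%x. f k x - f0 x)) ----> 0"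
  and g: "square_integrable M g"
 shows "(%k. \<integral>x. f k x * g x \<partial>M) ----> (LINT x|M. f0 x * g x)"
proof -
 have "(%k. (LINT x|M. f k x * g x) - (LINT x|M. f0 x * g x)) ----> 0"
 proof (rule Lim_null_comparison)
  show "\<forall>\<^sub>F k in sequentially. norm ((LINT x|M. f k x * g x) - (LINT x|M. f0 x * g x))
    <= norm_L2 M (%x. f k x - f0 x) * norm_L2 M g"
  proof (intro always_eventually allI)
   fix k
   have "(LINT x|M. f k x * g x) - (LINT x|M. f0 x * g x) = (LINT x|M. (f k x - f0 x) * g x)"
    using sqint_mult[OF f(1) g] sqint_mult[OF f(2) g] by (simp add: left_diff_distrib)
   then show "norm ((LINT x|M. f k x * g x) - (LINT x|M. f0 x * g x))
    <= norm_L2 M (%x. f k x - f0 x) * norm_L2 M g"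
    using Cauchy_Schwarz_L2[OF sqint_diff[OF f(1,2)] g] by simp
  qed
  show "(%k. norm_L2 M (%x. f k x - f0 x) * norm_L2 M g) ----> 0"
   using tendsto_mult_left_zero[OF f(3)] by blast
 qed
 then show ?thesis by (simp add: LIM_zero_iff)
qed

lemma norm_L2_eq_0_AE:
 assumes "square_integrable M f" "norm_L2 M f = 0"
 shows "AE x in M. f x = 0"
proof -
 have "(LINT x|M. (f x)\<^sup>2) = 0" using assms(2) by (simp add: norm_L2_def)
 then have "AE x in M. (f x)\<^sup>2 = 0"
  using integral_nonneg_eq_0_iff_AE[of M "%x. (f x)\<^sup>2"] assms(1) by (simp add: square_integrable_def)
 then show ?thesis by simp
qed

text \<open>A subsequence with differences below 2^-k converges almost everywhere, and Fatou's lemma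
  makes its pointwise limit the limit of the whole sequence in the mean. The subsequence is part of
  the conclusion because pointwise convergence carries positivity over to traces.\<close>

lemma L2_complete:
 assumes f: "!!k. square_integrable M (f k)"
  and C: "!!e. e > 0 ==> EX N. ALL m>=N. ALL n>=N. norm_L2 M (%x. f m x - f n x) < e"
 obtains t r where "square_integrable M t" "(%k. norm_L2 M (%x. f k x - t x)) ----> 0"
  "strict_mono r" "AE x in M. (%k. f (r k) x) ----> t x"
proof -
 have fm [measurable]: "f k \<in> borel_measurable M" for k using f by (simp add: square_integrable_def)
 have "ALL k. EX N. ALL m>=N. ALL n>=N. norm_L2 M (%x. f m x - f n x) < (1/2)^k" using C by simp
 then obtain N where N: "!!k m n. m >= N k ==> n >= N k ==> norm_L2 M (%x. f m x - f n x) < (1/2)^k" by metis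
 define r where "r = rec_nat (N 0) (%k a. max (Suc a) (N (Suc k)))"
 have r0: "r 0 = N 0" and rS: "r (Suc k) = max (Suc (r k)) (N (Suc k))" for k by (simp_all add: r_def)
 have rN: "r k >= N k" for k by (cases k) (auto simp: r0 rS)
 have sm: "strict_mono r" by (rule strict_monoI_Suc) (simp add: rS)
 define d where "d k x = \<bar>f (r (Suc k)) x - f (r k) x\<bar>" for k x
 have dm [measurable]: "d k \<in> borel_measurable M" for k unfolding d_def by measurable
 \<comment> \<open>The weight 2^k leaves integrals of at most 2^k 4^-k, which are summable, and it
   is large enough for Young's inequality to recover a summable bound for \<open>d k x\<close>
   itself.\<close>
 have dint: "(\<integral>\<^sup>+x. ennreal (2^k * (d k x)\<^sup>2) \<partial>M) <= ennreal ((1/2)^k)" for k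
 proof -
  have sq: "integrable M (%x. (f (r (Suc k)) x - f (r k) x)\<^sup>2)"
   using sqint_diff[OF f f] by (simp add: square_integrable_def)
  have "(\<integral>\<^sup>+x. ennreal (2^k * (d k x)\<^sup>2) \<partial>M) = ennreal (LINT x|M. 2^k * (d k x)\<^sup>2)"
   by (rule nn_integral_eq_integral) (use sq in "auto simp: d_def")
  also have "(LINT x|M. 2^k * (d k x)\<^sup>2) = 2^k * (norm_L2 M (%x. f (r (Suc k)) x - f (r k) x))\<^sup>2"
   by (simp add: norm_L2_sq d_def)
  also have "... <= 2^k * ((1/2)^k)\<^sup>2"
  proof (intro mult_left_mono power_mono)
   have "r (Suc k) >= N k" using rN[of k] rS[of k] by linarith
   then show "norm_L2 M (%x. f (r (Suc k)) x - f (r k) x) <= (1/2)^k"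
    using N[of k "r (Suc k)" "r k"] rN[of k] by simp
  qed auto
  also have "... = (1/2)^k" by (simp add: power2_eq_square power_divide)
  finally show ?thesis by (simp add: ennreal_leI)
 qed
 have "(\<integral>\<^sup>+x. (\<Sum>k. ennreal (2^k * (d k x)\<^sup>2)) \<partial>M) = (\<Sum>k. \<integral>\<^sup>+x. ennreal (2^k * (d k x)\<^sup>2) \<partial>M)"
  by (rule nn_integral_suminf) simp
 also have "... <= (\<Sum>k. ennreal ((1/2)^k))" by (rule suminf_le) (use dint in auto)
 also have "... < \<infinity>" by (subst suminf_ennreal2) (auto simp: summable_geometric)
 finally have "AE x in M. (\<Sum>k. ennreal (2^k * (d k x)\<^sup>2)) ~= \<infinity>"
  by (intro nn_integral_PInf_AE) auto
 then have conv: "AE x in M. convergent (%k. f (r k) x)"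
 proof eventually_elim
  case (elim x)
  then have s: "summable (%k. 2^k * (d k x)\<^sup>2)" by (intro summable_suminf_not_top) auto
  have "summable (%k. f (r (Suc k)) x - f (r k) x)"
  proof (rule summable_comparison_test')
   show "summable (%k. (1/2)^k + 2^k * (d k x)\<^sup>2)" using s by (intro summable_add) (auto simp: summable_geometric)
   fix k
   have "2 * (d k x) <= (1/2)^k + 2^k * (d k x)\<^sup>2"
   proof -
    have "0 <= 2^k * (d k x - (1/2)^k)\<^sup>2" by simp
    also have "... = 2^k * (d k x)\<^sup>2 - 2 * d k x * (2^k * (1/2)^k) + 2^k * (1/2)^k * (1/2)^k"
     by (simp add: power2_eq_square algebra_simps)
    also have "2^k * (1/2)^k = (1::real)" by (simp add: power_divide)
    finally show ?thesis by simp
   qed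
   moreover have "0 <= d k x" "norm (f (r (Suc k)) x - f (r k) x) = d k x" by (simp_all add: d_def)
   ultimately show "norm (f (r (Suc k)) x - f (r k) x) <= (1/2)^k + 2^k * (d k x)\<^sup>2"
    by linarith
  qed
  then have "convergent (%n. \<Sum>k<n. f (r (Suc k)) x - f (r k) x)" by (simp add: summable_iff_convergent)
  then have "convergent (%n. f (r n) x - f (r 0) x)" by (simp only: sum_lessThan_telescope[of "%k. f (r k) x"])
  from convergent_add[OF this convergent_const[of "f (r 0) x"]]
  show ?case by simp
 qed
 define t where "t x = lim (%k. f (r k) x)" for x
 have tm [measurable]: "t \<in> borel_measurable M" unfolding t_def by measurable
 have lim: "AE x in M. (%k. f (r k) x) ----> t x"
  using conv by eventually_elim (simp add: t_def convergent_LIMSEQ_iff)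
 \<comment> \<open>Fatou's lemma along the subsequence. The bound is carried with <= because strict
   inequalities are lost in the limit.\<close>
 have main: "square_integrable M (%x. f m x - t x) & norm_L2 M (%x. f m x - t x) <= e"
  if e: "e > 0" and n: "!!n. n >= K ==> norm_L2 M (%x. f m x - f n x) <= e" for m K e
 proof -
  have "(\<integral>\<^sup>+x. ennreal ((f m x - t x)\<^sup>2) \<partial>M) = (\<integral>\<^sup>+x. liminf (%k. ennreal ((f m x - f (r k) x)\<^sup>2)) \<partial>M)"
  proof (rule nn_integral_cong_AE, use lim in eventually_elim)
   case (elim x)
   have "(%k. ennreal ((f m x - f (r k) x)\<^sup>2)) ----> ennreal ((f m x - t x)\<^sup>2)"
    by (intro tendsto_intros elim)
   then show ?case by (rule lim_imp_Liminf[OF trivial_limit_sequentially, symmetric])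
  qed
  also have "... <= liminf (%k. \<integral>\<^sup>+x. ennreal ((f m x - f (r k) x)\<^sup>2) \<partial>M)"
   by (rule nn_integral_liminf) simp
  also have "... <= ennreal (e\<^sup>2)"
  proof (rule Liminf_le)
   show "\<forall>\<^sub>F k in sequentially. (\<integral>\<^sup>+x. ennreal ((f m x - f (r k) x)\<^sup>2) \<partial>M) <= ennreal (e\<^sup>2)"
    using eventually_ge_at_top[of K]
   proof eventually_elim
    case (elim k)
    have "r k >= K" using elim seq_suble[OF sm, of k] by linarith
    then have le: "norm_L2 M (%x. f m x - f (r k) x) <= e" using n by blast
    have "(\<integral>\<^sup>+x. ennreal ((f m x - f (r k) x)\<^sup>2) \<partial>M) = ennreal ((norm_L2 M (%x. f m x - f (r k) x))\<^sup>2)"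
     unfolding norm_L2_sq
     by (rule nn_integral_eq_integral) (use sqint_diff[OF f f] in "auto simp: square_integrable_def")
    also have "... <= ennreal (e\<^sup>2)" using le by (intro ennreal_leI power_mono) auto
    finally show ?case .
   qed
  qed simp
  finally have le: "(\<integral>\<^sup>+x. ennreal ((f m x - t x)\<^sup>2) \<partial>M) <= ennreal (e\<^sup>2)" .
  have int: "integrable M (%x. (f m x - t x)\<^sup>2)"
   by (rule integrableI_bounded) (use le in "auto simp: less_top[symmetric] top_unique intro: le_less_trans")
  then have "ennreal (LINT x|M. (f m x - t x)\<^sup>2) <= ennreal (e\<^sup>2)"
   using le by (simp add: nn_integral_eq_integral)
  then have "(LINT x|M. (f m x - t x)\<^sup>2) <= e\<^sup>2" by (simp add: ennreal_le_iff)
  then have "norm_L2 M (%x. f m x - t x) <= sqrt (e\<^sup>2)" unfolding norm_L2_def by (rule real_sqrt_le_mono)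
  then show ?thesis using int e by (simp add: square_integrable_def)
 qed
 have sq: "square_integrable M (%x. f (N 0) x - t x)"
  using main[of 1 "N 0" "N 0"] N[of 0] by (simp add: less_imp_le)
 have t: "square_integrable M t" using sqint_diff[OF f[of "N 0"] sq] by simp
 have "(%k. norm_L2 M (%x. f k x - t x)) ----> 0"
 proof (rule LIMSEQ_I)
  fix e :: real assume e: "e > 0"
  obtain K where K: "!!m n. m >= K ==> n >= K ==> norm_L2 M (%x. f m x - f n x) < e / 2"
   using C[of "e / 2"] e by auto
  have "norm_L2 M (%x. f m x - t x) <= e / 2" if "m >= K" for m
   using main[of "e / 2" K m] K that e by (auto intro: less_imp_le)
  then show "EX no. ALL n>=no. norm (norm_L2 M (%x. f n x - t x) - 0) < e" using e by (intro exI[of _ K]) force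
 qed
 then show ?thesis using that t sm lim by blast
qed

text \<open>The solution is the limit of a minimising sequence of \<open>\<integral>h\<^sup>2 / 2 - l\<close> over the graph \<open>P\<close> of a
 bounded linear functional.\<close>

lemma Riesz_L2:
 assumes P0: "(h0, l0) \<in> P" and P: "!!h l. (h, l) \<in> P ==> square_integrable M h"
  and lin: "!!h l h' l' a b. (h, l) \<in> P ==> (h', l') \<in> P ==> (%x. a * h x + b * h' x, a * l + b * l') \<in> P"
  and bd: "!!h l. (h, l) \<in> P ==> \<bar>l\<bar> <= C * norm_L2 M h"
 obtains \<gamma> where "square_integrable M \<gamma>" "!!h l. (h, l) \<in> P ==> (LINT x|M. \<gamma> x * h x) = l"
proof -
 define E where "E p = (LINT x|M. (fst p x)\<^sup>2) / 2 - snd p" for p :: "('a => real) \<times> real"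
 have Eb: "E p >= - C\<^sup>2 / 2" if "p \<in> P" for p
 proof -
  have "snd p <= C * norm_L2 M (fst p)" using bd[of "fst p" "snd p"] that by simp
  moreover have "E p = (norm_L2 M (fst p))\<^sup>2 / 2 - snd p" by (simp add: E_def norm_L2_sq)
  moreover have "0 <= (norm_L2 M (fst p) - C)\<^sup>2" by simp
  ultimately show ?thesis by (simp add: power2_diff field_simps)
 qed
 define m where "m = Inf (E ` P)"
 have bdd: "bdd_below (E ` P)" using Eb by (auto intro!: bdd_belowI[of _ "- C\<^sup>2 / 2"])
 have m: "m <= E p" if "p \<in> P" for p unfolding m_def using bdd that by (simp add: cINF_lower)
 have "EX p:P. E p < m + 1 / (real k + 1)" for k
  using cInf_lessD[of "E ` P" "m + 1 / (real k + 1)"] P0 unfolding m_def by (force simp: field_simps)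
 then obtain p where p: "!!k. p k \<in> P" "!!k. E (p k) < m + 1 / (real k + 1)" by metis
 define f where "f k = fst (p k)" for k
 have fP: "(f k, snd (p k)) \<in> P" for k using p by (simp add: f_def)
 have f: "square_integrable M (f k)" for k using P[OF fP] .
 \<comment> \<open>Parallelogram identity: the midpoint of two almost minimisers lies in
   \<open>P\<close>, so its energy cannot fall below \<open>m\<close>.\<close>
 have par: "(LINT x|M. (f j x - f k x)\<^sup>2) <= 4 * (1 / (real j + 1) + 1 / (real k + 1))" for j k
 proof -
  let ?A = "\<integral>x. (f j x)\<^sup>2 \<partial>M" and ?B = "\<integral>x. f j x * f k x \<partial>M" and ?D = "\<integral>x. (f k x)\<^sup>2 \<partial>M"
  have "(%x. 1/2 * f j x + 1/2 * f k x, 1/2 * snd (p j) + 1/2 * snd (p k)) \<in> P" by (rule lin[OF fP fP])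
  from m[OF this] have "m <= (LINT x|M. (1/2 * f j x + 1/2 * f k x)\<^sup>2) / 2 - (1/2 * snd (p j) + 1/2 * snd (p k))"
   by (simp only: E_def fst_conv snd_conv)
  also have "(LINT x|M. (1/2 * f j x + 1/2 * f k x)\<^sup>2) = ?A / 4 + ?B / 2 + ?D / 4"
   unfolding integral_sq_lin[OF f f] by (simp add: power2_eq_square)
  finally have 1: "m <= (?A / 4 + ?B / 2 + ?D / 4) / 2 - (1/2 * snd (p j) + 1/2 * snd (p k))" .
  have 2: "?A / 2 - snd (p j) < m + 1 / (real j + 1)" "?D / 2 - snd (p k) < m + 1 / (real k + 1)"
   using p(2)[of j] p(2)[of k] by (simp_all add: E_def f_def)
  have "(LINT x|M. (f j x - f k x)\<^sup>2) = ?A - 2 * ?B + ?D"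
   using integral_sq_lin[OF f f, of 1 j "-1" k] by simp
  moreover have "X <= 4 * (u + w)"
   if "m <= (A / 4 + B / 2 + D / 4) / 2 - (1/2 * s + 1/2 * t)" "A / 2 - s < m + u" "D / 2 - t < m + w"
    "X = A - 2 * B + D" for X A B D s t u w :: real
   using that by (simp add: field_simps)
  ultimately show ?thesis using 1 2 by blast
 qed
 have CC: "EX N. ALL i>=N. ALL j>=N. norm_L2 M (%x. f i x - f j x) < e" if e: "e > 0" for e
 proof -
  obtain N where N: "8 / e\<^sup>2 < real N" using reals_Archimedean2 by blast
  have "norm_L2 M (%x. f i x - f j x) < e" if "i >= N" "j >= N" for i j
  proof -
   have "1 / (real i + 1) <= 1 / (real N + 1)" "1 / (real j + 1) <= 1 / (real N + 1)"
    using that by (auto intro!: divide_left_mono mult_pos_pos)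
   then have "(LINT x|M. (f i x - f j x)\<^sup>2) <= 8 / (real N + 1)" using par[of i j] by simp
   also have "8 / (real N + 1) < e\<^sup>2"
   proof -
    have "0 < e\<^sup>2" using e by simp
    moreover have "8 < real N * e\<^sup>2" using N calculation by (simp add: pos_divide_less_eq)
    moreover have "(real N + 1) * e\<^sup>2 = real N * e\<^sup>2 + e\<^sup>2" by (simp add: distrib_right)
    ultimately have "8 < e\<^sup>2 * (real N + 1)" by (simp only: mult.commute)
    then show ?thesis by (simp add: pos_divide_less_eq)
   qed
   finally have "sqrt (LINT x|M. (f i x - f j x)\<^sup>2) < sqrt (e\<^sup>2)" by (rule real_sqrt_less_mono)
   then show ?thesis using e by (simp add: norm_L2_def)
  qed
  then show ?thesis by blast
 qed
 obtain \<gamma> where g: "square_integrable M \<gamma>" "(%k. norm_L2 M (%x. f k x - \<gamma> x)) ----> 0"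
  by (rule L2_complete[OF f CC]) blast
 have "(LINT x|M. \<gamma> x * h x) = l" if hl: "(h, l) \<in> P" for h l
 proof -
  have h: "square_integrable M h" using P[OF hl] .
  \<comment> \<open>First variation of the energy in the direction \<open>h\<close>; the defect 1 /
    (k + 1) of the minimising sequence disappears in the limit.\<close>
  have q: "0 <= t * ((LINT x|M. \<gamma> x * h x) - l) + t\<^sup>2 / 2 * (LINT x|M. (h x)\<^sup>2)" for t
  proof (rule LIMSEQ_le_const)
   have "(%k. 1 / (real k + 1)) ----> 0"
    using LIMSEQ_inverse_real_of_nat by (simp add: inverse_eq_divide add.commute)
   then have "(%k. 1 / (real k + 1) + (t * ((LINT x|M. f k x * h x) - l) + t\<^sup>2 / 2 * (LINT x|M. (h x)\<^sup>2)))
     ----> 0 + (t * ((LINT x|M. \<gamma> x * h x) - l) + t\<^sup>2 / 2 * (LINT x|M. (h x)\<^sup>2))"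
    by (intro tendsto_add tendsto_mult tendsto_diff tendsto_const integral_L2_tendsto f g h)
   then show "(%k. 1 / (real k + 1) + (t * ((LINT x|M. f k x * h x) - l) + t\<^sup>2 / 2 * (LINT x|M. (h x)\<^sup>2)))
     ----> t * ((LINT x|M. \<gamma> x * h x) - l) + t\<^sup>2 / 2 * (LINT x|M. (h x)\<^sup>2)" by simp
   show "EX N. ALL k>=N. 0 <= 1 / (real k + 1) + (t * ((LINT x|M. f k x * h x) - l) + t\<^sup>2 / 2 * (LINT x|M. (h x)\<^sup>2))"
   proof (intro exI[of _ 0] allI impI)
    fix k
    have "(%x. 1 * f k x + t * h x, 1 * snd (p k) + t * l) \<in> P" by (rule lin[OF fP hl])
    from m[OF this] have "m <= (LINT x|M. (1 * f k x + t * h x)\<^sup>2) / 2 - (1 * snd (p k) + t * l)"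
     by (simp only: E_def fst_conv snd_conv)
    moreover have "(LINT x|M. (f k x)\<^sup>2) / 2 - snd (p k) < m + 1 / (real k + 1)"
     using p(2)[of k] by (simp add: E_def f_def)
    ultimately show "0 <= 1 / (real k + 1) + (t * ((LINT x|M. f k x * h x) - l) + t\<^sup>2 / 2 * (LINT x|M. (h x)\<^sup>2))"
     unfolding integral_sq_lin[OF f h] by (simp add: algebra_simps)
   qed
  qed
  have "(((LINT x|M. \<gamma> x * h x) - l) / 2)\<^sup>2 <= 0 * ((LINT x|M. (h x)\<^sup>2) / 2)"
   by (rule nonneg_quadratic_discriminant) (use q in auto)
  then show ?thesis by simp
 qed
 then show ?thesis using that g by blast
qed

section \<open>Translations and mollification in \<open>L\<^sup>2\<close>\<close>

lemma nn_integral_lborel_translate: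
 fixes f :: "'a::euclidean_space => ennreal"
 assumes [measurable]: "f \<in> borel_measurable borel"
 shows "(\<integral>\<^sup>+x. f (x + h) \<partial>lborel) = (\<integral>\<^sup>+x. f x \<partial>lborel)"
proof -
 have "(\<integral>\<^sup>+x. f x \<partial>lborel) = (\<integral>\<^sup>+x. f x \<partial>distr lborel borel ((+) h))" by (simp add: lborel_distr_plus)
 also have "... = (\<integral>\<^sup>+x. f (h + x) \<partial>lborel)" by (rule nn_integral_distr) auto
 finally show ?thesis by (simp add: add.commute)
qed

lemma integral_lborel_translate:
 fixes f :: "'a::euclidean_space => real"
 assumes [measurable]: "f \<in> borel_measurable borel"
 shows "(LBINT x. f (x + h)) = (LBINT x. f x)"
proof -
 have "(LBINT x. f x) = (\<integral>x. f x \<partial>distr lborel borel ((+) h))" by (simp add: lborel_distr_plus)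
 also have "... = (LBINT x. f (h + x))" by (rule integral_distr) auto
 finally show ?thesis by (simp add: add.commute)
qed

lemma integrable_lborel_translate:
 fixes f :: "'a::euclidean_space => real"
 assumes "integrable lborel f"
 shows "integrable lborel (%x. f (x + h))"
proof -
 have [measurable]: "f \<in> borel_measurable borel" using assms by auto
 have "integrable (distr lborel borel ((+) h)) f" using assms by (simp add: lborel_distr_plus)
 then have "integrable lborel (%x. f (h + x))" by (subst (asm) integrable_distr_eq) auto
 then show ?thesis by (simp add: add.commute)
qed

lemma sqint_translate:
 fixes u :: "'a::euclidean_space => real"
 assumes "square_integrable lborel u"
 shows "square_integrable lborel (%x. u (x + h))"
proof -
 have [measurable]: "u \<in> borel_measurable borel" using assms by (simp add: square_integrable_def)
 show ?thesis
  using integrable_lborel_translate[of "%x. (u x)\<^sup>2" h] assms by (simp add: square_integrable_def)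
qed

lemma norm_L2_translate:
 fixes u :: "'a::euclidean_space => real"
 assumes "u \<in> borel_measurable borel"
 shows "norm_L2 lborel (%x. u (x + h)) = norm_L2 lborel u"
 unfolding norm_L2_def using integral_lborel_translate[of "%x. (u x)\<^sup>2" h] assms by simp

lemma indicator_sq: "(indicator A x :: real)\<^sup>2 = indicator A x"
 by (simp add: indicator_def)

definition L2_cont :: "('a::euclidean_space => real) => bool" where
 "L2_cont u \<longleftrightarrow> (ALL e>0. EX d>0. ALL h. norm h < d --> norm_L2 lborel (%x. u (x + h) - u x) <= e)"

lemma L2_cont_approx:
 assumes u: "square_integrable lborel u"
  and w: "!!e. e > 0 ==> EX w. square_integrable lborel w & L2_cont w & norm_L2 lborel (%x. u x - w x) <= e"
 shows "L2_cont u"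
 unfolding L2_cont_def
proof (intro allI impI)
 fix e :: real assume "e > 0"
 then obtain w where w: "square_integrable lborel w" "L2_cont w" "norm_L2 lborel (%x. u x - w x) <= e / 3"
  using w[of "e / 3"] by auto
 obtain d where d: "d > 0" "!!h. norm h < d ==> norm_L2 lborel (%x. w (x + h) - w x) <= e / 3"
  using w(2) \<open>e > 0\<close> unfolding L2_cont_def by (metis zero_less_divide_iff zero_less_numeral)
 have "norm_L2 lborel (%x. u (x + h) - u x) <= e" if h: "norm h < d" for h
 proof -
  note t = sqint_translate[of _ h]
  have "norm_L2 lborel (%x. u (x + h) - w (x + h)) = norm_L2 lborel (%x. u x - w x)"
   by (rule norm_L2_translate[of "%x. u x - w x"]) (use sqint_diff[OF u w(1)] in "simp add: square_integrable_def")
  then show ?thesis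
   using norm_L2_triangle3[OF t[OF u] t[OF w(1)] u] norm_L2_triangle3[OF t[OF w(1)] w(1) u]
    w(3) d(2)[OF h] norm_L2_minus[of lborel u w] by simp
 qed
 then show "EX d>0. ALL h. norm h < d --> norm_L2 lborel (%x. u (x + h) - u x) <= e"
  using d(1) by blast
qed

lemma L2_cont_lin:
 assumes "square_integrable lborel u" "L2_cont u" "square_integrable lborel v" "L2_cont v"
 shows "L2_cont (%x. a * u x + b * v x)"
 unfolding L2_cont_def
proof (intro allI impI)
 fix e :: real assume e: "e > 0"
 let ?e = "e / (\<bar>a\<bar> + \<bar>b\<bar> + 1)"
 have e': "?e > 0" using e by (simp add: add_nonneg_pos)
 obtain d1 where d1: "d1 > 0" "!!h. norm h < d1 ==> norm_L2 lborel (%x. u (x + h) - u x) <= ?e"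
  using assms(2) e' unfolding L2_cont_def by metis
 obtain d2 where d2: "d2 > 0" "!!h. norm h < d2 ==> norm_L2 lborel (%x. v (x + h) - v x) <= ?e"
  using assms(4) e' unfolding L2_cont_def by metis
 have "norm_L2 lborel (%x. (a * u (x + h) + b * v (x + h)) - (a * u x + b * v x)) <= e"
  if h: "norm h < min d1 d2" for h
 proof -
  let ?u = "%x. u (x + h) - u x" and ?v = "%x. v (x + h) - v x"
  have "norm_L2 lborel (%x. (a * u (x + h) + b * v (x + h)) - (a * u x + b * v x)) = norm_L2 lborel (%x. a * ?u x + b * ?v x)"
   by (simp add: algebra_simps)
  also have "... <= norm_L2 lborel (%x. a * ?u x) + norm_L2 lborel (%x. b * ?v x)"
   by (intro norm_L2_triangle sqint_cmult sqint_diff sqint_translate assms)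
  also have "... = \<bar>a\<bar> * norm_L2 lborel ?u + \<bar>b\<bar> * norm_L2 lborel ?v" by (simp only: norm_L2_cmult)
  also have "... <= \<bar>a\<bar> * ?e + \<bar>b\<bar> * ?e"
   using d1(2)[of h] d2(2)[of h] h by (intro add_mono mult_left_mono) auto
  also have "... = (\<bar>a\<bar> + \<bar>b\<bar>) * ?e" by (rule distrib_right[symmetric])
  also have "... <= e" using e by (simp add: field_simps)
  finally show ?thesis .
 qed
 then show "EX d>0. ALL h. norm h < d --> norm_L2 lborel (%x. (a * u (x + h) + b * v (x + h)) - (a * u x + b * v x)) <= e"
  using d1(1) d2(1) by (intro exI[of _ "min d1 d2"]) auto
qed

text \<open>By translation invariance the squared distance between the indicator and its translate
  is twice the measure of \<open>U\<close> minus twice the measure of the overlap. Dominated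
  convergence handles the overlap: at a point of \<open>U\<close> the translated indicator is
  eventually 1, since \<open>U\<close> is open.\<close>

lemma L2_cont_open:
 fixes U :: "'a::euclidean_space set"
 assumes U: "open U" "emeasure lborel U < \<infinity>"
 shows "L2_cont (indicator U :: 'a => real)"
proof (rule ccontr)
 have [measurable]: "U \<in> sets borel" using U by simp
 assume "\<not> L2_cont (indicator U :: 'a => real)"
 then obtain e where e: "e > 0" "!!d. d > 0 ==> EX h. norm h < d & \<not> norm_L2 lborel (%x. indicator U (x + h) - indicator U x :: real) <= e"
  unfolding L2_cont_def by metis
 have "ALL n. EX h. norm h < inverse (real (Suc n)) & \<not> norm_L2 lborel (%x. indicator U (x + h) - indicator U x :: real) <= e"
  using e(2) by simp
 then obtain h where h: "!!n. norm (h n) < inverse (real (Suc n))"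
  "!!n. \<not> norm_L2 lborel (%x. indicator U (x + h n) - indicator U x :: real) <= e" by metis
 have h0: "h ----> 0"
  by (rule Lim_null_comparison[OF _ LIMSEQ_inverse_real_of_nat]) (use h(1) in "auto intro!: always_eventually less_imp_le")
 have iU: "integrable lborel (indicator U :: 'a => real)" using U by (simp add: integrable_indicator_iff)
 have sU: "square_integrable lborel (indicator U :: 'a => real)"
  using iU by (simp add: square_integrable_def indicator_sq)
 have lim: "(%n. \<integral>x. indicator U x * indicator U (x + h n) \<partial>lborel) ----> (\<integral>x. indicator U x \<partial>lborel :: real)"
 proof (rule integral_dominated_convergence)
  show "integrable lborel (indicator U :: 'a => real)" by (rule iU)
  show "AE x in lborel. (%n. indicator U x * indicator U (x + h n)) ----> (indicator U x :: real)"
  proof (rule AE_I2)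
   fix x :: 'a
   show "(%n. indicator U x * indicator U (x + h n)) ----> (indicator U x :: real)"
   proof (cases "x \<in> U")
    case True
    have "(%n. x + h n) ----> x + 0" by (intro tendsto_intros h0)
    then have "\<forall>\<^sub>F n in sequentially. x + h n \<in> U"
     using U(1) True topological_tendstoD by fastforce
    then have "\<forall>\<^sub>F n in sequentially. indicator U x * indicator U (x + h n) = (1::real)"
     by eventually_elim (use True in simp)
    then show ?thesis using True by (simp add: tendsto_eventually)
   qed simp
  qed
 qed (auto simp: indicator_def)
 have eq: "(norm_L2 lborel (%x. indicator U (x + h n) - indicator U x :: real))\<^sup>2
   = 2 * (LBINT x. indicator U x) - 2 * (LBINT x. indicator U x * indicator U (x + h n))" for n
 proof -
  have "(LBINT x. (indicator U (x + h n))\<^sup>2) = (\<integral>x. indicator U x \<partial>lborel :: real)"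
   using integral_lborel_translate[of "indicator U" "h n"] by (simp add: indicator_sq)
  then show ?thesis
   using integral_sq_lin[OF sqint_translate[OF sU, of "h n"] sU, of 1 "-1"]
   by (simp add: norm_L2_sq indicator_sq mult.commute)
 qed
 have "(%n. (norm_L2 lborel (%x. indicator U (x + h n) - indicator U x :: real))\<^sup>2) ---->
  2 * (LBINT x. indicator U x) - 2 * (LBINT x. indicator U x)"
  unfolding eq by (intro tendsto_intros lim)
 then have "(%n. (norm_L2 lborel (%x. indicator U (x + h n) - indicator U x :: real))\<^sup>2) ----> 0" by simp
 moreover have "e\<^sup>2 > 0" using e(1) by simp
 ultimately have "\<forall>\<^sub>F n in sequentially. (norm_L2 lborel (%x. indicator U (x + h n) - indicator U x :: real))\<^sup>2 < e\<^sup>2"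
  by (rule order_tendstoD(2))
 then obtain n where "(norm_L2 lborel (%x. indicator U (x + h n) - indicator U x :: real))\<^sup>2 < e\<^sup>2"
  using eventually_happens'[OF sequentially_bot] by blast
 then have "norm_L2 lborel (%x. indicator U (x + h n) - indicator U x :: real) < e"
  by (rule power2_less_imp_less) (use e in simp)
 then show False using h(2)[of n] by simp
qed

text \<open>Reduction to open sets: outer regularity handles Borel sets of finite measure, then come
  simple functions, monotone limits, and positive and negative parts. Every passage is an
  approximation in the L^2 norm or a linear combination.\<close>

lemma L2_cont_sqint:
 fixes u :: "'a::euclidean_space => real"
 assumes u: "square_integrable lborel u"
 shows "L2_cont u"
proof -
 have nonneg: "square_integrable lborel v --> L2_cont v" if "v \<in> borel_measurable lborel" "!!x. 0 <= v x" for v :: "'a => real"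
  using that
 proof (induct rule: borel_measurable_induct_real)
  case (set A)
  show ?case
  proof
   assume sq: "square_integrable lborel (indicator A :: 'a => real)"
   have A [measurable]: "A \<in> sets borel" using set by simp
   have fin: "emeasure lborel A < \<infinity>"
    using sq by (simp add: square_integrable_def indicator_sq integrable_indicator_iff)
   show "L2_cont (indicator A :: 'a => real)"
   proof (rule L2_cont_approx[OF sq])
    fix e :: real assume e: "e > 0"
    have "A \<in> sets lebesgue" by simp
    then obtain T where T: "open T" "A \<subseteq> T" "emeasure lebesgue (T - A) < ennreal (e\<^sup>2)"
     using sets_lebesgue_outer_open[of A "e\<^sup>2"] e by (metis zero_less_power)
    have [measurable]: "T \<in> sets borel" using T by simp
    have TA: "emeasure lborel (T - A) < ennreal (e\<^sup>2)" using T(3) by simp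
    have "emeasure lborel T = emeasure lborel A + emeasure lborel (T - A)"
     using T(2) by (subst plus_emeasure) (auto simp: Un_absorb1)
    also have "... < \<infinity>" using fin TA by (simp add: less_top[symmetric]) (metis ennreal_less_top less_trans order_less_irrefl)
    finally have Tf: "emeasure lborel T < \<infinity>" .
    have sT: "square_integrable lborel (indicator T :: 'a => real)"
     using Tf by (simp add: square_integrable_def indicator_sq integrable_indicator_iff)
    have "(LBINT x. (indicator A x - indicator T x)\<^sup>2) = (\<integral>x. indicator (T - A) x \<partial>lborel :: real)"
     by (rule Bochner_Integration.integral_cong) (use T(2) in "auto simp: indicator_def")
    also have "... = measure lborel (T - A)" by simp
    also have "... <= e\<^sup>2"
     unfolding measure_def using TA by (intro enn2real_leI) (auto intro: less_imp_le)
    finally have "norm_L2 lborel (%x. indicator A x - indicator T x :: real) <= e"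
     unfolding norm_L2_def using e by (simp add: real_le_lsqrt)
    then show "EX w. square_integrable lborel w & L2_cont w & norm_L2 lborel (%x. indicator A x - w x) <= e"
     using sT L2_cont_open[OF T(1) Tf] by blast
   qed
  qed
 next
  case (mult v c)
  show ?case
  proof
   assume sq: "square_integrable lborel (%x. c * v x)"
   show "L2_cont (%x. c * v x)"
   proof (cases "c = 0")
    case True
    then show ?thesis by (auto simp: L2_cont_def norm_L2_def intro: exI[of _ 1])
   next
    case False
    then have "square_integrable lborel v" using sqint_cmult[OF sq, of "1 / c"] by simp
    then show ?thesis using mult L2_cont_lin[of v v c 0] by simp
   qed
  qed
 next
  case (add v w)
  show ?case
  proof
   assume sq: "square_integrable lborel (%x. w x + v x)"
   have "square_integrable lborel v" "square_integrable lborel w"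
    by (rule sqint_bound[OF sq, where C=1]; use add in auto)+
   then show "L2_cont (%x. w x + v x)" using add L2_cont_lin[of w v 1 1] by simp
  qed
 next
  case (seq U)
  show ?case
  proof
   assume sq: "square_integrable lborel v"
   have le: "U i x <= v x" for i x
    using seq(4) seq(5)[of x] incseq_le[of "%i. U i x" "v x" i] by (auto simp: incseq_def le_fun_def)
   have sU: "square_integrable lborel (U i)" for i
    by (rule sqint_bound[OF sq, where C=1]) (use le seq(1,2) that in "auto intro: order_trans")
   have "(%i. \<integral>x. (v x - U i x)\<^sup>2 \<partial>lborel) ----> (LBINT x. (v x - v x)\<^sup>2)"
   proof (rule integral_dominated_convergence)
    show "integrable lborel (%x. (v x)\<^sup>2)" using sq by (simp add: square_integrable_def)
    show "AE x in lborel. (%i. (v x - U i x)\<^sup>2) ----> (v x - v x)\<^sup>2"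
     by (intro AE_I2 tendsto_intros seq(5)) auto
    show "AE x in lborel. norm ((v x - U i x)\<^sup>2) <= (v x)\<^sup>2" for i
     using le[of i] seq(2)[of i] by (auto intro!: AE_I2 power_mono)
   qed (use seq(1) sq in "auto simp: square_integrable_def")
   then have lim: "(%i. norm_L2 lborel (%x. v x - U i x)) ----> 0"
    unfolding norm_L2_def using tendsto_real_sqrt by fastforce
   show "L2_cont v"
   proof (rule L2_cont_approx[OF sq])
    fix e :: real assume "e > 0"
    then have "\<forall>\<^sub>F i in sequentially. norm_L2 lborel (%x. v x - U i x) < e" by (rule order_tendstoD(2)[OF lim])
    then obtain i where "norm_L2 lborel (%x. v x - U i x) < e" using eventually_happens'[OF sequentially_bot] by blast
    then show "EX w. square_integrable lborel w & L2_cont w & norm_L2 lborel (%x. v x - w x) <= e"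
     using sU[of i] seq(3)[of i] by (intro exI[of _ "U i"]) auto
   qed
  qed
 qed
 have [measurable]: "u \<in> borel_measurable borel" using u by (simp add: square_integrable_def)
 have p: "square_integrable lborel (%x. max 0 (u x))" "square_integrable lborel (%x. max 0 (- u x))"
  by (rule sqint_bound[OF u, where C=1]; auto)+
 have "L2_cont (%x. 1 * max 0 (u x) + (-1) * max 0 (- u x))"
  using nonneg[of "%x. max 0 (u x)"] nonneg[of "%x. max 0 (- u x)"] p by (intro L2_cont_lin p) auto
 moreover have "(%x. 1 * max 0 (u x) + (-1) * max 0 (- u x)) = u" by (auto simp: max_def)
 ultimately show ?thesis by simp
qed

text \<open>Cauchy-Schwarz with respect to the weight, then Tonelli: the squared norm of
  \<open>K k\<close> is at most the mass of \<open>w k\<close> times the weighted integral over y of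
  ||u(. + y) - u||^2, which is small once the supports shrink. The hypothesis on \<open>K k\<close>
  is an inequality in \<open>ennreal\<close>, so that it also covers integrals that are not known to
  converge.\<close>

lemma weighted_difference_L2:
 fixes u :: "'a::euclidean_space => real" and w :: "nat => 'a => real"
 assumes u: "square_integrable lborel u"
  and wm: "!!k. w k \<in> borel_measurable borel" and w0: "!!k y. 0 <= w k y"
  and wC: "!!k. (\<integral>\<^sup>+y. ennreal (w k y) \<partial>lborel) <= ennreal C"
  and wr: "!!k y. w k y ~= 0 ==> norm y <= r k" and r: "r ----> 0"
  and Km: "!!k. K k \<in> borel_measurable borel"
  and K: "!!k. AE x in lborel. ennreal \<bar>K k x\<bar> <= (\<integral>\<^sup>+y. ennreal (w k y * \<bar>u (x + y) - u x\<bar>) \<partial>lborel)"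
 shows "\<forall>\<^sub>F k in sequentially. square_integrable lborel (K k)" and "(%k. norm_L2 lborel (K k)) ----> 0"
proof -
 have um [measurable]: "u \<in> borel_measurable borel" using u by (simp add: square_integrable_def)
 note wm [measurable] Km [measurable]
 have main: "\<forall>\<^sub>F k in sequentially. square_integrable lborel (K k) & norm_L2 lborel (K k) <= \<bar>C\<bar> * e" if e: "e > 0" for e
 proof -
  obtain d where d: "d > 0" "!!h. norm h < d ==> norm_L2 lborel (%x. u (x + h) - u x) <= e"
   using L2_cont_sqint[OF u] e unfolding L2_cont_def by metis
  have "\<forall>\<^sub>F k in sequentially. r k < d" using order_tendstoD(2)[OF r d(1)] .
  then show ?thesis
  proof eventually_elim
   case (elim k)
   let ?W = "\<integral>\<^sup>+y. ennreal (w k y) \<partial>lborel"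
   have y: "ennreal (w k y) * (\<integral>\<^sup>+x. ennreal ((u (x + y) - u x)\<^sup>2) \<partial>lborel) <= ennreal (w k y) * ennreal (e\<^sup>2)" for y
   proof (cases "w k y = 0")
    case False
    then have "norm y < d" using wr[of k y] elim by linarith
    then have le: "norm_L2 lborel (%x. u (x + y) - u x) <= e" by (rule d(2))
    have "(\<integral>\<^sup>+x. ennreal ((u (x + y) - u x)\<^sup>2) \<partial>lborel) = ennreal ((norm_L2 lborel (%x. u (x + y) - u x))\<^sup>2)"
     unfolding norm_L2_sq
     by (rule nn_integral_eq_integral) (use sqint_diff[OF sqint_translate[OF u] u] in "auto simp: square_integrable_def")
    also have "... <= ennreal (e\<^sup>2)" using le by (intro ennreal_leI power_mono) auto
    finally show ?thesis by (rule mult_left_mono) simp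
   qed simp
   have "(\<integral>\<^sup>+x. ennreal ((K k x)\<^sup>2) \<partial>lborel) <= (\<integral>\<^sup>+x. ?W * (\<integral>\<^sup>+y. ennreal (w k y * (u (x + y) - u x)\<^sup>2) \<partial>lborel) \<partial>lborel)"
   proof (rule nn_integral_mono_AE, use K[of k] in eventually_elim)
    case (elim x)
    have "ennreal ((K k x)\<^sup>2) = (ennreal \<bar>K k x\<bar>)\<^sup>2" by (simp add: ennreal_power)
    also have "... <= (\<integral>\<^sup>+y. ennreal (w k y * \<bar>u (x + y) - u x\<bar>) \<partial>lborel)\<^sup>2"
     using elim by (rule power_mono) simp
    also have "... = (\<integral>\<^sup>+y. ennreal (sqrt (w k y)) * ennreal (sqrt (w k y) * \<bar>u (x + y) - u x\<bar>) \<partial>lborel)\<^sup>2"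
     using w0[of k] by (simp add: ennreal_mult[symmetric] mult.assoc[symmetric])
    also have "... <= (\<integral>\<^sup>+y. (ennreal (sqrt (w k y)))\<^sup>2 \<partial>lborel) * (\<integral>\<^sup>+y. (ennreal (sqrt (w k y) * \<bar>u (x + y) - u x\<bar>))\<^sup>2 \<partial>lborel)"
     by (rule Cauchy_Schwarz_nn_integral) measurable
    also have "... = ?W * (\<integral>\<^sup>+y. ennreal (w k y * (u (x + y) - u x)\<^sup>2) \<partial>lborel)"
     using w0[of k] by (simp add: ennreal_power power_mult_distrib)
    finally show ?case .
   qed
   also have "... = ?W * (\<integral>\<^sup>+x. \<integral>\<^sup>+y. ennreal (w k y * (u (x + y) - u x)\<^sup>2) \<partial>lborel \<partial>lborel)"
    by (rule nn_integral_cmult) measurable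
   also have "(\<integral>\<^sup>+x. \<integral>\<^sup>+y. ennreal (w k y * (u (x + y) - u x)\<^sup>2) \<partial>lborel \<partial>lborel)
    = (\<integral>\<^sup>+y. \<integral>\<^sup>+x. ennreal (w k y * (u (x + y) - u x)\<^sup>2) \<partial>lborel \<partial>lborel)"
    by (rule lborel_pair.Fubini'[symmetric]) measurable
   also have "... = (\<integral>\<^sup>+y. ennreal (w k y) * (\<integral>\<^sup>+x. ennreal ((u (x + y) - u x)\<^sup>2) \<partial>lborel) \<partial>lborel)"
    using w0[of k] by (subst nn_integral_cmult[symmetric]) (auto simp: ennreal_mult)
   also have "... <= (\<integral>\<^sup>+y. ennreal (w k y) * ennreal (e\<^sup>2) \<partial>lborel)" by (rule nn_integral_mono) (rule y)
   also have "... = ?W * ennreal (e\<^sup>2)" by (rule nn_integral_multc) measurable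
   also have "?W * (?W * ennreal (e\<^sup>2)) <= ennreal C * (ennreal C * ennreal (e\<^sup>2))"
    using wC[of k] by (intro mult_mono) auto
   also have "... <= ennreal ((\<bar>C\<bar> * e)\<^sup>2)"
    using e by (cases "C >= 0") (auto simp: ennreal_mult[symmetric] power2_eq_square mult.assoc mult.left_commute ennreal_neg)
   finally have le: "(\<integral>\<^sup>+x. ennreal ((K k x)\<^sup>2) \<partial>lborel) <= ennreal ((\<bar>C\<bar> * e)\<^sup>2)"
    by (simp add: mult_left_mono)
   have int: "integrable lborel (%x. (K k x)\<^sup>2)"
    by (rule integrableI_bounded) (use le in "auto intro: le_less_trans")
   then have "ennreal (LBINT x. (K k x)\<^sup>2) <= ennreal ((\<bar>C\<bar> * e)\<^sup>2)"
    using le by (simp add: nn_integral_eq_integral)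
   then have "(LBINT x. (K k x)\<^sup>2) <= (\<bar>C\<bar> * e)\<^sup>2" by (simp add: ennreal_le_iff)
   then have "norm_L2 lborel (K k) <= \<bar>C\<bar> * e" unfolding norm_L2_def using e by (intro real_le_lsqrt) auto
   then show ?case using int by (simp add: square_integrable_def)
  qed
 qed
 show "\<forall>\<^sub>F k in sequentially. square_integrable lborel (K k)"
  using main[of 1] by (auto elim: eventually_mono)
 show "(%k. norm_L2 lborel (K k)) ----> 0"
 proof (rule tendstoI)
  fix e :: real assume e: "e > 0"
  have "e / (\<bar>C\<bar> + 1) > 0" using e by simp
  from main[OF this] show "\<forall>\<^sub>F k in sequentially. dist (norm_L2 lborel (K k)) 0 < e"
  proof eventually_elim
   case (elim k)
   have "\<bar>C\<bar> * (e / (\<bar>C\<bar> + 1)) < e" using e by (simp add: field_simps)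
   then show ?case using elim by simp
  qed
 qed
qed

section \<open>Compactly supported smooth functions\<close>

definition smooth_cs :: "(real ^ 'n::finite => real) => bool" where
 "smooth_cs Th \<longleftrightarrow> C_inf Th & bounded {x. Th x ~= 0}"

lemma smooth_csD: "smooth_cs Th ==> C_inf Th"
 by (simp add: smooth_cs_def)

lemma smooth_cs_support:
 assumes "smooth_cs Th" obtains R where "R > 0" "!!x. Th x ~= 0 ==> norm x <= R"
 using assms bounded_pos[of "{x. Th x ~= 0}"] that by (auto simp: smooth_cs_def)

lemma smooth_cs_mult: "C_inf f ==> smooth_cs Th ==> smooth_cs (%x. f x * Th x)"
 by (auto simp: smooth_cs_def intro: bounded_subset)

lemma smooth_cs_add:
 assumes "smooth_cs f" "smooth_cs Th"
 shows "smooth_cs (%x. f x + Th x)"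
proof -
 have "{x. f x + Th x ~= 0} \<subseteq> {x. f x ~= 0} \<union> {x. Th x ~= 0}" by auto
 moreover have "bounded ({x. f x ~= 0} \<union> {x. Th x ~= 0})" using assms by (simp add: smooth_cs_def)
 ultimately have "bounded {x. f x + Th x ~= 0}" by (rule bounded_subset[rotated])
 then show ?thesis using assms by (simp add: smooth_cs_def C_inf_add)
qed

lemma pd_outside_support:
 assumes "x \<notin> closure {x. f x ~= 0}"
 shows "pd i f x = 0"
proof -
 have "((%x. 0) has_derivative (%h. 0)) (at x)" by simp
 then have "(f has_derivative (%h. 0)) (at x)"
  by (rule has_derivative_transform_within_open[where s="- closure {x. f x ~= 0}"])
   (use assms closure_subset[of "{x. f x ~= 0}"] in auto)
 then show ?thesis by (simp add: pd_eq)
qed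

lemma pd_support: "{x. pd i f x ~= 0} \<subseteq> closure {x. f x ~= 0}"
 using pd_outside_support by blast

lemma smooth_cs_pd: "smooth_cs Th ==> smooth_cs (pd i Th)"
 unfolding smooth_cs_def using bounded_subset[OF bounded_closure pd_support] C_inf_pd by blast

lemma smooth_cs_affine:
 assumes "smooth_cs Th" "c ~= 0"
 shows "smooth_cs (%x. Th (a + c *\<^sub>R x))"
proof -
 obtain R where R: "R > 0" "!!x. Th x ~= 0 ==> norm x <= R" using assms(1) smooth_cs_support by blast
 have "norm x <= (R + norm a) / \<bar>c\<bar>" if "Th (a + c *\<^sub>R x) ~= 0" for x
 proof -
  have "norm (c *\<^sub>R x) <= norm (a + c *\<^sub>R x) + norm a" using norm_triangle_sub[of "c *\<^sub>R x" "a + c *\<^sub>R x"] by simp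
  also have "... <= R + norm a" using R(2)[OF that] by simp
  finally show ?thesis using assms(2) by (simp add: field_simps)
 qed
 then have "bounded {x. Th (a + c *\<^sub>R x) ~= 0}" by (auto simp: bounded_iff)
 then show ?thesis using assms(1) by (simp add: smooth_cs_def C_inf_affine)
qed

lemma smooth_cs_bounded:
 assumes "smooth_cs Th" obtains M where "M >= 0" "!!x. \<bar>Th x\<bar> <= M"
proof -
 obtain R where R: "!!x. Th x ~= 0 ==> norm x <= R" using assms smooth_cs_support by blast
 have "compact (Th ` cball 0 R)"
  by (rule compact_continuous_image[OF C_inf_continuous compact_cball]) (use assms in "simp add: smooth_cs_def")
 then obtain M where "ALL y:Th ` cball 0 R. norm y <= M" using compact_imp_bounded bounded_iff by metis
 then have "\<bar>Th x\<bar> <= max M 0" for x using R[of x] by (cases "Th x = 0") (auto simp: le_max_iff_disj)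
 then show ?thesis using that[of "max M 0"] by simp
qed

lemma integrable_indicator_cball: "integrable lborel (indicator (cball a R) :: 'a::euclidean_space => real)"
 by (rule integrable_real_indicator) (use emeasure_compact_finite[OF compact_cball, of a R] in auto)

lemma integrable_bounded_support:
 fixes f :: "'a::euclidean_space => real"
 assumes "f \<in> borel_measurable borel" "!!x. \<bar>f x\<bar> <= M" "!!x. f x ~= 0 ==> norm x <= R"
 shows "integrable lborel f"
proof (rule Bochner_Integration.integrable_bound)
 show "integrable lborel (%x. M * indicator (cball (0::'a) R) x)"
  by (intro integrable_mult_right integrable_indicator_cball)
 show "AE x in lborel. norm (f x) <= norm (M * indicator (cball (0::'a) R) x)"
  using assms(2,3) by (intro AE_I2) (auto simp: indicator_def abs_of_nonneg[OF order_trans[OF abs_ge_zero]] order_trans[OF _ abs_ge_self])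
qed (use assms in simp)

lemma smooth_cs_measurable [measurable_dest]: "smooth_cs Th ==> Th \<in> borel_measurable borel"
 by (simp add: smooth_cs_def C_inf_borel)

lemma smooth_cs_integrable: "smooth_cs Th ==> integrable lborel Th"
 by (metis integrable_bounded_support smooth_cs_bounded smooth_cs_measurable smooth_cs_support)

lemma smooth_cs_sqint: "smooth_cs Th ==> square_integrable lborel Th"
 using smooth_cs_integrable[OF smooth_cs_mult[of Th Th]]
 by (simp add: square_integrable_def smooth_cs_measurable power2_eq_square smooth_csD)

lemma integrable_mult_smooth_cs:
 assumes "integrable lborel u" "smooth_cs Th"
 shows "integrable lborel (%z. u z * Th z)"
proof -
 obtain M where M: "!!x. \<bar>Th x\<bar> <= M" using smooth_cs_bounded[OF assms(2)] by metis
 have "integrable lborel (%z. Th z * u z)"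
  by (rule Bochner_Integration.integrable_bound[of _ "%z. M * u z"])
   (use assms M abs_ge_zero[THEN order_trans, OF M] in "auto simp: abs_mult smooth_cs_measurable intro!: mult_right_mono order_trans[OF M abs_ge_self]")
 then show ?thesis by (simp add: mult.commute)
qed

section \<open>Lipschitz and Taylor bounds for smooth functions\<close>

lemma Lipschitz_convex:
 fixes f :: "real ^ 'n::finite => real"
 assumes f: "!!x. f differentiable (at x)" and S: "convex S" "x \<in> S" "y \<in> S" and M: "!!i z. z \<in> S ==> \<bar>pd i f z\<bar> <= M i"
 shows "\<bar>f x - f y\<bar> <= (\<Sum>i\<in>UNIV. M i) * norm (x - y)"
proof -
 let ?L = "\<Sum>i\<in>UNIV. M i"
 have "norm (f x - f y) <= ?L * norm (x - y)"
 proof (rule differentiable_bound[OF S(1)])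
  show "(f has_derivative (%h. grad f z \<bullet> h)) (at z within S)" for z
   using differentiable_has_grad[OF f] has_derivative_at_withinI by blast
  show "onorm (%h. grad f z \<bullet> h) <= ?L" if z: "z \<in> S" for z
  proof (rule onorm_le)
   fix h :: "real ^ 'n"
   have "norm (grad f z) <= (\<Sum>i\<in>UNIV. \<bar>pd i f z\<bar>)" using norm_le_l1_cart[of "grad f z"] by simp
   also have "... <= ?L" by (rule sum_mono) (rule M[OF z])
   finally have "norm (grad f z) * norm h <= ?L * norm h" by (rule mult_right_mono) simp
   then show "norm (grad f z \<bullet> h) <= ?L * norm h" using Cauchy_Schwarz_ineq2[of "grad f z" h] by simp
  qed
 qed (use S in auto)
 then show ?thesis by simp
qed

lemma smooth_cs_Lipschitz:
 assumes "smooth_cs Th" obtains L where "L >= 0" "!!x y. \<bar>Th x - Th y\<bar> <= L * norm (x - y)"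
proof -
 have "EX M. M >= 0 & (ALL x. \<bar>pd i Th x\<bar> <= M)" for i using smooth_cs_bounded[OF smooth_cs_pd[OF assms]] by metis
 then obtain M where M: "!!i. M i >= 0" "!!i x. \<bar>pd i Th x\<bar> <= M i" by metis
 show ?thesis
  using Lipschitz_convex[OF C_inf_differentiable[OF smooth_csD[OF assms]] convex_UNIV UNIV_I UNIV_I M(2)] that[of "\<Sum>i\<in>UNIV. M i"] M(1)
  by (simp add: sum_nonneg)
qed

lemma C1_grad_continuous:
 fixes f :: "real ^ 'n::finite => real"
 assumes "C_k 1 f"
 shows "continuous_on UNIV (grad f)"
proof -
 have "continuous_on UNIV (pd i f)" for i using assms C_k_Suc[of 0 f] by (auto simp: C_k_0)
 moreover have "grad f = (%x. \<chi> i::'n. pd i f x)" by (simp add: fun_eq_iff vec_eq_iff)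
 ultimately show ?thesis by (simp only:) (intro continuous_on_vec_lambda)
qed

lemma C1_Lipschitz_on_ball:
 fixes f :: "real ^ 'n::finite => real"
 assumes "C_k 1 f"
 shows "EX L>=0. ALL x:cball a Q. ALL y:cball a Q. \<bar>f x - f y\<bar> <= L * norm (x - y)"
proof -
 have f: "!!x. f differentiable (at x)" "!!i. continuous_on UNIV (pd i f)"
  using assms C_k_Suc[of 0 f] by (auto simp: C_k_0)
 have "EX M>=0. ALL x:cball a Q. \<bar>pd i f x\<bar> <= M" for i
 proof -
  have "compact (pd i f ` cball a Q)" by (rule compact_continuous_image[OF continuous_on_subset[OF f(2)] compact_cball]) simp
  then obtain M where "M > 0" "ALL y:pd i f ` cball a Q. norm y <= M" using compact_imp_bounded bounded_pos by metis
  then show ?thesis by (intro exI[of _ M]) auto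
 qed
 then obtain M where M: "!!i. M i >= 0" "!!i x. x \<in> cball a Q ==> \<bar>pd i f x\<bar> <= M i" by metis
 show ?thesis
  using Lipschitz_convex[OF f(1) convex_cball _ _ M(2)] M(1) by (intro exI[of _ "\<Sum>i\<in>UNIV. M i"]) (auto simp: sum_nonneg)
qed

lemma smooth_cs_linearization:
 assumes "smooth_cs Th"
 obtains L where "L >= 0" "!!x h. \<bar>Th (x + h) - Th x - grad Th x \<bullet> h\<bar> <= L * (norm h)\<^sup>2"
proof -
 have "EX M. M >= 0 & (ALL x y. \<bar>pd i Th x - pd i Th y\<bar> <= M * norm (x - y))" for i
  using smooth_cs_Lipschitz[OF smooth_cs_pd[OF assms]] by metis
 then obtain M where M: "!!i. M i >= 0" "!!i x y. \<bar>pd i Th x - pd i Th y\<bar> <= M i * norm (x - y)" by metis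
 let ?L = "\<Sum>i\<in>UNIV. M i"
 have L0: "?L >= 0" using M(1) by (simp add: sum_nonneg)
 have "norm (Th (x + h) - Th x - grad Th x \<bullet> (x + h - x)) <= norm (x + h - x) * (?L * norm h)" for x h
 proof (rule differentiable_bound_linearization[where S="cball x (norm h)" and f' = "%x h. grad Th x \<bullet> h" and ?x0.0 = x])
  show "x + t *\<^sub>R (x + h - x) \<in> cball x (norm h)" if "t \<in> {0..1}" for t
   using that by (auto simp: dist_norm abs_mult intro: mult_left_le_one_le)
  show "(Th has_derivative (%h. grad Th y \<bullet> h)) (at y within cball x (norm h))" for y
   using C_inf_has_grad[OF smooth_csD[OF assms]] has_derivative_at_withinI by blast
  show "onorm ((%h. grad Th y \<bullet> h) - (%h. grad Th x \<bullet> h)) <= ?L * norm h" if y: "y \<in> cball x (norm h)" for y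
  proof (rule onorm_le)
   fix v :: "real ^ 'a"
   have "norm (grad Th y - grad Th x) <= (\<Sum>i\<in>UNIV. \<bar>pd i Th y - pd i Th x\<bar>)"
    using norm_le_l1_cart[of "grad Th y - grad Th x"] by simp
   also have "... <= (\<Sum>i\<in>UNIV. M i * norm (y - x))" by (rule sum_mono) (rule M)
   also have "... = ?L * norm (y - x)" by (simp add: sum_distrib_right)
   also have "... <= ?L * norm h" using y L0 by (intro mult_left_mono) (auto simp: dist_norm norm_minus_commute)
   finally have "norm (grad Th y - grad Th x) * norm v <= ?L * norm h * norm v" by (rule mult_right_mono) simp
   then show "norm (((%h. grad Th y \<bullet> h) - (%h. grad Th x \<bullet> h)) v) <= ?L * norm h * norm v"
    using Cauchy_Schwarz_ineq2[of "grad Th y - grad Th x" v] by (simp add: inner_diff_left)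
  qed
 qed simp
 then show ?thesis using that[OF L0] by (simp add: power2_eq_square mult_ac)
qed

text \<open>The difference quotients of \<open>f\<close> in the direction \<open>w\<close> have vanishing integral by translation.\<close>

lemma integral_directional_derivative:
 fixes f a :: "real ^ 'n::finite => real"
 assumes f: "C_k 1 f" "!!x. f x ~= 0 ==> norm x <= R"
  and a [measurable]: "a \<in> borel_measurable borel" and inv: "!!x t. a (x + t *\<^sub>R w) = a x" and K: "!!x. norm x <= R + norm w ==> \<bar>a x\<bar> <= K"
 shows "(LBINT x. a x * (grad f x \<bullet> w)) = 0" and "integrable lborel (%x. a x * (grad f x \<bullet> w))"
proof -
 let ?Q = "R + norm w"
 have df: "f differentiable (at x)" for x using f(1) C_k_Suc[of 0 f] by auto
 have [measurable]: "f \<in> borel_measurable borel" "grad f \<in> borel_measurable borel"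
  using borel_measurable_continuous_onI C_k_continuous[OF f(1)] C1_grad_continuous[OF f(1)] by blast+
 obtain L where L: "L >= 0" "!!x y. x \<in> cball 0 ?Q ==> y \<in> cball 0 ?Q ==> \<bar>f x - f y\<bar> <= L * norm (x - y)"
  using C1_Lipschitz_on_ball[OF f(1), of 0 ?Q] by blast
 \<comment> \<open>Steps of length at most 1 keep both points of a difference quotient within radius
   \<open>R + norm w\<close>, where \<open>a\<close> is bounded and \<open>f\<close> is
   Lipschitz.\<close>
 define h where "h k = 1 / real (Suc k)" for k
 have h: "h k > 0" "h k <= 1" for k by (auto simp: h_def)
 have h0: "filterlim h (at 0) sequentially"
  unfolding filterlim_at h_def[abs_def] using LIMSEQ_inverse_real_of_nat by (auto simp: inverse_eq_divide)
 define D where "D k x = (f (x + h k *\<^sub>R w) - f x) / h k" for k x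
 have D: "\<bar>a x * D k x\<bar> <= (\<bar>K\<bar> * (L * norm w)) * indicator (cball (0 :: real ^ 'n) ?Q) x" for k x
 proof (cases "f (x + h k *\<^sub>R w) = 0 & f x = 0")
  case False
  have hw: "h k * norm w <= norm w" using h[of k] by (simp add: mult_left_le_one_le)
  have "norm x <= norm (x + h k *\<^sub>R w) + h k * norm w" "norm (x + h k *\<^sub>R w) <= norm x + h k * norm w"
   using norm_triangle_ineq4[of "x + h k *\<^sub>R w" "h k *\<^sub>R w"] norm_triangle_ineq[of x "h k *\<^sub>R w"] h(1)[of k] by simp_all
  then have n: "norm x <= ?Q" "norm (x + h k *\<^sub>R w) <= ?Q" using False f(2)[of x] f(2)[of "x + h k *\<^sub>R w"] hw norm_ge_zero[of w] by linarith+
  then have "\<bar>f (x + h k *\<^sub>R w) - f x\<bar> <= L * (h k * norm w)" using L(2)[of "x + h k *\<^sub>R w" x] h(1)[of k] by simp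
  then have "\<bar>D k x\<bar> <= L * norm w" using h(1)[of k] by (simp add: D_def abs_divide pos_divide_le_eq mult_ac)
  moreover have "\<bar>a x\<bar> <= \<bar>K\<bar>" using K[OF n(1)] by simp
  ultimately show ?thesis using n(1) unfolding abs_mult by (simp add: mult_mono)
 qed (use L(1) in "simp add: D_def")
 have lim: "(%k. a x * D k x) ----> a x * (grad f x \<bullet> w)" for x
 proof -
  have "((%t. f (x + t *\<^sub>R w)) has_derivative (%t. grad f (x + 0 *\<^sub>R w) \<bullet> (t *\<^sub>R w))) (at 0)"
   by (rule has_derivative_compose[of "%t. x + t *\<^sub>R w" "%t. t *\<^sub>R w" 0 UNIV f "%h. grad f (x + 0 *\<^sub>R w) \<bullet> h"])
    (auto intro!: derivative_eq_intros differentiable_has_grad df)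
  then have "((%t. f (x + t *\<^sub>R w)) has_real_derivative grad f x \<bullet> w) (at 0)" by (simp add: has_field_derivative_def mult_commute_abs)
  then have "((%t. (f (x + t *\<^sub>R w) - f x) / t) \<longlongrightarrow> grad f x \<bullet> w) (at 0)" by (simp add: DERIV_def)
  from filterlim_compose[OF this h0] show ?thesis unfolding D_def by (intro tendsto_mult tendsto_const)
 qed
 have dom: "integrable lborel (%x. (\<bar>K\<bar> * (L * norm w)) * indicator (cball (0 :: real ^ 'n) ?Q) x)"
  by (intro integrable_mult_right integrable_indicator_cball)
 have m: "(%x. a x * D k x) \<in> borel_measurable lborel" "(%x. a x * (grad f x \<bullet> w)) \<in> borel_measurable lborel" for k
  unfolding D_def by measurable
 have D': "AE x in lborel. norm (a x * D k x) <= (\<bar>K\<bar> * (L * norm w)) * indicator (cball (0 :: real ^ 'n) ?Q) x" for k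
  using D by (intro AE_I2) simp
 show "integrable lborel (%x. a x * (grad f x \<bullet> w))"
  by (rule integrable_dominated_convergence[OF m(2,1) dom AE_I2[OF lim] D'])
 have "(%k. \<integral>x. a x * D k x \<partial>lborel) ----> (LBINT x. a x * (grad f x \<bullet> w))"
  by (rule integral_dominated_convergence[OF m(2,1) dom AE_I2[OF lim] D'])
 moreover have "(LBINT x. a x * D k x) = 0" for k
 proof -
  have "compact (f ` cball 0 R)" by (rule compact_continuous_image[OF continuous_on_subset[OF C_k_continuous[OF f(1)]] compact_cball]) simp
  then obtain M where M: "M > 0" "ALL y:f ` cball 0 R. norm y <= M" using compact_imp_bounded bounded_pos by metis
  have "\<bar>a x * f x\<bar> <= \<bar>K\<bar> * M" for x
  proof (cases "f x = 0")
   case False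
   then have "norm x <= R" by (rule f(2))
   then show ?thesis using M K[of x] norm_ge_zero[of w] unfolding abs_mult by (intro mult_mono) force+
  qed (use M in simp)
  then have i: "integrable lborel (%x. a x * f x)" by (rule integrable_bounded_support[rotated]) (use f(2) in auto)
  \<comment> \<open>As \<open>a\<close> is constant along \<open>w\<close>, its product with the
    quotient of \<open>f\<close> is the quotient of the product, whose integral vanishes by
    translation invariance. So \<open>a\<close> is never differentiated.\<close>
  have "a x * D k x = (a (x + h k *\<^sub>R w) * f (x + h k *\<^sub>R w) - a x * f x) / h k" for x
   using inv by (simp add: D_def right_diff_distrib)
  then show ?thesis using integrable_lborel_translate[OF i, of "h k *\<^sub>R w"] i integral_lborel_translate[of "%x. a x * f x" "h k *\<^sub>R w"] by simp
 qed
 ultimately show "(LBINT x. a x * (grad f x \<bullet> w)) = 0" by (simp add: LIMSEQ_const_iff)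
qed

lemma integral_pd_smooth_cs:
 assumes "smooth_cs Th"
 shows "(LBINT x. pd i Th x) = 0"
proof -
 obtain R where R: "!!x. Th x ~= 0 ==> norm x <= R" using assms smooth_cs_support by blast
 have "C_k 1 Th" using smooth_csD[OF assms] by (simp add: C_inf_def)
 from integral_directional_derivative(1)[OF this R, of "%x. 1" "axis i 1" 1] show ?thesis by (simp add: inner_axis)
qed

subsection \<open>Mollification\<close>

text \<open>Correlation rather than convolution: the value at x is the integral of u(x + y) Th(y),
  so a kernel supported in a cone samples u in x plus the cone, inside the domain. The price is a
  minus sign in the derivatives.\<close>

definition mollify :: "(real ^ 'n::finite => real) => (real ^ 'n => real) => real ^ 'n => real" where
 "mollify Th u x = (LBINT z. u z * Th (z - x))"

lemma mollify_shift:
 assumes [measurable]: "u \<in> borel_measurable borel" and "smooth_cs Th"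
 shows "mollify Th u x = (LBINT y. u (x + y) * Th y)"
proof -
 have [measurable]: "Th \<in> borel_measurable borel" by (rule smooth_cs_measurable) fact
 show ?thesis
  unfolding mollify_def using integral_lborel_translate[of "%z. u z * Th (z - x)" x] by (simp add: add.commute)
qed

lemma mollify_integrable:
 assumes "integrable lborel u" "smooth_cs Th"
 shows "integrable lborel (%z. u z * Th (z - x))"
 using integrable_mult_smooth_cs[OF assms(1) smooth_cs_affine[OF assms(2), of 1 "-x"]] by simp

text \<open>The quadratic Taylor remainder of the kernel is uniform in the base point, so the error
  is at most the L^1 norm of u times L |h|^2.\<close>

lemma mollify_has_derivative:
 assumes u: "integrable lborel u" and Th: "smooth_cs Th"
 shows "(mollify Th u has_derivative (%h. \<Sum>i\<in>UNIV. h $ i * mollify (%y. - pd i Th y) u x)) (at x)"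
 unfolding has_derivative_at_alt
proof (intro conjI allI impI)
 let ?g = "%i. mollify (%y. - pd i Th y) u x"
 show "bounded_linear (%h. \<Sum>i\<in>UNIV. h $ i * ?g i)"
  by (intro bounded_linear_sum bounded_linear_mult_const bounded_linear_vec_nth)
 fix e :: real assume e: "e > 0"
 obtain L where L: "L >= 0" "!!x h. \<bar>Th (x + h) - Th x - grad Th x \<bullet> h\<bar> <= L * (norm h)\<^sup>2"
  using smooth_cs_linearization[OF Th] by metis
 let ?U = "\<integral>z. \<bar>u z\<bar> \<partial>lborel"
 have U: "?U >= 0" by simp
 have dcs: "smooth_cs (%y. - pd i Th y)" for i
  using smooth_cs_mult[OF C_inf_const[of "-1"] smooth_cs_pd[OF Th, of i]] by simp
 have key: "norm (mollify Th u y - mollify Th u x - (\<Sum>i\<in>UNIV. (y - x) $ i * ?g i)) <= ?U * (L * (norm (y - x))\<^sup>2)" for y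
 proof -
  let ?h = "x - y"
  have "(\<Sum>i\<in>UNIV. (y - x) $ i * ?g i) = (\<Sum>i\<in>UNIV. \<integral>z. ?h $ i * (u z * pd i Th (z - x)) \<partial>lborel)"
   unfolding mollify_def integral_mult_right_zero by (rule sum.cong) (simp_all add: left_diff_distrib)
  also have "... = (LBINT z. (\<Sum>i\<in>UNIV. ?h $ i * (u z * pd i Th (z - x))))"
   by (rule Bochner_Integration.integral_sum[symmetric], intro integrable_mult_right mollify_integrable u smooth_cs_pd Th)
  finally have g: "(\<Sum>i\<in>UNIV. (y - x) $ i * ?g i) = (LBINT z. u z * (grad Th (z - x) \<bullet> ?h))"
   by (simp add: inner_vec_def sum_distrib_left mult_ac)
  have ig: "integrable lborel (%z. u z * (grad Th (z - x) \<bullet> ?h))"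
  proof -
   have "integrable lborel (%z. \<Sum>i\<in>UNIV. ?h $ i * (u z * pd i Th (z - x)))"
    by (intro Bochner_Integration.integrable_sum integrable_mult_right mollify_integrable u smooth_cs_pd Th)
   then show ?thesis by (simp add: inner_vec_def sum_distrib_left mult_ac)
  qed
  have eqn: "(%z. u z * (Th (z - x + ?h) - Th (z - x) - grad Th (z - x) \<bullet> ?h)) =
    (%z. u z * Th (z - y) - u z * Th (z - x) - u z * (grad Th (z - x) \<bullet> ?h))"
   by (simp add: right_diff_distrib)
  have iD: "integrable lborel (%z. u z * (Th (z - x + ?h) - Th (z - x) - grad Th (z - x) \<bullet> ?h))"
   unfolding eqn by (intro Bochner_Integration.integrable_diff mollify_integrable u Th ig)
  have E1: "mollify Th u y - mollify Th u x - (\<Sum>i\<in>UNIV. (y - x) $ i * ?g i) =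
    (LBINT z. u z * (Th (z - x + ?h) - Th (z - x) - grad Th (z - x) \<bullet> ?h))"
   unfolding g eqn unfolding mollify_def
   by (simp only: Bochner_Integration.integral_diff Bochner_Integration.integrable_diff mollify_integrable[OF u Th] ig)
  have "norm (LBINT z. u z * (Th (z - x + ?h) - Th (z - x) - grad Th (z - x) \<bullet> ?h)) <= (LBINT z. \<bar>u z * (Th (z - x + ?h) - Th (z - x) - grad Th (z - x) \<bullet> ?h)\<bar>)"
   unfolding real_norm_def by (rule integral_abs_bound)
  also have "... <= (LBINT z. \<bar>u z\<bar> * (L * (norm ?h)\<^sup>2))"
  proof (rule Bochner_Integration.integral_mono)
   show "integrable lborel (%z. \<bar>u z * (Th (z - x + ?h) - Th (z - x) - grad Th (z - x) \<bullet> ?h)\<bar>)"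
    using iD by (rule integrable_abs)
   show "integrable lborel (%z. \<bar>u z\<bar> * (L * (norm ?h)\<^sup>2))" using u by simp
   show "\<bar>u z * (Th (z - x + ?h) - Th (z - x) - grad Th (z - x) \<bullet> ?h)\<bar> <= \<bar>u z\<bar> * (L * (norm ?h)\<^sup>2)" for z
    unfolding abs_mult by (rule mult_left_mono[OF L(2) abs_ge_zero])
  qed
  also have "... = ?U * (L * (norm (y - x))\<^sup>2)" by (simp add: norm_minus_commute)
  finally show ?thesis unfolding E1 .
 qed
 show "EX d>0. ALL y. norm (y - x) < d --> norm (mollify Th u y - mollify Th u x - (\<Sum>i\<in>UNIV. (y - x) $ i * ?g i)) <= e * norm (y - x)"
 proof (intro exI[of _ "e / (?U * L + 1)"] conjI allI impI)
  have UL: "0 <= ?U * L" using U L by simp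
  show "0 < e / (?U * L + 1)" using e UL by simp
  fix y assume y: "norm (y - x) < e / (?U * L + 1)"
  have "?U * L * norm (y - x) <= ?U * L * (e / (?U * L + 1))" using y UL by (intro mult_left_mono) auto
  also have "... <= e" using e UL by (simp add: field_simps)
  finally have "?U * L * norm (y - x) * norm (y - x) <= e * norm (y - x)" by (rule mult_right_mono) simp
  then show "norm (mollify Th u y - mollify Th u x - (\<Sum>i\<in>UNIV. (y - x) $ i * ?g i)) <= e * norm (y - x)"
   using key[of y] by (simp add: power2_eq_square mult_ac)
 qed
qed

lemma pd_mollify:
 assumes "integrable lborel u" "smooth_cs Th"
 shows "pd i (mollify Th u) = mollify (%y. - pd i Th y) u"
proof
 fix x
 have "pd i (mollify Th u) x = (\<Sum>j\<in>UNIV. axis i 1 $ j * mollify (%y. - pd j Th y) u x)"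
  by (rule pd_eq[OF mollify_has_derivative[OF assms]])
 also have "... = mollify (%y. - pd i Th y) u x" by (simp add: axis_def if_distrib[of "%c. c * _"] cong: if_cong)
 finally show "pd i (mollify Th u) x = mollify (%y. - pd i Th y) u x" .
qed

lemma C_inf_mollify:
 assumes u: "integrable lborel u" and Th: "smooth_cs Th"
 shows "C_inf (mollify Th u)"
proof (rule C_inf_coinduct[of _ "{mollify Th u | Th. smooth_cs Th}"])
 fix f :: "real ^ 'a => real" and x assume "f \<in> {mollify Th u | Th. smooth_cs Th}"
 then show "f differentiable (at x)" using mollify_has_derivative[OF u] differentiable_def by blast
next
 fix f :: "real ^ 'a => real" and i assume "f \<in> {mollify Th u | Th. smooth_cs Th}"
 then obtain Th where f: "f = mollify Th u" and Th: "smooth_cs Th" by blast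
 have "smooth_cs (%y. - pd i Th y)"
  using smooth_cs_mult[OF C_inf_const[of "-1"] smooth_cs_pd[OF Th, of i]] by simp
 then show "pd i f \<in> {mollify Th u | Th. smooth_cs Th}" using pd_mollify[OF u Th] f by blast
qed (use Th in blast)

lemma smooth_cs_bump_exists:
 fixes a :: "real ^ 'n::finite"
 assumes "r > 0"
 obtains b where "smooth_cs b" "!!x. 0 <= b x" "!!x. b x < 1" "!!x. b x > 0 \<longleftrightarrow> x \<in> ball a r"
proof -
 obtain b where b: "C_inf b" "!!x. 0 <= b x" "!!x. b x < 1" "!!x. b x > 0 \<longleftrightarrow> x \<in> ball a r"
  using bump_exists[OF assms] by metis
 have "{x. b x ~= 0} = ball a r" using b(2,4) by (metis (mono_tags, lifting) Collect_cong less_le mem_Collect_eq set_eqI)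
 then have "smooth_cs b" using b(1) by (simp add: smooth_cs_def)
 then show ?thesis using that b by blast
qed

lemma integral_lborel_scale:
 fixes f :: "'a::euclidean_space => real"
 assumes [measurable]: "f \<in> borel_measurable borel" and r: "r > 0"
 shows "(LBINT y. f (y /\<^sub>R r)) = r ^ DIM('a) * (LBINT y. f y)"
proof -
 have "(LBINT y. f (y /\<^sub>R r)) = (\<integral>y. f (y /\<^sub>R r) \<partial>density (distr lborel borel (%x. 0 + r *\<^sub>R x)) (%_. ennreal (\<bar>r\<bar> ^ DIM('a))))"
  using lborel_affine[of r "0::'a"] r by (simp add: ennreal_power)
 also have "... = (\<integral>y. \<bar>r\<bar> ^ DIM('a) *\<^sub>R f (y /\<^sub>R r) \<partial>distr lborel borel (%x. 0 + r *\<^sub>R x))"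
  by (rule integral_density) auto
 also have "... = (LBINT x. \<bar>r\<bar> ^ DIM('a) *\<^sub>R f ((0 + r *\<^sub>R x) /\<^sub>R r))"
  by (rule integral_distr) auto
 also have "... = r ^ DIM('a) * (LBINT y. f y)" using r by simp
 finally show ?thesis .
qed

lemma integral_smooth_cs_pos:
 assumes b: "smooth_cs b" "!!x. 0 <= b x" "!!x. b x > 0 \<longleftrightarrow> x \<in> ball a r" "r > 0"
 shows "(LBINT x. b x) > 0"
proof -
 have "(LBINT x. b x) ~= 0"
 proof
  assume "(LBINT x. b x) = 0"
  then have "AE x in lborel. b x = 0"
   using integral_nonneg_eq_0_iff_AE[OF smooth_cs_integrable[OF b(1)]] b(2) by simp
  then have "AE x in lborel. x \<notin> ball a r" by eventually_elim (use b(3) in force)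
  then have "ball a r \<in> null_sets lborel" by (simp add: AE_iff_null_sets)
  then have "negligible (ball a r)" by (simp add: negligible_iff_null_sets null_sets_completionI)
  then show False using open_not_negligible[of "ball a r"] b(4) by simp
 qed
 moreover have "(LBINT x. b x) >= 0" using b(2) by simp
 ultimately show ?thesis by simp
qed

text \<open>A bump on the ball of radius \<open>s\<close> about \<open>e\<close>, rescaled by
  factors that tend to 0. The L^1 norm of |y| times a derivative of the kernel is invariant under
  this scaling, whence a bound \<open>C\<close> that does not depend on k. The support is controlled
  up to its closure because test functions need the closure inside the domain.\<close>

lemma cone_mollifier_exists:
 fixes e :: "real ^ 'n::finite"
 assumes s: "s > 0" and Ta: "Ta > 0"
 obtains Th r C where "!!k::nat. smooth_cs (Th k)" "!!k y. 0 <= Th k y" "!!k. (LBINT y. Th k y) = 1"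
  "!!k y. Th k y ~= 0 ==> EX t z. 0 < t & t < Ta & norm (z - e) < s & y = t *\<^sub>R z"
  "!!k y. y \<in> closure {y. Th k y ~= 0} ==> EX t z. 0 < t & t < Ta & norm (z - e) <= s & y = t *\<^sub>R z & norm y <= r k"
  "r ----> 0" "!!k i. (LBINT y. norm y * \<bar>pd i (Th k) y\<bar>) <= C"
proof -
 obtain b where b: "smooth_cs b" "!!x. 0 <= b x" "!!x. b x > 0 \<longleftrightarrow> x \<in> ball e s"
  using smooth_cs_bump_exists[OF s, of e] by metis
 have b0: "b x ~= 0 \<longleftrightarrow> x \<in> ball e s" for x using b(2)[of x] b(3)[of x] by auto
 define c where "c = (LBINT x. b x)"
 have c: "c > 0" unfolding c_def using integral_smooth_cs_pos[OF b(1,2,3) s] .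
 \<comment> \<open>The denominator \<open>real k + 2\<close> makes \<open>t k < Ta\<close> strict
   even for k = 0.\<close>
 define t where "t k = Ta / (real k + 2)" for k
 have t: "t k > 0" "t k < Ta" for k
 proof -
  show "t k > 0" using Ta by (simp add: t_def)
  have "Ta * real k >= 0" using Ta by simp
  then have "Ta < Ta * (real k + 2)" using Ta by (simp only: distrib_left)
  then show "t k < Ta" by (simp add: t_def pos_divide_less_eq)
 qed
 define Th where "Th k y = (1 / (c * t k ^ CARD('n))) * b (0 + inverse (t k) *\<^sub>R y)" for k y
 have cs: "smooth_cs (Th k)" for k
  unfolding Th_def using t(1)[of k] by (intro smooth_cs_mult C_inf_const smooth_cs_affine b) simp
 have [measurable]: "b \<in> borel_measurable borel" by (rule smooth_cs_measurable) fact
 have nz: "Th k y ~= 0 \<longleftrightarrow> inverse (t k) *\<^sub>R y \<in> ball e s" for k y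
  using c t(1)[of k] b0 by (auto simp: Th_def)
 have int: "(LBINT y. Th k y) = 1" for k
  unfolding Th_def using integral_lborel_scale[of b "t k"] t(1)[of k] c by (simp add: c_def[symmetric])
 have sup: "y = t k *\<^sub>R (inverse (t k) *\<^sub>R y)" for k and y :: "real ^ 'n" using t(1)[of k] by simp
 have cl: "norm (inverse (t k) *\<^sub>R y - e) <= s" if "y \<in> closure {y. Th k y ~= 0}" for k y
 proof -
  have "closure {y. Th k y ~= 0} \<subseteq> {y. norm (inverse (t k) *\<^sub>R y - e) <= s}"
  proof (rule closure_minimal)
   show "{y. Th k y ~= 0} \<subseteq> {y. norm (inverse (t k) *\<^sub>R y - e) <= s}"
    unfolding nz by (auto simp: dist_norm norm_minus_commute)
   show "closed {y. norm (inverse (t k) *\<^sub>R y - e) <= s}"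
    by (intro closed_Collect_le continuous_intros)
  qed
  then show ?thesis using that by blast
 qed
 define C where "C = (\<Sum>i\<in>UNIV. \<integral>z. norm z * \<bar>pd i b z\<bar> \<partial>lborel) / c"
 have bdC: "(LBINT y. norm y * \<bar>pd i (Th k) y\<bar>) <= C" for k i
 proof -
  have P: "pd i (Th k) y = (1 / (c * t k ^ CARD('n))) * (inverse (t k) * pd i b (inverse (t k) *\<^sub>R y))" for y
  proof -
   have "((%y. b (0 + inverse (t k) *\<^sub>R y)) has_derivative (%v. grad b (0 + inverse (t k) *\<^sub>R y) \<bullet> (inverse (t k) *\<^sub>R v))) (at y)"
    by (rule pd_affine[OF C_inf_differentiable[OF smooth_csD[OF b(1)]]])
   from pd_eq[OF has_derivative_mult_right[OF this, of "1 / (c * t k ^ CARD('n))"], of i]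
   show ?thesis unfolding Th_def by (simp add: inner_axis)
  qed
  have "norm y * \<bar>pd i (Th k) y\<bar> = (1 / (c * t k ^ CARD('n))) * (norm (inverse (t k) *\<^sub>R y) * \<bar>pd i b (inverse (t k) *\<^sub>R y)\<bar>)" for y
   unfolding P abs_mult using c t(1)[of k] by simp
  then have "(LBINT y. norm y * \<bar>pd i (Th k) y\<bar>) =
    (LBINT y. (1 / (c * t k ^ CARD('n))) * (norm (inverse (t k) *\<^sub>R y) * \<bar>pd i b (inverse (t k) *\<^sub>R y)\<bar>))"
   by (simp only:)
  also have "... = (1 / (c * t k ^ CARD('n))) * (LBINT y. (norm (inverse (t k) *\<^sub>R y) * \<bar>pd i b (inverse (t k) *\<^sub>R y)\<bar>))"
   by simp
  also have "(LBINT y. (norm (inverse (t k) *\<^sub>R y) * \<bar>pd i b (inverse (t k) *\<^sub>R y)\<bar>)) =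
    t k ^ CARD('n) * (LBINT z. norm z * \<bar>pd i b z\<bar>)"
   using integral_lborel_scale[of "%z. norm z * \<bar>pd i b z\<bar>" "t k"] t(1)[of k] smooth_cs_measurable[OF smooth_cs_pd[OF b(1)]] by simp
  also have "(1 / (c * t k ^ CARD('n))) * (t k ^ CARD('n) * (LBINT z. norm z * \<bar>pd i b z\<bar>)) = (LBINT z. norm z * \<bar>pd i b z\<bar>) / c"
   using t(1)[of k] by simp
  also have "... <= C" unfolding C_def using c by (intro divide_right_mono member_le_sum) auto
  finally show ?thesis .
 qed
 show ?thesis
 proof (rule that[of Th "%k. t k * (norm e + s)" C])
  show "smooth_cs (Th k)" for k by (rule cs)
  show "0 <= Th k y" for k y using c t(1)[of k] b(2) by (simp add: Th_def)
  show "(LBINT y. Th k y) = 1" for k by (rule int)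
  show "EX t' z. 0 < t' & t' < Ta & norm (z - e) < s & y = t' *\<^sub>R z" if "Th k y ~= 0" for k y
   using that sup[of y k] t[of k] unfolding nz by (metis dist_commute dist_norm mem_ball)
  show "EX t' z. 0 < t' & t' < Ta & norm (z - e) <= s & y = t' *\<^sub>R z & norm y <= t k * (norm e + s)"
   if "y \<in> closure {y. Th k y ~= 0}" for k y
  proof -
   let ?z = "inverse (t k) *\<^sub>R y"
   have z: "norm (?z - e) <= s" by (rule cl[OF that])
   have "norm ?z <= norm e + s" using z norm_triangle_sub[of ?z e] by simp
   then have "t k * norm ?z <= t k * (norm e + s)" using t(1)[of k] by (intro mult_left_mono) auto
   moreover have "t k * norm ?z = norm y" using t(1)[of k] by simp
   ultimately show ?thesis using z sup[of y k] t[of k] by metis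
  qed
  have "(%k. Ta * (1 / real (Suc (Suc k)))) ----> Ta * 0"
   using LIMSEQ_inverse_real_of_nat[THEN LIMSEQ_Suc] by (intro tendsto_intros) (simp add: inverse_eq_divide)
  then have "t ----> 0" by (simp add: t_def[abs_def] add.commute)
  then show "(%k. t k * (norm e + s)) ----> 0" using tendsto_mult_left_zero by blast
  show "(LBINT y. norm y * \<bar>pd i (Th k) y\<bar>) <= C" for k i by (rule bdC)
 qed
qed

section \<open>Measures and functions are determined by smooth test functions\<close>

lemma box_bump_exists:
 fixes a c :: "real ^ 'n::finite"
 obtains b where "smooth_cs b" "!!x. 0 <= b x" "!!x. b x <= 1" "!!x. b x > 0 \<longleftrightarrow> x \<in> box a c"
proof -
 let ?f = "%i (x::real^'n). exp_cusp 0 (x \<bullet> axis i 1 - a $ i) * exp_cusp 0 (c $ i - x \<bullet> axis i 1)"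
 let ?b = "%x::real^'n. \<Prod>i\<in>UNIV. ?f i x"
 have C: "C_inf ?b"
  by (intro C_inf_prod C_inf_mult C_inf_exp_cusp C_inf_diff C_inf_inner C_inf_const)
 have e: "0 <= exp_cusp 0 t" "exp_cusp 0 t <= 1" "exp_cusp 0 t > 0 \<longleftrightarrow> t > 0" for t
  by (auto simp: exp_cusp_def)
 have f: "0 <= ?f i x" "?f i x <= 1" for i x using e by (auto intro: mult_le_one)
 have 1: "0 <= ?b x" for x by (rule prod_nonneg) (use f in blast)
 have 2: "?b x <= 1" for x by (rule prod_le_1) (use f in blast)
 have nz: "?b x ~= 0 \<longleftrightarrow> x \<in> box a c" for x
  by (simp add: prod_zero_iff mem_box_cart exp_cusp_def inner_axis) auto
 have 3: "?b x > 0 \<longleftrightarrow> x \<in> box a c" for x using nz[of x] 1[of x] by linarith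
 have "bounded {x. ?b x ~= 0}" unfolding nz by (simp add: bounded_box)
 then have "smooth_cs ?b" using C unfolding smooth_cs_def by blast
 from that[OF this 1 2 3] show ?thesis .
qed

lemma finite_measure_eq_smooth:
 fixes \<mu> \<nu> :: "(real ^ 'n::finite) measure"
 assumes sets: "sets \<mu> = sets borel" "sets \<nu> = sets borel" and fin: "finite_measure \<mu>"
  and eq: "!!b. smooth_cs b ==> (!!x. 0 <= b x) ==> (!!x. b x <= 1) ==> (\<integral>\<^sup>+x. ennreal (b x) \<partial>\<mu>) = (\<integral>\<^sup>+x. ennreal (b x) \<partial>\<nu>)"
 shows "\<mu> = \<nu>"
proof -
 interpret finite_measure \<mu> by fact
 let ?E = "range (%(a, b). box a b :: (real ^ 'n) set)"
 let ?A = "%n::nat. box (- (real n *\<^sub>R One)) (real n *\<^sub>R One) :: (real ^ 'n) set"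
 have boxes: "emeasure \<mu> (box a c) = emeasure \<nu> (box a c)" for a c :: "real ^ 'n"
 proof -
  obtain b where b: "smooth_cs b" "!!x. 0 <= b x" "!!x. b x <= 1" "!!x. b x > 0 \<longleftrightarrow> x \<in> box a c"
   using box_bump_exists[of a c] by metis
  \<comment> \<open>These functions increase to the indicator of the set where b > 0, which is the
    open box.\<close>
  define Ph where "Ph k x = 1 - (1 - b x) ^ k" for k :: nat and x
  have Ph: "0 <= Ph k x" "Ph k x <= 1" for k x
   using b(2,3)[of x] by (auto simp: Ph_def power_le_one)
  have Phcs: "smooth_cs (Ph k)" for k
  proof -
   have "{x. Ph k x ~= 0} \<subseteq> {x. b x ~= 0}" by (auto simp: Ph_def)
   then show ?thesis using b(1) unfolding smooth_cs_def Ph_def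
    by (auto intro!: C_inf_diff C_inf_power intro: bounded_subset)
  qed
  have lim: "(%k. ennreal (Ph k x)) ----> indicator (box a c) x" for x
  proof (cases "x \<in> box a c")
   case True
   then have "0 < b x" using b(4) by blast
   then have "(%k. (1 - b x) ^ k) ----> 0" using b(3)[of x] by (intro LIMSEQ_realpow_zero) simp_all
   then have "(%k. Ph k x) ----> 1 - 0" unfolding Ph_def by (rule tendsto_diff[OF tendsto_const])
   from tendsto_ennrealI[OF this] show ?thesis using True by simp
  next
   case False
   then have "b x = 0" using b(2)[of x] b(4)[of x] by linarith
   then show ?thesis using False by (simp add: Ph_def)
  qed
  have inc: "incseq (%k x. ennreal (Ph k x))"
   unfolding incseq_def le_fun_def Ph_def using b(2,3) by (auto intro!: ennreal_leI power_decreasing)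
  have m: "(%x. ennreal (Ph k x)) \<in> borel_measurable borel" for k
   using smooth_cs_measurable[OF Phcs] by measurable
  have "(%k. \<integral>\<^sup>+x. ennreal (Ph k x) \<partial>M) ----> emeasure M (box a c)" if "sets M = sets borel" for M
  proof -
   have "(%k. \<integral>\<^sup>+x. ennreal (Ph k x) \<partial>M) ----> (\<integral>\<^sup>+x. indicator (box a c) x \<partial>M)"
    by (rule nn_integral_LIMSEQ[OF inc _ lim]) (use m in "simp add: measurable_cong_sets[OF that refl]")
   then show ?thesis using that by simp
  qed
  from this[OF sets(1)] this[OF sets(2)] show ?thesis
   using eq[OF Phcs Ph] by (simp add: LIMSEQ_unique)
 qed
 show ?thesis
 proof (rule measure_eqI_generator_eq)
  show "Int_stable ?E" by (auto simp: Int_stable_def box_Int_box)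
  show "?E \<subseteq> Pow UNIV" "sets \<mu> = sigma_sets UNIV ?E" "sets \<nu> = sigma_sets UNIV ?E"
   by (simp_all add: borel_eq_box sets)
  show "range ?A \<subseteq> ?E" "(\<Union>i. ?A i) = UNIV" unfolding UN_box_eq_UNIV by auto
  show "emeasure \<mu> (?A i) ~= \<infinity>" for i by simp
  show "emeasure \<mu> X = emeasure \<nu> X" if "X \<in> ?E" for X using that boxes by auto
 qed
qed

text \<open>Measures that may be infinite are compared through the finite measures with a bump on a
  small ball as density; the bump is positive exactly on the ball and can be divided out again.
  Lindelof's theorem turns the local statement into countably many disjoint pieces.\<close>

lemma measure_eq_smooth_local:
 fixes \<mu> \<nu> :: "(real ^ 'n::finite) measure"
 assumes sets: "sets \<mu> = sets borel" "sets \<nu> = sets borel" and G: "open G"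
  and eq: "!!b. smooth_cs b ==> (!!x. 0 <= b x) ==> (!!x. b x <= 1) ==> closure {x. b x ~= 0} \<subseteq> G ==>
   (\<integral>\<^sup>+x. ennreal (b x) \<partial>\<mu>) = (\<integral>\<^sup>+x. ennreal (b x) \<partial>\<nu>) & (\<integral>\<^sup>+x. ennreal (b x) \<partial>\<mu>) < \<infinity>"
  and A: "A \<in> sets borel" "A \<subseteq> G"
 shows "emeasure \<mu> A = emeasure \<nu> A"
proof -
 have loc: "emeasure \<mu> A' = emeasure \<nu> A'"
  if A' [measurable]: "A' \<in> sets borel" and sub: "A' \<subseteq> ball a r" and r: "r > 0" "cball a r \<subseteq> G" for A' and a :: "real ^ 'n" and r
 proof -
  obtain \<zeta> where z: "smooth_cs \<zeta>" "!!x. 0 <= \<zeta> x" "!!x. \<zeta> x < 1" "!!x. \<zeta> x > 0 \<longleftrightarrow> x \<in> ball a r"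
   using smooth_cs_bump_exists[OF r(1), of a] by metis
  have [measurable]: "\<zeta> \<in> borel_measurable borel" using z(1) by (rule smooth_cs_measurable)
  have nz: "\<zeta> x ~= 0 \<longleftrightarrow> x \<in> ball a r" for x using z(2)[of x] z(4)[of x] by linarith
  have zO: "closure {x. b x * \<zeta> x ~= 0} \<subseteq> G" for b
  proof -
   have "closure {x. b x * \<zeta> x ~= 0} \<subseteq> cball a r" by (rule closure_minimal) (auto simp: nz)
   then show ?thesis using r(2) by blast
  qed
  have mb: "f \<in> borel_measurable \<mu>" "f \<in> borel_measurable \<nu>" if "f \<in> borel_measurable borel" for f :: "real ^ 'n => ennreal"
   using that by (simp_all add: measurable_cong_sets[OF sets(1) refl] measurable_cong_sets[OF sets(2) refl])
  have dens: "density \<mu> (%x. ennreal (\<zeta> x)) = density \<nu> (%x. ennreal (\<zeta> x))"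
  proof (rule finite_measure_eq_smooth)
   show "sets (density \<mu> (%x. ennreal (\<zeta> x))) = sets borel" "sets (density \<nu> (%x. ennreal (\<zeta> x))) = sets borel"
    using sets by simp_all
   have "emeasure (density \<mu> (%x. ennreal (\<zeta> x))) (space \<mu>) = (\<integral>\<^sup>+x. ennreal (\<zeta> x) \<partial>\<mu>)"
    by (subst emeasure_density) (auto intro!: mb nn_integral_cong)
   also have "... < \<infinity>" using eq[OF z(1,2) less_imp_le[OF z(3)] zO[of "%x. 1", simplified]] by blast
   finally show "finite_measure (density \<mu> (%x. ennreal (\<zeta> x)))" by (intro finite_measureI) simp
   fix b :: "real ^ 'n => real" assume b: "smooth_cs b" "!!x. 0 <= b x" "!!x. b x <= 1"
   have [measurable]: "b \<in> borel_measurable borel" using b(1) by (rule smooth_cs_measurable)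
   have dd: "(\<integral>\<^sup>+x. ennreal (b x) \<partial>density M (%x. ennreal (\<zeta> x))) = (\<integral>\<^sup>+x. ennreal (b x * \<zeta> x) \<partial>M)"
    if "!!f :: real ^ 'n => ennreal. f \<in> borel_measurable borel ==> f \<in> borel_measurable M" for M
    by (subst nn_integral_density[OF that that]) (use b z in "auto intro!: nn_integral_cong simp: ennreal_mult mult.commute")
   have "(\<integral>\<^sup>+x. ennreal (b x * \<zeta> x) \<partial>\<mu>) = (\<integral>\<^sup>+x. ennreal (b x * \<zeta> x) \<partial>\<nu>)"
    using eq[of "%x. b x * \<zeta> x"] smooth_cs_mult[OF smooth_csD[OF b(1)] z(1)] b z zO by (simp add: mult_le_one less_imp_le)
   then show "(\<integral>\<^sup>+x. ennreal (b x) \<partial>density \<mu> (%x. ennreal (\<zeta> x))) = (\<integral>\<^sup>+x. ennreal (b x) \<partial>density \<nu> (%x. ennreal (\<zeta> x)))"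
    using dd[OF mb(1)] dd[OF mb(2)] by simp
  qed
  have "emeasure M A' = (\<integral>\<^sup>+x. indicator A' x * ennreal (1 / \<zeta> x) \<partial>density M (%x. ennreal (\<zeta> x)))"
   if M: "!!f :: real ^ 'n => ennreal. f \<in> borel_measurable borel ==> f \<in> borel_measurable M" "sets M = sets borel" for M
  proof -
   have "(\<integral>\<^sup>+x. indicator A' x * ennreal (1 / \<zeta> x) \<partial>density M (%x. ennreal (\<zeta> x))) =
     (\<integral>\<^sup>+x. ennreal (\<zeta> x) * (indicator A' x * ennreal (1 / \<zeta> x)) \<partial>M)"
    by (rule nn_integral_density) (auto intro!: M(1))
   also have "... = (\<integral>\<^sup>+x. indicator A' x \<partial>M)"
   proof (rule nn_integral_cong)
    fix x
    show "ennreal (\<zeta> x) * (indicator A' x * ennreal (1 / \<zeta> x)) = indicator A' x"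
     using sub z(4)[of x] by (cases "x \<in> A'") (auto simp: ennreal_mult[symmetric])
   qed
   also have "... = emeasure M A'" using M(2) A' by simp
   finally show ?thesis by simp
  qed
  from this[of \<mu>, OF mb(1) sets(1)] this[of \<nu>, OF mb(2) sets(2)] show ?thesis using dens by simp
 qed
 let ?F = "{ball a r | a r. r > 0 & cball a r \<subseteq> G}"
 obtain F' where F': "F' \<subseteq> ?F" "countable F'" "\<Union>F' = \<Union>?F"
 proof (rule Lindelof[of ?F])
  show "open S" if "S \<in> ?F" for S using that by auto
 qed
 have UF: "\<Union>?F = G"
 proof
  show "G \<subseteq> \<Union>?F"
  proof
   fix x assume "x \<in> G"
   then obtain r where "r > 0" "cball x r \<subseteq> G" using G open_contains_cball by blast
   then show "x \<in> \<Union>?F" by (intro UnionI[of "ball x r"]) auto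
  qed
 qed (use ball_subset_cball in blast)
 show ?thesis
 proof (cases "F' = {}")
  case True
  then show ?thesis using F' UF A by auto
 next
  case False
  define B where "B = from_nat_into F'"
  have B: "range B = F'" unfolding B_def using False F'(2) by (rule range_from_nat_into)
  have Bo: "open (B n)" for n
  proof -
   have "B n \<in> ?F" using B F'(1) by blast
   then show ?thesis by auto
  qed
  let ?D = "%n. A \<inter> disjointed B n"
  have "range B \<subseteq> sets borel" using borel_open[OF Bo] by blast
  then have "range (disjointed B) \<subseteq> sets borel" by (rule sets.range_disjointed_sets)
  then have D: "?D n \<in> sets borel" for n using sets.Int[OF A(1)] by blast
  have DA: "(\<Union>n. ?D n) = A" using A(2) UF F'(3) B by (auto simp: UN_disjointed_eq simp flip: Int_UN_distrib)
  have dis: "disjoint_family ?D" using disjoint_family_disjointed[of B] by (auto simp: disjoint_family_on_def)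
  have e: "emeasure \<mu> (?D n) = emeasure \<nu> (?D n)" for n
  proof -
   have "B n \<in> ?F" using B F'(1) by blast
   then obtain a r where ar: "B n = ball a r" "r > 0" "cball a r \<subseteq> G" by auto
   have "?D n \<subseteq> ball a r" using disjointed_subset[of B n] ar(1) by blast
   then show ?thesis using loc[OF D _ ar(2,3)] by blast
  qed
  have sm: "(\<Sum>n. emeasure M (?D n)) = emeasure M A" if "sets M = sets borel" for M
   using suminf_emeasure[of ?D M, OF _ dis] D unfolding DA that by blast
  have "emeasure \<mu> A = (\<Sum>n. emeasure \<mu> (?D n))" using sm[OF sets(1)] by simp
  also have "... = (\<Sum>n. emeasure \<nu> (?D n))" using e by simp
  also have "... = emeasure \<nu> A" by (rule sm[OF sets(2)])
  finally show ?thesis .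
 qed
qed

text \<open>The positive and the negative part of \<open>f\<close>, taken as densities, integrate
  test functions equally, hence agree on the Borel subsets of \<open>G\<close>, in particular on the
  set where f > 0. \<open>M\<close> is general because the lemma is applied to Lebesgue measure and
  to boundary measures.\<close>

lemma smooth_fundamental:
 fixes f :: "real ^ 'n::finite => real"
 assumes sets: "sets M = sets borel" and f: "f \<in> borel_measurable borel" and G: "open G"
  and eq: "!!b. smooth_cs b ==> closure {x. b x ~= 0} \<subseteq> G ==>
   integrable M (%x. f x * b x) & (LINT x|M. f x * b x) = 0"
 shows "AE x in M. x \<in> G --> f x = 0"
proof -
 note f [measurable]
 have mb: "h \<in> borel_measurable M" if "h \<in> borel_measurable borel" for h :: "real ^ 'n => ennreal"
  using that by (simp add: measurable_cong_sets[OF sets refl])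
 have mM: "{x \<in> G. f x > 0} \<in> sets M" "{x \<in> G. f x < 0} \<in> sets M" using G by (simp_all add: sets)
 let ?P = "density M (%x. ennreal (f x))" and ?N = "density M (%x. ennreal (- f x))"
 have *: "emeasure ?P A = emeasure ?N A" if "A \<in> sets borel" "A \<subseteq> G" for A
 proof (rule measure_eq_smooth_local[OF _ _ G _ that])
  show "sets ?P = sets borel" "sets ?N = sets borel" using sets by simp_all
  fix b assume b: "smooth_cs b" "!!x. 0 <= b x" "!!x. b x <= 1" "closure {x. b x ~= 0} \<subseteq> G"
  have [measurable]: "b \<in> borel_measurable borel" using b(1) by (rule smooth_cs_measurable)
  have [measurable]: "b \<in> borel_measurable M" "f \<in> borel_measurable M"
   using smooth_cs_measurable[OF b(1)] f by (simp_all add: measurable_cong_sets[OF sets refl])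
  have i: "integrable M (%x. f x * b x)" "(LINT x|M. f x * b x) = 0" using eq[OF b(1,4)] by auto
  have P: "(\<integral>\<^sup>+x. ennreal (b x) \<partial>?P) = (\<integral>\<^sup>+x. ennreal (f x * b x) \<partial>M)"
   by (subst nn_integral_density) (use b in "auto intro!: mb nn_integral_cong simp: ennreal_mult''")
  have N: "(\<integral>\<^sup>+x. ennreal (b x) \<partial>?N) = (\<integral>\<^sup>+x. ennreal (- (f x * b x)) \<partial>M)"
   by (subst nn_integral_density) (use b in "auto intro!: mb nn_integral_cong simp: ennreal_mult''[symmetric]")
  have fin: "(\<integral>\<^sup>+x. ennreal (f x * b x) \<partial>M) < \<infinity>" "(\<integral>\<^sup>+x. ennreal (- (f x * b x)) \<partial>M) < \<infinity>"
   using i(1) by (auto simp: real_integrable_def top.not_eq_extremum)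
  have "enn2real (\<integral>\<^sup>+x. ennreal (f x * b x) \<partial>M) = enn2real (\<integral>\<^sup>+x. ennreal (- (f x * b x)) \<partial>M)"
   using i real_lebesgue_integral_def[OF i(1)] by simp
  then have "(\<integral>\<^sup>+x. ennreal (f x * b x) \<partial>M) = (\<integral>\<^sup>+x. ennreal (- (f x * b x)) \<partial>M)"
   using fin by (metis ennreal_enn2real infinity_ennreal_def)
  then show "(\<integral>\<^sup>+x. ennreal (b x) \<partial>?P) = (\<integral>\<^sup>+x. ennreal (b x) \<partial>?N) & (\<integral>\<^sup>+x. ennreal (b x) \<partial>?P) < \<infinity>"
   unfolding P N using fin by simp
 qed
 have "AE x in M. \<not> (x \<in> G & f x > 0)"
 proof -
  let ?A = "{x \<in> G. f x > 0}"
  have A: "?A \<in> sets borel" using G by simp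
  have "(\<integral>\<^sup>+x. ennreal (f x) * indicator ?A x \<partial>M) = (\<integral>\<^sup>+x. ennreal (- f x) * indicator ?A x \<partial>M)"
   using *[OF A] mM by (simp add: emeasure_density mb)
  also have "... = (\<integral>\<^sup>+x. 0 \<partial>M)" by (rule nn_integral_cong) (auto simp: indicator_def ennreal_neg)
  finally have z: "(\<integral>\<^sup>+x. ennreal (f x) * indicator ?A x \<partial>M) = 0" by simp
  have "AE x in M. ennreal (f x) * indicator ?A x = 0"
   by (rule nn_integral_0_iff_AE[THEN iffD1, OF _ z]) (use A in "auto intro!: mb")
  then show ?thesis by eventually_elim (auto simp: indicator_def)
 qed
 moreover have "AE x in M. \<not> (x \<in> G & f x < 0)"
 proof -
  let ?A = "{x \<in> G. f x < 0}"
  have A: "?A \<in> sets borel" using G by simp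
  have "(\<integral>\<^sup>+x. ennreal (- f x) * indicator ?A x \<partial>M) = (\<integral>\<^sup>+x. ennreal (f x) * indicator ?A x \<partial>M)"
   using *[OF A] mM by (simp add: emeasure_density mb)
  also have "... = (\<integral>\<^sup>+x. 0 \<partial>M)" by (rule nn_integral_cong) (auto simp: indicator_def ennreal_neg)
  finally have z: "(\<integral>\<^sup>+x. ennreal (- f x) * indicator ?A x \<partial>M) = 0" by simp
  have "AE x in M. ennreal (- f x) * indicator ?A x = 0"
   by (rule nn_integral_0_iff_AE[THEN iffD1, OF _ z]) (use A in "auto intro!: mb")
  then show ?thesis by eventually_elim (auto simp: indicator_def)
 qed
 ultimately show ?thesis by eventually_elim (use linorder_neqE_linordered_idom in blast)
qed

text \<open>Let the d-neighbourhood of \<open>K\<close> lie in \<open>G\<close>. The indicator of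
  the closed d/3-neighbourhood is mollified by a bump of radius d/3; the result is 1 on
  \<open>K\<close> and 0 at distance more than 2d/3.\<close>

lemma smooth_Urysohn:
 fixes K :: "(real ^ 'n::finite) set"
 assumes K: "compact K" and G: "open G" "K \<subseteq> G"
 obtains \<xi> where "smooth_cs \<xi>" "!!x. 0 <= \<xi> x" "!!x. \<xi> x <= 1" "!!x. x \<in> K ==> \<xi> x = 1" "closure {x. \<xi> x ~= 0} \<subseteq> G"
proof (cases "K = {}")
 case True
 show ?thesis by (rule that[of "%x. 0"]) (use True in "auto simp: smooth_cs_def")
next
 case False
 obtain d where d: "d > 0" "(\<Union>x\<in>K. ball x d) \<subseteq> G"
  using compact_subset_open_imp_ball_epsilon_subset[OF K G] by metis
 obtain b :: "real ^ 'n => real" where b: "smooth_cs b" "!!x. 0 <= b x" "!!x. b x > 0 \<longleftrightarrow> x \<in> ball 0 (d / 3)"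
  using smooth_cs_bump_exists[of "d / 3" "0 :: real ^ 'n"] d(1) by (metis divide_pos_pos zero_less_numeral)
 let ?c = "\<integral>x. b x \<partial>lborel"
 have c: "?c > 0" using integral_smooth_cs_pos[OF b] d(1) by simp
 have bn: "b y ~= 0 ==> norm y < d / 3" for y using b(2)[of y] b(3)[of y] by auto
 define KK where "KK = {x. infdist x K <= d / 3}"
 have cK: "compact KK" unfolding KK_def by (rule compact_infdist_le[OF False K]) (use d(1) in simp)
 have Kb [measurable]: "KK \<in> sets borel" using cK by (simp add: borel_compact)
 have [measurable]: "b \<in> borel_measurable borel" by (rule smooth_cs_measurable) fact
 have iK: "integrable lborel (indicator KK :: real ^ 'n => real)"
  by (rule integrable_real_indicator) (simp_all only: sets_lborel Kb emeasure_compact_finite[OF cK])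
 define \<xi> where "\<xi> x = mollify b (indicator KK) x / ?c" for x
 have C: "C_inf \<xi>"
  using C_inf_mult[OF C_inf_const[of "1 / ?c"] C_inf_mollify[OF iK b(1)]] by (simp add: \<xi>_def[abs_def])
 have eq: "mollify b (indicator KK) x = (LBINT y. indicator KK (x + y) * b y)" for x
  by (rule mollify_shift[OF borel_measurable_indicator[OF Kb] b(1)])
 have ib: "integrable lborel b" by (rule smooth_cs_integrable) fact
 have ii: "integrable lborel (%y. indicator KK (x + y) * b y)" for x
  by (rule Bochner_Integration.integrable_bound[OF ib]) (auto simp: indicator_def)
 have 0: "0 <= \<xi> x" for x unfolding \<xi>_def eq using c b(2) by simp
 have 1: "\<xi> x <= 1" for x
 proof -
  have "(LBINT y. indicator KK (x + y) * b y) <= ?c"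
   by (rule Bochner_Integration.integral_mono[OF ii ib]) (use b(2) in "auto simp: indicator_def")
  then show ?thesis unfolding \<xi>_def eq using c by simp
 qed
 have K1: "\<xi> x = 1" if "x \<in> K" for x
 proof -
  have "(LBINT y. indicator KK (x + y) * b y) = ?c"
  proof (rule Bochner_Integration.integral_cong[OF refl])
   fix y
   show "indicator KK (x + y) * b y = b y"
   proof (cases "b y = 0")
    case False
    then have "infdist (x + y) K <= d / 3" using bn[of y] infdist_le[OF that, of "x + y"] by (simp add: dist_norm)
    then show ?thesis by (simp add: KK_def)
   qed simp
  qed
  then show ?thesis unfolding \<xi>_def eq using c by simp
 qed
 let ?L = "{x. infdist x K <= 2 * d / 3}"
 have L: "\<xi> x = 0" if "x \<notin> ?L" for x
 proof -
  have "(LBINT y. indicator KK (x + y) * b y) = (\<integral>y. 0 \<partial>(lborel :: (real ^ 'n) measure))"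
  proof (rule Bochner_Integration.integral_cong[OF refl])
   fix y
   show "indicator KK (x + y) * b y = 0"
   proof (cases "b y = 0")
    case False
    then have "dist x (x + y) < d / 3" using bn[of y] by (simp add: dist_norm)
    then have "infdist (x + y) K > d / 3" using that infdist_triangle[of x K "x + y"] by simp
    then show ?thesis by (simp add: KK_def)
   qed simp
  qed
  then show ?thesis unfolding \<xi>_def eq by simp
 qed
 have cL: "compact ?L" by (rule compact_infdist_le[OF False K]) (use d(1) in simp)
 have sub: "{x. \<xi> x ~= 0} \<subseteq> ?L" using L by blast
 have "closure {x. \<xi> x ~= 0} \<subseteq> ?L" by (rule closure_minimal[OF sub compact_imp_closed[OF cL]])
 moreover have "?L \<subseteq> G"
 proof
  fix x assume x: "x \<in> ?L"
  obtain k where "k \<in> K" "infdist x K = dist x k" using infdist_attains_inf[OF compact_imp_closed[OF K] False] by metis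
  then have "x \<in> ball k d" using x d(1) by (auto simp: dist_commute)
  then show "x \<in> G" using d(2) \<open>k \<in> K\<close> by blast
 qed
 moreover have "smooth_cs \<xi>" unfolding smooth_cs_def
  using C bounded_subset[OF compact_imp_bounded[OF cL] sub] by blast
 ultimately show ?thesis using that 0 1 K1 by blast
qed

section \<open>Borel representatives\<close>

text \<open>A Borel function on the whole space that vanishes off the domain stands in for a class
  of functions modulo null sets. Integrals over the domain become integrals over
  \<open>lborel\<close>, where translations and Tonelli's theorem are at hand.\<close>

definition rep :: "(real ^ 'n::finite) set => (real ^ 'n => real) => (real ^ 'n => real) => bool" where
 "rep Om F G \<longleftrightarrow> G \<in> borel_measurable borel & (ALL x. x \<notin> Om --> G x = 0) & (AE x in lebesgue_on Om. F x = G x)"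

lemma AE_lebesgue_on_iff:
 assumes "Om \<in> sets borel"
 shows "(AE x in lebesgue_on Om. P x) \<longleftrightarrow> (AE x in lborel. x \<in> Om --> P x)"
 using assms by (subst AE_restrict_space_iff) (auto simp: AE_completion_iff)

lemma rep_exists:
 assumes O: "Om \<in> sets borel" and F: "F \<in> borel_measurable (lebesgue_on Om)"
 obtains G where "rep Om F G"
proof -
 have "(%x. if x \<in> Om then F x else 0) \<in> borel_measurable lebesgue"
  by (rule borel_measurable_if_I[OF F]) (use O in auto)
 then obtain g where g: "g \<in> borel_measurable lborel" "AE x in lborel. (if x \<in> Om then F x else 0) = g x"
  using completion_ex_borel_measurable_real by blast
 have [measurable]: "Om \<in> sets borel" "g \<in> borel_measurable borel" using O g by auto
 have "AE x in lborel. x \<in> Om --> F x = indicator Om x * g x"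
  using g(2) by eventually_elim auto
 then have "rep Om F (%x. indicator Om x * g x)"
  using O by (auto simp: rep_def AE_lebesgue_on_iff)
 then show ?thesis by (rule that)
qed

lemma rep_AE: "Om \<in> sets borel ==> rep Om F G ==> AE x in lborel. x \<in> Om --> F x = G x"
 by (simp add: rep_def AE_lebesgue_on_iff)

lemma borel_imp_lebesgue:
 fixes G :: "real ^ 'n::finite => real"
 assumes "G \<in> borel_measurable borel"
 shows "G \<in> borel_measurable lebesgue" "G \<in> borel_measurable (lebesgue_on Om)"
proof -
 have "G \<in> borel_measurable lborel" using assms by simp
 then show "G \<in> borel_measurable lebesgue" by (rule measurable_completion)
 then show "G \<in> borel_measurable (lebesgue_on Om)" by (rule measurable_restrict_space1)
qed

lemma rep_measurable:
 assumes "Om \<in> sets borel" "rep Om F G"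
 shows "F \<in> borel_measurable (lebesgue_on Om)"
proof -
 have ae: "AE x in lebesgue. G x = (if x \<in> Om then F x else 0)"
  unfolding AE_completion_iff using rep_AE[OF assms]
  by eventually_elim (use assms(2) in "auto simp: rep_def")
 have m: "G \<in> borel_measurable lebesgue" by (rule borel_imp_lebesgue) (use assms(2) in "simp add: rep_def")
 have "(%x. if x \<in> Om then F x else 0) \<in> borel_measurable lebesgue"
  by (rule borel_measurable_AE[OF m ae])
 then show ?thesis by (rule borel_measurable_if_D)
qed

lemma rep_lebesgue_on:
 assumes O: "Om \<in> sets borel" and r: "rep Om F G"
 shows "integral\<^sup>L (lebesgue_on Om) F = (LBINT x. G x)"
  and "integrable (lebesgue_on Om) F \<longleftrightarrow> integrable lborel G"
proof -
 have F: "F \<in> borel_measurable (lebesgue_on Om)" by (rule rep_measurable[OF O r])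
 have Gm: "G \<in> borel_measurable borel" and G0: "!!x. x \<notin> Om ==> G x = 0" using r by (auto simp: rep_def)
 have G: "G \<in> borel_measurable (lebesgue_on Om)" using Gm by (rule borel_imp_lebesgue)
 have ae: "AE x in lebesgue_on Om. F x = G x" using r by (simp add: rep_def)
 have eq: "(%x. indicator Om x * G x) = G"
 proof
  show "indicator Om x * G x = G x" for x by (cases "x \<in> Om") (auto simp: G0)
 qed
 have O': "Om \<inter> space lebesgue \<in> sets lebesgue" using O by simp
 have "integral\<^sup>L (lebesgue_on Om) F = integral\<^sup>L (lebesgue_on Om) G" by (rule integral_cong_AE[OF F G ae])
 also have "... = (LBINT x. G x)"
  using integral_restrict_space[OF O', of G] Gm by (simp add: eq integral_completion)
 finally show "integral\<^sup>L (lebesgue_on Om) F = (LBINT x. G x)" .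
 have "integrable (lebesgue_on Om) F \<longleftrightarrow> integrable (lebesgue_on Om) G" by (rule integrable_cong_AE[OF F G ae])
 also have "... \<longleftrightarrow> integrable lborel G"
  using integrable_restrict_space[OF O', of G] Gm by (simp add: eq integrable_completion)
 finally show "integrable (lebesgue_on Om) F \<longleftrightarrow> integrable lborel G" .
qed

lemma rep_compose2:
 assumes "rep Om F1 G1" "rep Om F2 G2" "(%x. h x (G1 x) (G2 x)) \<in> borel_measurable borel" "!!x. x \<notin> Om ==> h x 0 0 = 0"
 shows "rep Om (%x. h x (F1 x) (F2 x)) (%x. h x (G1 x) (G2 x))"
proof -
 have "AE x in lebesgue_on Om. F1 x = G1 x" "AE x in lebesgue_on Om. F2 x = G2 x" using assms by (auto simp: rep_def)
 then have "AE x in lebesgue_on Om. h x (F1 x) (F2 x) = h x (G1 x) (G2 x)" by eventually_elim simp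
 then show ?thesis using assms by (auto simp: rep_def)
qed

lemma rep_lin:
 assumes "rep Om F1 G1" "rep Om F2 G2"
 shows "rep Om (%x. a * F1 x + b * F2 x) (%x. a * G1 x + b * G2 x)"
 by (rule rep_compose2[OF assms, of "%x p q. a * p + b * q"]) (use assms in "auto simp: rep_def")

lemma rep_mult:
 assumes "rep Om F1 G1" "rep Om F2 G2"
 shows "rep Om (%x. F1 x * F2 x) (%x. G1 x * G2 x)"
 by (rule rep_compose2[OF assms, of "%x p q. p * q"]) (use assms in "auto simp: rep_def")

lemma rep_mult_borel:
 assumes "rep Om F G" "h \<in> borel_measurable borel"
 shows "rep Om (%x. F x * h x) (%x. G x * h x)"
 by (rule rep_compose2[OF assms(1,1), of "%x p q. p * h x"]) (use assms in "auto simp: rep_def")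

lemma rep_sum:
 assumes "!!i. i \<in> I ==> rep Om (F i) (G i)"
 shows "rep Om (%x. \<Sum>i\<in>I. F i x) (%x. \<Sum>i\<in>I. G i x)"
 using assms
proof (induction I rule: infinite_finite_induct)
 case (insert i I)
 then show ?case using rep_lin[of Om "F i" "G i" "%x. \<Sum>i\<in>I. F i x" "%x. \<Sum>i\<in>I. G i x" 1 1] by simp
qed (auto simp: rep_def)

lemma rep_borel: "Om \<in> sets borel ==> f \<in> borel_measurable borel ==> rep Om f (%x. indicator Om x * f x)"
 by (auto simp: rep_def AE_lebesgue_on_iff)

lemma rep_cong: "rep Om F G ==> AE x in lebesgue_on Om. F x = F' x ==> rep Om F' G"
 unfolding rep_def by (auto elim: eventually_elim2)

lemma rep_cong_right:
 assumes "Om \<in> sets borel" "rep Om F G" "AE x in lborel. G x = G' x" "G' \<in> borel_measurable borel" "!!x. x \<notin> Om ==> G' x = 0"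
 shows "rep Om F G'"
proof -
 have "AE x in lborel. x \<in> Om --> F x = G' x" using rep_AE[OF assms(1,2)] assms(3) by eventually_elim auto
 then show ?thesis using assms by (simp add: rep_def AE_lebesgue_on_iff)
qed

lemma rep_unique:
 assumes "Om \<in> sets borel" "rep Om F G" "rep Om F' G'" "AE x in lborel. G x = G' x"
 shows "AE x in lebesgue_on Om. F x = F' x"
 unfolding AE_lebesgue_on_iff[OF assms(1)]
 using rep_AE[OF assms(1,2)] rep_AE[OF assms(1,3)] assms(4) by eventually_elim auto

lemma rep_sqint:
 assumes "Om \<in> sets borel" "rep Om F G"
 shows "square_integrable (lebesgue_on Om) F \<longleftrightarrow> square_integrable lborel G"
  and "norm_L2 (lebesgue_on Om) F = norm_L2 lborel G"
 using rep_lebesgue_on[OF assms(1) rep_mult[OF assms(2,2)]] rep_measurable[OF assms] assms(2)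
 by (auto simp: square_integrable_def norm_L2_def power2_eq_square rep_def)

definition sqz :: "(real ^ 'n::finite) set => (real ^ 'n => real) => bool" where
 "sqz Om v \<longleftrightarrow> square_integrable lborel v & (ALL x. x \<notin> Om --> v x = 0)"

lemma sqzD: "sqz Om v ==> square_integrable lborel v" "sqz Om v ==> v \<in> borel_measurable borel"
 "sqz Om v ==> x \<notin> Om ==> v x = 0"
 by (auto simp: sqz_def square_integrable_def)

lemma sqz_lin: "sqz Om u ==> sqz Om v ==> sqz Om (%x. a * u x + b * v x)"
 by (auto simp: sqz_def intro: sqint_lin)

lemma sqz_mult_bounded:
 assumes "sqz Om v" "h \<in> borel_measurable borel" "!!x. x \<in> Om ==> \<bar>h x\<bar> <= C"
 shows "sqz Om (%x. h x * v x)"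
proof -
 have "\<bar>h x * v x\<bar> <= C * \<bar>v x\<bar>" for x
  using assms(3)[of x] sqzD(3)[OF assms(1), of x] by (cases "x \<in> Om") (auto simp: abs_mult mult_right_mono)
 moreover have "(%x. h x * v x) \<in> borel_measurable lborel"
  using assms(2) sqzD(2)[OF assms(1)] by simp
 ultimately have "square_integrable lborel (%x. h x * v x)"
  by (intro sqint_bound[OF sqzD(1)[OF assms(1)], where C=C] AE_I2)
 then show ?thesis using assms(1) by (simp add: sqz_def)
qed

lemma rep_sqz_exists:
 assumes O: "Om \<in> sets borel" and F: "square_integrable (lebesgue_on Om) F"
 obtains G where "rep Om F G" "sqz Om G"
proof -
 obtain G where G: "rep Om F G" using rep_exists[OF O] F by (auto simp: square_integrable_def)
 then have "sqz Om G" using rep_sqint(1)[OF O G] F by (simp add: sqz_def rep_def)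
 then show ?thesis using that G by blast
qed

lemma sqz_integrable:
 assumes Om: "Om \<in> sets borel" "bounded Om" and v: "sqz Om v"
 shows "integrable lborel v"
proof -
 obtain R where "ALL x:Om. norm x <= R" using Om(2) unfolding bounded_iff ..
 then have R: "Om \<subseteq> cball 0 R" by auto
 have "square_integrable lborel (indicator (cball (0 :: real ^ 'a) R) :: real ^ 'a => real)"
  unfolding square_integrable_def indicator_sq
  by (intro conjI borel_measurable_indicator integrable_indicator_cball) simp
 from sqint_mult[OF this sqzD(1)[OF v]]
 have "integrable lborel (%x. indicator (cball 0 R) x * v x)" .
 moreover have "(%x. indicator (cball 0 R) x * v x) = v"
 proof
  show "indicator (cball 0 R) x * v x = v x" for x
   by (cases "x \<in> Om") (use R sqzD(3)[OF v] in auto)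
 qed
 ultimately show ?thesis by simp
qed

section \<open>Test functions, local integrability, uniqueness of weak derivatives\<close>

lemma test_functions_iff: "Ph \<in> test_functions Om \<longleftrightarrow> smooth_cs Ph & closure {x. Ph x ~= 0} \<subseteq> Om"
proof -
 have "compact (closure {x. Ph x ~= 0}) \<longleftrightarrow> bounded {x. Ph x ~= 0}"
  unfolding compact_eq_bounded_closed using bounded_closure bounded_subset[OF _ closure_subset] by blast
 then show ?thesis unfolding test_functions_def smooth_cs_def by blast
qed

lemma test_functions_pd: "Ph \<in> test_functions Om ==> pd i Ph \<in> test_functions Om"
 unfolding test_functions_iff
 using smooth_cs_pd closure_minimal[OF pd_support closed_closure] by blast

lemma test_functions_mult: "C_inf f ==> Ph \<in> test_functions Om ==> (%x. f x * Ph x) \<in> test_functions Om"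
 unfolding test_functions_iff using smooth_cs_mult closure_mono[of "{x. f x * Ph x ~= 0}" "{x. Ph x ~= 0}"] by auto

lemma loc_integrable_sqint:
 assumes Om: "Om \<in> sets borel" and r: "rep Om F G" and G: "sqz Om G"
 shows "loc_integrable Om F"
 unfolding loc_integrable_def
proof (intro allI impI)
 fix K assume K: "compact K & K \<subseteq> Om"
 then have Kb: "K \<in> sets borel" by (simp add: borel_compact)
 have ik: "integrable lborel (indicator K :: real ^ 'a => real)"
  by (rule integrable_real_indicator) (use K Kb emeasure_compact_finite[of K] in auto)
 have "square_integrable lborel (indicator K :: real ^ 'a => real)"
  using ik Kb by (simp add: square_integrable_def indicator_sq)
 from sqint_mult[OF this sqzD(1)[OF G]] have i: "integrable lborel (%x. indicator K x * G x)" .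
 have ae: "AE x in lborel. indicator K x * G x = indicator K x *\<^sub>R F x"
  using rep_AE[OF Om r] by eventually_elim (use K in "auto simp: indicator_def")
 have m: "(%x. indicator K x * G x) \<in> borel_measurable lebesgue"
  by (rule borel_imp_lebesgue) (use i in auto)
 have "(%x. indicator K x *\<^sub>R F x) \<in> borel_measurable lebesgue"
  by (rule borel_measurable_AE[OF m]) (use ae in "simp add: AE_completion_iff")
 moreover have "integrable lebesgue (%x. indicator K x * G x)" using i by (subst integrable_completion) auto
 ultimately have "integrable lebesgue (%x. indicator K x *\<^sub>R F x)"
  using integrable_cong_AE[OF m, of "%x. indicator K x *\<^sub>R F x"] ae unfolding AE_completion_iff by blast
 then show "F absolutely_integrable_on K" by (simp add: set_integrable_def)
qed

text \<open>Local integrability speaks of compact subsets only; truncations to an exhaustion by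
  compact sets are measurable and converge pointwise.\<close>

lemma loc_integrable_measurable:
 assumes Om: "open Om" and f: "loc_integrable Om f"
 shows "f \<in> borel_measurable (lebesgue_on Om)"
proof -
 obtain C :: "nat => (real ^ 'a) set" where C: "!!n. compact (C n)" "!!n. C n \<subseteq> Om"
  "!!n. C n \<subseteq> interior (C (Suc n))" "\<Union>(range C) = Om"
  using open_Union_compact_subsets[OF Om] by metis
 have mono: "mono C" using C(3) interior_subset by (intro incseq_SucI) blast
 have "(%x. indicator (C n) x *\<^sub>R f x) \<in> borel_measurable lebesgue" for n
  using f C(1,2) unfolding loc_integrable_def set_integrable_def by auto
 then have "(%x. if x \<in> Om then f x else 0) \<in> borel_measurable lebesgue"
 proof (rule borel_measurable_LIMSEQ_real[rotated])
  fix x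
  show "(%n. indicator (C n) x *\<^sub>R f x) ----> (if x \<in> Om then f x else 0)"
  proof (cases "x \<in> Om")
   case True
   then obtain n where "x \<in> C n" using C(4) by blast
   then have "ALL m>=n. x \<in> C m" using mono by (auto simp: mono_def)
   then have "\<forall>\<^sub>F m in sequentially. x \<in> C m" unfolding eventually_sequentially by blast
   then have "\<forall>\<^sub>F m in sequentially. indicator (C m) x *\<^sub>R f x = f x" by eventually_elim simp
   then show ?thesis using True by (simp add: tendsto_eventually)
  next
   case False
   then have "x \<notin> C n" for n using C(2) by blast
   then show ?thesis using False by simp
  qed
 qed
 then show ?thesis by (rule borel_measurable_if_D)
qed

lemma loc_integrable_zero:
 assumes Om: "open Om" and f: "loc_integrable Om f"
  and eq: "!!Ph. Ph \<in> test_functions Om ==> (\<integral>x. f x * Ph x \<partial>lebesgue_on Om) = 0"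
 shows "AE x in lebesgue_on Om. f x = 0"
proof -
 have Ob: "Om \<in> sets borel" using Om by simp
 obtain g where g: "rep Om f g" using rep_exists[OF Ob loc_integrable_measurable[OF Om f]] .
 have gm: "g \<in> borel_measurable borel" using g by (simp add: rep_def)
 have "AE x in lborel. x \<in> Om --> g x = 0"
 proof (rule smooth_fundamental[OF _ gm Om])
  fix b assume b: "smooth_cs b" "closure {x. b x ~= 0} \<subseteq> Om"
  let ?K = "closure {x. b x ~= 0}"
  have K: "compact ?K" using b by (simp add: smooth_cs_def compact_eq_bounded_closed bounded_closure)
  have Kb: "?K \<in> sets borel" by simp
  have "integrable lebesgue (%x. indicator ?K x *\<^sub>R f x)"
   using f K b(2) unfolding loc_integrable_def set_integrable_def by blast
  moreover have ae: "AE x in lebesgue. indicator ?K x *\<^sub>R f x = indicator ?K x * g x"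
   unfolding AE_completion_iff using rep_AE[OF Ob g] by eventually_elim (use b(2) in "auto simp: indicator_def")
  moreover have m: "(%x. indicator ?K x * g x) \<in> borel_measurable borel" using gm by simp
  ultimately have "integrable lebesgue (%x. indicator ?K x * g x)"
   using integrable_cong_AE[OF borel_measurable_integrable borel_imp_lebesgue(1)[OF m] ae] by blast
  then have "integrable lborel (%x. indicator ?K x * g x)" using m by (subst (asm) integrable_completion) auto
  from integrable_mult_smooth_cs[OF this b(1)]
  have "integrable lborel (%x. indicator ?K x * g x * b x)" .
  moreover have "(%x. indicator ?K x * g x * b x) = (%x. g x * b x)"
   using closure_subset[of "{x. b x ~= 0}"] by (auto simp: indicator_def fun_eq_iff)
  ultimately have "integrable lborel (%x. g x * b x)" by simp
  moreover have "(LBINT x. g x * b x) = 0"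
   using eq[of b] rep_lebesgue_on(1)[OF Ob rep_mult_borel[OF g smooth_cs_measurable[OF b(1)]]] b by (simp add: test_functions_iff)
  ultimately show "integrable lborel (%x. g x * b x) & (LBINT x. g x * b x) = 0" by blast
 qed simp
 then show ?thesis
  unfolding AE_lebesgue_on_iff[OF Ob] using rep_AE[OF Ob g] by eventually_elim auto
qed

lemma loc_integrable_diff: "loc_integrable Om f ==> loc_integrable Om g ==> loc_integrable Om (%x. f x - g x)"
 unfolding loc_integrable_def by (auto intro: set_integral_diff(1))

lemma loc_integrable_unique:
 assumes Om: "open Om" and f: "loc_integrable Om f" "loc_integrable Om g"
  and eq: "!!Ph. Ph \<in> test_functions Om ==> (\<integral>x. f x * Ph x \<partial>lebesgue_on Om) = (\<integral>x. g x * Ph x \<partial>lebesgue_on Om)"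
 shows "AE x in lebesgue_on Om. f x = g x"
proof -
 have int: "integrable (lebesgue_on Om) (%x. h x * b x)" if h: "loc_integrable Om h" and b: "b \<in> test_functions Om" for h b :: "real ^ 'a => real"
 proof -
  have Ob: "Om \<inter> space lebesgue \<in> sets lebesgue" using Om by simp
  let ?K = "closure {x. b x ~= 0}"
  have bb: "smooth_cs b" "?K \<subseteq> Om" using b by (auto simp: test_functions_iff)
  have K: "compact ?K" using bb by (simp add: smooth_cs_def compact_eq_bounded_closed bounded_closure)
  obtain M where M: "!!x. \<bar>b x\<bar> <= M" using smooth_cs_bounded[OF bb(1)] by metis
  have bm: "b \<in> borel_measurable lebesgue" by (rule borel_imp_lebesgue[OF smooth_cs_measurable[OF bb(1)]])
  have i: "integrable lebesgue (%x. indicator ?K x *\<^sub>R h x)"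
   using h K bb(2) unfolding loc_integrable_def set_integrable_def by blast
  have "integrable lebesgue (%x. b x * (indicator ?K x *\<^sub>R h x))"
   by (rule Bochner_Integration.integrable_bound[OF integrable_mult_right[OF i, of M]])
    (use i bm M in "auto simp: abs_mult intro!: AE_I2 mult_right_mono order_trans[OF M abs_ge_self]")
  moreover have "(%x. b x * (indicator ?K x *\<^sub>R h x)) = (%x. indicator Om x *\<^sub>R (h x * b x))"
  proof
   show "b x * (indicator ?K x *\<^sub>R h x) = indicator Om x *\<^sub>R (h x * b x)" for x
    using closure_subset[of "{x. b x ~= 0}"] bb(2) by (cases "b x = 0") (auto simp: indicator_def)
  qed
  ultimately show ?thesis unfolding integrable_restrict_space[OF Ob] by (simp only:)
 qed
 have "AE x in lebesgue_on Om. f x - g x = 0"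
  by (rule loc_integrable_zero[OF Om loc_integrable_diff[OF f]])
   (use int[OF f(1)] int[OF f(2)] eq in "simp add: left_diff_distrib")
 then show ?thesis by simp
qed

lemma count_list_single: "(ALL j. count_list is j = mi_unit i j) \<longleftrightarrow> is = [i]"
proof
 assume a: "ALL j. count_list is j = mi_unit i j"
 have "j \<in> set is \<longleftrightarrow> j = i" for j
  using a[rule_format, of j] count_list_0_iff[of "is" j] by (auto simp: mi_unit_def split: if_splits)
 then have s: "set is = {i}" by blast
 show "is = [i]"
 proof (cases "is")
  case (Cons j js)
  then have "j = i" using s by simp
  then have "count_list js i = 0" using a[rule_format, of i] Cons by (simp add: mi_unit_def)
  then have "i \<notin> set js" by (simp add: count_list_0_iff)
  then have "js = []" using s Cons by (cases js) auto
  then show ?thesis using Cons \<open>j = i\<close> by simp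
 qed (use s in simp)
qed (auto simp: mi_unit_def)

lemma mi_order_count: "mi_order (count_list is) = length is"
proof (induction "is")
 case (Cons a "is")
 have "mi_order (count_list (a # is)) = (\<Sum>i\<in>UNIV. count_list is i + (if i = a then 1 else 0))"
  unfolding mi_order_def by (rule sum.cong) auto
 then show ?case using Cons by (simp add: sum.distrib mi_order_def)
qed (simp add: mi_order_def)

text \<open>Multi-indices are given in the form \<open>count_list is\<close>, so that the list
  itself is an admissible enumeration to insert into \<open>has_weak_deriv\<close>.\<close>

lemma weak_deriv_unique:
 assumes "open Om" "has_weak_deriv Om (count_list is) u v" "has_weak_deriv Om (count_list is) u v'"
 shows "AE x in lebesgue_on Om. v x = v' x"
proof (rule loc_integrable_unique)
 fix Ph assume p: "Ph \<in> test_functions Om"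
 have "(- 1) ^ mi_order (count_list is) * (\<integral>x. v x * Ph x \<partial>lebesgue_on Om) =
   (- 1) ^ mi_order (count_list is) * (\<integral>x. v' x * Ph x \<partial>lebesgue_on Om)"
  using assms(2,3) p unfolding has_weak_deriv_def by (metis (no_types, lifting))
 then show "(\<integral>x. v x * Ph x \<partial>lebesgue_on Om) = (\<integral>x. v' x * Ph x \<partial>lebesgue_on Om)" by simp
qed (use assms in "auto simp: has_weak_deriv_def")

lemma weak_deriv_eq:
 assumes "open Om" "has_weak_deriv Om (count_list is) u v"
 shows "AE x in lebesgue_on Om. weak_deriv Om (count_list is) u x = v x"
proof -
 have "has_weak_deriv Om (count_list is) u (weak_deriv Om (count_list is) u)"
  unfolding weak_deriv_def by (rule someI[of "has_weak_deriv Om (count_list is) u", OF assms(2)])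
 then show ?thesis using weak_deriv_unique[OF assms(1)] assms(2) by blast
qed

text \<open>\<open>f\<close> is the distribution \<open>b \<cdot> \<nabla>v\<close>, where \<open>D\<close> plays the role of \<open>div b\<close>.\<close>

definition adv :: "(real ^ 'n::finite) set => (real ^ 'n => real ^ 'n) => (real ^ 'n => real) => (real ^ 'n => real) => (real ^ 'n => real) => bool" where
 "adv Om b D v f \<longleftrightarrow> (\<forall>Ph\<in>test_functions Om.
  (LBINT x. f x * Ph x) = - (LBINT x. v x * (b x \<bullet> grad Ph x + D x * Ph x)))"

text \<open>A partial derivative is the advection along a constant field of divergence 0. Density
  and trace theorems for advections therefore cover H^1 as well.\<close>

abbreviation wder :: "(real ^ 'n::finite) set => 'n => (real ^ 'n => real) => (real ^ 'n => real) => bool" where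
 "wder Om i v f \<equiv> adv Om (%_. axis i 1) (%_. 0) v f"

lemma wder_iff: "wder Om i v f \<longleftrightarrow> (\<forall>Ph\<in>test_functions Om. (LBINT x. f x * Ph x) = - (LBINT x. v x * pd i Ph x))"
 by (simp add: adv_def inner_axis')

lemma has_weak_deriv_unit_rep:
 assumes Om: "Om \<in> sets borel" and u: "rep Om u u'" "sqz Om u'" and v: "rep Om v v'" "sqz Om v'"
 shows "has_weak_deriv Om (mi_unit i) u v \<longleftrightarrow> wder Om i u' v'"
proof -
 have o: "mi_order (mi_unit i) = 1"
  using mi_order_count[of "[i]"] count_list_single[of "[i]" i] by (metis One_nat_def ext length_Cons list.size(3))
 have "(\<integral>x. u x * pd i Ph x \<partial>lebesgue_on Om) = (LBINT x. u' x * pd i Ph x)"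
   "(\<integral>x. v x * Ph x \<partial>lebesgue_on Om) = (LBINT x. v' x * Ph x)" if "Ph \<in> test_functions Om" for Ph
  using rep_lebesgue_on(1)[OF Om rep_mult_borel[OF u(1)]] rep_lebesgue_on(1)[OF Om rep_mult_borel[OF v(1)]]
   that test_functions_pd[OF that, of i] smooth_cs_measurable by (auto simp: test_functions_iff)
 then show ?thesis
  unfolding has_weak_deriv_def wder_iff count_list_single
  using loc_integrable_sqint[OF Om u] loc_integrable_sqint[OF Om v] by (auto simp: o)
qed

lemma has_advection_rep:
 assumes Om: "Om \<in> sets borel" and b: "!!i. rep Om (%x. \<beta> x $ i) (%x. b x $ i)" and D: "rep Om (weak_div Om \<beta>) D"
  and v: "rep Om v v'" and f: "rep Om f f'" "sqz Om f'"
 shows "has_advection Om \<beta> v f \<longleftrightarrow> adv Om b D v' f'"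
proof -
 have "(\<integral>x. v x * (\<beta> x \<bullet> grad Ph x + weak_div Om \<beta> x * Ph x) \<partial>lebesgue_on Om) = (LBINT x. v' x * (b x \<bullet> grad Ph x + D x * Ph x))"
   "(\<integral>x. f x * Ph x \<partial>lebesgue_on Om) = (LBINT x. f' x * Ph x)" if "Ph \<in> test_functions Om" for Ph
 proof -
  have m: "Ph \<in> borel_measurable borel" "pd i Ph \<in> borel_measurable borel" for i
   using that test_functions_pd[OF that] smooth_cs_measurable by (auto simp: test_functions_iff)
  show "(\<integral>x. f x * Ph x \<partial>lebesgue_on Om) = (LBINT x. f' x * Ph x)"
   by (rule rep_lebesgue_on(1)[OF Om rep_mult_borel[OF f(1) m(1)]])
  have "rep Om (%x. \<Sum>i\<in>UNIV. \<beta> x $ i * pd i Ph x) (%x. \<Sum>i\<in>UNIV. b x $ i * pd i Ph x)"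
   by (intro rep_sum rep_mult_borel b m)
  from rep_mult[OF v rep_lin[OF this rep_mult_borel[OF D m(1)], of 1 1]]
  show "(\<integral>x. v x * (\<beta> x \<bullet> grad Ph x + weak_div Om \<beta> x * Ph x) \<partial>lebesgue_on Om) = (LBINT x. v' x * (b x \<bullet> grad Ph x + D x * Ph x))"
   using rep_lebesgue_on(1)[OF Om] by (simp add: inner_vec_def)
 qed
 then show ?thesis
  unfolding has_advection_def adv_def using loc_integrable_sqint[OF Om f] by auto
qed

section \<open>Friedrichs' lemma up to the boundary\<close>

lemma integrable_mult_bounded:
 assumes "integrable M u" "h \<in> borel_measurable M" "!!x. \<bar>h x\<bar> <= (B::real)"
 shows "integrable M (%x. u x * h x)"
proof (rule Bochner_Integration.integrable_bound[OF integrable_mult_right[OF assms(1), of B]])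
 have "\<bar>u x * h x\<bar> <= \<bar>B * u x\<bar>" for x
  using mult_right_mono[OF order_trans[OF assms(3) abs_ge_self], of "\<bar>u x\<bar>" x] by (simp add: abs_mult mult.commute)
 then show "AE x in M. norm (u x * h x) <= norm (B * u x)" by simp
qed (use assms in auto)

definition cone_set :: "real ^ 'n::finite => real => real => (real ^ 'n) set" where
 "cone_set e s Ta = {t *\<^sub>R z | t z. 0 < t & t < Ta & norm (z - e) <= s}"

text \<open>The uniform cone condition: one truncated cone fits into the domain from every point of
  the closure near \<open>c\<close>.\<close>

definition cone_at :: "(real ^ 'n::finite) set => real ^ 'n => real => real ^ 'n => real => real => bool" where
 "cone_at Om c R e s Ta \<longleftrightarrow> R > 0 & s > 0 & Ta > 0 &
  (ALL x:closure Om \<inter> ball c (2 * R). ALL y:cone_set e s Ta. x + y \<in> Om)"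

text \<open>A Lipschitz condition along cone directions, for almost every x and y in place of a
  continuous representative. Bounded weak derivatives give exactly this, and the commutator estimate
  uses exactly this.\<close>

definition cone_Lip :: "(real ^ 'n::finite) set => real ^ 'n => real => real ^ 'n => real => real => (real ^ 'n => real ^ 'n) => bool" where
 "cone_Lip Om c R e s Ta b \<longleftrightarrow> (EX L>=0. AE x in lborel. x \<in> Om \<inter> ball c (2 * R) -->
  (AE y in lborel. y \<in> cone_set e s Ta --> norm (b (x + y) - b x) <= L * norm y))"

text \<open>The last clause says that \<open>D\<close> is the divergence of \<open>b\<close> in the
  domain, in the sense of distributions.\<close>

definition bounded_field :: "(real ^ 'n::finite) set => (real ^ 'n => real ^ 'n) => (real ^ 'n => real) => real => bool" where
 "bounded_field Om b D B \<longleftrightarrow> b \<in> borel_measurable borel & D \<in> borel_measurable borel &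
  (ALL x. norm (b x) <= B) & (ALL x. \<bar>D x\<bar> <= B) &
  (\<forall>Ph\<in>test_functions Om. (LBINT x. b x \<bullet> grad Ph x + D x * Ph x) = 0)"

lemma grad_measurable:
 fixes Th :: "real ^ 'n::finite => real"
 shows "C_inf Th ==> grad Th \<in> borel_measurable borel"
proof (rule borel_measurable_continuous_onI)
 assume "C_inf Th"
 moreover have "grad Th = (%x. \<chi> i::'n. pd i Th x)" by (simp add: fun_eq_iff vec_eq_iff)
 ultimately show "continuous_on UNIV (grad Th)"
  by (simp only:) (intro continuous_on_vec_lambda C_inf_continuous C_inf_pd)
qed

lemma grad_bounded:
 assumes "smooth_cs Th" obtains M where "M >= 0" "!!x. norm (grad Th x) <= M"
proof -
 have "EX M. M >= 0 & (ALL x. \<bar>pd i Th x\<bar> <= M)" for i using smooth_cs_bounded[OF smooth_cs_pd[OF assms]] by metis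
 then obtain M where M: "!!i. M i >= 0" "!!i x. \<bar>pd i Th x\<bar> <= M i" by metis
 have "norm (grad Th x) <= (\<Sum>i\<in>UNIV. M i)" for x
 proof -
  have "norm (grad Th x) <= (\<Sum>i\<in>UNIV. \<bar>pd i Th x\<bar>)" using norm_le_l1_cart[of "grad Th x"] by simp
  also have "... <= (\<Sum>i\<in>UNIV. M i)" by (rule sum_mono) (rule M)
  finally show ?thesis .
 qed
 then show ?thesis using that[of "\<Sum>i\<in>UNIV. M i"] M(1) by (simp add: sum_nonneg)
qed

lemma grad_shift: "C_inf Th ==> grad (%z. Th (z - x)) z = grad Th (z - x)"
proof -
 assume "C_inf Th"
 then have "((%z. Th (- x + 1 *\<^sub>R z)) has_derivative (%v. grad Th (- x + 1 *\<^sub>R z) \<bullet> (1 *\<^sub>R v))) (at z)"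
  by (intro pd_affine C_inf_differentiable)
 then have "((%z. Th (z - x)) has_derivative (%v. grad Th (z - x) \<bullet> v)) (at z)" by simp
 from pd_eq[OF this] show ?thesis by (simp add: vec_eq_iff inner_axis)
qed

lemma test_function_shift:
 assumes Th: "smooth_cs Th" and sup: "closure {y. Th y ~= 0} \<subseteq> cone_set e s Ta"
  and c: "cone_at Om c R e s Ta" and x: "x \<in> closure Om" "x \<in> ball c (2 * R)"
 shows "(%z. Th (z - x)) \<in> test_functions Om"
proof -
 have "{z. Th (z - x) ~= 0} = (+) x ` {y. Th y ~= 0}"
  by (auto simp: image_def)
 then have "closure {z. Th (z - x) ~= 0} = (+) x ` closure {y. Th y ~= 0}" by (simp add: closure_translation)
 also have "... \<subseteq> Om" using sup c x by (auto simp: cone_at_def)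
 finally show ?thesis using smooth_cs_affine[OF Th, of 1 "-x"] by (simp add: test_functions_iff)
qed

lemma grad_mollify:
 assumes u: "integrable lborel u" and Th: "smooth_cs Th"
 shows "a \<bullet> grad (mollify Th u) x = - (LBINT z. u z * (a \<bullet> grad Th (z - x)))"
proof -
 have "a \<bullet> grad (mollify Th u) x = (\<Sum>i\<in>UNIV. a $ i * (LBINT z. u z * - pd i Th (z - x)))"
  by (simp add: inner_vec_def pd_mollify[OF assms] mollify_def)
 also have "... = - (\<Sum>i\<in>UNIV. \<integral>z. a $ i * (u z * pd i Th (z - x)) \<partial>lborel)"
  by (simp add: sum_negf)
 also have "(\<Sum>i\<in>UNIV. \<integral>z. a $ i * (u z * pd i Th (z - x)) \<partial>lborel) = (LBINT z. (\<Sum>i\<in>UNIV. a $ i * (u z * pd i Th (z - x))))"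
  by (rule Bochner_Integration.integral_sum[symmetric], intro integrable_mult_right mollify_integrable u smooth_cs_pd Th)
 also have "... = (LBINT z. u z * (a \<bullet> grad Th (z - x)))"
  by (simp add: inner_vec_def sum_distrib_left mult_ac)
 finally show ?thesis .
qed

text \<open>The equation for u is tested with the translated kernel. The resulting weight has
  integral 0, since \<open>D\<close> is the divergence of \<open>b\<close> and derivatives of
  compactly supported functions have mean 0; hence u(x) may be subtracted from u(x + y).\<close>

lemma mollify_commutator:
 assumes u: "integrable lborel u" and f: "integrable lborel f" and Th: "smooth_cs Th"
  and b: "bounded_field Om b D B" and a: "adv Om b D u f" and t: "(%z. Th (z - x)) \<in> test_functions Om"
 shows "b x \<bullet> grad (mollify Th u) x - mollify Th f x =
  (LBINT y. (u (x + y) - u x) * ((b (x + y) - b x) \<bullet> grad Th y + D (x + y) * Th y))"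
proof -
 let ?g = "%z. grad Th (z - x)" and ?t = "%z. Th (z - x)"
 let ?k = "%z. (b z - b x) \<bullet> ?g z + D z * ?t z"
 have [measurable]: "b \<in> borel_measurable borel" "D \<in> borel_measurable borel" "Th \<in> borel_measurable borel" "u \<in> borel_measurable borel"
   "grad Th \<in> borel_measurable borel"
  using b u smooth_cs_measurable[OF Th] grad_measurable[OF smooth_csD[OF Th]] by (auto simp: bounded_field_def)
 have B: "norm (b z) <= B" "\<bar>D z\<bar> <= B" for z using b by (auto simp: bounded_field_def)
 have B0: "B >= 0" using B(2)[of 0] by linarith
 obtain M where M: "M >= 0" "!!x. norm (grad Th x) <= M" using grad_bounded[OF Th] by metis
 obtain T where T: "T >= 0" "!!x. \<bar>Th x\<bar> <= T" using smooth_cs_bounded[OF Th] by metis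
 have bd1: "\<bar>a' \<bullet> ?g z\<bar> <= A * M" if "norm a' <= A" for a' z A
  by (rule order_trans[OF Cauchy_Schwarz_ineq2]) (use that M order_trans[OF norm_ge_zero that] in "intro mult_mono; simp")
 have bd2: "\<bar>D z * ?t z\<bar> <= B * T" for z unfolding abs_mult using B(2) T B0 by (intro mult_mono) auto
 have i1: "integrable lborel (%z. u z * (b z \<bullet> ?g z + D z * ?t z))"
  by (rule integrable_mult_bounded[OF u, where B="B * M + B * T"])
   (measurable, use bd1[OF B(1)] bd2 in "blast intro: order_trans[OF abs_triangle_ineq] add_mono")
 have i2: "integrable lborel (%z. u z * (b x \<bullet> ?g z))"
  by (rule integrable_mult_bounded[OF u, where B="B * M"]) (measurable, rule bd1[OF B(1)])
 have supp: "EX R. ALL z. (?g z ~= 0 \<or> ?t z ~= 0) --> norm z <= R"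
 proof -
  obtain R where R: "!!x. Th x ~= 0 ==> norm x <= R" using smooth_cs_support[OF Th] by metis
  have cl: "closure {x. Th x ~= 0} \<subseteq> cball 0 R" by (rule closure_minimal) (use R in auto)
  have "norm y <= R" if nz: "grad Th y ~= 0" for y
  proof -
   obtain i where "pd i Th y ~= 0" using nz by (auto simp: vec_eq_iff)
   then have "y \<in> cball 0 R" using pd_outside_support[of y Th i] cl by blast
   then show ?thesis by simp
  qed
  then have "norm z <= R + norm x" if "?g z ~= 0 \<or> ?t z ~= 0" for z
   using that R[of "z - x"] norm_triangle_sub[of z x] by force
  then show ?thesis by blast
 qed
 then obtain R where R: "!!z. ?g z ~= 0 \<or> ?t z ~= 0 ==> norm z <= R" by blast
 have j1: "integrable lborel (%z. b z \<bullet> ?g z + D z * ?t z)"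
  by (rule integrable_bounded_support[where M="B * M + B * T" and R=R])
   (measurable, use bd1[OF B(1)] bd2 in \<open>blast intro: order_trans[OF abs_triangle_ineq] add_mono\<close>, use R in force)
 have j2: "integrable lborel (%z. b x \<bullet> ?g z)"
  by (rule integrable_bounded_support[where M="B * M" and R=R]) (measurable, rule bd1[OF B(1)], use R in force)
 have keq: "?k z = (b z \<bullet> ?g z + D z * ?t z) - b x \<bullet> ?g z" for z by (simp add: inner_diff_left)
 have gs: "grad ?t z = ?g z" for z by (rule grad_shift[OF smooth_csD[OF Th]])
 have c0: "(LBINT z. b z \<bullet> ?g z + D z * ?t z) = 0"
  using b t unfolding bounded_field_def by (auto simp: gs dest!: bspec[where x="?t"])
 have "(LBINT z. b x \<bullet> ?g z) = (\<Sum>i\<in>UNIV. \<integral>z. b x $ i * pd i ?t z \<partial>lborel)"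
  unfolding inner_vec_def
  by (subst Bochner_Integration.integral_sum)
   (use t test_functions_pd[OF t] in "auto simp: gs[symmetric] test_functions_iff intro!: smooth_cs_integrable")
 also have "... = 0" using t integral_pd_smooth_cs[of ?t] by (simp add: test_functions_iff)
 finally have k0: "(LBINT z. ?k z) = 0" unfolding keq using j1 j2 c0 by simp
 have "b x \<bullet> grad (mollify Th u) x - mollify Th f x = - (LBINT z. u z * (b x \<bullet> ?g z)) + (LBINT z. u z * (b z \<bullet> ?g z + D z * ?t z))"
  using a t unfolding adv_def grad_mollify[OF u Th] mollify_def by (auto simp: gs dest!: bspec[where x="?t"])
 also have "... = (LBINT z. u z * (b z \<bullet> ?g z + D z * ?t z) - u z * (b x \<bullet> ?g z))" using i1 i2 by simp
 also have "... = (LBINT z. u z * ?k z)" unfolding keq by (simp add: right_diff_distrib)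
 also have "... = (LBINT z. u z * ?k z) - u x * (LBINT z. ?k z)" using k0 by simp
 also have "... = (LBINT z. u z * ?k z - u x * ?k z)"
 proof -
  have "integrable lborel (%z. u z * ?k z)" unfolding keq right_diff_distrib by (rule Bochner_Integration.integrable_diff[OF i1 i2])
  moreover have "integrable lborel ?k" unfolding keq by (rule Bochner_Integration.integrable_diff[OF j1 j2])
  ultimately show ?thesis by simp
 qed
 also have "... = (LBINT z. (u z - u x) * ?k z)" by (simp only: left_diff_distrib)
 also have "... = (LBINT y. (u (y + x) - u x) * ?k (y + x))"
  by (rule integral_lborel_translate[symmetric]) measurable
 finally show ?thesis by (simp add: add.commute)
qed

lemma mollify_tendsto_L2:
 fixes Th :: "nat => real ^ 'n::finite => real"
 assumes u: "square_integrable lborel u" "integrable lborel u"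
  and Th: "!!k. smooth_cs (Th k)" "!!k y. 0 <= Th k y" "!!k. (LBINT y. Th k y) = 1"
   "!!k y. Th k y ~= 0 ==> norm y <= r k" "r ----> 0"
 shows "\<forall>\<^sub>F k in sequentially. square_integrable lborel (%x. mollify (Th k) u x - u x)"
  and "(%k. norm_L2 lborel (%x. mollify (Th k) u x - u x)) ----> 0"
proof -
 have um [measurable]: "u \<in> borel_measurable borel" using u by (simp add: square_integrable_def)
 have Thm [measurable]: "Th k \<in> borel_measurable borel" for k by (rule smooth_cs_measurable[OF Th(1)])
 have nn: "(\<integral>\<^sup>+y. ennreal (Th k y) \<partial>lborel) <= ennreal 1" for k
  using nn_integral_eq_integral[OF smooth_cs_integrable[OF Th(1)], of k] Th(2,3) by simp
 have m: "(%x. mollify (Th k) u x - u x) \<in> borel_measurable borel" for k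
  using C_inf_borel[OF C_inf_mollify[OF u(2) Th(1)]] by simp
 have bd: "AE x in lborel. ennreal \<bar>mollify (Th k) u x - u x\<bar> <= (\<integral>\<^sup>+y. ennreal (Th k y * \<bar>u (x + y) - u x\<bar>) \<partial>lborel)" for k
 proof (rule AE_I2)
  fix x
  have i: "integrable lborel (%y. u (x + y) * Th k y)"
   using integrable_mult_smooth_cs[OF integrable_lborel_translate[OF u(2), of x] Th(1)] by (simp add: add.commute)
  have "mollify (Th k) u x - u x = (LBINT y. u (x + y) * Th k y) - u x * (LBINT y. Th k y)"
   using Th(3) by (simp add: mollify_shift[OF um Th(1)])
  also have "... = (LBINT y. u (x + y) * Th k y - u x * Th k y)"
   using i smooth_cs_integrable[OF Th(1)] by simp
  finally have eq: "mollify (Th k) u x - u x = (LBINT y. Th k y * (u (x + y) - u x))"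
   by (simp add: algebra_simps)
  have "integrable lborel (%y. Th k y * (u (x + y) - u x))"
   using Bochner_Integration.integrable_diff[OF i integrable_mult_right[OF smooth_cs_integrable[OF Th(1)], of "u x" k]]
   by (simp add: algebra_simps)
  from integral_norm_bound_ennreal[OF this] Th(2)
  show "ennreal \<bar>mollify (Th k) u x - u x\<bar> <= (\<integral>\<^sup>+y. ennreal (Th k y * \<bar>u (x + y) - u x\<bar>) \<partial>lborel)"
   unfolding eq by (simp add: abs_mult)
 qed
 show "\<forall>\<^sub>F k in sequentially. square_integrable lborel (%x. mollify (Th k) u x - u x)"
  "(%k. norm_L2 lborel (%x. mollify (Th k) u x - u x)) ----> 0"
  using weighted_difference_L2[OF u(1) Thm Th(2) nn Th(4,5) m bd] by auto
qed

text \<open>The commutator weight is dominated by L |y| times the sum of the |pd i Th|, plus B Th.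
  Its mass stays bounded by the scale invariant estimate for the kernels, so
  \<open>weighted_difference_L2\<close> applies.\<close>

lemma commutator_tendsto_L2:
 fixes Th :: "nat => real ^ 'n::finite => real"
 assumes Om: "open Om" and u: "square_integrable lborel u" "integrable lborel u" and f: "integrable lborel f"
  and Th: "!!k. smooth_cs (Th k)" "!!k y. 0 <= Th k y" "!!k. (LBINT y. Th k y) = 1"
   "!!k y. y \<in> closure {y. Th k y ~= 0} ==> y \<in> cone_set e s Ta & norm y <= r k" "r ----> 0"
   "!!k i. (LBINT y. norm y * \<bar>pd i (Th k) y\<bar>) <= C"
  and b: "bounded_field Om b D B" and a: "adv Om b D u f" and c: "cone_at Om c R e s Ta" and L: "cone_Lip Om c R e s Ta b"
 defines "K \<equiv> %k x. indicator (Om \<inter> ball c (2 * R)) x * (b x \<bullet> grad (mollify (Th k) u) x - mollify (Th k) f x)"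
 shows "\<forall>\<^sub>F k in sequentially. square_integrable lborel (K k)" and "(%k. norm_L2 lborel (K k)) ----> 0"
proof -
 obtain L where L: "L >= 0" "AE x in lborel. x \<in> Om \<inter> ball c (2 * R) -->
  (AE y in lborel. y \<in> cone_set e s Ta --> norm (b (x + y) - b x) <= L * norm y)"
  using L unfolding cone_Lip_def by blast
 have [measurable]: "b \<in> borel_measurable borel" "D \<in> borel_measurable borel" "u \<in> borel_measurable borel"
  using b u by (auto simp: bounded_field_def)
 have B: "norm (b z) <= B" "\<bar>D z\<bar> <= B" for z using b by (auto simp: bounded_field_def)
 have B0: "B >= 0" using B(2)[of 0] by linarith
 note Thm [measurable] = smooth_cs_measurable[OF Th(1)] smooth_cs_measurable[OF smooth_cs_pd[OF Th(1)]] grad_measurable[OF smooth_csD[OF Th(1)]]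
 define w where "w k y = (\<Sum>i\<in>UNIV. L * (norm y * \<bar>pd i (Th k) y\<bar>)) + B * Th k y" for k y
 have wm: "w k \<in> borel_measurable borel" for k unfolding w_def by measurable
 have w0: "0 <= w k y" for k y unfolding w_def using L(1) B0 Th(2) by (intro add_nonneg_nonneg sum_nonneg mult_nonneg_nonneg) auto
 have pi: "integrable lborel (%y. norm y * \<bar>pd i (Th k) y\<bar>)" for k i
 proof -
  obtain Q where Q: "!!x. pd i (Th k) x ~= 0 ==> norm x <= Q" using smooth_cs_support[OF smooth_cs_pd[OF Th(1)]] by metis
  obtain M where M: "M >= 0" "!!x. \<bar>pd i (Th k) x\<bar> <= M" using smooth_cs_bounded[OF smooth_cs_pd[OF Th(1)]] by metis
  have "\<bar>norm y * \<bar>pd i (Th k) y\<bar>\<bar> <= \<bar>Q\<bar> * M" for y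
   using Q[of y] M by (cases "pd i (Th k) y = 0") (auto simp: abs_mult intro!: mult_mono)
  then show ?thesis by (rule integrable_bounded_support[where R=Q, rotated]) (use Q in auto)
 qed
 have wC: "(\<integral>\<^sup>+y. ennreal (w k y) \<partial>lborel) <= ennreal (real CARD('n) * (L * C) + B)" for k
 proof -
  have iw: "integrable lborel (w k)" unfolding w_def
   by (intro Bochner_Integration.integrable_add Bochner_Integration.integrable_sum integrable_mult_right pi smooth_cs_integrable Th(1))
  have "(LBINT y. w k y) = (\<Sum>i\<in>UNIV. L * (LBINT y. norm y * \<bar>pd i (Th k) y\<bar>)) + B * (LBINT y. Th k y)"
   unfolding w_def using pi smooth_cs_integrable[OF Th(1)] by simp
  also have "... <= (\<Sum>i\<in>(UNIV::'n set). L * C) + B * 1"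
   using Th(3,6) L(1) B0 by (intro add_mono sum_mono mult_left_mono) auto
  finally have "(LBINT y. w k y) <= real CARD('n) * (L * C) + B" by simp
  then show ?thesis using nn_integral_eq_integral[OF iw] w0 by (simp add: ennreal_leI)
 qed
 have off: "pd i (Th k) y = 0 & Th k y = 0" if "y \<notin> closure {y. Th k y ~= 0}" for k y i
  using pd_outside_support[OF that] that closure_subset[of "{y. Th k y ~= 0}"] by auto
 have wr: "norm y <= r k" if "w k y ~= 0" for k y
 proof (rule ccontr)
  assume "\<not> norm y <= r k"
  then have n: "y \<notin> closure {y. Th k y ~= 0}" using Th(4) by blast
  have "w k y = 0" unfolding w_def using off[OF n] by simp
  then show False using that by simp
 qed
 have Km: "K k \<in> borel_measurable borel" for k
 proof -
  have 1: "Om \<inter> ball c (2 * R) \<in> sets borel" using Om by simp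
  have 2: "grad (mollify (Th k) u) \<in> borel_measurable borel" "mollify (Th k) f \<in> borel_measurable borel"
   using grad_measurable[OF C_inf_mollify[OF u(2) Th(1)]] C_inf_borel[OF C_inf_mollify[OF f Th(1)]] by auto
  show ?thesis unfolding K_def
   by (intro borel_measurable_times borel_measurable_indicator borel_measurable_diff borel_measurable_inner 1 2) measurable
 qed
 have bd: "AE x in lborel. ennreal \<bar>K k x\<bar> <= (\<integral>\<^sup>+y. ennreal (w k y * \<bar>u (x + y) - u x\<bar>) \<partial>lborel)" for k
  using L(2)
 proof eventually_elim
  case (elim x)
  show ?case
  proof (cases "x \<in> Om \<inter> ball c (2 * R)")
   case True
   have "(%z. Th k (z - x)) \<in> test_functions Om"
    by (rule test_function_shift[OF Th(1) _ c]) (use Th(4) True closure_subset[of Om] in auto)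
   from mollify_commutator[OF u(2) f Th(1) b a this] True
   have K: "K k x = (LBINT y. (u (x + y) - u x) * ((b (x + y) - b x) \<bullet> grad (Th k) y + D (x + y) * Th k y))"
    by (simp add: K_def)
   let ?F = "%y. (u (x + y) - u x) * ((b (x + y) - b x) \<bullet> grad (Th k) y + D (x + y) * Th k y)"
   have "ennreal \<bar>K k x\<bar> <= (\<integral>\<^sup>+y. ennreal \<bar>?F y\<bar> \<partial>lborel)"
   \<comment> \<open>If the integrand is not integrable, its Bochner integral is 0 and the bound is
     trivial.\<close>
   proof (cases "integrable lborel ?F")
    case True
    then show ?thesis unfolding K using integral_norm_bound_ennreal[OF True] by simp
   qed (simp add: K not_integrable_integral_eq)
   also have "... <= (\<integral>\<^sup>+y. ennreal (w k y * \<bar>u (x + y) - u x\<bar>) \<partial>lborel)"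
   proof (rule nn_integral_mono_AE)
    have "AE y in lborel. y \<in> cone_set e s Ta --> norm (b (x + y) - b x) <= L * norm y" using elim True by blast
    then show "AE y in lborel. ennreal \<bar>?F y\<bar> <= ennreal (w k y * \<bar>u (x + y) - u x\<bar>)"
    proof eventually_elim
     case (elim y)
     have "\<bar>(b (x + y) - b x) \<bullet> grad (Th k) y + D (x + y) * Th k y\<bar> <= w k y"
     proof (cases "y \<in> closure {y. Th k y ~= 0}")
      case True
      then have le: "norm (b (x + y) - b x) <= L * norm y" using elim Th(4) by blast
      have "\<bar>(b (x + y) - b x) \<bullet> grad (Th k) y\<bar> <= norm (b (x + y) - b x) * norm (grad (Th k) y)"
       by (rule Cauchy_Schwarz_ineq2)
      also have "... <= (L * norm y) * (\<Sum>i\<in>UNIV. \<bar>pd i (Th k) y\<bar>)"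
       using le norm_le_l1_cart[of "grad (Th k) y"] L(1) by (intro mult_mono) auto
      also have "... = (\<Sum>i\<in>UNIV. L * (norm y * \<bar>pd i (Th k) y\<bar>))" by (simp add: sum_distrib_left mult_ac)
      finally have "\<bar>(b (x + y) - b x) \<bullet> grad (Th k) y\<bar> <= (\<Sum>i\<in>UNIV. L * (norm y * \<bar>pd i (Th k) y\<bar>))" .
      moreover have "\<bar>D (x + y) * Th k y\<bar> <= B * Th k y" using B(2) Th(2) by (simp add: abs_mult mult_right_mono)
      ultimately show ?thesis unfolding w_def by linarith
     next
      case False
      have "grad (Th k) y = 0" "Th k y = 0" using off[OF False] by (simp_all add: vec_eq_iff)
      then show ?thesis using w0 by simp
     qed
     from mult_right_mono[OF this abs_ge_zero[of "u (x + y) - u x"]]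
     have "\<bar>?F y\<bar> <= w k y * \<bar>u (x + y) - u x\<bar>" by (simp only: abs_mult mult.commute)
     then show ?case by (rule ennreal_leI)
    qed
   qed
   finally show ?thesis .
  qed (simp add: K_def)
 qed
 show "\<forall>\<^sub>F k in sequentially. square_integrable lborel (K k)" "(%k. norm_L2 lborel (K k)) ----> 0"
  using weighted_difference_L2[OF u(1) wm w0 wC wr Th(5) Km bd] by auto
qed

text \<open>Square integrability is part of the notion, since \<open>norm_L2\<close> is 0 at a
  function whose square is not integrable. It is demanded eventually, as the mollification estimates
  deliver it for large k.\<close>

definition L2null :: "'a measure => (nat => 'a => real) => bool" where
 "L2null M g \<longleftrightarrow> (\<forall>\<^sub>F k in sequentially. square_integrable M (g k)) & (%k. norm_L2 M (g k)) ----> 0"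

lemma L2null_zero: "L2null M (%k x. 0)"
 by (simp add: L2null_def norm_L2_def)

lemma L2null_add:
 assumes "L2null M f" "L2null M g"
 shows "L2null M (%k x. f k x + g k x)"
proof -
 have e: "\<forall>\<^sub>F k in sequentially. square_integrable M (f k) & square_integrable M (g k)"
  using assms by (auto simp: L2null_def eventually_conj_iff)
 have "(%k. norm_L2 M (%x. f k x + g k x)) ----> 0"
 proof (rule Lim_null_comparison)
  show "\<forall>\<^sub>F k in sequentially. norm (norm_L2 M (%x. f k x + g k x)) <= norm_L2 M (f k) + norm_L2 M (g k)"
   using e by eventually_elim (simp add: norm_L2_triangle)
  show "(%k. norm_L2 M (f k) + norm_L2 M (g k)) ----> 0"
   using assms tendsto_add[of "%k. norm_L2 M (f k)" 0 _ "%k. norm_L2 M (g k)" 0] by (simp add: L2null_def)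
 qed
 moreover have "\<forall>\<^sub>F k in sequentially. square_integrable M (%x. f k x + g k x)"
  using e by eventually_elim (simp add: sqint_add)
 ultimately show ?thesis by (simp add: L2null_def)
qed

lemma L2null_sum: "(!!c. c \<in> C ==> L2null M (g c)) ==> L2null M (%k x. \<Sum>c\<in>C. g c k x)"
 by (induction C rule: infinite_finite_induct) (auto simp: L2null_zero intro: L2null_add)

lemma L2null_bounded_mult:
 assumes "L2null M g" "h \<in> borel_measurable M" "!!x. \<bar>h x\<bar> <= (B::real)"
 shows "L2null M (%k x. h x * g k x)"
proof -
 have B: "0 <= B" using assms(3)[of undefined] by linarith
 have e: "\<forall>\<^sub>F k in sequentially. square_integrable M (g k)" using assms by (simp add: L2null_def)
 have b: "\<bar>h x * g k x\<bar> <= B * \<bar>g k x\<bar>" for k x by (simp add: abs_mult assms(3) mult_right_mono)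
 have "(%k. norm_L2 M (%x. h x * g k x)) ----> 0"
 proof (rule Lim_null_comparison)
  show "\<forall>\<^sub>F k in sequentially. norm (norm_L2 M (%x. h x * g k x)) <= B * norm_L2 M (g k)"
   using e
  proof eventually_elim
   case (elim k)
   have m: "(%x. h x * g k x) \<in> borel_measurable M"
    using assms(2) elim by (auto simp: square_integrable_def)
   show ?case using norm_L2_mono_AE[OF elim m AE_I2[OF b] B] by simp
  qed
  show "(%k. B * norm_L2 M (g k)) ----> 0" using assms tendsto_mult_right_zero by (auto simp: L2null_def)
 qed
 moreover have "\<forall>\<^sub>F k in sequentially. square_integrable M (%x. h x * g k x)"
  using e by eventually_elim (rule sqint_mult_bounded[OF _ assms(2) AE_I2[OF assms(3)]])
 ultimately show ?thesis by (simp add: L2null_def)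
qed

lemma L2null_cong:
 assumes "L2null M g" "\<forall>\<^sub>F k in sequentially. g' k = g k"
 shows "L2null M g'"
proof -
 have "\<forall>\<^sub>F k in sequentially. square_integrable M (g' k)"
  using assms(1)[unfolded L2null_def, THEN conjunct1] assms(2) by eventually_elim simp
 moreover have "(%k. norm_L2 M (g' k)) ----> 0"
  by (rule Lim_transform_eventually[OF assms(1)[unfolded L2null_def, THEN conjunct2]])
   (use assms(2) in "eventually_elim, simp")
 ultimately show ?thesis by (simp add: L2null_def)
qed

section \<open>Partitions of unity and density of smooth functions\<close>

text \<open>Telescoping: a new function \<open>b c\<close> receives the share of 1 that the others
  have left, namely their product of \<open>1 - b d x\<close>. The sum is 1 wherever some
  \<open>b c\<close> equals 1.\<close>

lemma partition_of_unity:
 fixes b :: "'c => real ^ 'n::finite => real"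
 assumes "finite C" "!!c. c \<in> C ==> C_inf (b c)" "!!c x. c \<in> C ==> 0 <= b c x & b c x <= 1"
 shows "\<exists>Ps. (ALL c:C. C_inf (Ps c) & (ALL x. 0 <= Ps c x & Ps c x <= b c x)) & (ALL x. (\<Sum>c\<in>C. Ps c x) = 1 - (\<Prod>c\<in>C. 1 - b c x))"
 using assms
proof (induction C)
 case (insert c C)
 then obtain Ps where Ps: "ALL c:C. C_inf (Ps c) & (ALL x. 0 <= Ps c x & Ps c x <= b c x)"
  "ALL x. (\<Sum>c\<in>C. Ps c x) = 1 - (\<Prod>c\<in>C. 1 - b c x)" by auto
 let ?P = "%x. \<Prod>d\<in>C. 1 - b d x"
 have P: "0 <= ?P x" "?P x <= 1" for x
  using insert.prems by (auto intro!: prod_nonneg prod_le_1)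
 have C: "C_inf ?P" using insert.prems by (intro C_inf_prod C_inf_diff C_inf_const) auto
 let ?Ps = "Ps(c := %x. b c x * ?P x)"
 have "b c x * ?P x <= b c x" for x using P[of x] insert.prems(2)[of c x] mult_left_mono[of "?P x" 1 "b c x"] by simp
 moreover have "(\<Sum>d\<in>C. ?Ps d x) = (\<Sum>d\<in>C. Ps d x)" for x using insert.hyps by (intro sum.cong) auto
 ultimately have "(ALL d:insert c C. C_inf (?Ps d) & (ALL x. 0 <= ?Ps d x & ?Ps d x <= b d x)) &
   (ALL x. (\<Sum>d\<in>insert c C. ?Ps d x) = 1 - (\<Prod>d\<in>insert c C. 1 - b d x))"
  using Ps insert.hyps insert.prems C P by (auto simp: algebra_simps)
 then show ?case by blast
qed auto

text \<open>The factor 3/2 leaves a margin of R/2 inside the balls of radius 2 R in which the cones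
  are available, so that short kernels do not spread a localised function beyond them.\<close>

lemma ball_partition_of_unity:
 fixes C :: "(real ^ 'n::finite) set"
 assumes "finite C" "!!c. c \<in> C ==> R c > 0" "X \<subseteq> (\<Union>c\<in>C. ball c (R c))"
 obtains Ps where "!!c. c \<in> C ==> smooth_cs (Ps c)" "!!c x. c \<in> C ==> 0 <= Ps c x" "!!c x. c \<in> C ==> Ps c x <= 1"
  "!!c. c \<in> C ==> closure {x. Ps c x ~= 0} \<subseteq> cball c (3 / 2 * R c)" "!!x. x \<in> X ==> (\<Sum>c\<in>C. Ps c x) = 1"
proof -
 have "EX b. smooth_cs b & (ALL x. 0 <= b x & b x <= 1) & (ALL x:cball c (R c). b x = 1) & closure {x. b x ~= 0} \<subseteq> ball c (3 / 2 * R c)"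
  if "c \<in> C" for c
 proof -
  have "cball c (R c) \<subseteq> ball c (3 / 2 * R c)" using assms(2)[OF that] by auto
  from smooth_Urysohn[OF compact_cball open_ball this] show ?thesis by metis
 qed
 then obtain b where b: "!!c. c \<in> C ==> smooth_cs (b c)" "!!c x. c \<in> C ==> 0 <= b c x & b c x <= 1"
  "!!c x. c \<in> C ==> x \<in> cball c (R c) ==> b c x = 1" "!!c. c \<in> C ==> closure {x. b c x ~= 0} \<subseteq> ball c (3 / 2 * R c)"
  by metis
 obtain Ps where Ps: "ALL c:C. C_inf (Ps c) & (ALL x. 0 <= Ps c x & Ps c x <= b c x)"
  "ALL x. (\<Sum>c\<in>C. Ps c x) = 1 - (\<Prod>c\<in>C. 1 - b c x)"
  using partition_of_unity[of C b, OF assms(1) smooth_csD[OF b(1)] b(2)] by blast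
 have sub: "{x. Ps c x ~= 0} \<subseteq> {x. b c x ~= 0}" if "c \<in> C" for c
 proof
  fix x assume "x \<in> {x. Ps c x ~= 0}"
  then have "Ps c x > 0" using Ps(1) that by (simp add: order_less_le)
  moreover have "Ps c x <= b c x" using Ps(1) that by blast
  ultimately show "x \<in> {x. b c x ~= 0}" by simp
 qed
 show ?thesis
 proof (rule that)
  fix c assume c: "c \<in> C"
  show "smooth_cs (Ps c)" using Ps(1) c b(1)[OF c] bounded_subset[OF _ sub[OF c]] by (auto simp: smooth_cs_def)
  show "closure {x. Ps c x ~= 0} \<subseteq> cball c (3 / 2 * R c)"
   using closure_mono[OF sub[OF c]] b(4)[OF c] ball_subset_cball by blast
  show "0 <= Ps c x" "Ps c x <= 1" for x using Ps(1) b(2)[OF c, of x] c order_trans by blast+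
 next
  fix x assume "x \<in> X"
  then obtain c where c: "c \<in> C" "x \<in> ball c (R c)" using assms(3) by blast
  then have "b c x = 1" using b(3) ball_subset_cball by blast
  then have "(\<Prod>c\<in>C. 1 - b c x) = 0" using assms(1) c(1) by (auto intro!: prod_zero)
  then show "(\<Sum>c\<in>C. Ps c x) = 1" using Ps(2) by simp
 qed
qed

text \<open>The equation for v is tested with \<open>Ps x * Ph x\<close>; the cut-off produces the
  additional term with \<open>grad Ps\<close>.\<close>

lemma adv_product:
 assumes Om: "Om \<in> sets borel" "bounded Om" and v: "sqz Om v" and f: "sqz Om f"
  and b: "bounded_field Om b D B" and a: "adv Om b D v f" and Ps: "smooth_cs Ps"
 shows "adv Om b D (%x. Ps x * v x) (%x. Ps x * f x + (b x \<bullet> grad Ps x) * v x)"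
  and "sqz Om (%x. Ps x * v x)" and "sqz Om (%x. Ps x * f x + (b x \<bullet> grad Ps x) * v x)"
proof -
 have [measurable]: "b \<in> borel_measurable borel" "D \<in> borel_measurable borel"
  using b by (auto simp: bounded_field_def)
 have B: "norm (b z) <= B" "\<bar>D z\<bar> <= B" for z using b by (auto simp: bounded_field_def)
 have B0: "B >= 0" using B(2)[of 0] by linarith
 have vi: "integrable lborel v" "integrable lborel f" using sqz_integrable[OF Om] v f by auto
 have bg: "\<bar>b x \<bullet> grad Ph x\<bar> <= B * M" if "!!x. norm (grad Ph x) <= M" for Ph x M
  by (rule order_trans[OF Cauchy_Schwarz_ineq2]) (use that B B0 in "intro mult_mono; simp")
 obtain M where M: "M >= 0" "!!x. norm (grad Ps x) <= M" using grad_bounded[OF Ps] by metis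
 obtain P where P: "P >= 0" "!!x. \<bar>Ps x\<bar> <= P" using smooth_cs_bounded[OF Ps] by metis
 note [measurable] = smooth_cs_measurable[OF Ps] grad_measurable[OF smooth_csD[OF Ps]]
 show "sqz Om (%x. Ps x * v x)" by (rule sqz_mult_bounded[OF v _ P(2)]) measurable
 have "sqz Om (%x. Ps x * f x)" by (rule sqz_mult_bounded[OF f _ P(2)]) measurable
 moreover have "sqz Om (%x. (b x \<bullet> grad Ps x) * v x)" by (rule sqz_mult_bounded[OF v _ bg[OF M(2)]]) measurable
 ultimately show "sqz Om (%x. Ps x * f x + (b x \<bullet> grad Ps x) * v x)" using sqz_lin[of Om _ _ 1 1] by simp
 show "adv Om b D (%x. Ps x * v x) (%x. Ps x * f x + (b x \<bullet> grad Ps x) * v x)"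
  unfolding adv_def
 proof
  fix Ph assume Ph: "Ph \<in> test_functions Om"
  then have cs: "smooth_cs Ph" by (simp add: test_functions_iff)
  obtain Q where Q: "Q >= 0" "!!x. norm (grad Ph x) <= Q" using grad_bounded[OF cs] by metis
  obtain T where T: "T >= 0" "!!x. \<bar>Ph x\<bar> <= T" using smooth_cs_bounded[OF cs] by metis
  note [measurable] = smooth_cs_measurable[OF cs] grad_measurable[OF smooth_csD[OF cs]]
  have t: "(%x. Ps x * Ph x) \<in> test_functions Om" by (rule test_functions_mult[OF smooth_csD[OF Ps] Ph])
  have g: "grad (%x. Ps x * Ph x) x = Ps x *\<^sub>R grad Ph x + Ph x *\<^sub>R grad Ps x" for x
   using Ps cs by (simp add: vec_eq_iff smooth_csD)
  have i0: "integrable lborel (%x. v x * ((b x \<bullet> grad Ps x) * Ph x))"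
  proof (rule integrable_mult_bounded[OF vi(1), where B="B * M * T"])
   show "\<bar>(b x \<bullet> grad Ps x) * Ph x\<bar> <= B * M * T" for x
    unfolding abs_mult using bg[OF M(2)] T M(1) B0 by (intro mult_mono) auto
  qed measurable
  have i1: "integrable lborel (%x. f x * (Ps x * Ph x))"
   using integrable_mult_smooth_cs[OF vi(2)] t by (simp add: test_functions_iff)
  have i2: "integrable lborel (%x. v x * (Ps x * (b x \<bullet> grad Ph x + D x * Ph x)))"
  proof (rule integrable_mult_bounded[OF vi(1), where B="P * (B * Q + B * T)"])
   show "\<bar>Ps x * (b x \<bullet> grad Ph x + D x * Ph x)\<bar> <= P * (B * Q + B * T)" for x
   proof -
    have "\<bar>D x * Ph x\<bar> <= B * T" unfolding abs_mult using B T B0 by (intro mult_mono) auto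
    then have "\<bar>b x \<bullet> grad Ph x + D x * Ph x\<bar> <= B * Q + B * T" using bg[OF Q(2), of x] by linarith
    then show ?thesis unfolding abs_mult using P by (intro mult_mono) auto
   qed
  qed measurable
  have "(LBINT x. f x * (Ps x * Ph x)) = - (LBINT x. v x * (Ps x * (b x \<bullet> grad Ph x + D x * Ph x)) + v x * ((b x \<bullet> grad Ps x) * Ph x))"
   using a[unfolded adv_def, rule_format, OF t] unfolding g by (simp add: inner_add_right algebra_simps)
  also have "... = - (LBINT x. v x * (Ps x * (b x \<bullet> grad Ph x + D x * Ph x))) - (LBINT x. v x * ((b x \<bullet> grad Ps x) * Ph x))"
   using i0 i2 by simp
  finally have "(LBINT x. f x * (Ps x * Ph x)) + (LBINT x. v x * ((b x \<bullet> grad Ps x) * Ph x)) = - (LBINT x. v x * (Ps x * (b x \<bullet> grad Ph x + D x * Ph x)))"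
   by simp
  moreover have "(LBINT x. f x * (Ps x * Ph x)) + (LBINT x. v x * ((b x \<bullet> grad Ps x) * Ph x)) =
    (LBINT x. (Ps x * f x + (b x \<bullet> grad Ps x) * v x) * Ph x)"
   using Bochner_Integration.integral_add[OF i1 i0] by (simp add: algebra_simps)
  ultimately show "(LBINT x. (Ps x * f x + (b x \<bullet> grad Ps x) * v x) * Ph x) = - (LBINT x. Ps x * v x * (b x \<bullet> grad Ph x + D x * Ph x))"
   by (simp add: mult_ac)
 qed
qed

lemma mollify_outside:
 assumes u0: "!!z. u z ~= 0 ==> z \<in> cball c (3 / 2 * R)" and Th: "!!y. Th y ~= 0 ==> norm y <= r" and r: "r < R / 2"
  and x: "x \<notin> ball c (2 * R)"
 shows "mollify Th u x = 0"
proof -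
 have "u z * Th (z - x) = 0" for z
 proof (rule ccontr)
  assume "\<not> ?thesis"
  then have "dist c z <= 3 / 2 * R" "dist z x <= r" using u0[of z] Th[of "z - x"] by (auto simp: dist_norm)
  then show False using dist_triangle[of c x z] x r by simp
 qed
 then have "(%z. u z * Th (z - x)) = (%z. 0)" by (rule ext)
 then show ?thesis unfolding mollify_def by (simp only: Bochner_Integration.integral_zero)
qed

definition cone_mollifier :: "real ^ 'n::finite => real => real => (nat => real ^ 'n => real) => (nat => real) => real => bool" where
 "cone_mollifier e s Ta Th r K \<longleftrightarrow> (ALL k. smooth_cs (Th k) & (ALL y. 0 <= Th k y) & (LBINT y. Th k y) = 1 &
   (ALL y:closure {y. Th k y ~= 0}. y \<in> cone_set e s Ta & norm y <= r k) &
   (ALL i. (LBINT y. norm y * \<bar>pd i (Th k) y\<bar>) <= K)) & r ----> 0"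

lemma cone_mollifier_ex:
 assumes "s > 0" "Ta > 0"
 shows "\<exists>Th r K. cone_mollifier e s Ta Th r K"
proof (rule cone_mollifier_exists[OF assms, of e])
 fix Th r K
 assume *: "!!k::nat. smooth_cs (Th k)" "!!k y. 0 <= Th k y" "!!k. (LBINT y. Th k y) = 1"
  "!!k y. Th k y ~= 0 ==> EX t z. 0 < t & t < Ta & norm (z - e) < s & y = t *\<^sub>R z"
  "!!k y. y \<in> closure {y. Th k y ~= 0} ==> EX t z. 0 < t & t < Ta & norm (z - e) <= s & y = t *\<^sub>R z & norm y <= r k"
  "r ----> 0" "!!k i. (LBINT y. norm y * \<bar>pd i (Th k) y\<bar>) <= K"
 have "y \<in> cone_set e s Ta & norm y <= r k" if "y \<in> closure {y. Th k y ~= 0}" for k y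
  using *(5)[OF that] unfolding cone_set_def by blast
 with *(1,2,3,6,7) have "cone_mollifier e s Ta Th r K" unfolding cone_mollifier_def by simp
 then show ?thesis by blast
qed

text \<open>With s <= 1/2, |e| = 1 and 2 Ta <= R every cone vector is shorter than R. The cone
  condition is asked for at twice the radius, so that a point reached by a cone step from the ball
  of radius 2 R can again be the vertex of a cone inside the domain.\<close>

locale cone_cover =
 fixes Om :: "(real ^ 'n::finite) set" and C :: "(real ^ 'n) set" and R s Ta :: "real ^ 'n => real" and e :: "real ^ 'n => real ^ 'n"
 assumes open_dom: "open Om" and bounded_dom: "bounded Om" and finite_C: "finite C"
  and cone2: "!!c. c \<in> C ==> cone_at Om c (2 * R c) (e c) (s c) (Ta c)"
  and sizes: "!!c. c \<in> C ==> s c <= 1 / 2 & 2 * Ta c <= R c & norm (e c) = 1"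
  and cover: "closure Om \<subseteq> (\<Union>c\<in>C. ball c (R c))"
begin

lemma dom_sets [measurable, simp]: "Om \<in> sets borel"
 using open_dom by simp

lemma cone:
 assumes "c \<in> C"
 shows "cone_at Om c (R c) (e c) (s c) (Ta c)"
proof -
 have "R c > 0" using cone2[OF assms] by (simp add: cone_at_def)
 then have "ball c (2 * R c) \<subseteq> ball c (2 * (2 * R c))" by auto
 then show ?thesis using cone2[OF assms] unfolding cone_at_def by auto
qed

lemma R_pos: "c \<in> C ==> R c > 0" and s_pos: "c \<in> C ==> s c > 0" and Ta_pos: "c \<in> C ==> Ta c > 0"
 using cone by (auto simp: cone_at_def)

definition cone_Lipschitz :: "(real ^ 'n => real ^ 'n) => bool" where
 "cone_Lipschitz b \<longleftrightarrow> (ALL c:C. cone_Lip Om c (R c) (e c) (s c) (Ta c) b)"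

text \<open>One sequence serves all fields in \<open>M\<close>: H^1 needs all coordinate directions
  at once, the graph space a single field. Each localised piece has its own cone, and the mollified
  pieces are added. The last conclusion holds because kernels and partition are nonnegative and the
  values at the boundary depend on v near the boundary only; it carries lower bounds over to
  traces.\<close>

theorem Friedrichs_density:
 assumes v: "sqz Om v" and b: "!!m. m \<in> M ==> bounded_field Om (b m) (D m) (B m)" and L: "!!m. m \<in> M ==> cone_Lipschitz (b m)"
  and a: "!!m. m \<in> M ==> adv Om (b m) (D m) v (f m)" and f: "!!m. m \<in> M ==> sqz Om (f m)"
 obtains F where "!!k. C_inf (F k)" "L2null lborel (%k x. indicator Om x * (F k x - v x))"
  "!!m. m \<in> M ==> L2null lborel (%k x. indicator Om x * (b m x \<bullet> grad (F k) x - f m x))"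
  "!!N. open N ==> frontier Om \<subseteq> N ==> AE x in lborel. x \<in> Om \<inter> N --> 0 <= v x ==>
    \<forall>\<^sub>F k in sequentially. ALL x:frontier Om. 0 <= F k x"
proof -
 obtain Ps where Ps: "!!c. c \<in> C ==> smooth_cs (Ps c)" "!!c x. c \<in> C ==> 0 <= Ps c x" "!!c x. c \<in> C ==> Ps c x <= 1"
  "!!c. c \<in> C ==> closure {x. Ps c x ~= 0} \<subseteq> cball c (3 / 2 * R c)" "!!x. x \<in> closure Om ==> (\<Sum>c\<in>C. Ps c x) = 1"
  using ball_partition_of_unity[OF finite_C R_pos cover] by blast
 have "\<exists>Th r K. cone_mollifier (e c) (s c) (Ta c) Th r K" if c: "c \<in> C" for c
  by (rule cone_mollifier_ex[OF s_pos[OF c] Ta_pos[OF c]])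
 then obtain Th r K where mol: "!!c. c \<in> C ==> cone_mollifier (e c) (s c) (Ta c) (Th c) (r c) (K c)" by metis
 have Th: "!!c k. c \<in> C ==> smooth_cs (Th c k)" "!!c k y. c \<in> C ==> 0 <= Th c k y" "!!c k. c \<in> C ==> (LBINT y. Th c k y) = 1"
   "!!c k y. c \<in> C ==> y \<in> closure {y. Th c k y ~= 0} ==> y \<in> cone_set (e c) (s c) (Ta c) & norm y <= r c k"
   "!!c k i. c \<in> C ==> (LBINT y. norm y * \<bar>pd i (Th c k) y\<bar>) <= K c" "!!c. c \<in> C ==> r c ----> 0"
  using mol unfolding cone_mollifier_def by blast+
 have Thr: "norm y <= r c k" if "c \<in> C" "Th c k y ~= 0" for c k y
  using Th(4)[OF that(1), of y k] that(2) closure_subset[of "{y. Th c k y ~= 0}"] by blast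
 define w where "w c x = Ps c x * v x" for c x
 define h where "h m c x = Ps c x * f m x + (b m x \<bullet> grad (Ps c) x) * v x" for m c x
 have w: "sqz Om (w c)" if c: "c \<in> C" for c
 proof -
  obtain P where "!!x. \<bar>Ps c x\<bar> <= P" using smooth_cs_bounded[OF Ps(1)[OF c]] by metis
  then show ?thesis unfolding w_def using smooth_cs_measurable[OF Ps(1)[OF c]] by (intro sqz_mult_bounded[OF v]) auto
 qed
 have h: "adv Om (b m) (D m) (w c) (h m c)" "sqz Om (h m c)" if "c \<in> C" "m \<in> M" for c m
  unfolding w_def h_def
  using adv_product[OF dom_sets bounded_dom v f[OF that(2)] b[OF that(2)] a[OF that(2)] Ps(1)[OF that(1)]] by auto
 have wi: "integrable lborel (w c)" "square_integrable lborel (w c)" if "c \<in> C" for c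
  using sqz_integrable[OF dom_sets bounded_dom w[OF that]] sqzD(1)[OF w[OF that]] by auto
 have hi: "integrable lborel (h m c)" "square_integrable lborel (h m c)" if "c \<in> C" "m \<in> M" for c m
  using sqz_integrable[OF dom_sets bounded_dom h(2)[OF that]] sqzD(1)[OF h(2)[OF that]] by auto
 have w0: "w c z ~= 0 ==> z \<in> cball c (3 / 2 * R c)" if "c \<in> C" for c z
  using Ps(4)[OF that] closure_subset[of "{x. Ps c x ~= 0}"] by (auto simp: w_def)
 have h0: "h m c z = 0" if "c \<in> C" "z \<notin> ball c (2 * R c)" for m c z
 proof -
  have "cball c (3 / 2 * R c) \<subseteq> ball c (2 * R c)" using R_pos[OF that(1)] by auto
  then have n: "z \<notin> closure {x. Ps c x ~= 0}" using Ps(4)[OF that(1)] that(2) by blast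
  then have "Ps c z = 0" using closure_subset[of "{x. Ps c x ~= 0}"] by blast
  moreover have "grad (Ps c) z = 0" using pd_outside_support[OF n] by (simp add: vec_eq_iff)
  ultimately show ?thesis by (simp add: h_def)
 qed
 define J where "J c k = mollify (Th c k) (w c)" for c k
 define F where "F k x = (\<Sum>c\<in>C. J c k x)" for k x
 have JC: "C_inf (J c k)" if "c \<in> C" for c k unfolding J_def by (rule C_inf_mollify[OF wi(1)[OF that] Th(1)[OF that]])
 have FC: "C_inf (F k)" for k unfolding F_def by (intro C_inf_sum JC)
 have n1: "L2null lborel (%k x. mollify (Th c k) u x - u x)" if "c \<in> C" "integrable lborel u" "square_integrable lborel u" for c u
  using mollify_tendsto_L2[OF that(3,2) Th(1,2,3)[OF that(1)] Thr[OF that(1)] Th(6)[OF that(1)]] by (auto simp: L2null_def)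
 have im: "(%x. indicator Om x :: real) \<in> borel_measurable lborel" "!!x. \<bar>indicator Om x :: real\<bar> <= 1"
  by (auto simp: indicator_def)
 have P1: "L2null lborel (%k x. indicator Om x * (F k x - v x))"
 proof (rule L2null_cong[OF L2null_bounded_mult[OF L2null_sum[of C lborel "%c k x. J c k x - w c x"] im]])
  show "L2null lborel (%k x. J c k x - w c x)" if "c \<in> C" for c unfolding J_def by (rule n1[OF that wi[OF that]])
  have "(\<Sum>c\<in>C. w c x) = v x" if "x \<in> Om" for x
   using Ps(5)[of x] that closure_subset[of Om] by (auto simp: w_def sum_distrib_right[symmetric])
  then show "\<forall>\<^sub>F k in sequentially. (%x. indicator Om x * (F k x - v x)) = (%x. indicator Om x * (\<Sum>c\<in>C. J c k x - w c x))"
   by (intro always_eventually allI ext) (auto simp: F_def sum_subtractf indicator_def)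
 qed
 have P2: "L2null lborel (%k x. indicator Om x * (b m x \<bullet> grad (F k) x - f m x))" if m: "m \<in> M" for m
 proof -
  have c: "L2null lborel (%k x. indicator Om x * (b m x \<bullet> grad (J c k) x - h m c x))" if c: "c \<in> C" for c
  proof -
   let ?I = "%x. indicator (Om \<inter> ball c (2 * R c)) x :: real"
   have "L2null lborel (%k x. ?I x * (b m x \<bullet> grad (J c k) x - mollify (Th c k) (h m c) x))"
    unfolding L2null_def J_def
    using commutator_tendsto_L2[OF open_dom wi(2,1)[OF c] hi(1)[OF c m] Th(1,2,3,4)[OF c] Th(6)[OF c] Th(5)[OF c] b[OF m] h(1)[OF c m] cone[OF c]]
     L[OF m] c by (auto simp: cone_Lipschitz_def)
   moreover have "L2null lborel (%k x. ?I x * (mollify (Th c k) (h m c) x - h m c x))"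
    by (rule L2null_bounded_mult[OF n1[OF c hi[OF c m]], where B=1]) (auto simp: indicator_def)
   ultimately have s: "L2null lborel (%k x. ?I x * (b m x \<bullet> grad (J c k) x - mollify (Th c k) (h m c) x) + ?I x * (mollify (Th c k) (h m c) x - h m c x))"
    by (rule L2null_add)
   \<comment> \<open>For short kernels the mollified piece has no gradient off the ball of radius
     \<open>2 * R c\<close>, so the commutator estimate inside the ball is one on the whole
     domain.\<close>
   show ?thesis
   proof (rule L2null_cong[OF s])
    have "\<forall>\<^sub>F k in sequentially. r c k < R c / 2" by (rule order_tendstoD(2)[OF Th(6)[OF c]]) (use R_pos[OF c] in simp)
    then show "\<forall>\<^sub>F k in sequentially. (%x. indicator Om x * (b m x \<bullet> grad (J c k) x - h m c x)) =
      (%x. ?I x * (b m x \<bullet> grad (J c k) x - mollify (Th c k) (h m c) x) + ?I x * (mollify (Th c k) (h m c) x - h m c x))"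
    proof eventually_elim
     case (elim k)
     have g0: "grad (J c k) x = 0" if x: "x \<notin> ball c (2 * R c)" for x
     proof -
      have "pd i (J c k) x = 0" for i
       unfolding J_def pd_mollify[OF wi(1)[OF c] Th(1)[OF c]]
      proof (rule mollify_outside[OF w0[OF c] _ elim x])
       fix y assume "- pd i (Th c k) y ~= 0"
       then have "y \<in> closure {y. Th c k y ~= 0}" using pd_outside_support[of y "Th c k" i] by auto
       then show "norm y <= r c k" using Th(4)[OF c] by blast
      qed
      then show ?thesis by (simp add: vec_eq_iff)
     qed
     show ?case
     proof
      fix x
      show "indicator Om x * (b m x \<bullet> grad (J c k) x - h m c x) =
       ?I x * (b m x \<bullet> grad (J c k) x - mollify (Th c k) (h m c) x) + ?I x * (mollify (Th c k) (h m c) x - h m c x)"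
      proof (cases "x \<in> ball c (2 * R c)")
       case True
       then show ?thesis by (simp add: indicator_inter_arith right_diff_distrib)
      next
       case False
       then show ?thesis using g0[OF False] h0[OF c False, of m] by (simp add: indicator_inter_arith)
      qed
     qed
    qed
   qed
  qed
  show ?thesis
  proof (rule L2null_cong[OF L2null_sum[of C, OF c]])
   have gF: "grad (F k) x = (\<Sum>c\<in>C. grad (J c k) x)" for k x
   proof -
    have "pd i (F k) = (%x. \<Sum>c\<in>C. pd i (J c k) x)" for i unfolding F_def[abs_def] by (rule pd_sum') (rule JC)
    then show ?thesis by (simp add: vec_eq_iff)
   qed
   \<comment> \<open>The terms with \<open>grad (Ps c)\<close> cancel in the sum, the partition
     being constantly 1 on the open domain.\<close>
   have hf: "(\<Sum>c\<in>C. h m c x) = f m x" if x: "x \<in> Om" for x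
   proof -
    have "(\<Sum>c\<in>C. pd i (Ps c) x) = 0" for i
    proof -
     have "((%x. 1) has_derivative (%h. 0)) (at x)" by simp
     then have "((%x. \<Sum>c\<in>C. Ps c x) has_derivative (%h. 0)) (at x)"
      by (rule has_derivative_transform_within_open[OF _ open_dom x]) (use Ps(5) closure_subset[of Om] in auto)
     then have "pd i (%x. \<Sum>c\<in>C. Ps c x) x = 0" by (simp add: pd_eq)
     moreover have "pd i (%x. \<Sum>c\<in>C. Ps c x) = (%x. \<Sum>c\<in>C. pd i (Ps c) x)"
      by (rule pd_sum') (rule smooth_csD[OF Ps(1)])
     ultimately show ?thesis by simp
    qed
    then have "(\<Sum>c\<in>C. grad (Ps c) x) = 0" by (simp add: vec_eq_iff)
    then have "(\<Sum>c\<in>C. b m x \<bullet> grad (Ps c) x) = 0" by (simp add: inner_sum_right[symmetric])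
    then show ?thesis using Ps(5)[of x] x closure_subset[of Om]
     by (auto simp: h_def sum.distrib sum_distrib_right[symmetric])
   qed
   show "\<forall>\<^sub>F k in sequentially. (%x. indicator Om x * (b m x \<bullet> grad (F k) x - f m x)) =
    (%x. \<Sum>c\<in>C. indicator Om x * (b m x \<bullet> grad (J c k) x - h m c x))"
   proof (intro always_eventually allI ext)
    fix k x
    show "indicator Om x * (b m x \<bullet> grad (F k) x - f m x) = (\<Sum>c\<in>C. indicator Om x * (b m x \<bullet> grad (J c k) x - h m c x))"
     by (cases "x \<in> Om") (simp_all add: gF inner_sum_right sum_subtractf hf)
   qed
  qed
 qed
 have P3: "\<forall>\<^sub>F k in sequentially. ALL x:frontier Om. 0 <= F k x"
  if N: "open N" "frontier Om \<subseteq> N" and pos: "AE x in lborel. x \<in> Om \<inter> N --> 0 <= v x" for N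
 proof -
  have "compact (frontier Om)" using bounded_dom by (simp add: compact_frontier_bounded)
  then obtain d where d: "d > 0" "(\<Union>x\<in>frontier Om. ball x d) \<subseteq> N"
   using compact_subset_open_imp_ball_epsilon_subset N by metis
  have "\<forall>\<^sub>F k in sequentially. ALL c:C. r c k < d"
   using finite_C order_tendstoD(2)[OF Th(6) d(1)] by (simp add: eventually_ball_finite)
  then show ?thesis
  proof eventually_elim
   case (elim k)
   have "0 <= J c k x" if c: "c \<in> C" and x: "x \<in> frontier Om" for c x
    unfolding J_def mollify_def
   proof (rule integral_nonneg_AE)
    show "AE z in lborel. 0 <= w c z * Th c k (z - x)" using pos
    proof eventually_elim
     case z: (elim z)
     show ?case
     proof (cases "Th c k (z - x) = 0 \<or> z \<notin> Om")
      case False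
      then have "norm (z - x) < d" using Thr[OF c, of k "z - x"] elim c by force
      then have "z \<in> ball x d" by (simp add: dist_norm norm_minus_commute)
      then have "z \<in> N" using d(2) x by blast
      then show ?thesis using z False Ps(2)[OF c] Th(2)[OF c] by (simp add: w_def)
     qed (use sqzD(3)[OF w[OF c]] in auto)
    qed
   qed
   then show ?case unfolding F_def by (auto intro!: sum_nonneg)
  qed
 qed
 show ?thesis by (rule that[OF FC P1 P2 P3])
qed

end

section \<open>A Sobolev embedding\<close>

lemma nn_integral_lborel_scale:
 fixes F :: "'a::euclidean_space => ennreal"
 assumes [measurable]: "F \<in> borel_measurable borel" and r: "r > 0"
 shows "(\<integral>\<^sup>+d. F (r *\<^sub>R d) \<partial>lborel) = ennreal (1 / r ^ DIM('a)) * (\<integral>\<^sup>+z. F z \<partial>lborel)"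
proof -
 have "(\<integral>\<^sup>+z. F z \<partial>lborel) = (\<integral>\<^sup>+z. F z \<partial>density (distr lborel borel (%x. 0 + r *\<^sub>R x)) (%_. ennreal (r ^ DIM('a))))"
  using lborel_affine[of r "0::'a"] r by (simp add: ennreal_power)
 also have "... = (\<integral>\<^sup>+z. ennreal (r ^ DIM('a)) * F z \<partial>distr lborel borel (%x. 0 + r *\<^sub>R x))"
  by (rule nn_integral_density) auto
 also have "... = (\<integral>\<^sup>+d. ennreal (r ^ DIM('a)) * F (0 + r *\<^sub>R d) \<partial>lborel)"
  by (rule nn_integral_distr) auto
 also have "... = ennreal (r ^ DIM('a)) * (\<integral>\<^sup>+d. F (r *\<^sub>R d) \<partial>lborel)" by (simp add: nn_integral_cmult)
 finally show ?thesis using r by (simp add: mult.assoc[symmetric] ennreal_mult[symmetric])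
qed

text \<open>Integrating along the ray \<open>t \<mapsto> x + t\<^sup>2 d\<close> keeps all weights polynomial: in dimension at most 3
 the factor \<open>t\<^sup>6\<close> absorbs the Jacobian of \<open>d \<mapsto> x + t\<^sup>2 d\<close>.\<close>

lemma ray_bound:
 fixes f P :: "real ^ 'n::finite => real"
 assumes n: "CARD('n) <= 3" and f: "C_inf f" and S: "0 < S" "S <= 1" and d: "norm d <= 2"
  and P: "!!t is. 0 < t ==> t <= S ==> length is <= 2 ==> (partials is f (x + t\<^sup>2 *\<^sub>R d))\<^sup>2 <= P (x + t\<^sup>2 *\<^sub>R d)"
 shows "ennreal \<bar>f x\<bar> <= (\<integral>\<^sup>+t. ennreal (72 + 28 / S ^ 4) * (indicator {0..S} t * ennreal (1 + t ^ 6 * \<bar>P (x + t\<^sup>2 *\<^sub>R d)\<bar>)) \<partial>lborel)"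
proof -
 let ?y = "%t. x + t\<^sup>2 *\<^sub>R d"
 let ?H1 = "%t. grad f (?y t) \<bullet> d" and ?H2 = "%t. \<Sum>i\<in>UNIV. d $ i * (grad (pd i f) (?y t) \<bullet> d)"
 \<comment> \<open>\<open>?F\<close> runs from f x at t = 0 to 0 at t = S. Subtracting t^2 times the
   directional derivative cancels the first-order term of the derivative, and the cut-off is
   quartic; hence every term of \<open>?J\<close> carries a factor t^3.\<close>
 let ?F = "%t. (f (?y t) - t\<^sup>2 * ?H1 t) * (1 - t ^ 4 / S ^ 4)"
 let ?J = "%t. - (2 * t ^ 3 * ?H2 t) * (1 - t ^ 4 / S ^ 4) - (f (?y t) - t\<^sup>2 * ?H1 t) * (4 * t ^ 3 / S ^ 4)"
 have D: "((%t. g (?y t)) has_real_derivative 2 * t * (grad g (?y t) \<bullet> d)) (at t)" if "C_inf g" for g t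
 proof -
  have "(?y has_derivative (%h. (2 * t * h) *\<^sub>R d)) (at t)" by (auto intro!: derivative_eq_intros)
  from has_derivative_compose[OF this, of g "%h. grad g (?y t) \<bullet> h"]
  have "((%t. g (?y t)) has_derivative (%h. grad g (?y t) \<bullet> ((2 * t * h) *\<^sub>R d))) (at t)" using C_inf_has_grad[OF that] by simp
  moreover have "(%h. grad g (?y t) \<bullet> ((2 * t * h) *\<^sub>R d)) = (*) (2 * t * (grad g (?y t) \<bullet> d))" by (simp add: fun_eq_iff mult_ac)
  ultimately show ?thesis by (simp only: has_field_derivative_def)
 qed
 have H1: "?H1 = (%t. \<Sum>i\<in>UNIV. d $ i * pd i f (?y t))" by (simp add: inner_vec_def mult.commute)
 have D1: "(?H1 has_real_derivative 2 * t * ?H2 t) (at t)" for t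
 proof -
  have "((%t. \<Sum>i\<in>UNIV. d $ i * pd i f (?y t)) has_real_derivative (\<Sum>i\<in>UNIV. d $ i * (2 * t * (grad (pd i f) (?y t) \<bullet> d)))) (at t)"
   by (intro DERIV_sum DERIV_cmult D C_inf_pd f)
  then show ?thesis unfolding H1 by (simp add: sum_distrib_left mult_ac)
 qed
 have DF: "(?F has_real_derivative ?J t) (at t)" for t
 proof -
  have a: "((%t. t\<^sup>2) has_real_derivative 2 * t) (at t)" "((%t. 1 - t ^ 4 / S ^ 4) has_real_derivative - (4 * t ^ 3 / S ^ 4)) (at t)"
   using DERIV_diff[OF DERIV_const DERIV_cdivide[OF DERIV_pow[of 4 t], of "S ^ 4"], of 1] DERIV_pow[of 2 t] by simp_all
  have "2 * t * ?H1 t - (2 * t * ?H1 t + 2 * t * ?H2 t * t\<^sup>2) = - (2 * t ^ 3 * ?H2 t)" by (simp add: power2_eq_square power3_eq_cube)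
  with DERIV_mult[OF DERIV_diff[OF D[OF f] DERIV_mult[OF a(1) D1]] a(2)]
  show ?thesis by (simp only:) (simp add: mult.commute)
 qed
 have cp: "continuous_on UNIV (%t. partials is f (?y t))" for "is"
  by (rule continuous_on_compose2[OF C_inf_continuous[OF C_inf_partials[OF f], of UNIV]]) (auto intro!: continuous_intros)
 have "continuous_on UNIV ?J"
  using S(1) cp[of "[]"] cp[of "[_]"] cp[of "[_, _]"] by (auto simp: inner_vec_def intro!: continuous_intros)
 then have cJ: "isCont ?J t" for t by (simp add: continuous_on_eq_continuous_at)
 have bi: "has_bochner_integral lborel (%t. ?J t * indicator {0..S} t) (?F S - ?F 0)"
  by (rule has_bochner_integral_FTC_Icc_real) (use S DF cJ in auto)
 have F: "?F S - ?F 0 = - f x" using S by simp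
 have "ennreal \<bar>f x\<bar> <= (\<integral>\<^sup>+t. ennreal (norm (?J t * indicator {0..S} t)) \<partial>lborel)"
  using integral_norm_bound_ennreal[OF integrable.intros[OF bi]] unfolding has_bochner_integral_integral_eq[OF bi] F
  by (simp only: abs_minus_cancel real_norm_def)
 also have "... <= (\<integral>\<^sup>+t. ennreal (72 + 28 / S ^ 4) * (indicator {0..S} t * ennreal (1 + t ^ 6 * \<bar>P (x + t\<^sup>2 *\<^sub>R d)\<bar>)) \<partial>lborel)"
 proof (rule nn_integral_mono)
  fix t
  let ?Y = "1 + t ^ 6 * \<bar>P (?y t)\<bar>" and ?N = "real CARD('n)"
  \<comment> \<open>A sum over at most three directions with |d_i| <= 2 costs a factor 6. Two such
    sums and the factor 2 in \<open>?J\<close> give 72; f and its directional derivative, with the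
    factor 4 from the cut-off, give 4 times 1 + 6, which is 28.\<close>
  have "\<bar>?J t\<bar> <= (72 + 28 / S ^ 4) * ?Y" if t: "t \<in> {0..S}"
  proof (cases "t = 0")
   case False
   have t3: "0 <= t ^ 3" using t by simp
   have p: "t ^ 3 * \<bar>partials is f (?y t)\<bar> <= ?Y" if "length is <= 2" for "is"
   proof -
    have "0 <= (t ^ 3 * \<bar>partials is f (?y t)\<bar> - 1)\<^sup>2" by simp
    then have "2 * (t ^ 3 * \<bar>partials is f (?y t)\<bar>) <= 1 + t ^ 6 * (partials is f (?y t))\<^sup>2"
     by (simp add: power2_diff power_mult_distrib power_mult[symmetric])
    moreover have "t ^ 6 * (partials is f (?y t))\<^sup>2 <= t ^ 6 * \<bar>P (?y t)\<bar>"
     using P[OF _ _ that, of t] t False by (intro mult_left_mono) auto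
    moreover have "0 <= t ^ 3 * \<bar>partials is f (?y t)\<bar>" using t3 by simp
    ultimately show ?thesis by linarith
   qed
   have Y: "1 <= ?Y" by simp
   have di: "\<bar>d $ i\<bar> <= 2" for i using component_le_norm_cart[of d i] d by linarith
   have s: "t ^ 3 * \<bar>\<Sum>i\<in>UNIV. d $ i * a i\<bar> <= 6 * B" if a: "!!i. t ^ 3 * \<bar>a i\<bar> <= B" for a B
   proof -
    have "t ^ 3 * \<bar>d $ i * a i\<bar> <= 2 * B" for i
     using mult_mono[OF di[of i] a[of i]] t3 by (simp add: abs_mult mult_ac)
    then have "(\<Sum>i\<in>UNIV. t ^ 3 * \<bar>d $ i * a i\<bar>) <= ?N * (2 * B)" using sum_bounded_above[of UNIV "%i. t ^ 3 * \<bar>d $ i * a i\<bar>"] by simp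
    moreover have "t ^ 3 * \<bar>\<Sum>i\<in>UNIV. d $ i * a i\<bar> <= (\<Sum>i\<in>UNIV. t ^ 3 * \<bar>d $ i * a i\<bar>)"
     using mult_left_mono[OF sum_abs t3] by (simp add: sum_distrib_left)
    moreover have "0 <= B" using a[of undefined] t3 by (meson abs_ge_zero mult_nonneg_nonneg order_trans)
    then have "?N * (2 * B) <= 3 * (2 * B)" using n by (intro mult_right_mono) auto
    ultimately show ?thesis by linarith
   qed
   have h0: "t ^ 3 * \<bar>f (?y t)\<bar> <= ?Y" using p[of "[]"] by simp
   have h1: "t ^ 3 * \<bar>?H1 t\<bar> <= 6 * ?Y" using s[of "%i. pd i f (?y t)" ?Y] p[of "[_]"] by (simp add: inner_vec_def mult.commute)
   have h2: "t ^ 3 * \<bar>?H2 t\<bar> <= 6 * (6 * ?Y)"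
   proof (rule s)
    show "t ^ 3 * \<bar>grad (pd i f) (?y t) \<bullet> d\<bar> <= 6 * ?Y" for i
     using s[of "%j. pd j (pd i f) (?y t)" ?Y] p[of "[_, i]"] by (simp add: inner_vec_def mult.commute)
   qed
   have t2: "t\<^sup>2 <= 1" using t S by (simp add: power_le_one)
   have e: "0 <= 1 - t ^ 4 / S ^ 4" "1 - t ^ 4 / S ^ 4 <= 1" using t S power_mono[of t S 4] by (auto simp: divide_le_eq)
   have "\<bar>- (2 * t ^ 3 * ?H2 t) * (1 - t ^ 4 / S ^ 4)\<bar> <= 2 * (t ^ 3 * \<bar>?H2 t\<bar>)"
    using e mult_left_le[of "1 - t ^ 4 / S ^ 4" "2 * (t ^ 3 * \<bar>?H2 t\<bar>)"] t3 by (simp add: abs_mult mult_ac)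
   moreover have "\<bar>(f (?y t) - t\<^sup>2 * ?H1 t) * (4 * t ^ 3 / S ^ 4)\<bar> <= 28 * ?Y / S ^ 4"
   proof -
    have "\<bar>t\<^sup>2 * ?H1 t\<bar> <= \<bar>?H1 t\<bar>" using t2 mult_right_mono[of "t\<^sup>2" 1 "\<bar>?H1 t\<bar>"] by (simp add: abs_mult)
    then have "\<bar>f (?y t) - t\<^sup>2 * ?H1 t\<bar> <= \<bar>f (?y t)\<bar> + \<bar>?H1 t\<bar>" by linarith
    from mult_left_mono[OF this t3] have "t ^ 3 * \<bar>f (?y t) - t\<^sup>2 * ?H1 t\<bar> <= 7 * ?Y" using h0 h1 by (simp only: distrib_left)
    then have "4 * (t ^ 3 * \<bar>f (?y t) - t\<^sup>2 * ?H1 t\<bar>) / S ^ 4 <= 28 * ?Y / S ^ 4" using S by (intro divide_right_mono) auto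
    moreover have "\<bar>(f (?y t) - t\<^sup>2 * ?H1 t) * (4 * t ^ 3 / S ^ 4)\<bar> = 4 * (t ^ 3 * \<bar>f (?y t) - t\<^sup>2 * ?H1 t\<bar>) / S ^ 4"
     using t3 S by (simp add: abs_mult mult_ac)
    ultimately show ?thesis by linarith
   qed
   moreover have "(72 + 28 / S ^ 4) * ?Y = 72 * ?Y + 28 * ?Y / S ^ 4" by (simp add: distrib_right)
   ultimately show ?thesis using h2 by linarith
  qed (use S in simp)
  then have "t \<in> {0..S} ==> ennreal \<bar>?J t\<bar> <= ennreal (72 + 28 / S ^ 4) * ennreal ?Y"
   using S by (metis (mono_tags) ennreal_leI ennreal_mult' add_nonneg_nonneg divide_nonneg_nonneg zero_le_numeral zero_le_power less_imp_le)
  then show "ennreal (norm (?J t * indicator {0..S} t)) <= ennreal (72 + 28 / S ^ 4) * (indicator {0..S} t * ennreal ?Y)"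
   by (cases "t \<in> {0..S}") (simp_all only: indicator_simps mult_1 mult_1_right mult_zero_left mult_zero_right norm_zero ennreal_0 order_refl zero_le real_norm_def abs_zero not_False_eq_True)
 qed
 finally show ?thesis .
qed

section \<open>Pointwise limits and mollified families of weak derivatives\<close>

lemma L2null_AE_subseq:
 assumes "L2null M g"
 obtains r :: "nat => nat" where "AE x in M. (%n. g (r n) x) ----> 0"
proof -
 obtain k0 where k0: "!!k. k >= k0 ==> square_integrable M (g k)"
  using assms by (auto simp: L2null_def eventually_sequentially)
 let ?u = "%n x. (g (n + k0) x)\<^sup>2"
 have "(%n. norm_L2 M (g (n + k0))) ----> 0" using assms LIMSEQ_ignore_initial_segment by (auto simp: L2null_def)
 from tendsto_power[OF this, of 2] have "(%n. \<integral>x. ?u n x \<partial>M) ----> 0" by (simp add: norm_L2_sq)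
 then have l: "(%n. \<integral>x. norm (?u n x) \<partial>M) ----> 0" by simp
 have "integrable M (?u n)" for n using k0[of "n + k0"] by (simp add: square_integrable_def)
 then obtain r :: "nat => nat" where r: "AE x in M. (%n. ?u (r n) x) ----> 0"
  using tendsto_L1_AE_subseq[of M ?u] l by blast
 have "AE x in M. (%n. g (r n + k0) x) ----> 0"
  using r
 proof eventually_elim
  case (elim x)
  from tendsto_real_sqrt[OF elim] have "(%n. \<bar>g (r n + k0) x\<bar>) ----> 0" by simp
  then show ?case by (simp add: tendsto_rabs_zero_iff)
 qed
 then show ?thesis by (rule that)
qed

lemma AE_lborel_translate:
 fixes P :: "'a::euclidean_space => bool"
 assumes "AE x in lborel. P x"
 shows "AE y in lborel. P (x + y)"
proof -
 obtain N where N: "{x. \<not> P x} \<subseteq> N" "N \<in> null_sets lborel"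
  using assms unfolding eventually_ae_filter by auto
 have Nb [measurable]: "N \<in> sets borel" using N(2) by (auto simp: null_sets_def)
 have "emeasure lborel ((+) x -` N) = emeasure (distr lborel borel ((+) x)) N"
  by (subst emeasure_distr) auto
 also have "... = 0" using N(2) by (simp add: lborel_distr_plus null_sets_def)
 finally have "emeasure lborel ((+) x -` N) = 0" .
 moreover have "(+) x -` N \<in> sets lborel" using measurable_sets[of "(+) x" borel borel N] by simp
 ultimately have "(+) x -` N \<in> null_sets lborel" by (simp add: null_sets_def)
 then show ?thesis by (rule AE_I'[rotated 1, OF _ , rotated]) (use N(1) in auto)
qed

lemma smooth_cs_partials: "smooth_cs Th ==> smooth_cs (partials is Th)"
 by (induction "is") (auto intro: smooth_cs_pd)

lemma partials_mollify:
 assumes u: "integrable lborel u" and Th: "smooth_cs Th"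
 shows "partials is (mollify Th u) = mollify (%y. (- 1) ^ length is * partials is Th y) u"
proof (induction "is")
 case (Cons i "is")
 have cs: "smooth_cs (%y. (- 1) ^ length is * partials is Th y)"
  using smooth_cs_mult[OF C_inf_const smooth_cs_partials[OF Th]] .
 have "pd i (%y. (- 1) ^ length is * partials is Th y) = (%y. (- 1) ^ length is * pd i (partials is Th) y)"
  by (subst pd_mult'[OF C_inf_const C_inf_partials[OF smooth_csD[OF Th]]]) simp
 then show ?case using pd_mollify[OF u cs, of i] Cons by simp
qed simp

lemma partials_shift:
 assumes "C_inf Th"
 shows "partials is (%z. Th (z - x)) = (%z. partials is Th (z - x))"
proof (induction "is")
 case (Cons i "is")
 have "pd i (%z. partials is Th (z - x)) z = pd i (partials is Th) (z - x)" for z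
  using grad_shift[OF C_inf_partials[OF assms], of "is" x z] by (metis grad_nth)
 then show ?case using Cons by auto
qed simp

text \<open>Entries are indexed by lists rather than multi-indices: each one is a weak derivative of
  the entry for the tail, and no symmetry of mixed derivatives has to be invoked.\<close>

definition deriv_tower :: "(real ^ 'n::finite) set => nat => ('n list => real ^ 'n => real) => bool" where
 "deriv_tower Om n w \<longleftrightarrow> (ALL is. length is <= n --> sqz Om (w is)) & (ALL is i. length is < n --> wder Om i (w is) (w (i # is)))"

text \<open>Weak derivatives are moved onto the test function starting with the head of the list, so
  that the directions arrive there in reverse order.\<close>

lemma deriv_tower_test:
 assumes "deriv_tower Om n w" "length is <= n" "Ph \<in> test_functions Om"
 shows "(LBINT z. w [] z * partials (rev is) Ph z) = (- 1) ^ length is * (LBINT z. w is z * Ph z)"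
 using assms(2,3)
proof (induction "is" arbitrary: Ph)
 case (Cons i "is")
 have "(LBINT z. w [] z * partials (rev (i # is)) Ph z) = (- 1) ^ length is * (LBINT z. w is z * pd i Ph z)"
  using Cons.IH[OF _ test_functions_pd[OF Cons.prems(2), of i]] Cons.prems(1) by (simp add: partials_snoc)
 moreover have "wder Om i (w is) (w (i # is))" using assms(1) Cons.prems by (auto simp: deriv_tower_def)
 ultimately show ?case using Cons.prems by (simp add: wder_iff)
qed simp

lemma partials_mollify_tower:
 assumes "deriv_tower Om n w" "length is <= n" "(%z. Th (z - x)) \<in> test_functions Om" "smooth_cs Th" "integrable lborel (w [])"
 shows "partials (rev is) (mollify Th (w [])) x = mollify Th (w is) x"
proof -
 have "partials (rev is) (mollify Th (w [])) x = (- 1) ^ length is * (LBINT z. w [] z * partials (rev is) Th (z - x))"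
  unfolding partials_mollify[OF assms(5,4)] mollify_def
  by (simp add: mult.left_commute[of "w [] _" "(- 1) ^ length is"])
 also have "... = (- 1) ^ length is * ((- 1) ^ length is * (LBINT z. w is z * Th (z - x)))"
  using deriv_tower_test[OF assms(1,2,3)] by (simp add: partials_shift[OF smooth_csD[OF assms(4)]])
 also have "... = mollify Th (w is) x" by (simp add: mollify_def mult.assoc[symmetric] power_mult_distrib[symmetric])
 finally show ?thesis .
qed

lemma nn_integral_mollify_le:
 assumes u: "integrable lborel u" and Th: "smooth_cs Th" "!!y. 0 <= Th y" "(LBINT y. Th y) = 1"
 shows "(\<integral>\<^sup>+x. ennreal \<bar>mollify Th u x\<bar> \<partial>lborel) <= (\<integral>\<^sup>+x. ennreal \<bar>u x\<bar> \<partial>lborel)"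
proof -
 have [measurable]: "u \<in> borel_measurable borel" "Th \<in> borel_measurable borel"
  using u smooth_cs_measurable[OF Th(1)] by auto
 have "(\<integral>\<^sup>+x. ennreal \<bar>mollify Th u x\<bar> \<partial>lborel) <= (\<integral>\<^sup>+x. \<integral>\<^sup>+y. ennreal (Th y) * ennreal \<bar>u (x + y)\<bar> \<partial>lborel \<partial>lborel)"
 proof (rule nn_integral_mono)
  fix x
  have "integrable lborel (%y. u (x + y) * Th y)"
   using integrable_mult_smooth_cs[OF integrable_lborel_translate[OF u, of x] Th(1)] by (simp add: add.commute)
  from integral_norm_bound_ennreal[OF this]
  have "ennreal \<bar>mollify Th u x\<bar> <= (\<integral>\<^sup>+y. ennreal \<bar>u (x + y) * Th y\<bar> \<partial>lborel)"
   using mollify_shift[of u Th x] Th(1) by simp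
  also have "... = (\<integral>\<^sup>+y. ennreal (Th y) * ennreal \<bar>u (x + y)\<bar> \<partial>lborel)"
   using Th(2) by (intro nn_integral_cong) (simp add: abs_mult ennreal_mult mult.commute)
  finally show "ennreal \<bar>mollify Th u x\<bar> <= (\<integral>\<^sup>+y. ennreal (Th y) * ennreal \<bar>u (x + y)\<bar> \<partial>lborel)" .
 qed
 also have "... = (\<integral>\<^sup>+y. \<integral>\<^sup>+x. ennreal (Th y) * ennreal \<bar>u (x + y)\<bar> \<partial>lborel \<partial>lborel)"
  by (rule lborel_pair.Fubini'[symmetric]) measurable
 also have "... = (\<integral>\<^sup>+y. ennreal (Th y) * (\<integral>\<^sup>+x. ennreal \<bar>u x\<bar> \<partial>lborel) \<partial>lborel)"
  using nn_integral_lborel_translate[of "%x. ennreal \<bar>u x\<bar>"] by (simp add: nn_integral_cmult)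
 also have "... = (\<integral>\<^sup>+y. ennreal (Th y) \<partial>lborel) * (\<integral>\<^sup>+x. ennreal \<bar>u x\<bar> \<partial>lborel)"
  by (rule nn_integral_multc) measurable
 also have "(\<integral>\<^sup>+y. ennreal (Th y) \<partial>lborel) = 1"
  using nn_integral_eq_integral[OF smooth_cs_integrable[OF Th(1)]] Th(2,3) by simp
 finally show ?thesis by simp
qed

text \<open>Jensen's inequality for the probability density \<open>Th\<close>: expand the
  nonnegative integral of (u - m)^2 against the kernel, with m the mollified value.\<close>

lemma mollify_power2_le:
 assumes u: "integrable lborel u" "integrable lborel (%z. (u z)\<^sup>2)" and Th: "smooth_cs Th" "!!y. 0 <= Th y" "(LBINT y. Th y) = 1"
 shows "(mollify Th u x)\<^sup>2 <= mollify Th (%z. (u z)\<^sup>2) x"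
proof -
 let ?m = "mollify Th u x" and ?t = "%z. Th (z - x)"
 have i: "integrable lborel (%z. u z * ?t z)" "integrable lborel (%z. (u z)\<^sup>2 * ?t z)" by (rule mollify_integrable[OF _ Th(1)], rule u)+
 have t: "integrable lborel ?t" "(LBINT z. ?t z) = 1"
  using smooth_cs_integrable[OF smooth_cs_affine[OF Th(1), of 1 "- x"]] integral_lborel_translate[of Th "- x"] smooth_cs_measurable[OF Th(1)] Th(3) by simp_all
 have "0 <= (LBINT z. (u z - ?m)\<^sup>2 * ?t z)" using Th(2) by (intro Bochner_Integration.integral_nonneg) simp
 also have "(%z. (u z - ?m)\<^sup>2 * ?t z) = (%z. (u z)\<^sup>2 * ?t z - 2 * ?m * (u z * ?t z) + ?m\<^sup>2 * ?t z)"
  by (simp add: fun_eq_iff power2_diff algebra_simps)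
 also have "integral\<^sup>L lborel ... = mollify Th (%z. (u z)\<^sup>2) x - 2 * ?m * ?m + ?m\<^sup>2"
  using i t by (simp add: mollify_def)
 finally show ?thesis by (simp add: power2_eq_square)
qed

context cone_cover
begin

lemma cone_point:
 assumes c: "c \<in> C" and x: "x \<in> Om" "x \<in> ball c (a * R c)" and y: "y \<in> cone_set (e c) (s c) (Ta c)" and a: "a <= 3"
 shows "x + y \<in> Om" "x + y \<in> ball c ((a + 1) * R c)"
proof -
 obtain t z where tz: "0 < t" "t < Ta c" "norm (z - e c) <= s c" "y = t *\<^sub>R z" using y by (auto simp: cone_set_def)
 have "norm z <= norm (z - e c) + norm (e c)" using norm_triangle_ineq[of "z - e c" "e c"] by simp
 then have "norm z <= 3 / 2" using tz(3) sizes[OF c] by linarith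
 then have "t * norm z <= Ta c * (3 / 2)" using tz by (intro mult_mono) auto
 then have "norm y <= Ta c * (3 / 2)" using tz by simp
 then have ny: "norm y < R c" using sizes[OF c] Ta_pos[OF c] by linarith
 have "dist c (x + y) <= dist c x + norm y" using dist_triangle[of c "x + y" x] by (simp add: dist_norm)
 then show "x + y \<in> ball c ((a + 1) * R c)" using x(2) ny by (simp add: distrib_right)
 have "a * R c <= 3 * R c" using a R_pos[OF c] by (intro mult_right_mono) auto
 then have "dist c x < 3 * R c" using x(2) by simp
 then have "x \<in> ball c (2 * (2 * R c))" using R_pos[OF c] by simp
 then show "x + y \<in> Om" using cone2[OF c] x(1) y closure_subset[of Om] unfolding cone_at_def by blast
qed

text \<open>The ray estimate is averaged over all directions in the ball of radius
  \<open>s c\<close> about the axis. Along these rays the derivatives of the mollified function are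
  the mollified weak derivatives, and Jensen's inequality bounds their squares by mollified squares,
  whose integrals are bounded independently of the kernel. So the bound survives the removal of the
  mollifier.\<close>

lemma mollified_bound:
 assumes c: "c \<in> C" and n: "CARD('n) <= 3" and w: "deriv_tower Om 2 w"
 shows "EX A. \<forall>Th x. smooth_cs Th --> (ALL y. 0 <= Th y) --> (LBINT y. Th y) = 1 -->
   closure {y. Th y ~= 0} \<subseteq> cone_set (e c) (s c) (Ta c) --> x \<in> Om \<inter> ball c (R c) --> \<bar>mollify Th (w []) x\<bar> <= A"
proof -
 let ?n = "CARD('n)" and ?B = "ball (e c) (s c)" and ?L = "{is :: 'n list. length is <= 2}"
 have fL: "finite ?L" using finite_lists_length_le[of "UNIV :: 'n set" 2] by simp
 define S where "S = min 1 (Ta c / 2)"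
 have S: "0 < S" "S <= 1" "S < Ta c" using Ta_pos[OF c] by (auto simp: S_def)
 have z: "sqz Om (w (rev is))" if "is \<in> ?L" for "is" using w that by (simp add: deriv_tower_def)
 have wi: "integrable lborel (w (rev is))" if "is \<in> ?L" for "is" by (rule sqz_integrable[OF dom_sets bounded_dom z[OF that]])
 have wq: "integrable lborel (%z. (w (rev is) z)\<^sup>2)" if "is \<in> ?L" for "is" using sqzD(1)[OF z[OF that]] by (simp add: square_integrable_def)
 define N where "N = (\<Sum>is\<in>?L. \<integral>z. (w (rev is) z)\<^sup>2 \<partial>lborel)"
 have N: "0 <= N" unfolding N_def by (intro sum_nonneg) simp
 define V where "V = unit_ball_vol (real ?n) * s c ^ ?n"
 have V: "0 < V" "emeasure lborel ?B = ennreal V"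
  unfolding V_def using s_pos[OF c] by (simp_all add: emeasure_ball)
 let ?K = "72 + 28 / S ^ 4"
 have K: "0 <= ?K" using S by simp
 have "\<bar>mollify Th (w []) x\<bar> <= ?K * (V + N) * S / V" if Th: "smooth_cs Th" "!!y. 0 <= Th y" "(LBINT y. Th y) = 1"
   "closure {y. Th y ~= 0} \<subseteq> cone_set (e c) (s c) (Ta c)" and x: "x \<in> Om" "x \<in> ball c (R c)" for Th x
 proof -
  let ?f = "mollify Th (w [])"
  define P where "P y = (\<Sum>is\<in>?L. mollify Th (%z. (w (rev is) z)\<^sup>2) y)" for y
  have f: "C_inf ?f" using C_inf_mollify[OF wi[of "[]"] Th(1)] by simp
  have mn: "0 <= mollify Th (%z. (w (rev is) z)\<^sup>2) y" for "is" y
   unfolding mollify_def using Th(2) by (intro Bochner_Integration.integral_nonneg) simp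
  have P0: "0 <= P y" for y unfolding P_def by (intro sum_nonneg mn)
  have mm: "mollify Th (%z. (w (rev is) z)\<^sup>2) \<in> borel_measurable borel" if "is \<in> ?L" for "is"
   by (rule C_inf_borel[OF C_inf_mollify[OF wq[OF that] Th(1)]])
  have [measurable]: "P \<in> borel_measurable borel" unfolding P_def[abs_def] by (intro borel_measurable_sum mm)
  have PN: "(\<integral>\<^sup>+y. ennreal (P y) \<partial>lborel) <= ennreal N"
  proof -
   have "(\<integral>\<^sup>+y. ennreal (P y) \<partial>lborel) = (\<Sum>is\<in>?L. \<integral>\<^sup>+y. ennreal \<bar>mollify Th (%z. (w (rev is) z)\<^sup>2) y\<bar> \<partial>lborel)"
    unfolding P_def using mm mn by (subst nn_integral_sum[symmetric]) (auto simp: sum_nonneg)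
   also have "... <= (\<Sum>is\<in>?L. \<integral>\<^sup>+y. ennreal \<bar>(w (rev is) y)\<^sup>2\<bar> \<partial>lborel)"
    by (intro sum_mono nn_integral_mollify_le wq Th)
   also have "... = ennreal N"
    unfolding N_def using nn_integral_eq_integral[OF wq] by (simp add: sum_ennreal[symmetric] del: sum_ennreal)
   finally show ?thesis .
  qed
  let ?I = "%t. indicator {0..S} t :: ennreal" and ?J = "%d. if dist (e c) d < s c then 1 else 0 :: ennreal"
  let ?G = "%t d. 1 + t ^ 6 * \<bar>P (x + t\<^sup>2 *\<^sub>R d)\<bar>"
  have ray: "?J d * ennreal \<bar>?f x\<bar> <= (\<integral>\<^sup>+t. ennreal ?K * (?I t * (?J d * ennreal (?G t d))) \<partial>lborel)" for d
  proof (cases "d \<in> ?B")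
   case d: True
   have "norm d <= norm (d - e c) + norm (e c)" using norm_triangle_ineq[of "d - e c" "e c"] by simp
   then have "norm d <= 2" using d sizes[OF c] by (simp add: dist_norm norm_minus_commute)
   moreover have "(partials is ?f (x + t\<^sup>2 *\<^sub>R d))\<^sup>2 <= P (x + t\<^sup>2 *\<^sub>R d)" if t: "0 < t" "t <= S" and l: "length is <= 2" for t "is"
   proof -
    have "t\<^sup>2 <= t" using t S by (simp add: power2_eq_square mult_left_le)
    then have "t\<^sup>2 *\<^sub>R d \<in> cone_set (e c) (s c) (Ta c)"
     using d t S unfolding cone_set_def by (auto simp: dist_norm norm_minus_commute intro!: exI[of _ "t\<^sup>2"] exI[of _ d])
    then have p: "x + t\<^sup>2 *\<^sub>R d \<in> Om" "x + t\<^sup>2 *\<^sub>R d \<in> ball c (2 * R c)"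
     using cone_point[OF c x(1), of 1 "t\<^sup>2 *\<^sub>R d"] x(2) by auto
    have tf: "(%z. Th (z - (x + t\<^sup>2 *\<^sub>R d))) \<in> test_functions Om"
     by (rule test_function_shift[OF Th(1,4) cone[OF c]]) (use p closure_subset[of Om] in auto)
    have "partials is ?f (x + t\<^sup>2 *\<^sub>R d) = mollify Th (w (rev is)) (x + t\<^sup>2 *\<^sub>R d)"
     using partials_mollify_tower[OF w _ tf Th(1), of "rev is"] wi[of "[]"] l by simp
    also have "...\<^sup>2 <= mollify Th (%z. (w (rev is) z)\<^sup>2) (x + t\<^sup>2 *\<^sub>R d)"
     by (rule mollify_power2_le[OF wi wq Th(1,2,3)]) (use l in auto)
    also have "... <= P (x + t\<^sup>2 *\<^sub>R d)"
     unfolding P_def by (rule member_le_sum[of "is" ?L]) (use l fL mn in auto)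
    finally show ?thesis .
   qed
   ultimately show ?thesis using ray_bound[OF n f S(1,2), of d x P] d by simp
  qed simp
  have vol: "(\<integral>\<^sup>+d. ?J d \<partial>lborel) = ennreal V"
   using nn_integral_indicator[of ?B lborel] V(2) by (simp add: indicator_def of_bool_def)
  have shell: "(\<integral>\<^sup>+d. ?I t * (?J d * ennreal (?G t d)) \<partial>lborel) <= ennreal (V + N) * ?I t" for t
  proof (cases "t \<in> {0..S}")
   case t: True
   have "(\<integral>\<^sup>+d. ?J d * ennreal (?G t d) \<partial>lborel) <= (\<integral>\<^sup>+d. ?J d + ennreal (t ^ 6) * ennreal (P (x + t\<^sup>2 *\<^sub>R d)) \<partial>lborel)"
    using t P0 by (intro nn_integral_mono) (auto simp: ennreal_mult)
   also have "... = ennreal V + ennreal (t ^ 6) * (\<integral>\<^sup>+d. ennreal (P (x + t\<^sup>2 *\<^sub>R d)) \<partial>lborel)"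
    using vol by (simp add: nn_integral_add nn_integral_cmult)
   also have "ennreal (t ^ 6) * (\<integral>\<^sup>+d. ennreal (P (x + t\<^sup>2 *\<^sub>R d)) \<partial>lborel) <= ennreal N"
   proof (cases "t = 0")
    case False
    have "(t\<^sup>2) ^ 3 <= (t\<^sup>2) ^ ?n" using n t S by (intro power_decreasing) (auto simp: power_le_one)
    then have le: "t ^ 6 * (1 / (t\<^sup>2) ^ ?n) <= 1" using t False by (simp add: power_mult[symmetric] divide_le_eq)
    have "(\<integral>\<^sup>+d. ennreal (P (x + t\<^sup>2 *\<^sub>R d)) \<partial>lborel) = ennreal (1 / (t\<^sup>2) ^ ?n) * (\<integral>\<^sup>+z. ennreal (P (x + z)) \<partial>lborel)"
     using nn_integral_lborel_scale[of "%z. ennreal (P (x + z))" "t\<^sup>2"] False by simp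
    also have "(\<integral>\<^sup>+z. ennreal (P (x + z)) \<partial>lborel) = (\<integral>\<^sup>+z. ennreal (P z) \<partial>lborel)"
     using nn_integral_lborel_translate[of "%z. ennreal (P z)" x] by (simp add: add.commute)
    finally have "ennreal (t ^ 6) * (\<integral>\<^sup>+d. ennreal (P (x + t\<^sup>2 *\<^sub>R d)) \<partial>lborel) = ennreal (t ^ 6 * (1 / (t\<^sup>2) ^ ?n)) * (\<integral>\<^sup>+z. ennreal (P z) \<partial>lborel)"
     by (simp add: ennreal_mult' mult.assoc del: times_divide_eq_right times_divide_eq_left)
    also have "... <= 1 * ennreal N" using le PN by (intro mult_mono) (auto simp: ennreal_le_1)
    finally show ?thesis by simp
   qed simp
   finally show ?thesis using t V(1) N by (simp add: ennreal_plus add_left_mono)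
  qed simp
  have "ennreal V * ennreal \<bar>?f x\<bar> = (\<integral>\<^sup>+d. ?J d * ennreal \<bar>?f x\<bar> \<partial>lborel)"
   by (simp only: vol[symmetric]) (rule nn_integral_multc[symmetric], measurable)
  also have "... <= (\<integral>\<^sup>+d. \<integral>\<^sup>+t. ennreal ?K * (?I t * (?J d * ennreal (?G t d))) \<partial>lborel \<partial>lborel)" by (intro nn_integral_mono ray)
  also have "... = (\<integral>\<^sup>+t. \<integral>\<^sup>+d. ennreal ?K * (?I t * (?J d * ennreal (?G t d))) \<partial>lborel \<partial>lborel)"
   by (rule lborel_pair.Fubini'[symmetric]) measurable
  also have "... <= (\<integral>\<^sup>+t. ennreal ?K * (ennreal (V + N) * ?I t) \<partial>lborel)"
   using shell by (intro nn_integral_mono) (simp add: nn_integral_cmult mult_left_mono)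
  also have "... = ennreal (?K * (V + N) * S)"
   using S K V(1) N by (simp add: nn_integral_cmult ennreal_mult mult.assoc del: ennreal_plus)
  finally have "V * \<bar>?f x\<bar> <= ?K * (V + N) * S"
   using S K V(1) N by (simp add: ennreal_mult[symmetric] ennreal_le_iff del: ennreal_plus)
  then show ?thesis using V(1) by (simp add: pos_le_divide_eq mult.commute)
 qed
 then show ?thesis by blast
qed

text \<open>One sequence of kernels for all functions, with a subsequence that may depend on the
  function; bounds uniform in the kernel pass to the limit along it.\<close>

definition approx_kernel :: "real ^ 'n => (nat => real ^ 'n => real) => bool" where
 "approx_kernel c Th \<longleftrightarrow> (ALL k. smooth_cs (Th k) & (ALL y. 0 <= Th k y) & (LBINT y. Th k y) = 1 &
  closure {y. Th k y ~= 0} \<subseteq> cone_set (e c) (s c) (Ta c)) &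
  (ALL u. sqz Om u --> (\<exists>r :: nat => nat. AE x in lborel. (%k. mollify (Th (r k)) u x) ----> u x))"

lemma approx_kernel_exists:
 assumes c: "c \<in> C"
 shows "\<exists>Th. approx_kernel c Th"
proof -
 obtain Th r K where "cone_mollifier (e c) (s c) (Ta c) Th r K"
  using cone_mollifier_ex[OF s_pos[OF c] Ta_pos[OF c]] by blast
 then have Th: "!!k. smooth_cs (Th k)" "!!k y. 0 <= Th k y" "!!k. (LBINT y. Th k y) = 1"
   "!!k y. y \<in> closure {y. Th k y ~= 0} ==> y \<in> cone_set (e c) (s c) (Ta c) & norm y <= r k" "r ----> 0"
  unfolding cone_mollifier_def by blast+
 have Thr: "norm y <= r k" if "Th k y ~= 0" for k y
  using Th(4)[of y k] that closure_subset[of "{y. Th k y ~= 0}"] by blast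
 have "\<exists>r :: nat => nat. AE x in lborel. (%k. mollify (Th (r k)) u x) ----> u x" if u: "sqz Om u" for u
 proof -
  have "L2null lborel (%k x. mollify (Th k) u x - u x)"
   using mollify_tendsto_L2[OF sqzD(1)[OF u] sqz_integrable[OF dom_sets bounded_dom u] Th(1,2,3) Thr Th(5)] by (simp add: L2null_def)
  then obtain r' :: "nat => nat" where "AE x in lborel. (%k. mollify (Th (r' k)) u x - u x) ----> 0"
   by (rule L2null_AE_subseq)
  then show ?thesis by (intro exI[of _ r']) (simp add: LIM_zero_iff)
 qed
 moreover have "closure {y. Th k y ~= 0} \<subseteq> cone_set (e c) (s c) (Ta c)" for k using Th(4) by blast
 ultimately show ?thesis unfolding approx_kernel_def using Th(1,2,3) by blast
qed

theorem Sobolev_bounded: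
 assumes n: "CARD('n) <= 3" and w: "deriv_tower Om 2 w"
 shows "EX K. AE x in lborel. \<bar>w [] x\<bar> <= K"
proof -
 have w0: "sqz Om (w [])" using w by (simp add: deriv_tower_def)
 have "ALL c:C. EX A. AE x in lborel. x \<in> Om \<inter> ball c (R c) --> \<bar>w [] x\<bar> <= A"
 proof
  fix c assume c: "c \<in> C"
  obtain Th where "approx_kernel c Th" using approx_kernel_exists[OF c] by blast
  then have Th: "!!k. smooth_cs (Th k)" "!!k y. 0 <= Th k y" "!!k. (LBINT y. Th k y) = 1"
   "!!k. closure {y. Th k y ~= 0} \<subseteq> cone_set (e c) (s c) (Ta c)"
   "!!u. sqz Om u ==> \<exists>r :: nat => nat. AE x in lborel. (%k. mollify (Th (r k)) u x) ----> u x"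
   unfolding approx_kernel_def by blast+
  obtain r :: "nat => nat" where r: "AE x in lborel. (%k. mollify (Th (r k)) (w []) x) ----> w [] x"
   using Th(5)[OF w0] by blast
  obtain A where A: "!!Th x. smooth_cs Th ==> (!!y. 0 <= Th y) ==> (LBINT y. Th y) = 1 ==>
   closure {y. Th y ~= 0} \<subseteq> cone_set (e c) (s c) (Ta c) ==> x \<in> Om \<inter> ball c (R c) ==> \<bar>mollify Th (w []) x\<bar> <= A"
   using mollified_bound[OF c n w] by blast
  have "AE x in lborel. x \<in> Om \<inter> ball c (R c) --> \<bar>w [] x\<bar> <= A"
   using r
  proof eventually_elim
   case (elim x)
   have "\<bar>w [] x\<bar> <= A" if "x \<in> Om \<inter> ball c (R c)"
    by (rule LIMSEQ_le_const2[OF tendsto_rabs[OF elim]]) (use A[OF Th(1,2,3,4) that] in blast)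
   then show ?case by blast
  qed
  then show "EX A. AE x in lborel. x \<in> Om \<inter> ball c (R c) --> \<bar>w [] x\<bar> <= A" by blast
 qed
 from bchoice[OF this] obtain A where A: "ALL c:C. AE x in lborel. x \<in> Om \<inter> ball c (R c) --> \<bar>w [] x\<bar> <= A c" ..
 have "AE x in lborel. ALL c:C. x \<in> Om \<inter> ball c (R c) --> \<bar>w [] x\<bar> <= A c"
  by (intro AE_finite_allI finite_C) (use A in blast)
 then have "AE x in lborel. \<bar>w [] x\<bar> <= (\<Sum>c\<in>C. \<bar>A c\<bar>)"
 proof eventually_elim
  case (elim x)
  show ?case
  proof (cases "x \<in> Om")
   case True
   then obtain c where c: "c \<in> C" "x \<in> ball c (R c)" using cover closure_subset[of Om] by blast
   then have "\<bar>w [] x\<bar> <= \<bar>A c\<bar>" using elim True by fastforce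
   also have "... <= (\<Sum>c\<in>C. \<bar>A c\<bar>)" by (rule member_le_sum) (use c finite_C in auto)
   finally show ?thesis .
  qed (simp add: sqzD(3)[OF w0] sum_nonneg)
 qed
 then show ?thesis by blast
qed

lemma mollify_le_bound:
 assumes g: "sqz Om g" "AE x in lborel. \<bar>g x\<bar> <= K" and Th: "smooth_cs Th" "!!y. 0 <= Th y" "(LBINT y. Th y) = 1"
 shows "\<bar>mollify Th g p\<bar> <= K"
proof -
 have [measurable]: "Th \<in> borel_measurable borel" by (rule smooth_cs_measurable[OF Th(1)])
 have cs: "smooth_cs (%z. Th (z - p))" using smooth_cs_affine[OF Th(1), of 1 "- p"] by simp
 have i: "integrable lborel (%z. g z * Th (z - p))" by (rule mollify_integrable[OF sqz_integrable[OF dom_sets bounded_dom g(1)] Th(1)])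
 have "\<bar>mollify Th g p\<bar> <= (LBINT z. \<bar>g z * Th (z - p)\<bar>)" unfolding mollify_def by (rule integral_abs_bound)
 also have "... <= (LBINT z. K * Th (z - p))"
 proof (rule integral_mono_AE)
  show "AE z in lborel. \<bar>g z * Th (z - p)\<bar> <= K * Th (z - p)"
   using g(2) by eventually_elim (simp add: abs_mult Th(2) mult_right_mono)
 qed (use i smooth_cs_integrable[OF cs] in auto)
 also have "... = K" using integral_lborel_translate[of Th "- p"] Th(3) by simp
 finally show ?thesis .
qed

text \<open>Mollified components have partial derivatives bounded by \<open>K\<close>, and the
  segment from x to x + y stays in the domain for y in the cone, so the mean value inequality
  applies. The limit is taken at almost every x and, by translating the exceptional null set, at
  almost every x + y.\<close>

theorem cone_Lipschitz_intro:
 assumes v: "!!j. sqz Om (v j)" and g: "!!i j. sqz Om (g i j)" and d: "!!i j. wder Om i (v j) (g i j)"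
  and K: "!!i j. AE x in lborel. \<bar>g i j x\<bar> <= K"
 shows "cone_Lipschitz (%x. \<chi> j. v j x)"
 unfolding cone_Lipschitz_def
proof
 fix c assume c: "c \<in> C"
 obtain Th where "approx_kernel c Th" using approx_kernel_exists[OF c] by blast
 then have Th: "!!k. smooth_cs (Th k)" "!!k y. 0 <= Th k y" "!!k. (LBINT y. Th k y) = 1"
  "!!k. closure {y. Th k y ~= 0} \<subseteq> cone_set (e c) (s c) (Ta c)"
  "!!u. sqz Om u ==> \<exists>r :: nat => nat. AE x in lborel. (%k. mollify (Th (r k)) u x) ----> u x"
  unfolding approx_kernel_def by blast+
 let ?n = "real CARD('n)"
 have K0: "0 <= K"
  using mollify_le_bound[OF g K Th(1,2,3)] abs_ge_zero order_trans by blast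
 have diff: "\<bar>mollify (Th k) (v j) (x + y) - mollify (Th k) (v j) x\<bar> <= (?n * K) * norm y"
  if x: "x \<in> Om \<inter> ball c (2 * R c)" and y: "y \<in> cone_set (e c) (s c) (Ta c)" for k j x y
 proof -
  let ?f = "mollify (Th k) (v j)"
  have vi: "integrable lborel (v j)" by (rule sqz_integrable[OF dom_sets bounded_dom v])
  have "norm (?f (x + y) - ?f x) <= (?n * K) * norm (x + y - x)"
  proof (rule differentiable_bound[of "closed_segment x (x + y)"])
   fix p assume p: "p \<in> closed_segment x (x + y)"
   then obtain t where t: "0 <= t" "t <= 1" "p = x + t *\<^sub>R y"
    by (auto simp: in_segment algebra_simps)
   have pp: "p \<in> Om" "p \<in> ball c (2 * (2 * R c))"
   proof -
    have "p \<in> Om & p \<in> ball c (3 * R c)"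
    proof (cases "t = 0")
     case True
     then show ?thesis using t(3) x R_pos[OF c] by auto
    next
     case False
     obtain t' z where z: "0 < t'" "t' < Ta c" "norm (z - e c) <= s c" "y = t' *\<^sub>R z" using y by (auto simp: cone_set_def)
     \<comment> \<open>Points of the segment other than x are again cone steps from x, because the
       truncated cone is closed under multiplication by t in (0, 1].\<close>
     have "t * t' < Ta c" using t z mult_left_le_one_le[of t' t] by linarith
     then have "t *\<^sub>R y \<in> cone_set (e c) (s c) (Ta c)"
      using z t False unfolding cone_set_def by (intro CollectI exI[of _ "t * t'"] exI[of _ z]) auto
     then show ?thesis using cone_point[OF c, of x 2 "t *\<^sub>R y"] x t(3) by auto
    qed
    then show "p \<in> Om" "p \<in> ball c (2 * (2 * R c))" using R_pos[OF c] by auto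
   qed
   have tf: "(%z. Th k (z - p)) \<in> test_functions Om"
    by (rule test_function_shift[OF Th(1,4) cone2[OF c]]) (use pp closure_subset[of Om] in auto)
   have pdf: "\<bar>pd i ?f p\<bar> <= K" for i
   proof -
    have "pd i ?f p = - (LBINT z. v j z * pd i (%z. Th k (z - p)) z)"
     using partials_shift[OF smooth_csD[OF Th(1)], of "[i]" k p]
     by (simp add: pd_mollify[OF vi Th(1)] mollify_def)
    also have "... = mollify (Th k) (g i j) p"
     using d[of i j, unfolded wder_iff] tf by (simp add: mollify_def)
    finally show ?thesis using mollify_le_bound[OF g K Th(1,2,3)] by simp
   qed
   show "(?f has_derivative (%h. grad ?f p \<bullet> h)) (at p within closed_segment x (x + y))"
    using C_inf_has_grad[OF C_inf_mollify[OF vi Th(1)]] has_derivative_at_withinI by blast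
   show "onorm (%h. grad ?f p \<bullet> h) <= ?n * K"
   proof (rule onorm_le)
    fix h :: "real ^ 'n"
    have "norm (grad ?f p) <= (\<Sum>i\<in>UNIV. \<bar>pd i ?f p\<bar>)" using norm_le_l1_cart[of "grad ?f p"] by simp
    also have "... <= ?n * K" using sum_mono[of UNIV "%i. \<bar>pd i ?f p\<bar>" "%i. K"] pdf by simp
    finally have "norm (grad ?f p) * norm h <= ?n * K * norm h" by (rule mult_right_mono) simp
    then show "norm (grad ?f p \<bullet> h) <= ?n * K * norm h" using Cauchy_Schwarz_ineq2[of "grad ?f p" h] by simp
   qed
  qed auto
  then show ?thesis by simp
 qed
 have lim: "AE x in lborel. x \<in> Om \<inter> ball c (2 * R c) --> (AE y in lborel. y \<in> cone_set (e c) (s c) (Ta c) --> \<bar>v j (x + y) - v j x\<bar> <= (?n * K) * norm y)" for j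
 proof -
  obtain r :: "nat => nat" where r: "AE x in lborel. (%k. mollify (Th (r k)) (v j) x) ----> v j x" using Th(5)[OF v] by blast
  then show ?thesis
  proof eventually_elim
   case (elim x)
   show ?case
   proof
    assume x: "x \<in> Om \<inter> ball c (2 * R c)"
    from AE_lborel_translate[OF r, of x]
    show "AE y in lborel. y \<in> cone_set (e c) (s c) (Ta c) --> \<bar>v j (x + y) - v j x\<bar> <= (?n * K) * norm y"
    proof eventually_elim
     case y: (elim y)
     have "\<bar>v j (x + y) - v j x\<bar> <= (?n * K) * norm y" if "y \<in> cone_set (e c) (s c) (Ta c)"
      by (rule LIMSEQ_le_const2[OF tendsto_rabs[OF tendsto_diff[OF y elim]]]) (use diff[OF x that] in blast)
     then show ?case by blast
    qed
   qed
  qed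
 qed
 have "AE x in lborel. ALL j. x \<in> Om \<inter> ball c (2 * R c) --> (AE y in lborel. y \<in> cone_set (e c) (s c) (Ta c) --> \<bar>v j (x + y) - v j x\<bar> <= (?n * K) * norm y)"
  unfolding AE_all_countable using lim by blast
 then have "AE x in lborel. x \<in> Om \<inter> ball c (2 * R c) --> (AE y in lborel. y \<in> cone_set (e c) (s c) (Ta c) -->
   norm ((\<chi> j. v j (x + y)) - (\<chi> j. v j x)) <= (?n * (?n * K)) * norm y)"
 proof eventually_elim
  case (elim x)
  show ?case
  proof
   assume x: "x \<in> Om \<inter> ball c (2 * R c)"
   have "AE y in lborel. ALL j. y \<in> cone_set (e c) (s c) (Ta c) --> \<bar>v j (x + y) - v j x\<bar> <= (?n * K) * norm y"
    unfolding AE_all_countable using elim x by blast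
   then show "AE y in lborel. y \<in> cone_set (e c) (s c) (Ta c) --> norm ((\<chi> j. v j (x + y)) - (\<chi> j. v j x)) <= (?n * (?n * K)) * norm y"
   proof eventually_elim
    case (elim y)
    show ?case
    proof
     assume y: "y \<in> cone_set (e c) (s c) (Ta c)"
     have "norm ((\<chi> j. v j (x + y)) - (\<chi> j. v j x)) <= (\<Sum>j\<in>UNIV. \<bar>v j (x + y) - v j x\<bar>)"
      using norm_le_l1_cart[of "(\<chi> j. v j (x + y)) - (\<chi> j. v j x)"] by simp
     also have "... <= (\<Sum>j\<in>(UNIV :: 'n set). (?n * K) * norm y)" using elim y by (intro sum_mono) blast
     finally show "norm ((\<chi> j. v j (x + y)) - (\<chi> j. v j x)) <= (?n * (?n * K)) * norm y" by (simp add: mult_ac)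
    qed
   qed
  qed
 qed
 moreover have "0 <= ?n * (?n * K)" using K0 by simp
 ultimately show "cone_Lip Om c (R c) (e c) (s c) (Ta c) (%x. \<chi> j. v j x)" unfolding cone_Lip_def by blast
qed

lemma cone_Lipschitz_const: "cone_Lipschitz (%_. a)"
 by (auto simp: cone_Lipschitz_def cone_Lip_def)

end

section \<open>Divergence theorem on epigraphs\<close>

abbreviation slab :: "real ^ 'n::finite => (real ^ 'n) set" where
 "slab e \<equiv> {y. 0 <= y \<bullet> e & y \<bullet> e <= 1}"

text \<open>Tonelli along lines parallel to \<open>e\<close>: for a given z the admissible t form an
  interval of length 1, the height of the slab.\<close>

lemma nn_integral_slab:
 fixes F :: "real ^ 'n::finite => ennreal"
 assumes [measurable]: "F \<in> borel_measurable borel" and e: "norm e = 1"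
 shows "(\<integral>\<^sup>+y. \<integral>\<^sup>+t. indicator (slab e) y * F (y + t *\<^sub>R e) \<partial>lborel \<partial>lborel) = (\<integral>\<^sup>+z. F z \<partial>lborel)"
proof -
 have ee: "e \<bullet> e = 1" using e by (simp add: dot_square_norm)
 let ?I = "%t z. if z \<bullet> e - 1 <= t & t <= z \<bullet> e then 1 else 0 :: ennreal"
 have "(\<integral>\<^sup>+y. \<integral>\<^sup>+t. indicator (slab e) y * F (y + t *\<^sub>R e) \<partial>lborel \<partial>lborel) = (\<integral>\<^sup>+t. \<integral>\<^sup>+y. indicator (slab e) y * F (y + t *\<^sub>R e) \<partial>lborel \<partial>lborel)"
  by (rule lborel_pair.Fubini'[symmetric]) measurable
 also have "... = (\<integral>\<^sup>+t. \<integral>\<^sup>+z. ?I t z * F z \<partial>lborel \<partial>lborel)"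
 proof (rule nn_integral_cong)
  fix t :: real
  have "(\<integral>\<^sup>+z. ?I t z * F z \<partial>lborel) = (\<integral>\<^sup>+y. ?I t (y + t *\<^sub>R e) * F (y + t *\<^sub>R e) \<partial>lborel)"
   by (rule nn_integral_lborel_translate[symmetric]) measurable
  also have "... = (\<integral>\<^sup>+y. indicator (slab e) y * F (y + t *\<^sub>R e) \<partial>lborel)"
   by (rule nn_integral_cong) (auto simp: indicator_def inner_add_left ee)
  finally show "(\<integral>\<^sup>+y. indicator (slab e) y * F (y + t *\<^sub>R e) \<partial>lborel) = (\<integral>\<^sup>+z. ?I t z * F z \<partial>lborel)" ..
 qed
 also have "... = (\<integral>\<^sup>+z. \<integral>\<^sup>+t. ?I t z * F z \<partial>lborel \<partial>lborel)"
  by (rule lborel_pair.Fubini') measurable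
 also have "... = (\<integral>\<^sup>+z. F z \<partial>lborel)"
 proof (rule nn_integral_cong)
  fix z :: "real ^ 'n"
  have "?I t z * F z = F z * indicator {z \<bullet> e - 1..z \<bullet> e} t" for t by (simp add: indicator_def)
  then show "(\<integral>\<^sup>+t. ?I t z * F z \<partial>lborel) = F z" by (simp add: nn_integral_cmult_indicator)
 qed
 finally show ?thesis .
qed

lemma integral_slab:
 fixes F :: "real ^ 'n::finite => real"
 assumes F: "integrable lborel F" and e: "norm e = 1"
 shows "(LBINT y. indicator (slab e) y * (LBINT t. F (y + t *\<^sub>R e))) = (LBINT z. F z)"
  and "integrable lborel (%y. indicator (slab e) y * (LBINT t. F (y + t *\<^sub>R e)))"
proof -
 have [measurable]: "F \<in> borel_measurable borel" using F by auto
 let ?H = "%(y, t). indicator (slab e) y * F (y + t *\<^sub>R e)"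
 have nn: "(\<integral>\<^sup>+z. ennreal \<bar>F z\<bar> \<partial>lborel) < \<infinity>" using F by (simp add: integrable_iff_bounded)
 have H: "integrable (lborel \<Otimes>\<^sub>M lborel) ?H"
 proof (rule integrableI_bounded)
  show "?H \<in> borel_measurable (lborel \<Otimes>\<^sub>M lborel)" by measurable
  have "(\<integral>\<^sup>+p. ennreal (norm (?H p)) \<partial>(lborel \<Otimes>\<^sub>M lborel)) = (\<integral>\<^sup>+y. \<integral>\<^sup>+t. ennreal (norm (?H (y, t))) \<partial>lborel \<partial>lborel)"
   by (rule lborel.nn_integral_fst[symmetric]) measurable
  also have "... = (\<integral>\<^sup>+y. \<integral>\<^sup>+t. indicator (slab e) y * ennreal \<bar>F (y + t *\<^sub>R e)\<bar> \<partial>lborel \<partial>lborel)"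
   by (intro nn_integral_cong) (auto simp: indicator_def)
  also have "... = (\<integral>\<^sup>+z. ennreal \<bar>F z\<bar> \<partial>lborel)" by (rule nn_integral_slab[OF _ e]) measurable
  finally show "(\<integral>\<^sup>+p. ennreal (norm (?H p)) \<partial>(lborel \<Otimes>\<^sub>M lborel)) < \<infinity>" using nn by simp
 qed
 let ?P = "%z. ennreal (F z)" and ?N = "%z. ennreal (- F z)"
 have "(LINT p|(lborel \<Otimes>\<^sub>M lborel). ?H p) = (LBINT z. F z)"
 proof -
  have "(\<integral>\<^sup>+p. ennreal (c * ?H p) \<partial>(lborel \<Otimes>\<^sub>M lborel)) = (\<integral>\<^sup>+z. ennreal (c * F z) \<partial>lborel)" for c
  proof -
   have "(\<integral>\<^sup>+p. ennreal (c * ?H p) \<partial>(lborel \<Otimes>\<^sub>M lborel)) = (\<integral>\<^sup>+y. \<integral>\<^sup>+t. ennreal (c * ?H (y, t)) \<partial>lborel \<partial>lborel)"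
    by (rule lborel.nn_integral_fst[symmetric]) measurable
   also have "... = (\<integral>\<^sup>+y. \<integral>\<^sup>+t. indicator (slab e) y * ennreal (c * F (y + t *\<^sub>R e)) \<partial>lborel \<partial>lborel)"
    by (intro nn_integral_cong) (auto simp: indicator_def)
   also have "... = (\<integral>\<^sup>+z. ennreal (c * F z) \<partial>lborel)" by (rule nn_integral_slab[OF _ e]) measurable
   finally show ?thesis .
  qed
  from this[of 1] this[of "-1"] show ?thesis
   by (simp add: real_lebesgue_integral_def[OF F] real_lebesgue_integral_def[OF H])
 qed
 moreover have "(LBINT y. (LBINT t. ?H (y, t))) = (LINT p|(lborel \<Otimes>\<^sub>M lborel). ?H p)"
  by (rule lborel_pair.integral_fst'[OF H])
 ultimately show "(LBINT y. indicator (slab e) y * (LBINT t. F (y + t *\<^sub>R e))) = (LBINT z. F z)" by simp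
 show "integrable lborel (%y. indicator (slab e) y * (LBINT t. F (y + t *\<^sub>R e)))"
  using lborel_pair.integrable_fst'[OF H] by simp
qed

lemma integral_tail_derivative:
 fixes g g' :: "real => real"
 assumes g: "!!t. (g has_real_derivative g' t) (at t)" "continuous_on UNIV g'" and b: "!!t. b < t ==> g t = 0"
 shows "(LBINT t. indicator {a<..} t * g' t) = - g a"
proof -
 let ?b = "max a b + 1"
 have g'0: "g' t = 0" if "b < t" for t
 proof -
  have "(g has_real_derivative 0) (at t)"
   by (rule has_field_derivative_transform_within_open[where f = "%_. 0" and S = "{b<..}"]) (use that b in auto)
  then show ?thesis using g(1) DERIV_unique by blast
 qed
 have [measurable]: "g' \<in> borel_measurable borel" by (rule borel_measurable_continuous_onI[OF g(2)])
 have "(LBINT t. indicator {a<..} t * g' t) = (LBINT t. g' t * indicator {a..?b} t)"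
 proof (rule integral_cong_AE)
  show "AE t in lborel. indicator {a<..} t * g' t = g' t * indicator {a..?b} t"
   using AE_lborel_singleton[of a] by eventually_elim (auto simp: indicator_def intro!: g'0)
 qed simp_all
 also have "... = g ?b - g a"
  by (rule integral_FTC_Icc_real) (use g in "auto simp: continuous_on_eq_continuous_at")
 finally show ?thesis using b[of ?b] by simp
qed

section \<open>Surface measure and outward normal in a chart\<close>

definition graph_area :: "(real ^ 'n::finite => real) => real ^ 'n => real" where
 "graph_area Ph z = sqrt (1 + (norm (grad Ph z))\<^sup>2)"

text \<open>The image of the area density under projection onto the graph along \<open>e\<close>.
  The slab of height one replaces the hyperplane orthogonal to \<open>e\<close>, as in the defining
  property of the surface measure.\<close>

definition chart_measure :: "real ^ 'n::finite => (real ^ 'n => real) => (real ^ 'n) measure" where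
 "chart_measure e Ph = distr (density lborel (%y. ennreal (indicator (slab e) y * graph_area Ph y))) borel (graph_point e Ph)"

text \<open>The vector \<open>grad Ph z - e\<close> points below the graph, away from the domain;
  its length is the area density because \<open>grad Ph z\<close> is orthogonal to
  \<open>e\<close>.\<close>

definition chart_normal :: "real ^ 'n::finite => (real ^ 'n => real) => real ^ 'n => real ^ 'n" where
 "chart_normal e Ph z = (1 / graph_area Ph z) *\<^sub>R (grad Ph z - e)"

text \<open>Two different unit vectors are told apart by their difference: in the direction
  \<open>\<nu>' - \<nu>\<close> one of them sends the ray into the domain and the other sends it
  out.\<close>

lemma outward_normal_eqI:
 assumes "norm \<nu> = 1"
  and "!!w. w \<bullet> \<nu> < 0 ==> \<forall>\<^sub>F t in at_right 0. x + t *\<^sub>R w \<in> Om"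
  and "!!w. w \<bullet> \<nu> > 0 ==> \<forall>\<^sub>F t in at_right 0. x + t *\<^sub>R w \<notin> Om"
 shows "outward_normal Om x = \<nu>"
 unfolding outward_normal_def
proof (rule the_equality)
 fix \<nu>' assume a: "norm \<nu>' = 1 & (ALL w. w \<bullet> \<nu>' < 0 --> (\<forall>\<^sub>F t in at_right 0. x + t *\<^sub>R w \<in> Om)) &
  (ALL w. w \<bullet> \<nu>' > 0 --> (\<forall>\<^sub>F t in at_right 0. x + t *\<^sub>R w \<notin> Om))"
 show "\<nu>' = \<nu>"
 proof (rule ccontr)
  assume "\<nu>' ~= \<nu>"
  then have "0 < (norm (\<nu>' - \<nu>))\<^sup>2" by simp
  also have "(norm (\<nu>' - \<nu>))\<^sup>2 = 2 - 2 * (\<nu> \<bullet> \<nu>')"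
   using a assms(1) by (simp add: power2_norm_eq_inner inner_diff_left inner_diff_right norm_eq_1 inner_commute)
  finally have "\<nu> \<bullet> \<nu>' < 1" by simp
  then have "(\<nu>' - \<nu>) \<bullet> \<nu>' > 0" "(\<nu>' - \<nu>) \<bullet> \<nu> < 0"
   using a assms(1) by (simp_all add: inner_diff_left norm_eq_1 inner_commute[of \<nu>' \<nu>])
  then have "\<forall>\<^sub>F t in at_right (0::real). x + t *\<^sub>R (\<nu>' - \<nu>) \<notin> Om" "\<forall>\<^sub>F t in at_right (0::real). x + t *\<^sub>R (\<nu>' - \<nu>) \<in> Om"
   using a assms(2) by blast+
  then have "\<forall>\<^sub>F t in at_right (0::real). False" by eventually_elim simp
  then show False by (simp add: trivial_limit_at_right_real)
 qed
qed (use assms in auto)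

locale C1_chart =
 fixes Om :: "(real ^ 'n::finite) set" and e :: "real ^ 'n" and Ph :: "real ^ 'n => real" and B :: "(real ^ 'n) set"
 assumes chart: "graph_chart 1 Om e Ph B" and open_B: "open B"
begin

lemma norm_e: "norm e = 1" and e_e: "e \<bullet> e = 1" and C1: "C_k 1 Ph"
 and axis_invariant: "Ph (x + t *\<^sub>R e) = Ph x" and dom: "x \<in> B ==> x \<in> Om \<longleftrightarrow> Ph x < x \<bullet> e"
 using chart by (auto simp: graph_chart_def norm_eq_1)

lemma C1_props: "Ph differentiable (at x)" "continuous_on UNIV Ph" "continuous_on UNIV (grad Ph)"
 using C1 C_k_Suc[of 0 Ph] C_k_continuous C1_grad_continuous by auto

lemma measurable_chart [measurable]:
 "Ph \<in> borel_measurable borel" "grad Ph \<in> borel_measurable borel" "graph_area Ph \<in> borel_measurable borel"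
 "graph_point e Ph \<in> borel_measurable borel" "chart_normal e Ph \<in> borel_measurable borel"
proof -
 show m [measurable]: "Ph \<in> borel_measurable borel" "grad Ph \<in> borel_measurable borel"
  using C1_props borel_measurable_continuous_onI by blast+
 show [measurable]: "graph_area Ph \<in> borel_measurable borel" unfolding graph_area_def by measurable
 show "graph_point e Ph \<in> borel_measurable borel" unfolding graph_point_def by measurable
 show "chart_normal e Ph \<in> borel_measurable borel" unfolding chart_normal_def by measurable
qed

lemma grad_axis_invariant: "grad Ph (x + t *\<^sub>R e) = grad Ph x"
proof -
 have "((%x. Ph (x + t *\<^sub>R e)) has_derivative (%h. grad Ph (x + t *\<^sub>R e) \<bullet> h)) (at x)"
  by (rule has_derivative_compose[of "%x. x + t *\<^sub>R e" "%h. h" x UNIV Ph "%h. grad Ph (x + t *\<^sub>R e) \<bullet> h"])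
   (auto intro!: derivative_eq_intros differentiable_has_grad C1_props)
 then have "(Ph has_derivative (%h. grad Ph (x + t *\<^sub>R e) \<bullet> h)) (at x)" by (simp add: axis_invariant)
 then have "(%h. grad Ph (x + t *\<^sub>R e) \<bullet> h) = (%h. grad Ph x \<bullet> h)"
  using differentiable_has_grad[OF C1_props(1)] by (rule has_derivative_unique)
 then have "grad Ph (x + t *\<^sub>R e) \<bullet> axis i 1 = grad Ph x \<bullet> axis i 1" for i by meson
 then show ?thesis by (simp add: vec_eq_iff inner_axis del: grad_nth)
qed

lemma ray_derivative:
 "((%t. Ph (x + t *\<^sub>R w)) has_real_derivative grad Ph x \<bullet> w) (at 0)"
proof -
 have "((%t. Ph (x + t *\<^sub>R w)) has_derivative (%t. grad Ph (x + 0 *\<^sub>R w) \<bullet> (t *\<^sub>R w))) (at 0)"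
  by (rule has_derivative_compose[of "%t. x + t *\<^sub>R w" "%t. t *\<^sub>R w" 0 UNIV Ph "%h. grad Ph (x + 0 *\<^sub>R w) \<bullet> h"])
   (auto intro!: derivative_eq_intros differentiable_has_grad C1_props)
 then show ?thesis by (simp add: has_field_derivative_def mult_commute_abs)
qed

lemma grad_orthogonal: "grad Ph x \<bullet> e = 0"
 using DERIV_unique[OF ray_derivative[of x e]] by (simp add: axis_invariant)

text \<open>The field \<open>w + c e\<close> with \<open>c = (\<nabla>Ph - e) \<bullet> w\<close> is tangential to the graphs \<open>x \<bullet> e - Ph = const\<close>, so the smoothed
 indicators \<open>exp_cusp 0 (k (x \<bullet> e - Ph))\<close> of the epigraph are constant along it.\<close>

lemma epigraph_divergence:
 assumes Ps: "smooth_cs Ps"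
 shows "(LBINT x. indicator {x. Ph x < x \<bullet> e} x * (grad Ps x \<bullet> w)) =
   (LBINT y. indicator (slab e) y * (Ps (graph_point e Ph y) * ((grad Ph y - e) \<bullet> w)))" (is "?lhs = ?rhs")
proof -
 let ?E = "{x. Ph x < x \<bullet> e}"
 define c where "c y = (grad Ph y - e) \<bullet> w" for y
 have CPs: "C_inf Ps" using Ps by (rule smooth_csD)
 note [measurable] = smooth_cs_measurable[OF Ps] grad_measurable[OF CPs] measurable_chart
 have cm [measurable]: "c \<in> borel_measurable borel" unfolding c_def[abs_def] by measurable
 have cinv: "c (y + t *\<^sub>R e) = c y" for y t by (simp add: c_def grad_axis_invariant)
 obtain R where R: "R > 0" "!!x. Ps x ~= 0 ==> norm x <= R" using smooth_cs_support[OF Ps] by metis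
 have "compact (c ` cball 0 (R + norm e))"
  unfolding c_def by (intro compact_continuous_image continuous_intros continuous_on_subset[OF C1_props(3)]) auto
 then obtain K where K: "!!x. norm x <= R + norm e ==> \<bar>c x\<bar> <= K"
  using compact_imp_bounded[of "c ` cball 0 (R + norm e)"] unfolding bounded_iff by (metis imageI mem_cball_0 real_norm_def)
 define q where "q x = grad Ps x \<bullet> w + c x * (grad Ps x \<bullet> e)" for x
 have C1Ps: "C_k 1 Ps" using CPs by (simp add: C_inf_def)
 have qi: "integrable lborel q" "integrable lborel (%x. grad Ps x \<bullet> w)" "integrable lborel (%x. c x * (grad Ps x \<bullet> e))"
  using integral_directional_derivative(2)[OF C1Ps R(2), of "%x. 1" w 1] integral_directional_derivative(2)[OF C1Ps R(2) cm cinv K]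
  by (auto simp: q_def[abs_def])
 have zero: "(LBINT x. exp_cusp 0 (real k * (x \<bullet> e - Ph x)) * q x) = 0" for k
 proof -
  let ?s = "%x. real k * (x \<bullet> e - Ph x)" and ?F = "%x. exp_cusp 0 (real k * (x \<bullet> e - Ph x))"
  have C0: "C_inf (%x :: real ^ 'n. r)" "C_inf (%x :: real ^ 'n. real k * (x \<bullet> e))" for r
   by (intro C_inf_const C_inf_mult C_inf_inner)+
  then have "C_k 1 (%x. real k * (x \<bullet> e))" "C_k 1 (%x. - real k * Ph x)"
   using C_k_mult[OF _ C1, of "%x. - real k"] unfolding C_inf_def by blast+
  from C_k_add[OF this] have Cs: "C_k 1 ?s" by (simp add: right_diff_distrib)
  then have ds: "?s differentiable (at x)" "continuous_on UNIV (pd i ?s)" for x i using C_k_Suc[of 0 ?s] by (auto simp: C_k_0)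
  have gs: "grad ?s x = real k *\<^sub>R (e - grad Ph x)" for x
  proof -
   have "(?s has_derivative (%v. real k * (v \<bullet> e - grad Ph x \<bullet> v))) (at x)"
    by (auto intro!: derivative_eq_intros differentiable_has_grad C1_props)
   then have "pd i ?s x = real k * (axis i 1 \<bullet> e - grad Ph x \<bullet> axis i 1)" for i by (rule pd_eq)
   then show ?thesis by (simp add: vec_eq_iff inner_axis inner_axis')
  qed
  have dF: "(?F has_derivative (%v. exp_cusp 2 (?s x) * (grad ?s x \<bullet> v))) (at x)" for x
   using pd_chain[OF ds(1) exp_cusp_deriv[of 0]] by (simp add: numeral_2_eq_2)
  have pF: "pd i ?F = (%x. exp_cusp 2 (?s x) * pd i ?s x)" for i
   by (rule ext) (simp add: pd_eq[OF dF] inner_axis)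
  have c2: "continuous_on UNIV (exp_cusp m)" for m using exp_cusp_deriv DERIV_isCont continuous_at_imp_continuous_on by blast
  have "C_k 1 ?F"
   using C_k_Suc[of 0 ?F] differentiableI[OF dF] continuous_on_mult[OF continuous_on_compose2[OF c2 C_k_continuous[OF Cs]] ds(2)]
   by (simp add: C_k_0 pF)
  then have CF: "C_k 1 (%x. ?F x * Ps x)" by (rule C_k_mult[OF _ C1Ps])
  have gF: "grad (%x. ?F x * Ps x) x = ?F x *\<^sub>R grad Ps x + (exp_cusp 2 (?s x) * Ps x * real k) *\<^sub>R (e - grad Ph x)" for x
   using pd_mult[OF differentiableI[OF dF] C_inf_differentiable[OF CPs]] gs[of x] by (simp add: vec_eq_iff pF)
  have RF: "norm x <= R" if "?F x * Ps x ~= 0" for x using R(2) that by simp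
  note I1 = integral_directional_derivative[OF CF RF, of "%x. 1" w 1] and I2 = integral_directional_derivative[OF CF RF cm cinv K]
  \<comment> \<open>The derivatives of the smoothed indicator cancel here: (e - grad Ph).w + c = 0,
    while (e - grad Ph).e = 1.\<close>
  have "?F x * q x = grad (%x. ?F x * Ps x) x \<bullet> w + c x * (grad (%x. ?F x * Ps x) x \<bullet> e)" for x
   unfolding gF by (simp add: q_def c_def inner_add_left inner_diff_left grad_orthogonal e_e algebra_simps)
  then show ?thesis using I1 I2 by simp
 qed
 have F01: "0 <= exp_cusp 0 t" "exp_cusp 0 t <= 1" for t by (auto simp: exp_cusp_def)
 \<comment> \<open>Above the graph the smoothed indicator is exp (-1 / (k r)) with r > 0 the height
   over the graph and tends to 1; elsewhere it is 0.\<close>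
 have "(%k. \<integral>x. exp_cusp 0 (real k * (x \<bullet> e - Ph x)) * q x \<partial>lborel) ----> (LBINT x. indicator ?E x * q x)"
 proof (rule integral_dominated_convergence[where w = "%x. \<bar>q x\<bar>"])
  show "AE x in lborel. (%k. exp_cusp 0 (real k * (x \<bullet> e - Ph x)) * q x) ----> indicator ?E x * q x"
  proof (intro AE_I2 tendsto_mult tendsto_const)
   fix x
   show "(%k. exp_cusp 0 (real k * (x \<bullet> e - Ph x))) ----> indicator ?E x"
   proof (cases "x \<in> ?E")
    case True
    have "(%k. exp (- (inverse (real k) * (1 / (x \<bullet> e - Ph x))))) ----> exp (- (0 * (1 / (x \<bullet> e - Ph x))))"
     by (intro tendsto_intros lim_inverse_n)
    moreover have "\<forall>\<^sub>F k in sequentially. exp (- (inverse (real k) * (1 / (x \<bullet> e - Ph x)))) = exp_cusp 0 (real k * (x \<bullet> e - Ph x))"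
     using eventually_gt_at_top[of 0] by eventually_elim (use True in "simp add: exp_cusp_def divide_simps")
    ultimately show ?thesis using True by (simp add: filterlim_cong)
   qed (auto simp: exp_cusp_def zero_less_mult_iff)
  qed
  show "AE x in lborel. norm (exp_cusp 0 (real k * (x \<bullet> e - Ph x)) * q x) <= \<bar>q x\<bar>" for k
   using F01 by (intro AE_I2) (simp add: abs_mult mult_left_le_one_le)
  show "(%x. exp_cusp 0 (real k * (x \<bullet> e - Ph x)) * q x) \<in> borel_measurable lborel" for k
   unfolding exp_cusp_def q_def by measurable
 qed (use qi in "auto simp: q_def")
 then have "(LBINT x. indicator ?E x * q x) = 0" unfolding zero by (simp add: LIMSEQ_const_iff)
 moreover have iE: "integrable lborel (%x. indicator ?E x * h x)" if "integrable lborel h" for h :: "real ^ 'n => real"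
  using integrable_mult_indicator[OF _ that, of ?E] by simp
 have "(LBINT x. indicator ?E x * q x) = ?lhs + (LBINT x. indicator ?E x * (c x * (grad Ps x \<bullet> e)))"
  using iE[OF qi(2)] iE[OF qi(3)] by (simp add: q_def distrib_left)
 moreover have "(LBINT x. indicator ?E x * (c x * (grad Ps x \<bullet> e))) = - ?rhs"
 proof -
  have inner: "(LBINT t. indicator ?E (y + t *\<^sub>R e) * (c (y + t *\<^sub>R e) * (grad Ps (y + t *\<^sub>R e) \<bullet> e))) = - (Ps (graph_point e Ph y) * c y)" for y
  proof -
   have "indicator ?E (y + t *\<^sub>R e) = (indicator {Ph y - y \<bullet> e<..} t :: real)" for t
    by (auto simp: indicator_def axis_invariant inner_add_left e_e)
   then have "(LBINT t. indicator ?E (y + t *\<^sub>R e) * (c (y + t *\<^sub>R e) * (grad Ps (y + t *\<^sub>R e) \<bullet> e))) = c y * (LBINT t. indicator {Ph y - y \<bullet> e<..} t * (grad Ps (y + t *\<^sub>R e) \<bullet> e))"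
    by (simp add: cinv mult.left_commute)
   also have "(LBINT t. indicator {Ph y - y \<bullet> e<..} t * (grad Ps (y + t *\<^sub>R e) \<bullet> e)) = - Ps (y + (Ph y - y \<bullet> e) *\<^sub>R e)"
   proof (rule integral_tail_derivative)
    fix t
    have "((%t. Ps (y + t *\<^sub>R e)) has_derivative (%r. grad Ps (y + t *\<^sub>R e) \<bullet> (r *\<^sub>R e))) (at t)"
     by (rule has_derivative_compose[of "%t. y + t *\<^sub>R e" "%r. r *\<^sub>R e" t UNIV Ps "%h. grad Ps (y + t *\<^sub>R e) \<bullet> h"])
      (auto intro!: derivative_eq_intros C_inf_has_grad[OF CPs])
    then show "((%t. Ps (y + t *\<^sub>R e)) has_real_derivative grad Ps (y + t *\<^sub>R e) \<bullet> e) (at t)" by (simp add: has_field_derivative_def mult_commute_abs)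
    show "Ps (y + t *\<^sub>R e) = 0" if "R + norm y < t"
    proof (rule ccontr)
     assume "Ps (y + t *\<^sub>R e) ~= 0"
     then have "norm (y + t *\<^sub>R e) <= R" by (rule R(2))
     then show False using norm_triangle_ineq4[of "y + t *\<^sub>R e" y] norm_e that by simp
    qed
   next
    have "continuous_on UNIV (%t. grad Ps (y + t *\<^sub>R e))"
     by (rule continuous_on_compose2[OF C1_grad_continuous[OF C1Ps]]) (auto intro!: continuous_intros)
    then show "continuous_on UNIV (%t. grad Ps (y + t *\<^sub>R e) \<bullet> e)" by (intro continuous_intros)
   qed
   finally show ?thesis by (simp add: graph_point_def mult.commute)
  qed
  show ?thesis using integral_slab(1)[OF iE[OF qi(3)] norm_e] unfolding inner by (simp add: c_def)
 qed
 ultimately show ?thesis by simp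
qed

lemma graph_point_eq:
 "Ph (graph_point e Ph y) = Ph y" "grad Ph (graph_point e Ph y) = grad Ph y" "graph_area Ph (graph_point e Ph y) = graph_area Ph y"
 "graph_point e Ph y \<bullet> e = Ph y"
 by (simp_all add: graph_point_def axis_invariant grad_axis_invariant graph_area_def inner_add_left e_e)

lemma graph_area_ge_1: "graph_area Ph z >= 1"
 by (simp add: graph_area_def)

lemma graph_area_pos: "graph_area Ph z > 0"
 using graph_area_ge_1[of z] by linarith

lemma chart_normal_e: "chart_normal e Ph z \<bullet> e = - (1 / graph_area Ph z)"
 by (simp add: chart_normal_def inner_diff_left grad_orthogonal e_e)

lemma norm_chart_normal: "norm (chart_normal e Ph z) = 1"
proof -
 have "(norm (grad Ph z - e))\<^sup>2 = 1 + (norm (grad Ph z))\<^sup>2"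
  by (simp add: power2_norm_eq_inner inner_diff_left inner_diff_right grad_orthogonal e_e inner_commute[of e "grad Ph z"])
 then have "norm (grad Ph z - e) = graph_area Ph z"
  unfolding graph_area_def by (metis norm_ge_zero real_sqrt_unique)
 then show ?thesis using graph_area_pos[of z] by (simp add: chart_normal_def)
qed

lemma frontier_chart:
 assumes "z \<in> B"
 shows "z \<in> frontier Om \<longleftrightarrow> Ph z = z \<bullet> e"
proof -
 have ev: "\<forall>\<^sub>F x in nhds z. x \<in> B" using assms open_B by (simp add: eventually_nhds_in_open)
 have c: "isCont (%x. Ph x - x \<bullet> e) z"
  using C1_props(2) by (intro continuous_intros) (simp add: continuous_on_eq_continuous_at)
 have lim: "((%x. Ph x - x \<bullet> e) \<longlongrightarrow> Ph z - z \<bullet> e) (nhds z)" using c tendsto_at_iff_tendsto_nhds[of "%x. Ph x - x \<bullet> e" z] by (simp add: isCont_def)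
 consider "Ph z < z \<bullet> e" | "Ph z > z \<bullet> e" | "Ph z = z \<bullet> e" by linarith
 then show ?thesis
 proof cases
  case 1
  then have "\<forall>\<^sub>F x in nhds z. Ph x - x \<bullet> e < 0" using order_tendstoD(2)[OF lim, of 0] by simp
  with ev have "\<forall>\<^sub>F x in nhds z. x \<in> Om" by eventually_elim (simp add: dom)
  then have "z \<in> interior Om" by (auto simp: eventually_nhds interior_def)
  then show ?thesis using 1 by (simp add: frontier_def)
 next
  case 2
  then have "\<forall>\<^sub>F x in nhds z. Ph x - x \<bullet> e > 0" using order_tendstoD(1)[OF lim, of 0] by simp
  with ev have "\<forall>\<^sub>F x in nhds z. x \<in> - Om" by eventually_elim (simp add: dom)
  then have "z \<in> interior (- Om)" by (auto simp: eventually_nhds interior_def)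
  then show ?thesis using 2 by (simp add: frontier_def interior_complement)
 next
  case 3
  have "((%t. z + t *\<^sub>R e) \<longlongrightarrow> z + 0 *\<^sub>R e) (at_right 0)" by (intro tendsto_intros)
  then have l: "((%t. z + t *\<^sub>R e) \<longlongrightarrow> z) (at_right 0)" by simp
  have "\<forall>\<^sub>F t in at_right 0. z + t *\<^sub>R e \<in> B" using topological_tendstoD[OF l open_B assms] .
  with eventually_at_right_less[of "0::real"] have "\<forall>\<^sub>F t in at_right 0. z + t *\<^sub>R e \<in> Om"
   by eventually_elim (simp add: dom axis_invariant 3 inner_add_left e_e)
  then have "\<forall>\<^sub>F t in at_right 0. z + t *\<^sub>R e \<in> closure Om" by eventually_elim (use closure_subset in blast)
  then have "z \<in> closure Om" by (rule Lim_in_closed_set[OF closed_closure _ trivial_limit_at_right_real l])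
  moreover have "z \<notin> interior Om" using 3 dom[OF assms] interior_subset by force
  ultimately show ?thesis using 3 by (simp add: frontier_def)
 qed
qed

text \<open>Along a ray in direction w the function Ph x - x.e has derivative
  \<open>graph_area Ph z\<close> times w.n, so the sign of w.n decides on which side of the graph
  the ray starts.\<close>

lemma outward_normal_chart:
 assumes "z \<in> B" "z \<in> frontier Om"
 shows "outward_normal Om z = chart_normal e Ph z"
proof (rule outward_normal_eqI[OF norm_chart_normal])
 have z: "Ph z = z \<bullet> e" using assms frontier_chart by simp
 have inB: "\<forall>\<^sub>F t in at_right 0. z + t *\<^sub>R w \<in> B" for w
 proof -
  have "((%t. z + t *\<^sub>R w) \<longlongrightarrow> z + 0 *\<^sub>R w) (at_right 0)" by (intro tendsto_intros)
  then show ?thesis using topological_tendstoD[OF _ open_B] assms(1) by fastforce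
 qed
 have d: "((%t. Ph (z + t *\<^sub>R w) - (z + t *\<^sub>R w) \<bullet> e) has_real_derivative graph_area Ph z * (w \<bullet> chart_normal e Ph z)) (at 0)" for w
 proof -
  have "((%t. Ph (z + t *\<^sub>R w) - (z \<bullet> e + t * (w \<bullet> e))) has_real_derivative (grad Ph z \<bullet> w - (0 + 1 * (w \<bullet> e)))) (at 0)"
   by (intro DERIV_diff ray_derivative DERIV_add DERIV_const DERIV_cmult_right DERIV_ident)
  moreover have "graph_area Ph z * (w \<bullet> chart_normal e Ph z) = grad Ph z \<bullet> w - (0 + 1 * (w \<bullet> e))"
   using graph_area_pos[of z] by (simp add: chart_normal_def inner_diff_right inner_commute)
  ultimately show ?thesis by (simp only: inner_add_left inner_scaleR_left)
 qed
 have lim: "((%t. (Ph (z + t *\<^sub>R w) - (z + t *\<^sub>R w) \<bullet> e) / t) \<longlongrightarrow> graph_area Ph z * (w \<bullet> chart_normal e Ph z)) (at_right 0)" for w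
  using d[of w] z unfolding DERIV_def by (auto intro: tendsto_mono[OF at_le])
 show "\<forall>\<^sub>F t in at_right 0. z + t *\<^sub>R w \<in> Om" if "w \<bullet> chart_normal e Ph z < 0" for w
 proof -
  have "graph_area Ph z * (w \<bullet> chart_normal e Ph z) < 0" using that graph_area_pos by (simp add: mult_pos_neg)
  from order_tendstoD(2)[OF lim this] inB[of w] eventually_at_right_less[of "0::real"] show ?thesis
   by eventually_elim (simp add: dom divide_less_0_iff)
 qed
 show "\<forall>\<^sub>F t in at_right 0. z + t *\<^sub>R w \<notin> Om" if "w \<bullet> chart_normal e Ph z > 0" for w
 proof -
  have "graph_area Ph z * (w \<bullet> chart_normal e Ph z) > 0" using that graph_area_pos by simp
  from order_tendstoD(1)[OF lim this] inB[of w] eventually_at_right_less[of "0::real"] show ?thesis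
   by eventually_elim (simp add: dom zero_less_divide_iff)
 qed
qed

section \<open>Integration against the measure of a chart\<close>

lemma sets_chart_measure [simp, measurable_cong]: "sets (chart_measure e Ph) = sets borel"
 by (simp add: chart_measure_def)

lemma nn_integral_chart_measure:
 assumes [measurable]: "F \<in> borel_measurable borel"
 shows "(\<integral>\<^sup>+z. F z \<partial>chart_measure e Ph) = (\<integral>\<^sup>+y. ennreal (indicator (slab e) y * graph_area Ph y) * F (graph_point e Ph y) \<partial>lborel)"
 unfolding chart_measure_def by (subst nn_integral_distr) (simp_all add: nn_integral_density)

lemma emeasure_chart_measure:
 assumes [measurable]: "A \<in> sets borel"
 shows "emeasure (chart_measure e Ph) A = (\<integral>\<^sup>+y. ennreal (sqrt (1 + (norm (grad Ph y))\<^sup>2))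
         * indicator {y. 0 <= y \<bullet> e & y \<bullet> e <= 1 & graph_point e Ph y \<in> A} y \<partial>lborel)"
proof -
 have "emeasure (chart_measure e Ph) A = (\<integral>\<^sup>+z. indicator A z \<partial>chart_measure e Ph)" by simp
 also have "... = (\<integral>\<^sup>+y. ennreal (indicator (slab e) y * graph_area Ph y) * indicator A (graph_point e Ph y) \<partial>lborel)"
  by (rule nn_integral_chart_measure) measurable
 also have "... = (\<integral>\<^sup>+y. ennreal (sqrt (1 + (norm (grad Ph y))\<^sup>2))
         * indicator {y. 0 <= y \<bullet> e & y \<bullet> e <= 1 & graph_point e Ph y \<in> A} y \<partial>lborel)"
  by (rule nn_integral_cong) (auto simp: indicator_def graph_area_def)
 finally show ?thesis .
qed

lemma integral_chart_measure:
 assumes [measurable]: "F \<in> borel_measurable borel"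
 shows "(\<integral>z. F z \<partial>chart_measure e Ph) = (LBINT y. indicator (slab e) y * graph_area Ph y * F (graph_point e Ph y))"
 unfolding chart_measure_def
 by (subst integral_distr) (simp_all add: integral_density less_imp_le[OF graph_area_pos])

lemma chart_measure_graph: "AE z in chart_measure e Ph. Ph z = z \<bullet> e"
 unfolding chart_measure_def by (subst AE_distr_iff) (simp_all add: graph_point_eq)

text \<open>A point of the slab differs from its graph point only in the component along
  \<open>e\<close>, and that component is at most 1. Graph points in a ball of radius M therefore
  come from the ball of radius 2 M + 1, where the area density is bounded.\<close>

lemma chart_measure_finite: "emeasure (chart_measure e Ph) (cball 0 M) < \<infinity>"
proof -
 have [measurable]: "cball (0 :: real ^ 'n) M \<in> sets borel" by simp
 have "compact (graph_area Ph ` cball 0 M)"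
  unfolding graph_area_def by (intro compact_continuous_image continuous_intros continuous_on_subset[OF C1_props(3)]) auto
 then have "bounded (graph_area Ph ` cball 0 M)" by (rule compact_imp_bounded)
 then obtain K where K: "ALL y:graph_area Ph ` cball 0 M. norm y <= K" unfolding bounded_iff by blast
 have "emeasure (chart_measure e Ph) (cball 0 M) = (\<integral>\<^sup>+z. indicator (cball 0 M) z \<partial>chart_measure e Ph)" by simp
 also have "... = (\<integral>\<^sup>+y. ennreal (indicator (slab e) y * graph_area Ph y) * indicator (cball 0 M) (graph_point e Ph y) \<partial>lborel)"
  by (rule nn_integral_chart_measure) measurable
 also have "... <= (\<integral>\<^sup>+y. ennreal K * indicator (cball (0 :: real ^ 'n) (2 * M + 1)) y \<partial>lborel)"
 proof (rule nn_integral_mono)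
  fix y
  show "ennreal (indicator (slab e) y * graph_area Ph y) * indicator (cball 0 M) (graph_point e Ph y) <= ennreal K * indicator (cball 0 (2 * M + 1)) y"
  proof (cases "y \<in> slab e & graph_point e Ph y \<in> cball 0 M")
   case True
   let ?z = "graph_point e Ph y"
   have z: "norm ?z <= M" using True by simp
   have "\<bar>?z \<bullet> e\<bar> <= M" using Cauchy_Schwarz_ineq2[of ?z e] z norm_e by simp
   moreover have "y = ?z - (?z \<bullet> e) *\<^sub>R e + (y \<bullet> e) *\<^sub>R e" by (simp add: graph_point_eq) (simp add: graph_point_def algebra_simps)
   then have "norm y <= norm ?z + norm ((?z \<bullet> e) *\<^sub>R e) + norm ((y \<bullet> e) *\<^sub>R e)"
    by (metis norm_triangle_ineq4 norm_triangle_le add_right_mono order_refl)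
   ultimately have "norm y <= 2 * M + 1" using z True norm_e by simp
   moreover have "graph_area Ph ?z <= K" using K True graph_area_pos[of ?z] by force
   ultimately show ?thesis using True by (simp add: graph_point_eq(3) ennreal_leI)
  qed (auto simp: indicator_def)
 qed
 also have "... < \<infinity>" using emeasure_bounded_finite[of "cball (0 :: real ^ 'n) (2 * M + 1)"] by (simp add: nn_integral_cmult_indicator ennreal_mult_less_top)
 finally show ?thesis .
qed

lemma integrable_chart_measure:
 fixes F :: "real ^ 'n => real"
 assumes [measurable]: "F \<in> borel_measurable borel" and F: "!!z. \<bar>F z\<bar> <= K" "!!z. F z ~= 0 ==> norm z <= M"
 shows "integrable (chart_measure e Ph) F"
proof (rule Bochner_Integration.integrable_bound)
 show "integrable (chart_measure e Ph) (%z. K * indicator (cball 0 M) z :: real)"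
  using chart_measure_finite[of M] by (intro integrable_mult_right integrable_real_indicator) simp_all
 show "AE z in chart_measure e Ph. norm (F z) <= norm (K * indicator (cball 0 M) z)"
 proof (rule AE_I2)
  fix z show "norm (F z) <= norm (K * indicator (cball 0 M) z)" using F[of z] by (cases "F z = 0") auto
 qed
qed simp

lemma chart_divergence:
 assumes Ps: "smooth_cs Ps" "!!z. Ps z ~= 0 ==> z \<in> B" "closure {z. Ps z ~= 0} \<subseteq> B"
 shows "(LBINT x. indicator Om x * (grad Ps x \<bullet> w)) = (\<integral>z. Ps z * (chart_normal e Ph z \<bullet> w) \<partial>chart_measure e Ph)"
proof -
 note [measurable] = smooth_cs_measurable[OF Ps(1)]
 have off: "grad Ps x = 0" if "x \<notin> B" for x
 proof -
  have "x \<notin> closure {z. Ps z ~= 0}" using Ps(3) that by blast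
  then show ?thesis using pd_outside_support[of x Ps] by (simp add: vec_eq_iff)
 qed
 have "(LBINT x. indicator Om x * (grad Ps x \<bullet> w)) = (LBINT x. indicator {x. Ph x < x \<bullet> e} x * (grad Ps x \<bullet> w))"
 proof (rule Bochner_Integration.integral_cong[OF refl])
  fix x show "indicator Om x * (grad Ps x \<bullet> w) = indicator {x. Ph x < x \<bullet> e} x * (grad Ps x \<bullet> w)"
   using off[of x] dom[of x] by (cases "x \<in> B") (simp_all add: indicator_def)
 qed
 also have "... = (LBINT y. indicator (slab e) y * (Ps (graph_point e Ph y) * ((grad Ph y - e) \<bullet> w)))"
  by (rule epigraph_divergence[OF Ps(1)])
 also have "... = (LBINT y. indicator (slab e) y * graph_area Ph y * (Ps (graph_point e Ph y) * (chart_normal e Ph (graph_point e Ph y) \<bullet> w)))"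
  by (rule Bochner_Integration.integral_cong[OF refl])
   (use graph_area_pos in "simp add: chart_normal_def graph_point_eq less_imp_neq[symmetric]")
 also have "... = (\<integral>z. Ps z * (chart_normal e Ph z \<bullet> w) \<partial>chart_measure e Ph)"
  by (rule integral_chart_measure[symmetric]) measurable
 finally show ?thesis .
qed

end

section \<open>The surface measure and the divergence theorem on smooth domains\<close>

lemma emeasure_eq_density:
 assumes sets: "sets M = sets borel" "sets N = sets borel" and [measurable]: "G \<in> sets borel"
  and eq: "!!X. X \<in> sets borel ==> X \<subseteq> G ==> emeasure M X = emeasure N X"
 shows "density M (indicator G) = density N (indicator G)"
proof (rule measure_eqI)
 note [measurable_cong] = sets
 fix X assume "X \<in> sets (density M (indicator G))"
 then have [measurable]: "X \<in> sets borel" by (simp add: sets)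
 have *: "emeasure (density K (indicator G)) X = emeasure K (G \<inter> X)" if [measurable_cong]: "sets K = sets borel" for K
 proof -
  have "(\<integral>\<^sup>+x. indicator G x * indicator X x \<partial>K) = (\<integral>\<^sup>+x. indicator (G \<inter> X) x \<partial>K)"
   by (rule nn_integral_cong) (simp add: indicator_def)
  then show ?thesis by (subst emeasure_density) simp_all
 qed
 show "emeasure (density M (indicator G)) X = emeasure (density N (indicator G)) X"
  unfolding *[OF sets(1)] *[OF sets(2)] by (rule eq) auto
qed (simp add: sets)

lemma nn_integral_eq_local:
 assumes sets: "sets M = sets borel" "sets N = sets borel" and G [measurable]: "G \<in> sets borel"
  and eq: "!!X. X \<in> sets borel ==> X \<subseteq> G ==> emeasure M X = emeasure N X"
  and [measurable]: "F \<in> borel_measurable borel" and off: "!!x. x \<notin> G ==> F x = 0"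
 shows "(\<integral>\<^sup>+x. F x \<partial>M) = (\<integral>\<^sup>+x. F x \<partial>N)"
proof -
 have *: "(\<integral>\<^sup>+x. F x \<partial>density K (indicator G)) = (\<integral>\<^sup>+x. F x \<partial>K)" if [measurable_cong]: "sets K = sets borel" for K
  by (subst nn_integral_density) (auto intro!: nn_integral_cong simp: indicator_def off)
 show ?thesis using *[OF sets(1)] *[OF sets(2)] emeasure_eq_density[OF sets G eq] by simp
qed

lemma integral_eq_local:
 fixes F :: "_ => real"
 assumes sets: "sets M = sets borel" "sets N = sets borel" and G [measurable]: "G \<in> sets borel"
  and eq: "!!X. X \<in> sets borel ==> X \<subseteq> G ==> emeasure M X = emeasure N X"
  and [measurable]: "F \<in> borel_measurable borel" and off: "!!x. x \<notin> G ==> F x = 0"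
 shows "(LINT x|M. F x) = (LINT x|N. F x)"
proof -
 have *: "(\<integral>x. F x \<partial>density K (%x. ennreal (indicator G x))) = (LINT x|K. F x)" if [measurable_cong]: "sets K = sets borel" for K
  by (subst integral_density) (auto intro!: Bochner_Integration.integral_cong simp: indicator_def off)
 show ?thesis using *[OF sets(1)] *[OF sets(2)] emeasure_eq_density[OF sets G eq] by (simp add: ennreal_indicator)
qed

lemma sum_measure_exists:
 fixes K :: "'i => ('a::topological_space) measure"
 assumes "finite I" and K: "!!i. i \<in> I ==> sets (K i) = sets borel"
 obtains T where "sets T = sets borel" "!!A. A \<in> sets borel ==> emeasure T A = (\<Sum>i\<in>I. emeasure (K i) A)"
proof
 let ?f = "%A. \<Sum>i\<in>I. emeasure (K i) A"
 let ?T = "measure_of UNIV (sets borel) ?f"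
 have sa: "sigma_algebra (UNIV :: 'a set) (sets borel)" using sets.sigma_algebra_axioms[of "borel :: 'a measure"] by simp
 then show T: "sets ?T = sets borel" by (simp add: sigma_algebra.sigma_sets_eq)
 fix A :: "'a set" assume "A \<in> sets borel"
 show "emeasure ?T A = ?f A"
 proof (rule emeasure_measure_of[OF refl])
  show "countably_additive (sets ?T) ?f"
  proof (rule countably_additiveI)
   fix B :: "nat => 'a set" assume B: "range B \<subseteq> sets ?T" "disjoint_family B"
   have "(\<Sum>n. ?f (B n)) = (\<Sum>i\<in>I. \<Sum>n. emeasure (K i) (B n))" by (rule suminf_sum) simp
   also have "... = ?f (\<Union>n. B n)"
    by (rule sum.cong[OF refl]) (use B T K in "simp add: suminf_emeasure")
   finally show "(\<Sum>n. ?f (B n)) = ?f (\<Union>n. B n)" .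
  qed
 qed (use \<open>A \<in> sets borel\<close> T in "auto simp: positive_def")
qed

text \<open>Both charts express the same volume integral of the derivative of a test function along
  \<open>e1\<close>, and on the overlap both normals are the outward normal. So the two measures
  agree after weighting with a normal component that is positive in the first chart, and the weight
  can be divided out.\<close>

lemma chart_measure_unique:
 assumes 1: "C1_chart Om e1 Ph1 B1" and 2: "C1_chart Om e2 Ph2 B2" and A: "A \<in> sets borel" "A \<subseteq> B1 \<inter> B2"
 shows "emeasure (chart_measure e1 Ph1) A = emeasure (chart_measure e2 Ph2) A"
proof -
 interpret 1: C1_chart Om e1 Ph1 B1 by fact
 interpret 2: C1_chart Om e2 Ph2 B2 by fact
 let ?G = "B1 \<inter> B2"
 have G: "open ?G" using "1.open_B" "2.open_B" by blast
 \<comment> \<open>minus the normal component of the first axis, computed in the first chart\<close>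
 define h where "h z = 1 / graph_area Ph1 z" for z
 have h [measurable]: "h \<in> borel_measurable borel" unfolding h_def by measurable
 have h01: "0 < h z" "h z <= 1" for z using "1.graph_area_ge_1"[of z] "1.graph_area_pos"[of z] by (simp_all add: h_def)
 have main: "(\<integral>\<^sup>+z. ennreal (h z) * ennreal (Ps z) \<partial>chart_measure e1 Ph1) = (\<integral>\<^sup>+z. ennreal (h z) * ennreal (Ps z) \<partial>chart_measure e2 Ph2) &
   (\<integral>\<^sup>+z. ennreal (h z) * ennreal (Ps z) \<partial>chart_measure e1 Ph1) < \<infinity>"
  if Ps: "smooth_cs Ps" "!!x. 0 <= Ps x" "!!x. Ps x <= 1" "closure {x. Ps x ~= 0} \<subseteq> ?G" for Ps :: "real ^ 'a => real"
 proof -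
  note [measurable] = smooth_cs_measurable[OF Ps(1)]
  obtain M where M: "!!x. Ps x ~= 0 ==> norm x <= M" using smooth_cs_support[OF Ps(1)] by metis
  have on: "z \<in> ?G" if "Ps z ~= 0" for z using that Ps(4) closure_subset[of "{x. Ps x ~= 0}"] by auto
  have b: "\<bar>h z * Ps z\<bar> <= 1" for z using h01[of z] Ps(2,3)[of z] by (simp add: abs_mult mult_le_one)
  have nz: "norm z <= M" if "h z * Ps z ~= 0" for z using M that by simp
  have i: "integrable (chart_measure e1 Ph1) (%z. h z * Ps z)" "integrable (chart_measure e2 Ph2) (%z. h z * Ps z)"
   by (rule "1.integrable_chart_measure"[OF _ b nz] "2.integrable_chart_measure"[OF _ b nz]; simp)+
  have "(\<integral>z. h z * Ps z \<partial>chart_measure e1 Ph1) = (\<integral>z. Ps z * (chart_normal e1 Ph1 z \<bullet> - e1) \<partial>chart_measure e1 Ph1)"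
   by (simp add: "1.chart_normal_e" h_def mult.commute)
  also have "... = (LBINT x. indicator Om x * (grad Ps x \<bullet> - e1))"
   by (rule "1.chart_divergence"[symmetric]) (use Ps on in auto)
  also have "... = (\<integral>z. Ps z * (chart_normal e2 Ph2 z \<bullet> - e1) \<partial>chart_measure e2 Ph2)"
   by (rule "2.chart_divergence") (use Ps on in auto)
  also have "... = (\<integral>z. h z * Ps z \<partial>chart_measure e2 Ph2)"
  proof (rule integral_cong_AE)
   show "AE z in chart_measure e2 Ph2. Ps z * (chart_normal e2 Ph2 z \<bullet> - e1) = h z * Ps z"
    using "2.chart_measure_graph"
   proof eventually_elim
    case (elim z)
    show ?case
    proof (cases "Ps z = 0")
     case False
     then have z: "z \<in> B1" "z \<in> B2" using on by auto
     then have "z \<in> frontier Om" using "2.frontier_chart" elim by blast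
     then have "chart_normal e2 Ph2 z = chart_normal e1 Ph1 z"
      using z "1.outward_normal_chart" "2.outward_normal_chart" by metis
     then show ?thesis by (simp add: "1.chart_normal_e" h_def)
    qed simp
   qed
  qed simp_all
  finally have e: "(\<integral>z. h z * Ps z \<partial>chart_measure e1 Ph1) = (\<integral>z. h z * Ps z \<partial>chart_measure e2 Ph2)" .
  have p: "0 <= h z * Ps z" for z using h01[of z] Ps(2)[of z] by simp
  have c: "ennreal (h z) * ennreal (Ps z) = ennreal (h z * Ps z)" for z using Ps(2)[of z] by (simp add: ennreal_mult'')
  show ?thesis unfolding c using nn_integral_eq_integral[OF i(1)] nn_integral_eq_integral[OF i(2)] p e by simp
 qed
 have eq: "emeasure (density (chart_measure e1 Ph1) h) X = emeasure (density (chart_measure e2 Ph2) h) X"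
  if "X \<in> sets borel" "X \<subseteq> ?G" for X
 proof (rule measure_eq_smooth_local[OF _ _ G _ that])
  fix b :: "real ^ 'a => real" assume b: "smooth_cs b" "!!x. 0 <= b x" "!!x. b x <= 1" "closure {x. b x ~= 0} \<subseteq> ?G"
  note [measurable] = smooth_cs_measurable[OF b(1)]
  show "(\<integral>\<^sup>+x. ennreal (b x) \<partial>density (chart_measure e1 Ph1) (%x. ennreal (h x))) = (\<integral>\<^sup>+x. ennreal (b x) \<partial>density (chart_measure e2 Ph2) (%x. ennreal (h x))) &
   (\<integral>\<^sup>+x. ennreal (b x) \<partial>density (chart_measure e1 Ph1) (%x. ennreal (h x))) < \<infinity>"
   using main[OF b, THEN conjunct1] main[OF b, THEN conjunct2] by (simp add: nn_integral_density)
 qed simp_all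
 have inv: "ennreal (h z) * ennreal (graph_area Ph1 z) = 1" for z
  using "1.graph_area_pos"[of z] by (simp add: h_def ennreal_mult''[symmetric])
 note [measurable] = A(1)
 have *: "emeasure K A = (\<integral>\<^sup>+z. ennreal (graph_area Ph1 z) * indicator A z \<partial>density K h)"
  if [measurable_cong]: "sets K = sets borel" for K
  by (subst nn_integral_density) (simp_all add: mult.assoc[symmetric] inv)
 show ?thesis unfolding *[of "chart_measure e1 Ph1", simplified] *[of "chart_measure e2 Ph2", simplified]
  by (rule nn_integral_eq_local[of _ _ ?G, OF _ _ _ eq]) (use A G in "auto simp: indicator_def")
qed

lemma is_surface_measure_unique:
 assumes S: "is_surface_measure Om S" "is_surface_measure Om S'" and I: "finite I" "frontier Om \<subseteq> (\<Union>c\<in>I. ball c (r c))"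
  and ch: "!!c. c \<in> I ==> graph_chart 1 Om (e c) (Ph c) (ball c (r c))"
 shows "S = S'"
proof (rule measure_eqI)
 have s: "sets S = sets S'" "sets S = sets (restrict_space borel (frontier Om))" using S by (simp_all add: is_surface_measure_def)
 then show "sets S = sets S'" by blast
 have b: "A \<inter> ball c (r c) \<in> sets S" if "A \<in> sets S" for A c
 proof -
  obtain A' where "A' \<in> sets borel" "A = frontier Om \<inter> A'" using \<open>A \<in> sets S\<close> unfolding s(2) sets_restrict_space by blast
  then show ?thesis unfolding s(2) sets_restrict_space by (intro image_eqI[of _ _ "A' \<inter> ball c (r c)"]) auto
 qed
 have loc: "emeasure S A = emeasure S' A" if "A \<in> sets S" "A \<subseteq> ball c (r c)" "c \<in> I" for A c
  using S(1)[unfolded is_surface_measure_def, THEN conjunct2, rule_format, OF ch[OF that(3)] that(1,2)]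
   S(2)[unfolded is_surface_measure_def, THEN conjunct2, rule_format, OF ch[OF that(3)] that(1)[unfolded s(1)] that(2)] by simp
 have gen: "emeasure S A = emeasure S' A" if "finite J" "J \<subseteq> I" "A \<in> sets S" "A \<subseteq> (\<Union>c\<in>J. ball c (r c))" for A J
  using that
 proof (induction J arbitrary: A rule: finite_induct)
  case (insert c J)
  let ?X = "A \<inter> ball c (r c)" and ?Y = "A - A \<inter> ball c (r c)"
  have X: "?X \<in> sets S" "?Y \<in> sets S" using b insert.prems(2) by auto
  have "emeasure S ?X = emeasure S' ?X" by (rule loc[of _ c]) (use X insert.prems in auto)
  moreover have "emeasure S ?Y = emeasure S' ?Y" by (rule insert.IH) (use X insert.prems in auto)
  moreover have "emeasure S (?X \<union> ?Y) = emeasure S ?X + emeasure S ?Y" "emeasure S' (?X \<union> ?Y) = emeasure S' ?X + emeasure S' ?Y"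
   using X s(1) by (intro plus_emeasure[symmetric]; auto)+
  moreover have "?X \<union> ?Y = A" by blast
  ultimately show ?case by simp
 qed simp
 fix A assume A: "A \<in> sets S"
 then have "A \<subseteq> frontier Om" unfolding s(2) sets_restrict_space by blast
 then show "emeasure S A = emeasure S' A" using I A by (intro gen[of I]) auto
qed

text \<open>Balls inside the domain come with a cone alone; in every other ball the axis of the cone
  is also the axis of a graph chart.\<close>

locale smooth_domain = cone_cover +
 fixes Ph :: "real ^ 'a => real ^ 'a => real"
 assumes charts: "!!c. c \<in> C ==> ball c (2 * R c) \<subseteq> Om \<or> graph_chart 1 Om (e c) (Ph c) (ball c (2 * R c))"

lemma interior_cone:
 fixes x :: "real ^ 'n::finite"
 assumes "open Om" "x \<in> Om"
 shows "\<exists>R s Ta e. cone_at Om x (2 * R) e s Ta & s <= 1 / 2 & 2 * Ta <= R & norm e = 1 & ball x (2 * R) \<subseteq> Om"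
proof -
 obtain r where r: "r > 0" "ball x r \<subseteq> Om" using assms openE by blast
 define e :: "real ^ 'n" where "e = axis (SOME i. True) 1"
 have e: "norm e = 1" by (simp add: e_def)
 \<comment> \<open>Vertices lie within r/2 of x and cone vectors are shorter than r/8, so everything
   stays in the ball of radius r.\<close>
 have "cone_at Om x (2 * (r / 8)) e (1 / 2) (r / 16)"
  unfolding cone_at_def
 proof (intro conjI ballI)
  fix a y assume a: "a \<in> closure Om \<inter> ball x (2 * (2 * (r / 8)))" and "y \<in> cone_set e (1 / 2) (r / 16)"
  then obtain t z where y: "y = t *\<^sub>R z" "0 < t" "t < r / 16" "norm (z - e) <= 1 / 2" by (auto simp: cone_set_def)
  have "norm z <= 2" using norm_triangle_ineq2[of z e] y e by linarith
  then have "norm y <= t * 2" using y by simp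
  then have "norm y < r / 8" using y by linarith
  moreover have "dist x (a + y) <= dist x a + norm y" by (metis dist_norm dist_triangle add_diff_cancel_left' norm_minus_commute dist_commute)
  ultimately have "a + y \<in> ball x r" using a r(1) by simp
  then show "a + y \<in> Om" using r by blast
 qed (use r in auto)
 then show ?thesis using e r by (intro exI[of _ "r / 8"] exI[of _ "1 / 2 :: real"] exI[of _ "r / 16"] exI[of _ e]) auto
qed

text \<open>With L a Lipschitz constant of the graph and L s < 1/2, a cone vector t z lifts a point
  by at least t/2 along the axis while the graph rises by less than t/2.\<close>

lemma boundary_cone:
 fixes x :: "real ^ 'n::finite"
 assumes "open Om" "r > 0" and ch: "graph_chart 1 Om e Ph (ball x r)"
 shows "\<exists>R s Ta. cone_at Om x (2 * R) e s Ta & s <= 1 / 2 & 2 * Ta <= R & norm e = 1 & graph_chart 1 Om e Ph (ball x (2 * R))"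
proof -
 interpret C1_chart Om e Ph "ball x r" by unfold_locales (use ch in auto)
 obtain L where L: "L >= 0" "!!a b. a \<in> cball x r ==> b \<in> cball x r ==> \<bar>Ph a - Ph b\<bar> <= L * norm (a - b)"
  using C1_Lipschitz_on_ball[OF C1] by metis
 define s where "s = min (1 / 2) (1 / (2 * (L + 1)))"
 have s: "s > 0" "s <= 1 / 2" using L(1) by (simp_all add: s_def)
 have "L * s <= L * (1 / (2 * (L + 1)))" using L(1) by (intro mult_left_mono) (simp_all add: s_def)
 also have "... < 1 / 2" using L(1) by (simp add: field_simps)
 finally have Ls: "L * s < 1 / 2" .
 have "cone_at Om x (2 * (r / 8)) e s (r / 16)"
  unfolding cone_at_def
 proof (intro conjI ballI)
  fix a y assume a: "a \<in> closure Om \<inter> ball x (2 * (2 * (r / 8)))" and "y \<in> cone_set e s (r / 16)"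
  then obtain t z where y: "y = t *\<^sub>R z" "0 < t" "t < r / 16" "norm (z - e) <= s" by (auto simp: cone_set_def)
  have "norm z <= 2" using norm_triangle_ineq2[of z e] y norm_e s by linarith
  then have "norm y <= t * 2" using y by simp
  then have ny: "norm y < r / 8" using y by linarith
  have "norm (t *\<^sub>R (z - e)) <= t * 1" using y s by (simp only: norm_scaleR) (auto intro!: mult_left_mono)
  then have ne: "norm (t *\<^sub>R (z - e)) < r / 8" using y by linarith
  have near: "a + b \<in> ball x r" if "norm b < r / 8" for b
  proof -
   have "dist x (a + b) <= dist x a + norm b" by (metis dist_norm dist_triangle add_diff_cancel_left' norm_minus_commute dist_commute)
   then show ?thesis using a that assms(2) by simp
  qed
  have aB: "a \<in> ball x r" using a assms(2) by simp
  have "a \<in> Om \<or> a \<in> frontier Om" using a by (auto simp: frontier_def interior_open[OF assms(1)])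
  then have fa: "Ph a <= a \<bullet> e" using dom[OF aB] frontier_chart[OF aB] by auto
  have "Ph (a + y) = Ph (a + t *\<^sub>R (z - e) + t *\<^sub>R e)" by (simp add: y(1) scaleR_diff_right)
  also have "... = Ph (a + t *\<^sub>R (z - e))" by (rule axis_invariant)
  finally have e1: "Ph (a + y) = Ph (a + t *\<^sub>R (z - e))" .
  have m1: "a + t *\<^sub>R (z - e) \<in> cball x r" and m2: "a \<in> cball x r" using near[OF ne] aB by simp_all
  have "\<bar>Ph (a + t *\<^sub>R (z - e)) - Ph a\<bar> <= L * (t * norm (z - e))" using L(2)[OF m1 m2] y by simp
  moreover have "L * (t * norm (z - e)) <= L * (t * s)" using L(1) y by (intro mult_left_mono) auto
  moreover have "t * (L * s) < t * (1 / 2)" using Ls y(2) by (rule mult_strict_left_mono)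
  ultimately have "Ph (a + y) < Ph a + t / 2" unfolding e1 by (simp add: mult_ac)
  moreover have "\<bar>(z - e) \<bullet> e\<bar> <= s" using Cauchy_Schwarz_ineq2[of "z - e" e] y norm_e by simp
  then have "1 / 2 <= z \<bullet> e" using s e_e by (simp add: inner_diff_left)
  then have "t * (1 / 2) <= t * (z \<bullet> e)" using y(2) by (intro mult_left_mono) auto
  then have "a \<bullet> e + t / 2 <= (a + y) \<bullet> e" by (simp add: y(1) inner_add_left)
  ultimately have "Ph (a + y) < (a + y) \<bullet> e" using fa by linarith
  then show "a + y \<in> Om" using dom[OF near[OF ny]] by blast
 qed (use s assms in auto)
 moreover have "graph_chart 1 Om e Ph (ball x (2 * (r / 8)))"
  using ch assms(2) by (auto simp: graph_chart_def set_eq_iff)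
 ultimately show ?thesis using norm_e s by (intro exI[of _ "r / 8"] exI[of _ s] exI[of _ "r / 16"]) auto
qed

lemma smooth_domain_exists:
 fixes Om :: "(real ^ 'n::finite) set"
 assumes "C_k_bounded_domain k Om" "1 <= k"
 shows "\<exists>C R s Ta e Ph. smooth_domain Om C R s Ta e Ph"
proof -
 have op: "open Om" and bd: "bounded Om" using assms by (simp_all add: C_k_bounded_domain_def)
 define P where "P x R s Ta e Ph \<longleftrightarrow> cone_at Om x (2 * R) e s Ta & s <= 1 / 2 & 2 * Ta <= R & norm e = 1 &
   (ball x (2 * R) \<subseteq> Om \<or> graph_chart 1 Om e Ph (ball x (2 * R)))" for x R s Ta e Ph
 have "\<exists>R s Ta e Ph. P x R s Ta e Ph" if "x \<in> closure Om" for x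
 proof (cases "x \<in> Om")
  case True
  then show ?thesis using interior_cone[OF op] unfolding P_def by meson
 next
  case False
  then have "x \<in> frontier Om" using that interior_subset[of Om] by (auto simp: frontier_def)
  then obtain r e Ph where "r > 0" "graph_chart k Om e Ph (ball x r)" using assms(1) unfolding C_k_bounded_domain_def by meson
  then have "r > 0" "graph_chart 1 Om e Ph (ball x r)" using C_k_mono[OF _ assms(2)] by (auto simp: graph_chart_def)
  from boundary_cone[OF op this] show ?thesis unfolding P_def by meson
 qed
 then have "ALL x. \<exists>R s Ta e Ph. x \<in> closure Om --> P x R s Ta e Ph" by blast
 then obtain R s Ta e Ph where P: "!!x. x \<in> closure Om ==> P x (R x) (s x) (Ta x) (e x) (Ph x)"
  unfolding choice_iff by blast
 have Rp: "R x > 0" if "x \<in> closure Om" for x using P[OF that] by (simp add: P_def cone_at_def)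
 have "compact (closure Om)" using bd by simp
 moreover have "!!x. x \<in> closure Om ==> open (ball x (R x))" by simp
 moreover have "closure Om \<subseteq> (\<Union>x\<in>closure Om. ball x (R x))" using Rp by auto
 ultimately obtain C where C: "C \<subseteq> closure Om" "finite C" "closure Om \<subseteq> (\<Union>x\<in>C. ball x (R x))"
  by (rule compactE_image)
 have "P c (R c) (s c) (Ta c) (e c) (Ph c)" if "c \<in> C" for c using P C(1) that by blast
 then have "smooth_domain Om C R s Ta e Ph"
  using op bd C(2,3) unfolding P_def by unfold_locales simp_all
 then show ?thesis by blast
qed

context smooth_domain
begin

abbreviation surf :: "(real ^ 'a) measure" where "surf \<equiv> surface_measure Om"

definition bd :: "(real ^ 'a) set" where "bd = {c \<in> C. \<not> ball c (2 * R c) \<subseteq> Om}"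

lemma finite_bd: "finite bd"
 using finite_C by (simp add: bd_def)

lemma bd_chart: "c \<in> bd ==> C1_chart Om (e c) (Ph c) (ball c (2 * R c))"
 using charts by (auto simp: bd_def C1_chart_def)

lemma frontier_cover: "frontier Om \<subseteq> (\<Union>c\<in>bd. ball c (2 * R c))"
proof
 fix z assume z: "z \<in> frontier Om"
 then have zn: "z \<notin> Om" "z \<in> closure Om" using open_dom by (auto simp: frontier_def interior_open)
 then obtain c where c: "c \<in> C" "z \<in> ball c (R c)" using cover by blast
 then have "z \<in> ball c (2 * R c)" using R_pos[OF c(1)] by simp
 then show "z \<in> (\<Union>c\<in>bd. ball c (2 * R c))" using c(1) zn(1) unfolding bd_def by blast
qed

definition chart_partition :: "(real ^ 'a => real ^ 'a => real) => bool" where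
 "chart_partition Ps \<longleftrightarrow> (ALL c:C. smooth_cs (Ps c) & (ALL x. 0 <= Ps c x) & closure {x. Ps c x ~= 0} \<subseteq> ball c (2 * R c) &
   (ALL x. Ps c x ~= 0 --> x \<in> ball c (2 * R c))) &
  (ALL x:(\<Union>c\<in>C. ball c (R c)). (\<Sum>c\<in>C. Ps c x) = 1) & (ALL x:frontier Om. (\<Sum>c\<in>bd. Ps c x) = 1)"

lemma chart_partitionD:
 assumes "chart_partition Ps"
 shows "c \<in> C ==> smooth_cs (Ps c)" "c \<in> C ==> 0 <= Ps c x"
  "c \<in> C ==> closure {x. Ps c x ~= 0} \<subseteq> ball c (2 * R c)" "c \<in> C ==> Ps c x ~= 0 ==> x \<in> ball c (2 * R c)"
  "x \<in> (\<Union>c\<in>C. ball c (R c)) ==> (\<Sum>c\<in>C. Ps c x) = 1" "x \<in> frontier Om ==> (\<Sum>c\<in>bd. Ps c x) = 1"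
 using assms unfolding chart_partition_def by blast+

lemma partition_exists: "\<exists>Ps. chart_partition Ps"
proof -
 obtain Ps where Ps: "!!c. c \<in> C ==> smooth_cs (Ps c)" "!!c x. c \<in> C ==> 0 <= Ps c x"
  "!!c. c \<in> C ==> closure {x. Ps c x ~= 0} \<subseteq> cball c (3 / 2 * R c)" "!!x. x \<in> (\<Union>c\<in>C. ball c (R c)) ==> (\<Sum>c\<in>C. Ps c x) = 1"
  by (rule ball_partition_of_unity[where R = R, OF finite_C R_pos order_refl], assumption) (rule that; simp)
 have s: "closure {x. Ps c x ~= 0} \<subseteq> ball c (2 * R c)" if c: "c \<in> C" for c
  using Ps(3)[OF c] R_pos[OF c] by force
 have on: "x \<in> ball c (2 * R c)" if "c \<in> C" "Ps c x ~= 0" for c x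
  using s[OF that(1)] that(2) closure_subset[of "{x. Ps c x ~= 0}"] by blast
 have "(\<Sum>c\<in>bd. Ps c x) = 1" if x: "x \<in> frontier Om" for x
 proof -
  have xn: "x \<notin> Om" "x \<in> closure Om" using x open_dom by (auto simp: frontier_def interior_open)
  have "Ps c x = 0" if "c \<in> C - bd" for c
   using on[of c x] that xn(1) unfolding bd_def by blast
  then have "(\<Sum>c\<in>bd. Ps c x) = (\<Sum>c\<in>C. Ps c x)"
   by (intro sum.mono_neutral_left) (auto simp: finite_C bd_def)
  then show ?thesis using Ps(4)[of x] subsetD[OF cover xn(2)] by simp
 qed
 then have "chart_partition Ps" unfolding chart_partition_def using Ps(1,2,4) s on by blast
 then show ?thesis by blast
qed

text \<open>The chart measures, weighted by a partition of unity, are added and restricted to the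
  boundary. In an arbitrary chart all summands can be rewritten with the measure of that chart, and
  there the weights add up to 1. Uniqueness makes \<open>THE\<close> evaluate to this
  measure.\<close>

lemma is_surface: "is_surface_measure Om surf"
proof -
 from partition_exists obtain Ps where Ps: "chart_partition Ps" ..
 note Ps = chart_partitionD[OF Ps]
 have bdC: "c \<in> C" if "c \<in> bd" for c using that by (simp add: bd_def)
 note [measurable] = smooth_cs_measurable[OF Ps(1)[OF bdC]]
 let ?K = "%c. density (chart_measure (e c) (Ph c)) (Ps c)"
 have sK: "sets (?K c) = sets borel" if "c \<in> bd" for c using C1_chart.sets_chart_measure[OF bd_chart[OF that]] by simp
 obtain T where T: "sets T = sets borel" "!!A. A \<in> sets borel ==> emeasure T A = (\<Sum>c\<in>bd. emeasure (?K c) A)"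
  by (rule sum_measure_exists[where K = ?K, OF finite_bd sK]) (assumption, (rule that; blast))
 let ?S = "restrict_space T (frontier Om)"
 have \<Gamma>: "frontier Om \<in> sets borel" by simp
 have S: "is_surface_measure Om ?S"
  unfolding is_surface_measure_def
 proof (intro conjI allI impI ballI)
  show "sets ?S = sets (restrict_space borel (frontier Om))" by (rule sets_restrict_space_cong[OF T(1)])
  fix x r e' Ph' A
  assume ch: "graph_chart 1 Om e' Ph' (ball x r)" and A: "A \<in> sets ?S" "A \<subseteq> ball x r"
  interpret K: C1_chart Om e' Ph' "ball x r" by unfold_locales (use ch in auto)
  have A\<Gamma>: "A \<subseteq> frontier Om" and [measurable]: "A \<in> sets borel"
   using A(1) \<Gamma> by (simp_all add: sets_restrict_space_cong[OF T(1)] sets_restrict_space_iff)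
  have "emeasure ?S A = emeasure T A" using A\<Gamma> \<Gamma> T(1) by (simp add: emeasure_restrict_space)
  also have "... = (\<Sum>c\<in>bd. \<integral>\<^sup>+z. ennreal (Ps c z) * indicator A z \<partial>chart_measure e' Ph')"
   unfolding T(2)[OF \<open>A \<in> sets borel\<close>]
  proof (rule sum.cong[OF refl])
   fix c assume c: "c \<in> bd"
   interpret c: C1_chart Om "e c" "Ph c" "ball c (2 * R c)" by (rule bd_chart[OF c])
   have [measurable]: "Ps c \<in> borel_measurable borel" using Ps(1)[OF bdC[OF c]] by (rule smooth_cs_measurable)
   have "emeasure (?K c) A = (\<integral>\<^sup>+z. ennreal (Ps c z) * indicator A z \<partial>chart_measure (e c) (Ph c))"
    by (rule emeasure_density) measurable
   also have "... = (\<integral>\<^sup>+z. ennreal (Ps c z) * indicator A z \<partial>chart_measure e' Ph')"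
    by (rule nn_integral_eq_local[of _ _ "ball c (2 * R c) \<inter> ball x r", OF _ _ _ chart_measure_unique[OF c.C1_chart_axioms K.C1_chart_axioms]])
     (use Ps(4)[OF bdC[OF c]] A(2) in \<open>auto simp: indicator_def\<close>, metis ennreal_0)
   finally show "emeasure (?K c) A = (\<integral>\<^sup>+z. ennreal (Ps c z) * indicator A z \<partial>chart_measure e' Ph')" .
  qed
  also have "... = (\<integral>\<^sup>+z. (\<Sum>c\<in>bd. ennreal (Ps c z) * indicator A z) \<partial>chart_measure e' Ph')"
   by (rule nn_integral_sum[symmetric]) measurable
  also have "... = (\<integral>\<^sup>+z. indicator A z \<partial>chart_measure e' Ph')"
  proof (rule nn_integral_cong)
   fix z
   show "(\<Sum>c\<in>bd. ennreal (Ps c z) * indicator A z) = indicator A z"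
    using Ps(2,6) A\<Gamma> bdC by (cases "z \<in> A") (auto simp: sum_ennreal)
  qed
  also have "... = emeasure (chart_measure e' Ph') A" by simp
  finally show "emeasure ?S A = (\<integral>\<^sup>+y. ennreal (sqrt (1 + (norm (grad Ph' y))\<^sup>2))
    * indicator {y. 0 <= y \<bullet> e' & y \<bullet> e' <= 1 & graph_point e' Ph' y \<in> A} y \<partial>lborel)"
   by (simp only: K.emeasure_chart_measure[OF \<open>A \<in> sets borel\<close>])
 qed
 have "S = ?S" if "is_surface_measure Om S" for S
  using is_surface_measure_unique[OF that S finite_bd frontier_cover] bd_chart by (auto simp: C1_chart_def)
 then show ?thesis unfolding surface_measure_def by (rule theI[of "is_surface_measure Om", OF S])
qed

lemma sets_surf: "sets surf = sets (restrict_space borel (frontier Om))"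
 using is_surface by (simp add: is_surface_measure_def)

lemma space_surf [simp]: "space surf = frontier Om"
 using sets_eq_imp_space_eq[OF sets_surf] by (simp add: space_restrict_space)

lemma id_surf [measurable]: "(%x. x) \<in> surf \<rightarrow>\<^sub>M borel"
 using measurable_restrict_space1[OF measurable_ident_sets[OF refl], of borel "frontier Om"] measurable_cong_sets[OF sets_surf refl] by blast

lemma borel_surf: "f \<in> borel_measurable borel ==> f \<in> borel_measurable surf"
 using measurable_compose[OF id_surf] by blast

lemma emeasure_surf_chart:
 assumes c: "c \<in> bd" and A: "A \<in> sets borel" "A \<subseteq> ball c (2 * R c)"
 shows "emeasure (distr surf borel (%x. x)) A = emeasure (chart_measure (e c) (Ph c)) A"
proof -
 interpret C1_chart Om "e c" "Ph c" "ball c (2 * R c)" by (rule bd_chart[OF c])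
 have \<Gamma>: "frontier Om \<in> sets borel" by simp
 have A': "A \<inter> frontier Om \<in> sets surf" "A \<inter> frontier Om \<subseteq> ball c (2 * R c)" "A \<inter> frontier Om \<in> sets borel"
  using A unfolding sets_surf sets_restrict_space by auto
 have "emeasure (distr surf borel (%x. x)) A = emeasure surf (A \<inter> frontier Om)"
  using A by (simp add: emeasure_distr)
 also have "... = emeasure (chart_measure (e c) (Ph c)) (A \<inter> frontier Om)"
  using is_surface[unfolded is_surface_measure_def, THEN conjunct2, rule_format, OF chart A'(1,2)]
  by (simp only: emeasure_chart_measure[OF A'(3)])
 also have "... = emeasure (chart_measure (e c) (Ph c)) A"
 proof (rule emeasure_eq_AE)
  show "AE z in chart_measure (e c) (Ph c). z \<in> A \<inter> frontier Om \<longleftrightarrow> z \<in> A"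
   using chart_measure_graph by eventually_elim (use frontier_chart A(2) in auto)
 qed (use A A' in auto)
 finally show ?thesis .
qed

lemma surf_local:
 fixes F :: "real ^ 'a => real"
 assumes c: "c \<in> bd" and F: "F \<in> borel_measurable borel" "!!x. x \<notin> ball c (2 * R c) ==> F x = 0"
 shows "(LINT x|surf. F x) = (\<integral>x. F x \<partial>chart_measure (e c) (Ph c))"
proof -
 interpret C1_chart Om "e c" "Ph c" "ball c (2 * R c)" by (rule bd_chart[OF c])
 have "(LINT x|surf. F x) = (\<integral>x. F x \<partial>distr surf borel (%x. x))" using F(1) by (subst integral_distr) simp_all
 also have "... = (\<integral>x. F x \<partial>chart_measure (e c) (Ph c))"
  by (rule integral_eq_local[of _ _ "ball c (2 * R c)", OF _ _ _ emeasure_surf_chart[OF c]]) (use F in auto)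
 finally show ?thesis .
qed

lemma finite_surf: "finite_measure surf"
proof (rule finite_measureI)
 have "emeasure surf (frontier Om) <= (\<Sum>c\<in>bd. emeasure (distr surf borel (%x. x)) (ball c (2 * R c)))"
 proof -
  have "emeasure surf (frontier Om) = emeasure (distr surf borel (%x. x)) (frontier Om)" by (simp add: emeasure_distr)
  also have "... <= emeasure (distr surf borel (%x. x)) (\<Union>c\<in>bd. ball c (2 * R c))"
   by (rule emeasure_mono[OF frontier_cover]) (simp add: open_UN)
  also have "... <= (\<Sum>c\<in>bd. emeasure (distr surf borel (%x. x)) (ball c (2 * R c)))"
   by (rule emeasure_subadditive_finite) (auto simp: finite_bd)
  finally show ?thesis .
 qed
 also have "... < \<infinity>"
 proof -
  have "emeasure (distr surf borel (%x. x)) (ball c (2 * R c)) < \<infinity>" if c: "c \<in> bd" for c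
  proof -
   interpret C1_chart Om "e c" "Ph c" "ball c (2 * R c)" by (rule bd_chart[OF c])
   have "norm z <= norm c + 2 * R c" if "z \<in> ball c (2 * R c)" for z
    using that norm_triangle_ineq2[of z c] by (simp add: dist_norm norm_minus_commute)
   then have "emeasure (chart_measure (e c) (Ph c)) (ball c (2 * R c)) <= emeasure (chart_measure (e c) (Ph c)) (cball 0 (norm c + 2 * R c))"
    by (intro emeasure_mono) auto
   also have "... < \<infinity>" by (rule chart_measure_finite)
   finally show ?thesis by (simp add: emeasure_surf_chart[OF c])
  qed
  then show ?thesis using finite_bd by (simp add: ennreal_sum_less_top)
 qed
 finally show "emeasure surf (space surf) ~= \<infinity>" by simp
qed

text \<open>For the first part a partition of unity is inserted: pieces in balls inside the domain
  contribute 0, the others the formula of their chart. The fourth part provides a smooth field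
  transversal to the boundary; it stands in for the normal, which is only as regular as the charts,
  in the trace inequality.\<close>

lemma surface_divergence:
 assumes f: "C_inf f"
 shows "(LBINT x. indicator Om x * (grad f x \<bullet> w)) = (LINT z|surf. f z * (outward_normal Om z \<bullet> w))"
  and "(%z. outward_normal Om z \<bullet> w) \<in> borel_measurable surf"
  and "z \<in> frontier Om ==> norm (outward_normal Om z) = 1"
  and "\<exists>N \<kappa>. \<kappa> > 0 & (ALL i. smooth_cs (N i)) & (ALL z:frontier Om. (\<Sum>i\<in>UNIV. N i z * outward_normal Om z $ i) >= \<kappa>)"
proof -
 let ?\<nu> = "outward_normal Om"
 from partition_exists obtain Ps where Ps: "chart_partition Ps" ..
 note Ps = chart_partitionD[OF Ps]
 have bdC: "c \<in> C" if "c \<in> bd" for c using that by (simp add: bd_def)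
 have \<nu>c: "?\<nu> z = chart_normal (e c) (Ph c) z" if "c \<in> bd" "z \<in> frontier Om" "z \<in> ball c (2 * R c)" for c z
  using C1_chart.outward_normal_chart[OF bd_chart] that by blast
 have mn: "chart_normal (e c) (Ph c) \<in> borel_measurable borel" if "c \<in> bd" for c
  using C1_chart.measurable_chart(5)[OF bd_chart[OF that]] .
 have mPs: "Ps c \<in> borel_measurable borel" if "c \<in> bd" for c using smooth_cs_measurable[OF Ps(1)[OF bdC[OF that]]] .
 have Ps\<nu>: "Ps c z * (?\<nu> z \<bullet> w) = Ps c z * (chart_normal (e c) (Ph c) z \<bullet> w)" if "c \<in> bd" "z \<in> frontier Om" for c z w
  using \<nu>c[OF that] Ps(4)[OF bdC[OF that(1)], of z] by (cases "Ps c z = 0") auto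
 have sum\<nu>: "?\<nu> z \<bullet> w = (\<Sum>c\<in>bd. Ps c z * (?\<nu> z \<bullet> w))" if "z \<in> frontier Om" for z w
  using Ps(6)[OF that] by (simp add: sum_distrib_right[symmetric])
 show m\<nu>: "(%z. ?\<nu> z \<bullet> w) \<in> borel_measurable surf" for w
 proof (subst measurable_cong)
  show "?\<nu> z \<bullet> w = (\<Sum>c\<in>bd. Ps c z * (chart_normal (e c) (Ph c) z \<bullet> w))" if "z \<in> space surf" for z
   using sum\<nu>[of z w] that by (simp add: Ps\<nu> cong: sum.cong)
  show "(%z. \<Sum>c\<in>bd. Ps c z * (chart_normal (e c) (Ph c) z \<bullet> w)) \<in> borel_measurable surf"
   by (intro borel_surf borel_measurable_sum borel_measurable_times mPs borel_measurable_inner mn) auto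
 qed
 show n\<nu>: "norm (?\<nu> z) = 1" if z: "z \<in> frontier Om" for z
 proof -
  obtain c where "c \<in> bd" "z \<in> ball c (2 * R c)" using frontier_cover z by blast
  then show ?thesis using \<nu>c[of c z] C1_chart.norm_chart_normal[OF bd_chart] z by simp
 qed
 show "\<exists>N \<kappa>. \<kappa> > 0 & (ALL i. smooth_cs (N i)) & (ALL z:frontier Om. (\<Sum>i\<in>UNIV. N i z * ?\<nu> z $ i) >= \<kappa>)"
 proof -
  have "EX K>0. ALL z:ball c (2 * R c). graph_area (Ph c) z <= K" if c: "c \<in> bd" for c
  proof -
   interpret C1_chart Om "e c" "Ph c" "ball c (2 * R c)" by (rule bd_chart[OF c])
   have "compact (graph_area (Ph c) ` cball c (2 * R c))"
    unfolding graph_area_def by (intro compact_continuous_image continuous_intros continuous_on_subset[OF C1_props(3)]) auto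
   from compact_imp_bounded[OF this] obtain K where K: "K > 0" "ALL y:graph_area (Ph c) ` cball c (2 * R c). norm y <= K"
    unfolding bounded_pos by blast
   have "graph_area (Ph c) z <= K" if "z \<in> ball c (2 * R c)" for z
   proof -
    have "z \<in> cball c (2 * R c)" using that by simp
    then have "norm (graph_area (Ph c) z) <= K" using K(2) by blast
    then show ?thesis by simp
   qed
   then show ?thesis using K(1) by blast
  qed
  then obtain K where K: "!!c. c \<in> bd ==> K c > 0" "!!c z. c \<in> bd ==> z \<in> ball c (2 * R c) ==> graph_area (Ph c) z <= K c" by metis
  define Q where "Q = 1 + (\<Sum>c\<in>bd. K c)"
  have "0 <= (\<Sum>c\<in>bd. K c)" using K(1) by (intro sum_nonneg) (simp add: less_imp_le)
  then have Q: "Q > 0" by (simp add: Q_def)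
  have KQ: "K c <= Q" if "c \<in> bd" for c
   using member_le_sum[OF that, of K] K(1) finite_bd by (simp add: Q_def less_imp_le)
  \<comment> \<open>Each axis \<open>e c\<close> points into the domain; its negative has normal
    component 1 / \<open>graph_area\<close>, which is at least 1 / Q on the ball of the
    chart.\<close>
  define N where "N i z = (\<Sum>c\<in>bd. - (e c $ i) * Ps c z)" for i z
  have "smooth_cs (N i)" for i
  proof -
   have "J \<subseteq> bd ==> smooth_cs (%z. \<Sum>c\<in>J. - (e c $ i) * Ps c z)" for J
   proof (induction J rule: infinite_finite_induct)
    case (insert c J)
    have "smooth_cs (%z. - (e c $ i) * Ps c z)"
     by (rule smooth_cs_mult[OF C_inf_const Ps(1)]) (use insert.prems bdC in auto)
    from smooth_cs_add[OF this insert.IH] insert show ?case by simp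
   qed (simp_all add: smooth_cs_def C_inf_const)
   then show ?thesis unfolding N_def by blast
  qed
  moreover have "(\<Sum>i\<in>UNIV. N i z * ?\<nu> z $ i) >= 1 / Q" if z: "z \<in> frontier Om" for z
  proof -
   have "(\<Sum>i\<in>UNIV. N i z * ?\<nu> z $ i) = (\<Sum>i\<in>UNIV. \<Sum>c\<in>bd. Ps c z * (?\<nu> z $ i * - (e c $ i)))"
    by (rule sum.cong[OF refl]) (simp add: N_def sum_distrib_right sum_distrib_left mult_ac)
   also have "... = (\<Sum>c\<in>bd. Ps c z * (?\<nu> z \<bullet> - e c))"
    by (subst sum.swap) (simp add: inner_vec_def sum_distrib_left)
   also have "... >= (\<Sum>c\<in>bd. Ps c z * (1 / Q))"
   proof (rule sum_mono)
    fix c assume c: "c \<in> bd"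
    interpret C1_chart Om "e c" "Ph c" "ball c (2 * R c)" by (rule bd_chart[OF c])
    show "Ps c z * (1 / Q) <= Ps c z * (?\<nu> z \<bullet> - e c)"
    proof (cases "Ps c z = 0")
     case False
     then have zb: "z \<in> ball c (2 * R c)" using Ps(4) c bdC by blast
     have "1 / Q <= 1 / graph_area (Ph c) z"
      using graph_area_pos[of z] K(2)[OF c zb] KQ[OF c] by (intro divide_left_mono) auto
     also have "... = ?\<nu> z \<bullet> - e c" using \<nu>c[OF c z zb] chart_normal_e[of z] by simp
     finally show ?thesis using Ps(2)[OF bdC[OF c]] by (rule mult_left_mono)
    qed simp
   qed
   also have "(\<Sum>c\<in>bd. Ps c z * (1 / Q)) = 1 / Q" using Ps(6)[OF z] by (simp add: sum_divide_distrib[symmetric])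
   finally show ?thesis .
  qed
  ultimately show ?thesis using Q by (intro exI[of _ N] exI[of _ "1 / Q"]) simp
 qed
 let ?I = "%f. \<integral>x. indicator Om x * (grad f x \<bullet> w) \<partial>lborel"
 have sc: "smooth_cs (%x. f x * Ps c x)" if "c \<in> C" for c using smooth_cs_mult[OF f Ps(1)[OF that]] .
 have supp: "closure {x. f x * Ps c x ~= 0} \<subseteq> ball c (2 * R c)" if "c \<in> C" for c
  using Ps(3)[OF that] closure_mono[of "{x. f x * Ps c x ~= 0}" "{x. Ps c x ~= 0}"] by auto
 have gint: "integrable lborel (%x. grad (%x. f x * Ps c x) x \<bullet> w)" if "c \<in> C" for c
  unfolding inner_vec_def inner_real_def grad_nth
  by (intro Bochner_Integration.integrable_sum integrable_mult_left smooth_cs_integrable smooth_cs_pd sc that)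
 have "?I f = (LBINT x. (\<Sum>c\<in>C. indicator Om x * (grad (%x. f x * Ps c x) x \<bullet> w)))"
 proof (rule Bochner_Integration.integral_cong[OF refl])
  fix x
  have "grad f x = (\<Sum>c\<in>C. grad (%x. f x * Ps c x) x)" if x: "x \<in> Om"
  proof -
   let ?X = "\<Union>c\<in>C. ball c (R c)" and ?h = "%x. (\<Sum>c\<in>C. f x * Ps c x) - f x"
   have "?h y = 0" if "y \<in> ?X" for y using Ps(5)[OF that] by (simp add: sum_distrib_left[symmetric])
   then have "{y. ?h y ~= 0} \<subseteq> - ?X" by blast
   moreover have "closed (- ?X)" by (intro closed_Compl open_UN) simp
   ultimately have "closure {y. ?h y ~= 0} \<subseteq> - ?X" by (rule closure_minimal)
   moreover have "x \<in> ?X" using x cover closure_subset by blast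
   ultimately have "x \<notin> closure {y. ?h y ~= 0}" by blast
   then have "pd i ?h x = 0" for i by (rule pd_outside_support)
   moreover have "pd i ?h x = (\<Sum>c\<in>C. pd i (%x. f x * Ps c x) x) - pd i f x" for i
    using f smooth_csD[OF sc] finite_C by (simp add: C_inf_sum)
   ultimately show ?thesis by (simp add: vec_eq_iff)
  qed
  then show "indicator Om x * (grad f x \<bullet> w) = (\<Sum>c\<in>C. indicator Om x * (grad (%x. f x * Ps c x) x \<bullet> w))"
   by (cases "x \<in> Om") (simp_all add: inner_sum_left)
 qed
 also have "... = (\<Sum>c\<in>C. ?I (%x. f x * Ps c x))"
  by (rule Bochner_Integration.integral_sum) (use integrable_real_mult_indicator[OF _ gint] in "simp add: mult.commute")
 also have "... = (\<Sum>c\<in>bd. ?I (%x. f x * Ps c x))"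
 proof (rule sum.mono_neutral_right[OF finite_C])
  show "bd \<subseteq> C" using bdC by blast
  show "ALL c:C - bd. ?I (%x. f x * Ps c x) = 0"
  proof
   fix c assume c: "c \<in> C - bd"
   then have "closure {x. f x * Ps c x ~= 0} \<subseteq> Om" using supp[of c] by (auto simp: bd_def)
   then have "grad (%x. f x * Ps c x) x = 0" if "x \<notin> Om" for x
    using pd_outside_support[of x "%x. f x * Ps c x"] that by (auto simp: vec_eq_iff)
   then have "?I (%x. f x * Ps c x) = (LBINT x. (grad (%x. f x * Ps c x) x \<bullet> w))"
    by (intro Bochner_Integration.integral_cong[OF refl]) (auto simp: indicator_def)
   also have "... = (\<Sum>i\<in>UNIV. (LBINT x. pd i (%x. f x * Ps c x) x * w $ i))"
    unfolding inner_vec_def inner_real_def grad_nth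
    by (intro Bochner_Integration.integral_sum integrable_mult_left smooth_cs_integrable smooth_cs_pd sc) (use c in simp)
   also have "... = 0" using c by (simp add: integral_pd_smooth_cs[OF sc])
   finally show "?I (%x. f x * Ps c x) = 0" .
  qed
 qed
 also have "... = (\<Sum>c\<in>bd. \<integral>z. f z * (Ps c z * (?\<nu> z \<bullet> w)) \<partial>surf)"
 proof (rule sum.cong[OF refl])
  fix c assume c: "c \<in> bd"
  interpret C1_chart Om "e c" "Ph c" "ball c (2 * R c)" by (rule bd_chart[OF c])
  have "?I (%x. f x * Ps c x) = (\<integral>z. f z * Ps c z * (chart_normal (e c) (Ph c) z \<bullet> w) \<partial>chart_measure (e c) (Ph c))"
   by (rule chart_divergence) (use sc supp Ps(4) bdC[OF c] in auto)
  also have "... = (LINT z|surf. f z * Ps c z * (chart_normal (e c) (Ph c) z \<bullet> w))"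
  proof (rule surf_local[OF c, symmetric])
   note [measurable] = C_inf_borel[OF f] mPs[OF c]
   show "(%z. f z * Ps c z * (chart_normal (e c) (Ph c) z \<bullet> w)) \<in> borel_measurable borel" by measurable
  qed (use Ps(4)[OF bdC[OF c]] in auto)
  also have "... = (LINT z|surf. f z * (Ps c z * (?\<nu> z \<bullet> w)))"
   by (rule Bochner_Integration.integral_cong[OF refl]) (simp add: Ps\<nu>[OF c] mult.assoc)
  finally show "?I (%x. f x * Ps c x) = (LINT z|surf. f z * (Ps c z * (?\<nu> z \<bullet> w)))" .
 qed
 also have "... = (LINT z|surf. (\<Sum>c\<in>bd. f z * (Ps c z * (?\<nu> z \<bullet> w))))"
 proof (rule Bochner_Integration.integral_sum[symmetric])
  fix c assume c: "c \<in> bd"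
  interpret finite_measure surf by (rule finite_surf)
  obtain B where B: "!!x. \<bar>f x * Ps c x\<bar> <= B" using smooth_cs_bounded[OF sc[OF bdC[OF c]]] by metis
  have "integrable surf (%z. (f z * Ps c z) * (?\<nu> z \<bullet> w))"
  proof (rule integrable_const_bound)
   show "AE z in surf. norm ((f z * Ps c z) * (?\<nu> z \<bullet> w)) <= B * norm w"
   proof (rule AE_I2)
    fix z assume "z \<in> space surf"
    then have "\<bar>?\<nu> z \<bullet> w\<bar> <= norm w" using Cauchy_Schwarz_ineq2[of "?\<nu> z" w] n\<nu>[of z] by simp
    then show "norm ((f z * Ps c z) * (?\<nu> z \<bullet> w)) <= B * norm w"
     unfolding real_norm_def abs_mult[of "f z * Ps c z"] using B[of z] by (intro mult_mono) auto
   qed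
   show "(%z. (f z * Ps c z) * (?\<nu> z \<bullet> w)) \<in> borel_measurable surf"
    using borel_surf[OF C_inf_borel[OF f]] borel_surf[OF mPs[OF c]] m\<nu>[of w] by (intro borel_measurable_times)
  qed
  then show "integrable surf (%z. f z * (Ps c z * (?\<nu> z \<bullet> w)))" by (simp add: mult.assoc)
 qed
 also have "... = (LINT z|surf. f z * (?\<nu> z \<bullet> w))"
  by (rule Bochner_Integration.integral_cong[OF refl]) (use sum\<nu> in "simp add: sum_distrib_left[symmetric]")
 finally show "?I f = (LINT z|surf. f z * (?\<nu> z \<bullet> w))" .
qed

end

section \<open>Green's formula and traces\<close>

lemma grad_mult: "C_inf f ==> C_inf g ==> grad (%x. f x * g x) x = g x *\<^sub>R grad f x + f x *\<^sub>R grad g x"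
 by (simp add: vec_eq_iff)

lemma C_inf_bounded_on:
 assumes "C_inf F" "bounded Om"
 shows "EX K>=0. ALL x:closure Om. \<bar>F x\<bar> <= K & norm (grad F x) <= K"
proof -
 have c: "compact (closure Om)" using assms(2) by simp
 have b: "EX K>0. ALL y:h ` closure Om. norm y <= K" if "continuous_on UNIV h" for h :: "real ^ 'a => 'b::real_normed_vector"
  using compact_imp_bounded[OF compact_continuous_image[OF continuous_on_subset[OF that] c]] by (simp add: bounded_pos)
 obtain K1 where K1: "K1 > 0" "ALL y:F ` closure Om. norm y <= K1" using b[OF C_inf_continuous[OF assms(1)]] by blast
 have "continuous_on UNIV (grad F)" using C1_grad_continuous[of F] assms(1) unfolding C_inf_def by blast
 then obtain K2 where K2: "K2 > 0" "ALL y:grad F ` closure Om. norm y <= K2" using b by blast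
 show ?thesis using K1 K2 by (intro exI[of _ "max K1 K2"]) (auto simp: le_max_iff_disj)
qed

lemma sqz_bounded_fun:
 assumes "Om \<in> sets borel" "bounded Om" "h \<in> borel_measurable borel" "!!x. x \<in> Om ==> \<bar>h x\<bar> <= K"
 shows "sqz Om (%x. indicator Om x * h x)"
proof -
 have i: "integrable lborel (indicator Om :: _ => real)"
  using assms(1) emeasure_bounded_finite[OF assms(2)] by (intro integrable_real_indicator) simp_all
 then have "sqz Om (indicator Om)" using assms(1) by (simp add: sqz_def square_integrable_def indicator_sq)
 from sqz_mult_bounded[OF this assms(3,4)] show ?thesis by (simp add: mult.commute)
qed

locale field_domain =
 fixes Om :: "(real ^ 'n::finite) set" and b :: "real ^ 'n => real ^ 'n" and D :: "real ^ 'n => real" and B :: real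
 assumes op: "open Om" and bdd: "bounded Om" and bf: "bounded_field Om b D B"
begin

lemma dom_borel: "Om \<in> sets borel"
 using op by simp

lemma bm: "b \<in> borel_measurable borel" "D \<in> borel_measurable borel" "norm (b x) <= B" "\<bar>D x\<bar> <= B"
 using bf by (auto simp: bounded_field_def)

lemma sqz_drv:
 assumes F: "C_inf F"
 shows "sqz Om (%x. indicator Om x * F x)" "sqz Om (%x. indicator Om x * (b x \<bullet> grad F x))"
  "sqz Om (%x. indicator Om x * (b x \<bullet> grad F x + D x * F x))"
proof -
 note [measurable] = C_inf_borel[OF F] grad_measurable[OF F] bm(1,2)
 obtain K where K: "K >= 0" "!!x. x \<in> Om ==> \<bar>F x\<bar> <= K" "!!x. x \<in> Om ==> norm (grad F x) <= K"
  using C_inf_bounded_on[OF F bdd] closure_subset by blast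
 have 1: "\<bar>b x \<bullet> grad F x\<bar> <= B * K" if "x \<in> Om" for x
 proof -
  have "\<bar>b x \<bullet> grad F x\<bar> <= norm (b x) * norm (grad F x)" by (rule Cauchy_Schwarz_ineq2)
  also have "... <= B * K" using bm(3)[of x] K(3)[OF that] norm_ge_zero[of "b x"] norm_ge_zero[of "grad F x"] by (intro mult_mono) linarith+
  finally show ?thesis .
 qed
 have 2: "\<bar>D x * F x\<bar> <= B * K" if "x \<in> Om" for x
  unfolding abs_mult using bm(4)[of x] K(2)[OF that] by (intro mult_mono) auto
 have 3: "\<bar>b x \<bullet> grad F x + D x * F x\<bar> <= B * K + B * K" if "x \<in> Om" for x using 1[OF that] 2[OF that] by linarith
 show "sqz Om (%x. indicator Om x * F x)" "sqz Om (%x. indicator Om x * (b x \<bullet> grad F x))"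
  "sqz Om (%x. indicator Om x * (b x \<bullet> grad F x + D x * F x))"
  using sqz_bounded_fun[OF dom_borel bdd] K(2) 1 3 by measurable
qed

lemma cut_left: "sqz Om v ==> v x * (indicator Om x * y) = v x * y"
 using sqzD(3)[of Om v x] by (cases "x \<in> Om") auto

lemma integrable_green:
 assumes "sqz Om v" "C_inf Ps"
 shows "integrable lborel (%x. v x * (b x \<bullet> grad Ps x + D x * Ps x))" "integrable lborel (%x. v x * Ps x)"
 using sqint_mult[OF sqzD(1)[OF assms(1)] sqzD(1)[OF sqz_drv(3)[OF assms(2)]]]
  sqint_mult[OF sqzD(1)[OF assms(1)] sqzD(1)[OF sqz_drv(1)[OF assms(2)]]] by (simp_all add: cut_left[OF assms(1)])

end

text \<open>A measure \<open>N\<close> on the boundary with a weight \<open>s\<close> such that s dN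
  is the flux of \<open>b\<close>. The two instances are the surface measure with a component of the
  normal, for constant fields, and |b.n| ds with the sign of b.n.\<close>

locale boundary_pair = field_domain +
 fixes N :: "(real ^ 'a) measure" and s :: "real ^ 'a => real"
 assumes finN: "finite_measure N" and setsN: "sets N = sets (restrict_space borel (frontier Om))"
  and sN: "s \<in> borel_measurable N" "!!x. x \<in> space N ==> \<bar>s x\<bar> <= 1"
  and div: "!!F. C_inf F ==> (LBINT x. indicator Om x * (b x \<bullet> grad F x + D x * F x)) = (LINT x|N. s x * F x)"
begin

lemma spaceN: "space N = frontier Om"
 using sets_eq_imp_space_eq[OF setsN] by (simp add: space_restrict_space)

lemma borelN: "h \<in> borel_measurable borel ==> h \<in> borel_measurable N"
 using measurable_restrict_space1[of h borel borel "frontier Om"] measurable_cong_sets[OF setsN refl] by blast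

lemma sqint_smooth:
 assumes "C_inf F"
 shows "square_integrable N F" "square_integrable N (%x. s x * F x)"
proof -
 obtain K where K: "K >= 0" "ALL x:closure Om. \<bar>F x\<bar> <= K & norm (grad F x) <= K" using C_inf_bounded_on[OF assms bdd] by blast
 then have "AE x in N. \<bar>F x\<bar> <= K" by (intro AE_I2) (auto simp: spaceN frontier_def)
 with finN borelN[OF C_inf_borel[OF assms]] show F: "square_integrable N F" by (rule sqint_bounded_fun)
 show "square_integrable N (%x. s x * F x)" by (rule sqint_mult_bounded[OF F sN(1) AE_I2[OF sN(2)]])
qed

text \<open>Green's formula with t in the role of the boundary values of v and f in that of b.grad
  v. It determines t up to null sets where \<open>s\<close> is not 0.\<close>

definition green :: "(real ^ 'a => real) => (real ^ 'a => real) => (real ^ 'a => real) => bool" where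
 "green v f t \<longleftrightarrow> (\<forall>Ps. C_inf Ps --> (LBINT x. v x * (b x \<bullet> grad Ps x + D x * Ps x)) + (LBINT x. f x * Ps x) = (LINT x|N. t x * (s x * Ps x)))"

lemma green_lin:
 assumes "sqz Om v" "sqz Om f" "square_integrable N t" "green v f t" "sqz Om v'" "sqz Om f'" "square_integrable N t'" "green v' f' t'"
 shows "green (%x. p * v x + q * v' x) (%x. p * f x + q * f' x) (%x. p * t x + q * t' x)"
 unfolding green_def
proof (intro allI impI)
 fix Ps :: "real ^ 'a => real" assume Ps: "C_inf Ps"
 note i = integrable_green[OF assms(1) Ps] integrable_green[OF assms(2) Ps] integrable_green[OF assms(5) Ps] integrable_green[OF assms(6) Ps]
  sqint_mult[OF assms(3) sqint_smooth(2)[OF Ps]] sqint_mult[OF assms(7) sqint_smooth(2)[OF Ps]]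
 have g: "p * ((LBINT x. v x * (b x \<bullet> grad Ps x + D x * Ps x)) + (LBINT x. f x * Ps x)) +
   q * ((LBINT x. v' x * (b x \<bullet> grad Ps x + D x * Ps x)) + (LBINT x. f' x * Ps x)) =
   p * (LINT x|N. t x * (s x * Ps x)) + q * (LINT x|N. t' x * (s x * Ps x))"
  using assms(4,8) Ps by (simp add: green_def)
 have e: "(LINT x|K. (p * u x + q * u' x) * r x) = p * (LINT x|K. u x * r x) + q * (LINT x|K. u' x * r x)"
  if "integrable K (%x. u x * r x)" "integrable K (%x. u' x * r x)" for u u' r :: "real ^ 'a => real" and K
  using that by (simp add: distrib_right mult.assoc)
 show "(LBINT x. (p * v x + q * v' x) * (b x \<bullet> grad Ps x + D x * Ps x)) + (LBINT x. (p * f x + q * f' x) * Ps x) =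
   (LINT x|N. (p * t x + q * t' x) * (s x * Ps x))"
  unfolding e[OF i(1,5)] e[OF i(4,8)] e[OF i(9,10)] using g by (simp add: algebra_simps)
qed

lemma smooth_dense_boundary:
 assumes h: "h \<in> borel_measurable N" "integrable N h" and eq: "!!Ps. smooth_cs Ps ==> (LINT x|N. h x * Ps x) = 0"
 shows "AE x in N. h x = 0"
proof -
 define h' where "h' x = indicator (frontier Om) x * h x" for x
 have \<Gamma>: "frontier Om \<in> sets borel" by simp
 have "h \<in> borel_measurable (restrict_space borel (frontier Om))" using h(1) measurable_cong_sets[OF setsN refl] by blast
 then have h'm: "h' \<in> borel_measurable borel"
  unfolding h'_def[abs_def] using \<Gamma> by (subst (asm) borel_measurable_restrict_space_iff) simp_all
 have id: "(%x. x) \<in> N \<rightarrow>\<^sub>M borel" using borelN by (simp add: measurable_def spaceN setsN sets_restrict_space) blast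
 have hh: "h' x = h x" if "x \<in> space N" for x using that by (simp add: h'_def spaceN)
 have "AE x in distr N borel (%x. x). x \<in> UNIV --> h' x = 0"
 proof (rule smooth_fundamental[OF _ h'm open_UNIV])
  fix Ps :: "real ^ 'a => real" assume Ps: "smooth_cs Ps"
  have m: "(%x. h' x * Ps x) \<in> borel_measurable borel" using h'm smooth_cs_measurable[OF Ps] by simp
  obtain K where K: "!!x. \<bar>Ps x\<bar> <= K" using smooth_cs_bounded[OF Ps] by metis
  have "integrable N (%x. h x * Ps x)"
   by (rule Bochner_Integration.integrable_bound[OF integrable_mult_left[OF h(2), of K]])
    (use K borelN[OF smooth_cs_measurable[OF Ps]] h(1) in "auto simp: abs_mult intro!: mult_left_mono AE_I2 order_trans[OF K abs_ge_self]")
  then have "integrable N (%x. h' x * Ps x)" by (subst Bochner_Integration.integrable_cong[OF refl, of _ _ "%x. h x * Ps x"]) (simp_all add: hh)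
  moreover have "(LINT x|N. h' x * Ps x) = (LINT x|N. h x * Ps x)" by (rule Bochner_Integration.integral_cong[OF refl]) (simp add: hh)
  ultimately show "integrable (distr N borel (%x. x)) (%x. h' x * Ps x) & (\<integral>x. h' x * Ps x \<partial>distr N borel (%x. x)) = 0"
   using eq[OF Ps] by (simp add: integrable_distr_eq[OF id m] integral_distr[OF id m])
 qed simp
 then have "AE x in N. h' x = 0" using id h'm by (subst (asm) AE_distr_iff) simp_all
 then show ?thesis using AE_space by eventually_elim (simp add: hh)
qed

lemma green_unique:
 assumes t: "square_integrable N t" "square_integrable N t'" and "green v f t" "green v f t'"
 shows "AE x in N. s x * (t x - t' x) = 0"
proof (rule smooth_dense_boundary)
 have i: "integrable N (%x. t x * (s x * Ps x))" "integrable N (%x. t' x * (s x * Ps x))" if "C_inf Ps" for Ps :: "real ^ 'a => real"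
  using sqint_mult[OF _ sqint_smooth(2)[OF that]] t by blast+
 show "integrable N (%x. s x * (t x - t' x))"
  using Bochner_Integration.integrable_diff[OF i[OF C_inf_const[of 1]]] by (simp add: algebra_simps)
 then show "(%x. s x * (t x - t' x)) \<in> borel_measurable N" by simp
 fix Ps :: "real ^ 'a => real" assume "smooth_cs Ps"
 then have Ps: "C_inf Ps" by (rule smooth_csD)
 have "(LINT x|N. t x * (s x * Ps x)) = (LINT x|N. t' x * (s x * Ps x))" using assms(3)[unfolded green_def, rule_format, OF Ps] assms(4)[unfolded green_def, rule_format, OF Ps] by linarith
 then show "(LINT x|N. s x * (t x - t' x) * Ps x) = 0"
  using Bochner_Integration.integral_diff[OF i[OF Ps]] by (simp add: algebra_simps)
qed

lemma green_limit:
 assumes v: "sqz Om v" "sqz Om f" "square_integrable N t" and F: "!!k. C_inf (F k)"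
  and l: "(%k. norm_L2 lborel (%x. indicator Om x * F k x - v x)) ----> 0"
   "(%k. norm_L2 lborel (%x. indicator Om x * (b x \<bullet> grad (F k) x) - f x)) ----> 0"
   "(%k. norm_L2 N (%x. F k x - t x)) ----> 0"
 shows "green v f t"
  and "2 * (LBINT x. f x * v x) + (LBINT x. v x * (D x * v x)) = (LINT x|N. t x * (s x * t x))"
proof -
 have L1: "(%k. \<integral>x. (indicator Om x * F k x) * h x \<partial>lborel) ----> (LBINT x. v x * h x)"
  and L2: "(%k. \<integral>x. (indicator Om x * (b x \<bullet> grad (F k) x)) * h x \<partial>lborel) ----> (LBINT x. f x * h x)"
  if "sqz Om h" for h :: "real ^ 'a => real"
  using integral_L2_tendsto[OF sqzD(1)[OF sqz_drv(1)[OF F]] sqzD(1)[OF v(1)] l(1) sqzD(1)[OF that]]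
   integral_L2_tendsto[OF sqzD(1)[OF sqz_drv(2)[OF F]] sqzD(1)[OF v(2)] l(2) sqzD(1)[OF that]] by blast+
 have L3: "(%k. \<integral>x. F k x * h x \<partial>N) ----> (LINT x|N. t x * h x)" if "square_integrable N h" for h
  by (rule integral_L2_tendsto[OF sqint_smooth(1)[OF F] v(3) l(3) that])
 show g: "green v f t"
  unfolding green_def
 proof (intro allI impI)
  fix Ps :: "real ^ 'a => real" assume Ps: "C_inf Ps"
  let ?h = "%x. indicator Om x * (b x \<bullet> grad Ps x + D x * Ps x)"
  have "(LBINT x. (indicator Om x * F k x) * ?h x) + (LBINT x. (indicator Om x * (b x \<bullet> grad (F k) x)) * (indicator Om x * Ps x)) = (LINT x|N. F k x * (s x * Ps x))" for k
  proof -
   have "(LBINT x. (indicator Om x * F k x) * ?h x) + (LBINT x. (indicator Om x * (b x \<bullet> grad (F k) x)) * (indicator Om x * Ps x)) =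
    (LBINT x. indicator Om x * (b x \<bullet> grad (%x. F k x * Ps x) x + D x * (F k x * Ps x)))"
    unfolding grad_mult[OF F Ps] Bochner_Integration.integral_add[OF sqint_mult[OF sqzD(1)[OF sqz_drv(1)[OF F]] sqzD(1)[OF sqz_drv(3)[OF Ps]]]
      sqint_mult[OF sqzD(1)[OF sqz_drv(2)[OF F]] sqzD(1)[OF sqz_drv(1)[OF Ps]]], symmetric]
    by (rule Bochner_Integration.integral_cong[OF refl]) (simp add: indicator_def algebra_simps inner_add_right)
   also have "... = (LINT x|N. s x * (F k x * Ps x))" by (rule div[OF C_inf_mult[OF F Ps]])
   finally show ?thesis by (simp add: mult_ac)
  qed
  from LIMSEQ_unique[OF tendsto_add[OF L1[OF sqz_drv(3)[OF Ps]] L2[OF sqz_drv(1)[OF Ps]], unfolded this] L3[OF sqint_smooth(2)[OF Ps]]]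
  show "(LBINT x. v x * (b x \<bullet> grad Ps x + D x * Ps x)) + (LBINT x. f x * Ps x) = (LINT x|N. t x * (s x * Ps x))"
   by (simp add: cut_left[OF v(1)] cut_left[OF v(2)])
 qed
 \<comment> \<open>The energy identity is the limit of Green's formula tested with the approximations.\<close>
 have Dv: "sqz Om (%x. D x * v x)" by (rule sqz_mult_bounded[OF v(1) bm(2)]) (rule bm(4))
 have st: "square_integrable N (%x. s x * t x)" by (rule sqint_mult_bounded[OF v(3) sN(1) AE_I2[OF sN(2)]])
 have "(LBINT x. (indicator Om x * F k x) * (D x * v x)) + (LBINT x. (indicator Om x * (b x \<bullet> grad (F k) x)) * v x) +
   (LBINT x. (indicator Om x * F k x) * f x) = (LINT x|N. F k x * (s x * t x))" for k
 proof -
  have "(LBINT x. (indicator Om x * F k x) * (D x * v x)) + (LBINT x. (indicator Om x * (b x \<bullet> grad (F k) x)) * v x) =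
   (LBINT x. v x * (b x \<bullet> grad (F k) x + D x * F k x))"
   unfolding Bochner_Integration.integral_add[OF sqint_mult[OF sqzD(1)[OF sqz_drv(1)[OF F]] sqzD(1)[OF Dv]]
     sqint_mult[OF sqzD(1)[OF sqz_drv(2)[OF F]] sqzD(1)[OF v(1)]], symmetric]
   by (rule Bochner_Integration.integral_cong[OF refl]) (use sqzD(3)[OF v(1)] in "simp add: indicator_def algebra_simps")
  moreover have "(LBINT x. (indicator Om x * F k x) * f x) = (LBINT x. f x * F k x)"
   by (rule Bochner_Integration.integral_cong[OF refl]) (use cut_left[OF v(2)] in "simp add: mult.commute")
  moreover have "(LINT x|N. F k x * (s x * t x)) = (LINT x|N. t x * (s x * F k x))"
   by (rule Bochner_Integration.integral_cong[OF refl]) (simp add: mult_ac)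
  ultimately show ?thesis using g[unfolded green_def, rule_format, OF F[of k]] by linarith
 qed
 from LIMSEQ_unique[OF tendsto_add[OF tendsto_add[OF L1[OF Dv] L2[OF v(1)]] L1[OF v(2)], unfolded this] L3[OF st]]
 show "2 * (LBINT x. f x * v x) + (LBINT x. v x * (D x * v x)) = (LINT x|N. t x * (s x * t x))"
  by (simp add: mult.commute)
qed

end

context field_domain
begin

lemma adv_smooth:
 assumes F: "C_inf F"
 shows "adv Om b D (%x. indicator Om x * F x) (%x. indicator Om x * (b x \<bullet> grad F x))"
 unfolding adv_def
proof
 fix Ph assume Ph: "Ph \<in> test_functions Om"
 then have p: "smooth_cs Ph" "closure {x. Ph x ~= 0} \<subseteq> Om" by (simp_all add: test_functions_iff)
 have C: "C_inf Ph" using p(1) by (rule smooth_csD)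
 have off: "Ph x = 0" "grad Ph x = 0" if "x \<notin> Om" for x
 proof -
  have n: "x \<notin> closure {x. Ph x ~= 0}" using p(2) that by blast
  then show "Ph x = 0" using closure_subset[of "{x. Ph x ~= 0}"] by blast
  show "grad Ph x = 0" using pd_outside_support[OF n] by (simp add: vec_eq_iff)
 qed
 note i1 = sqint_mult[OF sqzD(1)[OF sqz_drv(2)[OF F]] smooth_cs_sqint[OF p(1)]]
 note i2 = integrable_green(1)[OF sqz_drv(1)[OF F] C]
 have "(LBINT x. b x \<bullet> grad (%x. F x * Ph x) x + D x * (F x * Ph x)) = 0"
  using bf test_functions_mult[OF F Ph] by (auto simp: bounded_field_def)
 also have "(LBINT x. b x \<bullet> grad (%x. F x * Ph x) x + D x * (F x * Ph x)) =
   (LBINT x. (indicator Om x * (b x \<bullet> grad F x)) * Ph x + indicator Om x * F x * (b x \<bullet> grad Ph x + D x * Ph x))"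
  unfolding grad_mult[OF F C]
  by (rule Bochner_Integration.integral_cong[OF refl]) (use off in "auto simp: indicator_def algebra_simps inner_add_right")
 finally show "(LBINT x. indicator Om x * (b x \<bullet> grad F x) * Ph x) = - (LBINT x. indicator Om x * F x * (b x \<bullet> grad Ph x + D x * Ph x))"
  unfolding Bochner_Integration.integral_add[OF i1 i2] by linarith
qed

end

section \<open>The norm of H^1 in terms of Borel representatives\<close>

lemma norm_null_iff:
 fixes h p :: "nat => real" and q :: "'i => nat => real"
 assumes "!!k. 0 <= h k" "!!k. 0 <= p k" "!!i k. 0 <= q i k" "finite I" and e: "!!k. (h k)\<^sup>2 = (p k)\<^sup>2 + (\<Sum>i\<in>I. (q i k)\<^sup>2)"
 shows "h ----> 0 \<longleftrightarrow> p ----> 0 & (ALL i:I. q i ----> 0)"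
proof
 have s0: "0 <= (\<Sum>i\<in>I. (q i k)\<^sup>2)" for k by (intro sum_nonneg) simp
 assume h: "h ----> 0"
 have pk: "p k <= h k" for k
  by (rule power2_le_imp_le[OF _ assms(1)]) (use e[of k] s0[of k] in linarith)
 have qh: "q i k <= h k" if "i \<in> I" for i k
 proof (rule power2_le_imp_le[OF _ assms(1)])
  have "(q i k)\<^sup>2 <= (\<Sum>i\<in>I. (q i k)\<^sup>2)" by (rule member_le_sum) (use that assms(4) in auto)
  then show "(q i k)\<^sup>2 <= (h k)\<^sup>2" using e[of k] zero_le_power2[of "p k"] by linarith
 qed
 have "g ----> 0" if "!!k. 0 <= g k" "!!k. g k <= h k" for g
  by (rule tendsto_sandwich[OF _ _ tendsto_const h]) (use that in auto)
 then show "p ----> 0 & (ALL i:I. q i ----> 0)" using assms(2,3) pk qh by blast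
next
 assume a: "p ----> 0 & (ALL i:I. q i ----> 0)"
 have "(%k. sqrt ((p k)\<^sup>2 + (\<Sum>i\<in>I. (q i k)\<^sup>2))) ----> sqrt (0\<^sup>2 + (\<Sum>i\<in>I. 0\<^sup>2))"
  using a by (intro tendsto_intros) auto
 then show "h ----> 0" using assms(1) by (simp add: e[symmetric])
qed

lemma adv_lin:
 assumes i: "!!Ph. Ph \<in> test_functions Om ==> integrable lborel (%x. v x * (b x \<bullet> grad Ph x + D x * Ph x))"
   "!!Ph. Ph \<in> test_functions Om ==> integrable lborel (%x. v' x * (b x \<bullet> grad Ph x + D x * Ph x))"
  and f: "square_integrable lborel f" "square_integrable lborel f'" and a: "adv Om b D v f" "adv Om b D v' f'"
 shows "adv Om b D (%x. p * v x + q * v' x) (%x. p * f x + q * f' x)"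
 unfolding adv_def
proof
 fix Ph assume Ph: "Ph \<in> test_functions Om"
 then have s: "square_integrable lborel Ph" by (simp add: test_functions_iff smooth_cs_sqint)
 have e: "(LBINT x. (p * u x + q * u' x) * r x) = p * (LBINT x. u x * r x) + q * (LBINT x. u' x * r x)"
  if "integrable lborel (%x. u x * r x)" "integrable lborel (%x. u' x * r x)" for u u' r :: "real ^ 'a => real"
  using that by (simp add: distrib_right mult.assoc)
 show "(LBINT x. (p * f x + q * f' x) * Ph x) = - (LBINT x. (p * v x + q * v' x) * (b x \<bullet> grad Ph x + D x * Ph x))"
  unfolding e[OF sqint_mult[OF f(1) s] sqint_mult[OF f(2) s]] e[OF i[OF Ph]] using a Ph by (simp add: adv_def algebra_simps)
qed

lemma (in field_domain) adv_diff_smooth: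
 assumes "sqz Om v" "sqz Om f" "adv Om b D v f" "C_inf F"
 shows "adv Om b D (%x. indicator Om x * F x - v x) (%x. indicator Om x * (b x \<bullet> grad F x) - f x)"
 using adv_lin[OF integrable_green(1)[OF sqz_drv(1)[OF assms(4)]] integrable_green(1)[OF assms(1)]
   sqzD(1)[OF sqz_drv(2)[OF assms(4)]] sqzD(1)[OF assms(2)] adv_smooth[OF assms(4)] assms(3), of 1 "-1"]
 by (simp add: test_functions_iff smooth_csD)

lemma sqz_diff: "sqz Om u ==> sqz Om v ==> sqz Om (%x. u x - v x)"
 using sqz_lin[of Om u v 1 "-1"] by simp

lemma mi_order_le_1: "{\<alpha> :: 'n::finite => nat. mi_order \<alpha> <= 1} = insert (%_. 0) (range mi_unit)"
proof -
 have "\<alpha> = (%_. 0) \<or> \<alpha> \<in> range mi_unit" if "mi_order \<alpha> <= 1" for \<alpha> :: "'n => nat"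
 proof (cases "ALL i. \<alpha> i = 0")
  case False
  then obtain i where i: "\<alpha> i ~= 0" by blast
  have "mi_order \<alpha> = \<alpha> i + (\<Sum>j\<in>UNIV - {i}. \<alpha> j)" unfolding mi_order_def by (rule sum.remove) auto
  then have "\<alpha> i = 1" "(\<Sum>j\<in>UNIV - {i}. \<alpha> j) = 0" using that i by linarith+
  then have "\<alpha> = mi_unit i" by (auto simp: fun_eq_iff mi_unit_def)
  then show ?thesis by blast
 qed auto
 moreover have "mi_order (mi_unit i) <= 1" for i :: 'n by (simp add: mi_order_def mi_unit_def)
 ultimately show ?thesis by (auto simp: mi_order_def)
qed

lemma rep_self: "sqz Om g ==> rep Om g g"
 by (simp add: rep_def sqz_def square_integrable_def)

lemma has_weak_deriv_0:
 assumes "loc_integrable Om u"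
 shows "has_weak_deriv Om (count_list []) u u"
 unfolding has_weak_deriv_def
proof (intro conjI ballI allI impI assms)
 fix Ph and "is" :: "'a list" assume "ALL i. count_list is i = count_list [] i"
 then have "is = []" by (cases "is") (auto split: if_splits dest: spec[of _ "hd is"])
 then show "(\<integral>x. u x * partials is Ph x \<partial>lebesgue_on Om) = (- 1) ^ mi_order (count_list [] :: 'a => nat) * (\<integral>x. u x * Ph x \<partial>lebesgue_on Om)"
  by (simp add: mi_order_count)
qed

lemma H1_rep:
 assumes op: "open Om" and u: "rep Om u u'" "sqz Om u'" and g: "!!i. sqz Om (g i)" "!!i. wder Om i u' (g i)"
 shows "(norm_H 1 Om u)\<^sup>2 = (norm_L2 lborel u')\<^sup>2 + (\<Sum>i\<in>UNIV. (norm_L2 lborel (g i))\<^sup>2)" and "u \<in> sobolev_H 1 Om"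
proof -
 have Ob: "Om \<in> sets borel" using op by simp
 have single: "mi_unit i = count_list [i]" for i :: 'a by (auto simp: fun_eq_iff mi_unit_def)
 have zero: "(%_. 0) = (count_list [] :: 'a => nat)" by (simp add: fun_eq_iff)
 have 0: "has_weak_deriv Om (%_. 0) u u" unfolding zero by (rule has_weak_deriv_0[OF loc_integrable_sqint[OF Ob u]])
 have 1: "has_weak_deriv Om (mi_unit i) u (g i)" for i
  using has_weak_deriv_unit_rep[OF Ob u rep_self[OF g(1)] g(1)] g(2) by simp
 have n: "norm_L2 (lebesgue_on Om) (weak_deriv Om \<alpha> u) = norm_L2 lborel h'"
  if "\<alpha> = count_list is" "has_weak_deriv Om \<alpha> u h" "rep Om h h'" for \<alpha> "is" h h'
 proof -
  have "AE x in lebesgue_on Om. h x = weak_deriv Om \<alpha> u x"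
   using weak_deriv_eq[OF op that(2)[unfolded that(1)]] unfolding that(1) by eventually_elim simp
  then show ?thesis using rep_sqint(2)[OF Ob rep_cong[OF that(3)]] by blast
 qed
 have "(%_. 0) ~= mi_unit i" for i :: 'a by (metis mi_unit_def zero_neq_one)
 then have notin: "(%_. 0) \<notin> range (mi_unit :: 'a => _)" by blast
 have inj: "inj (mi_unit :: 'a => _)" by (rule injI) (metis mi_unit_def zero_neq_one)
 have "(norm_H 1 Om u)\<^sup>2 = (\<Sum>\<alpha>\<in>insert (%_. 0) (range mi_unit). (norm_L2 (lebesgue_on Om) (weak_deriv Om \<alpha> u))\<^sup>2)"
  unfolding norm_H_def mi_order_le_1 by (simp add: sum_nonneg)
 also have "... = (norm_L2 (lebesgue_on Om) (weak_deriv Om (%_. 0) u))\<^sup>2 + (\<Sum>i\<in>UNIV. (norm_L2 (lebesgue_on Om) (weak_deriv Om (mi_unit i) u))\<^sup>2)"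
  by (simp add: notin sum.reindex[OF inj])
 finally show "(norm_H 1 Om u)\<^sup>2 = (norm_L2 lborel u')\<^sup>2 + (\<Sum>i\<in>UNIV. (norm_L2 lborel (g i))\<^sup>2)"
  by (simp add: n[OF zero 0 u(1)] n[OF single 1 rep_self[OF g(1)]])
 have "EX v. has_weak_deriv Om \<alpha> u v & square_integrable (lebesgue_on Om) v" if "\<alpha> \<in> insert (%_. 0) (range mi_unit)" for \<alpha>
  using that 0 1 rep_sqint(1)[OF Ob u(1)] u(2) rep_sqint(1)[OF Ob rep_self[OF g(1)]] g(1) by (auto simp: sqz_def)
 then show "u \<in> sobolev_H 1 Om" by (simp add: sobolev_H_def mi_order_le_1[symmetric])
qed

context smooth_domain
begin

lemma surf_pair: "boundary_pair Om (%_. axis i 1) (%_. 0) 1 surf (%z. outward_normal Om z $ i)"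
proof (intro boundary_pair.intro field_domain.intro boundary_pair_axioms.intro)
 show "bounded_field Om (%_. axis i 1) (%_. 0) 1"
  by (auto simp: bounded_field_def inner_axis' test_functions_iff integral_pd_smooth_cs)
 have n: "outward_normal Om z $ i = outward_normal Om z \<bullet> axis i 1" for z by (simp add: inner_axis)
 show "(%z. outward_normal Om z $ i) \<in> borel_measurable surf"
  using surface_divergence(2)[OF C_inf_const, of "axis i 1"] unfolding n .
 show "\<bar>outward_normal Om z $ i\<bar> <= 1" if "z \<in> space surf" for z
  using component_le_norm_cart[of "outward_normal Om z" i] surface_divergence(3)[OF C_inf_const, of z] that by simp
 show "(LBINT x. indicator Om x * (axis i 1 \<bullet> grad F x + 0 * F x)) = (LINT x|surf. outward_normal Om x $ i * F x)" if "C_inf F" for F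
  using surface_divergence(1)[OF that, of "axis i 1"] by (simp add: inner_commute[of "axis i 1"] n mult.commute)
qed (simp_all only: open_dom bounded_dom finite_surf sets_surf)

text \<open>With a transversal field N the boundary integral of F^2 is at most a multiple of that of
  F^2 N.n, which the divergence theorem turns into volume integrals of F^2 and of F times its
  derivatives.\<close>

lemma surf_energy:
 "EX c>=0. ALL F. C_inf F --> (LINT x|surf. (F x)\<^sup>2) <= c * ((LBINT x. (indicator Om x * F x)\<^sup>2) +
   (\<Sum>i\<in>UNIV. \<integral>x. (indicator Om x * (axis i 1 \<bullet> grad F x))\<^sup>2 \<partial>lborel))"
proof -
 interpret boundary_pair Om "%_. axis i 1" "%_. 0" 1 surf "%z. outward_normal Om z $ i" for i by (rule surf_pair)
 obtain N \<kappa> where N: "\<kappa> > 0" "!!i. smooth_cs (N i)" "!!z. z \<in> frontier Om ==> (\<Sum>i\<in>UNIV. N i z * outward_normal Om z $ i) >= \<kappa>"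
  using surface_divergence(4)[OF C_inf_const] by blast
 have "EX M>=0. ALL x. \<bar>N i x\<bar> <= M & \<bar>pd i (N i) x\<bar> <= M" for i
 proof -
  obtain M1 where "!!x. \<bar>N i x\<bar> <= M1" "M1 >= 0" using smooth_cs_bounded[OF N(2)] by metis
  moreover obtain M2 where "!!x. \<bar>pd i (N i) x\<bar> <= M2" using smooth_cs_bounded[OF smooth_cs_pd[OF N(2)]] by metis
  ultimately show ?thesis by (intro exI[of _ "max M1 M2"]) (auto simp: le_max_iff_disj)
 qed
 then obtain M where M: "!!i. M i >= 0" "!!i x. \<bar>N i x\<bar> <= M i" "!!i x. \<bar>pd i (N i) x\<bar> <= M i" by metis
 define Q where "Q = (\<Sum>i\<in>UNIV. M i)"
 have MQ: "M i <= Q" for i unfolding Q_def by (rule member_le_sum) (auto simp: M)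
 have Q0: "Q >= 0" unfolding Q_def by (rule sum_nonneg) (rule M)
 let ?n = "real CARD('a)"
 have "(LINT x|surf. (F x)\<^sup>2) <= (2 * Q * (?n + 1) / \<kappa>) * ((LBINT x. (indicator Om x * F x)\<^sup>2) +
   (\<Sum>i\<in>UNIV. \<integral>x. (indicator Om x * (axis i 1 \<bullet> grad F x))\<^sup>2 \<partial>lborel))" (is "_ <= _ * (?A + (\<Sum>i\<in>UNIV. ?G i))") if F: "C_inf F" for F
 proof -
  let ?H = "%i x. F x * (F x * N i x)"
  have CH: "C_inf (?H i)" for i by (intro C_inf_mult F smooth_csD N)
  have iF: "integrable surf (%x. (F x)\<^sup>2)" using sqint_smooth(1)[OF F] by (simp add: square_integrable_def)
  have iH: "integrable surf (%x. outward_normal Om x $ i * ?H i x)" for i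
   using sqint_mult[OF sqint_smooth(1)[OF C_inf_const[of 1]] sqint_smooth(2)[OF CH]] by simp
  have "\<kappa> * (LINT x|surf. (F x)\<^sup>2) = (LINT x|surf. \<kappa> * (F x)\<^sup>2)" by simp
  also have "... <= (LINT x|surf. (\<Sum>i\<in>UNIV. outward_normal Om x $ i * ?H i x))"
  proof (rule Bochner_Integration.integral_mono)
   fix x assume "x \<in> space surf"
   then have "\<kappa> * (F x)\<^sup>2 <= (\<Sum>i\<in>UNIV. N i x * outward_normal Om x $ i) * (F x)\<^sup>2" using N(3)[of x] by (intro mult_right_mono) auto
   then show "\<kappa> * (F x)\<^sup>2 <= (\<Sum>i\<in>UNIV. outward_normal Om x $ i * ?H i x)" by (simp add: sum_distrib_right sum_distrib_left power2_eq_square mult_ac)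
  qed (use iF iH in auto)
  also have "... = (\<Sum>i\<in>UNIV. \<integral>x. indicator Om x * (axis i 1 \<bullet> grad (?H i) x) \<partial>lborel)"
   using div[OF CH] iH by simp
  also have "... <= (\<Sum>i\<in>UNIV. 2 * Q * (?A + ?G i))"
  proof (rule sum_mono)
   fix i
   have i2: "integrable lborel (%x. (indicator Om x * F x)\<^sup>2)" "integrable lborel (%x. (indicator Om x * (axis i 1 \<bullet> grad F x))\<^sup>2)"
    using sqzD(1)[OF sqz_drv(1)[OF F]] sqzD(1)[OF sqz_drv(2)[OF F]] by (simp_all add: square_integrable_def)
   have "(LBINT x. indicator Om x * (axis i 1 \<bullet> grad (?H i) x)) <= (LBINT x. 2 * Q * ((indicator Om x * F x)\<^sup>2 + (indicator Om x * (axis i 1 \<bullet> grad F x))\<^sup>2))"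
   proof (rule Bochner_Integration.integral_mono)
    show "integrable lborel (%x. indicator Om x * (axis i 1 \<bullet> grad (?H i) x))"
     by (rule sqz_integrable[OF dom_borel bdd sqz_drv(2)[OF CH]])
    fix x
    have "axis i 1 \<bullet> grad (?H i) x = 2 * F x * pd i F x * N i x + (F x)\<^sup>2 * pd i (N i) x"
     using F smooth_csD[OF N(2)] by (simp add: inner_axis' C_inf_mult power2_eq_square algebra_simps)
    moreover have "2 * F x * pd i F x * N i x <= ((F x)\<^sup>2 + (pd i F x)\<^sup>2) * Q"
    proof -
     have "2 * F x * pd i F x * N i x <= \<bar>2 * F x * pd i F x\<bar> * \<bar>N i x\<bar>" by (metis abs_ge_self abs_mult)
     also have "... <= ((F x)\<^sup>2 + (pd i F x)\<^sup>2) * Q"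
      using M(2)[of i x] MQ[of i] sum_squares_bound[of "\<bar>F x\<bar>" "\<bar>pd i F x\<bar>"] by (intro mult_mono) (auto simp: abs_mult)
     finally show ?thesis .
    qed
    moreover have "(F x)\<^sup>2 * pd i (N i) x <= (F x)\<^sup>2 * Q" using M(3)[of i x] MQ[of i] by (intro mult_left_mono) auto
    moreover have "0 <= (pd i F x)\<^sup>2 * Q" using Q0 by simp
    ultimately have "axis i 1 \<bullet> grad (?H i) x <= 2 * Q * ((F x)\<^sup>2 + (pd i F x)\<^sup>2)" by (simp add: algebra_simps)
    then show "indicator Om x * (axis i 1 \<bullet> grad (?H i) x) <= 2 * Q * ((indicator Om x * F x)\<^sup>2 + (indicator Om x * (axis i 1 \<bullet> grad F x))\<^sup>2)"
     by (simp add: indicator_def inner_axis')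
   qed (use i2 in simp)
   also have "... = 2 * Q * (?A + ?G i)" using i2 by simp
   finally show "(LBINT x. indicator Om x * (axis i 1 \<bullet> grad (?H i) x)) <= 2 * Q * (?A + ?G i)" .
  qed
  also have "... = 2 * Q * (?n * ?A + (\<Sum>i\<in>UNIV. ?G i))" by (simp add: sum_distrib_left[symmetric] sum.distrib)
  also have "... <= 2 * Q * ((?n + 1) * (?A + (\<Sum>i\<in>UNIV. ?G i)))"
  proof (rule mult_left_mono)
   have "0 <= ?A" "0 <= (\<Sum>i\<in>UNIV. ?G i)" by (simp_all add: sum_nonneg)
   then show "?n * ?A + (\<Sum>i\<in>UNIV. ?G i) <= (?n + 1) * (?A + (\<Sum>i\<in>UNIV. ?G i))" by (simp add: distrib_right distrib_left)
  qed (use Q0 in simp)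
  finally show ?thesis using N(1) by (simp add: field_simps)
 qed
 then show ?thesis using Q0 N(1) by (intro exI[of _ "2 * Q * (?n + 1) / \<kappa>"]) simp
qed

text \<open>The family of fields and the boundary measure are parameters, so that one notion
  describes traces of H^1 and of the graph space.\<close>

definition approx :: "'i set => ('i => real ^ 'a => real ^ 'a) => (real ^ 'a) measure => (nat => real ^ 'a => real) =>
  (real ^ 'a => real) => ('i => real ^ 'a => real) => (real ^ 'a => real) => bool" where
 "approx M b N F v f t \<longleftrightarrow> (ALL k. C_inf (F k)) & (%k. norm_L2 lborel (%x. indicator Om x * F k x - v x)) ----> 0 &
  (ALL m:M. (%k. norm_L2 lborel (%x. indicator Om x * (b m x \<bullet> grad (F k) x) - f m x)) ----> 0) &
  square_integrable N t & (%k. norm_L2 N (%x. F k x - t x)) ----> 0"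

text \<open>Applied to differences, the energy inequality makes the approximations Cauchy on the
  boundary as soon as they converge in the domain. Positivity of v near the boundary passes to the
  limit along an almost everywhere convergent subsequence.\<close>

lemma trace_exists:
 assumes N: "!!F. C_inf F ==> square_integrable N F" "space N = frontier Om"
  and E: "!!F. C_inf F ==> (LINT x|N. (F x)\<^sup>2) <= c * ((LBINT x. (indicator Om x * F x)\<^sup>2) +
   (\<Sum>m\<in>M. \<integral>x. (indicator Om x * (b m x \<bullet> grad F x))\<^sup>2 \<partial>lborel))" "c >= 0" "finite M"
  and v: "sqz Om v" and b: "!!m. m \<in> M ==> bounded_field Om (b m) (D m) (B m)" and L: "!!m. m \<in> M ==> cone_Lipschitz (b m)"
  and a: "!!m. m \<in> M ==> adv Om (b m) (D m) v (f m)" and f: "!!m. m \<in> M ==> sqz Om (f m)"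
 shows "EX F t. approx M b N F v f t &
  (ALL G. open G --> frontier Om \<subseteq> G --> (AE x in lborel. x \<in> Om \<inter> G --> 0 <= v x) --> (AE x in N. 0 <= t x))"
proof (rule Friedrichs_density[OF v b L a f])
 fix F :: "nat => real ^ 'a => real"
 assume F: "!!k. C_inf (F k)" "L2null lborel (%k x. indicator Om x * (F k x - v x))"
  "!!m. m \<in> M ==> L2null lborel (%k x. indicator Om x * (b m x \<bullet> grad (F k) x - f m x))"
  and pos: "!!G. open G ==> frontier Om \<subseteq> G ==> AE x in lborel. x \<in> Om \<inter> G --> 0 <= v x ==> \<forall>\<^sub>F k in sequentially. ALL x:frontier Om. 0 <= F k x"
 have cut: "(%x. indicator Om x * (h x - u x)) = (%x. indicator Om x * h x - u x)" if "sqz Om u" for h u :: "real ^ 'a => real"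
  using sqzD(3)[OF that] by (auto simp: fun_eq_iff indicator_def)
 define A where "A k = norm_L2 lborel (%x. indicator Om x * F k x - v x)" for k
 define d where "d m k = norm_L2 lborel (%x. indicator Om x * (b m x \<bullet> grad (F k) x) - f m x)" for m k
 have A0: "A ----> 0" using F(2) by (simp add: L2null_def A_def[abs_def] cut[OF v])
 have d0: "d m ----> 0" if "m \<in> M" for m using F(3)[OF that] by (simp add: L2null_def d_def[abs_def] cut[OF f[OF that]])
 \<comment> \<open>A single null sequence that dominates the error of the function and the errors of
   all its advections.\<close>
 define Z where "Z k = A k + (\<Sum>m\<in>M. d m k)" for k
 have "Z ----> 0 + (\<Sum>m\<in>M. 0)" unfolding Z_def[abs_def] by (intro tendsto_intros A0 d0)
 then have Z0: "Z ----> 0" by simp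
 have AZ: "A k <= Z k" for k by (simp add: Z_def sum_nonneg d_def)
 have dZ: "d m k <= Z k" if "m \<in> M" for m k
  using member_le_sum[OF that, of "%m. d m k"] E(3) by (simp add: Z_def d_def A_def add_increasing)
 have Zn: "0 <= Z k" for k by (simp add: Z_def A_def d_def sum_nonneg)
 let ?n = "real (card M) + 1"
 have fd: "field_domain Om (b m) (D m) (B m)" if "m \<in> M" for m using b[OF that] open_dom bounded_dom by (simp add: field_domain_def)
 interpret S: boundary_pair Om "%_. axis i 1" "%_. 0" 1 surf "%z. outward_normal Om z $ i" for i by (rule surf_pair)
 have tri: "norm_L2 lborel (%x. h x - h' x) <= norm_L2 lborel (%x. h x - u x) + norm_L2 lborel (%x. h' x - u x)"
  if "sqz Om h" "sqz Om h'" "sqz Om u" for h h' u :: "real ^ 'a => real"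
  using norm_L2_triangle3[OF that(1,3,2)[THEN sqzD(1)]] norm_L2_minus[of lborel u h'] by simp
 have bound: "norm_L2 N (%x. F p x - F q x) <= sqrt (c * ?n) * (Z p + Z q)" for p q
 proof -
  have CF: "C_inf (%x. F p x - F q x)" by (intro C_inf_diff F)
  have "norm_L2 lborel (%x. indicator Om x * F p x - indicator Om x * F q x) <= A p + A q"
   unfolding A_def by (rule tri[OF S.sqz_drv(1)[OF F(1)] S.sqz_drv(1)[OF F(1)] v])
  also have "... <= Z p + Z q" using AZ by (intro add_mono)
  finally have 1: "(norm_L2 lborel (%x. indicator Om x * (F p x - F q x)))\<^sup>2 <= (Z p + Z q)\<^sup>2"
   by (intro power_mono) (simp_all add: right_diff_distrib)
  have 2: "(norm_L2 lborel (%x. indicator Om x * (b m x \<bullet> grad (%x. F p x - F q x) x)))\<^sup>2 <= (Z p + Z q)\<^sup>2" if m: "m \<in> M" for m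
  proof -
   interpret field_domain Om "b m" "D m" "B m" by (rule fd[OF m])
   have g: "b m x \<bullet> grad (%x. F p x - F q x) x = b m x \<bullet> grad (F p) x - b m x \<bullet> grad (F q) x" for x
    unfolding inner_diff_right[symmetric] using F(1) by (intro arg_cong[of _ _ "inner (b m x)"]) (simp add: vec_eq_iff)
   have "norm_L2 lborel (%x. indicator Om x * (b m x \<bullet> grad (F p) x) - indicator Om x * (b m x \<bullet> grad (F q) x)) <= d m p + d m q"
    unfolding d_def by (rule tri[OF sqz_drv(2)[OF F(1)] sqz_drv(2)[OF F(1)] f[OF m]])
   also have "... <= Z p + Z q" using dZ[OF m] by (intro add_mono)
   finally show ?thesis unfolding g right_diff_distrib by (intro power_mono) simp_all
  qed
  have "(norm_L2 N (%x. F p x - F q x))\<^sup>2 <= c * ((Z p + Z q)\<^sup>2 + (\<Sum>m\<in>M. (Z p + Z q)\<^sup>2))"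
   unfolding norm_L2_sq using E(2) 1 2 by (intro order_trans[OF E(1)[OF CF]] mult_left_mono add_mono sum_mono) (simp_all add: norm_L2_sq)
  also have "... = (sqrt (c * ?n) * (Z p + Z q))\<^sup>2" using E(2) by (simp add: power_mult_distrib) (simp add: algebra_simps)
  finally show ?thesis by (rule power2_le_imp_le) (use Zn E(2) in simp)
 qed
 have Cau: "EX K. ALL p>=K. ALL q>=K. norm_L2 N (%x. F p x - F q x) < e" if e: "e > 0" for e
 proof -
  define c' where "c' = sqrt (c * ?n)"
  have c0: "c' >= 0" using E(2) by (simp add: c'_def)
  have e': "e / (2 * (c' + 1)) > 0" by (rule divide_pos_pos[OF e]) (use c0 in simp)
  obtain K where K: "!!k. k >= K ==> Z k < e / (2 * (c' + 1))"
   using order_tendstoD(2)[OF Z0 e'] unfolding eventually_sequentially by blast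
  have "norm_L2 N (%x. F p x - F q x) < e" if "p >= K" "q >= K" for p q
  proof -
   have "Z p + Z q < e / (c' + 1)" using K[OF that(1)] K[OF that(2)] c0 by (simp add: field_simps)
   then have "(c' + 1) * (Z p + Z q) < e" using c0 by (simp add: field_simps)
   moreover have "c' * (Z p + Z q) <= (c' + 1) * (Z p + Z q)" using Zn by (intro mult_right_mono) (simp_all add: add_nonneg_nonneg)
   ultimately show ?thesis using bound[of p q, folded c'_def] by linarith
  qed
  then show ?thesis by blast
 qed
 obtain t r where t: "square_integrable N t" "(%k. norm_L2 N (%x. F k x - t x)) ----> 0"
  "strict_mono r" "AE x in N. (%k. F (r k) x) ----> t x"
  using L2_complete[OF N(1)[OF F(1)] Cau] by blast
 have "AE x in N. 0 <= t x" if "open G" "frontier Om \<subseteq> G" "AE x in lborel. x \<in> Om \<inter> G --> 0 <= v x" for G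
 proof -
  have ev: "\<forall>\<^sub>F k in sequentially. ALL x:frontier Om. 0 <= F (r k) x"
   using filterlim_subseq[OF t(3)] pos[OF that] unfolding filterlim_iff by blast
  show ?thesis using t(4) AE_space
  proof eventually_elim
   case (elim x)
   then have "\<forall>\<^sub>F k in sequentially. 0 <= F (r k) x" using ev N(2) by (auto elim: eventually_mono)
   then show ?case using elim(1) by (intro tendsto_lowerbound) auto
  qed
 qed
 moreover have "approx M b N F v f t" unfolding approx_def using F(1) A0 d0 t(1,2) by (simp add: A_def[abs_def] d_def[abs_def])
 ultimately show ?thesis by blast
qed

end

lemma adv_uminus: "adv Om b D v f ==> adv Om b D (%x. - v x) (%x. - f x)"
 by (simp add: adv_def)

lemma ex_conj_iff:
 assumes "!!F. P F ==> A F \<longleftrightarrow> B F & B' F" W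
 shows "(W & S & (EX F. P F & A F & N F)) \<longleftrightarrow> (EX F. P F & B F & B' F & S & N F)"
 using assms by blast

context smooth_domain
begin

lemma bdry_trace_iff:
 assumes v: "rep Om v v'" "sqz Om v'" and g: "!!i. sqz Om (g i)" "!!i. wder Om i v' (g i)"
 shows "is_bdry_trace Om v t \<longleftrightarrow> (EX F. approx UNIV (%i _. axis i 1) surf F v' g t)"
proof -
 interpret S: boundary_pair Om "%_. axis i 1" "%_. 0" 1 surf "%z. outward_normal Om z $ i" for i by (rule surf_pair)
 have key: "(%k. norm_H 1 Om (%x. F k x - v x)) ----> 0 \<longleftrightarrow>
   (%k. norm_L2 lborel (%x. indicator Om x * F k x - v' x)) ----> 0 &
   (ALL i:UNIV. (%k. norm_L2 lborel (%x. indicator Om x * (axis i 1 \<bullet> grad (F k) x) - g i x)) ----> 0)"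
  if "ALL k. C_inf (F k)" for F
 proof (rule norm_null_iff)
  fix k
  have F: "C_inf (F k)" for k using that by blast
  have "rep Om (%x. F k x - v x) (%x. indicator Om x * F k x - v' x)"
   using rep_lin[OF rep_borel[OF dom_sets C_inf_borel[OF F[of k]]] v(1), of 1 "-1"] by simp
  from H1_rep(1)[OF open_dom this sqz_diff[OF S.sqz_drv(1)[OF F] v(2)] sqz_diff[OF S.sqz_drv(2)[OF F] g(1)] S.adv_diff_smooth[OF v(2) g F]]
  show "(norm_H 1 Om (%x. F k x - v x))\<^sup>2 = (norm_L2 lborel (%x. indicator Om x * F k x - v' x))\<^sup>2 +
    (\<Sum>i\<in>UNIV. (norm_L2 lborel (%x. indicator Om x * (axis i 1 \<bullet> grad (F k) x) - g i x))\<^sup>2)" .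
 qed (simp_all add: norm_H_def sum_nonneg)
 show ?thesis unfolding is_bdry_trace_def approx_def by (rule ex_conj_iff[OF key H1_rep(2)[OF open_dom v g]])
qed

text \<open>\<open>bdry_trace\<close> is a choice among admissible traces, so a lower bound for a
  constructed trace reaches it only through uniqueness: Green's formula in every coordinate
  direction determines the trace wherever some component of the normal is not 0, hence almost
  everywhere. The lower bound c itself is positivity applied to v - c.\<close>

lemma bdry_trace_props:
 assumes v: "rep Om v v'" "sqz Om v'" and g: "!!i. sqz Om (g i)" "!!i. wder Om i v' (g i)"
 shows "square_integrable surf (bdry_trace Om v)"
  and "boundary_pair.green (%_. axis i 1) (%_. 0) surf (%z. outward_normal Om z $ i) v' (g i) (bdry_trace Om v)"
  and "open G ==> frontier Om \<subseteq> G ==> AE x in lborel. x \<in> Om \<inter> G --> c <= v' x ==> AE x in surf. c <= bdry_trace Om v x"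
proof -
 interpret S: boundary_pair Om "%_. axis i 1" "%_. 0" 1 surf "%z. outward_normal Om z $ i" for i by (rule surf_pair)
 note iff = bdry_trace_iff[OF v g]
 have gr: "S.green i v' (g i) t" if F: "approx UNIV (%i _. axis i 1) surf F v' g t" for F t i
  by (rule S.green_limit(1)[OF v(2) g(1), of t F]) (use F in "auto simp: approx_def")
 obtain c' where c': "c' >= 0" "!!F. C_inf F ==> (LINT x|surf. (F x)\<^sup>2) <= c' * ((LBINT x. (indicator Om x * F x)\<^sup>2) +
   (\<Sum>i\<in>UNIV. \<integral>x. (indicator Om x * (axis i 1 \<bullet> grad F x))\<^sup>2 \<partial>lborel))" using surf_energy by blast
 have ex: "EX t. is_bdry_trace Om v t & (ALL G. open G --> frontier Om \<subseteq> G --> (AE x in lborel. x \<in> Om \<inter> G --> c <= v' x) --> (AE x in surf. c <= t x))" for c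
 proof -
  let ?v = "%x. indicator Om x * c - v' x" and ?w = "%x. v' x - indicator Om x * c"
  have g0: "grad (%x. c) x = 0" for x :: "real ^ 'a" by (simp add: vec_eq_iff)
  have "wder Om i ?v (%x. indicator Om x * (axis i 1 \<bullet> grad (%x. c) x) - g i x)" for i
   by (rule S.adv_diff_smooth[OF v(2) g C_inf_const])
  from adv_uminus[OF this] have wv: "wder Om i ?w (g i)" for i by (simp add: g0)
  have w: "sqz Om ?w" by (rule sqz_diff[OF v(2) S.sqz_drv(1)[OF C_inf_const]])
  obtain F t where F: "approx UNIV (%i _. axis i 1) surf F ?w g t"
    and pos: "!!G. open G ==> frontier Om \<subseteq> G ==> AE x in lborel. x \<in> Om \<inter> G --> 0 <= ?w x ==> AE x in surf. 0 <= t x"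
   using trace_exists[where N = surf and b = "%i _. axis i 1" and D = "%_ _. 0" and B = "%_. 1" and M = UNIV and f = g, OF S.sqint_smooth(1) space_surf c'(2,1) finite w S.bf cone_Lipschitz_const wv g(1)] by blast
  have "approx UNIV (%i _. axis i 1) surf (%k x. F k x + c) v' g (%x. t x + c)"
   unfolding approx_def
  proof (intro conjI allI ballI)
   have C: "C_inf (F k)" for k using F by (simp add: approx_def)
   then show "C_inf (%x. F k x + c)" for k by (intro C_inf_add C_inf_const)
   have "grad (%x. F k x + c) = grad (F k)" for k using C[of k] by (simp add: fun_eq_iff vec_eq_iff C_inf_const)
   then show "(%k. norm_L2 lborel (%x. indicator Om x * (axis i 1 \<bullet> grad (%x. F k x + c) x) - g i x)) ----> 0" for i
    using F by (simp add: approx_def)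
   show "square_integrable surf (%x. t x + c)" by (rule sqint_add) (use F S.sqint_smooth(1)[OF C_inf_const] in "auto simp: approx_def")
  qed (use F in "simp_all add: approx_def algebra_simps")
  then have t: "is_bdry_trace Om v (%x. t x + c)" using iff by blast
  have "AE x in surf. c <= t x + c" if "open G" "frontier Om \<subseteq> G" "AE x in lborel. x \<in> Om \<inter> G --> c <= v' x" for G
  proof -
   have "AE x in lborel. x \<in> Om \<inter> G --> 0 <= ?w x" using that(3) by eventually_elim simp
   then show ?thesis using pos[OF that(1,2)] by simp
  qed
  with t show ?thesis by (intro exI[of _ "%x. t x + c"]) blast
 qed
 then have bt: "is_bdry_trace Om v (bdry_trace Om v)" unfolding bdry_trace_def by (metis someI_ex)
 then show sq: "square_integrable surf (bdry_trace Om v)" by (simp add: is_bdry_trace_def)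
 obtain F where F: "approx UNIV (%i _. axis i 1) surf F v' g (bdry_trace Om v)" using bt iff by blast
 then show "S.green i v' (g i) (bdry_trace Om v)" by (rule gr)
 show "AE x in surf. c <= bdry_trace Om v x" if G: "open G" "frontier Om \<subseteq> G" "AE x in lborel. x \<in> Om \<inter> G --> c <= v' x"
 proof -
  obtain t where t: "is_bdry_trace Om v t" "AE x in surf. c <= t x" using ex[of c] G by blast
  obtain F' where F': "approx UNIV (%i _. axis i 1) surf F' v' g t" using t(1) iff by blast
  have ts: "square_integrable surf t" using t(1) by (simp add: is_bdry_trace_def)
  have "AE x in surf. ALL i:UNIV. outward_normal Om x $ i * (t x - bdry_trace Om v x) = 0"
   using S.green_unique[OF ts sq gr[OF F'] gr[OF F]] by (intro AE_finite_allI) auto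
  with t(2) AE_space show ?thesis
  proof eventually_elim
   case (elim x)
   then have "outward_normal Om x ~= 0" using surface_divergence(3)[OF C_inf_const, of x] by force
   then obtain i where "outward_normal Om x $ i ~= 0" by (auto simp: vec_eq_iff)
   then show ?case using elim by force
  qed
 qed
qed

end

section \<open>The graph space\<close>

text \<open>The separation hypothesis is kept in one identity: \<open>1 - 2 * \<xi> x\<close> is a
  smooth function that equals the sign of the flux almost everywhere where the flux is not
  0.\<close>

locale transport = smooth_domain Om C R s Ta e Ph
 for Om :: "(real ^ 'n::finite) set" and C R s Ta e Ph +
 fixes \<beta> b :: "real ^ 'n => real ^ 'n" and D :: "real ^ 'n => real" and B :: real and \<xi> :: "real ^ 'n => real"
 assumes repb: "!!i. rep Om (%x. \<beta> x $ i) (%x. b x $ i)" and repD: "rep Om (weak_div Om \<beta>) D"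
  and bfield: "bounded_field Om b D B" and bLip: "cone_Lipschitz b"
  and bn_sq: "square_integrable (surface_measure Om) (normal_trace Om \<beta>)"
  and bn_div: "!!F. C_inf F ==> (LBINT x. indicator Om x * (b x \<bullet> grad F x + D x * F x)) = (\<integral>x. normal_trace Om \<beta> x * F x \<partial>surface_measure Om)"
  and \<xi>: "smooth_cs \<xi>" "!!x. 0 <= \<xi> x" "!!x. \<xi> x <= 1"
  and separates: "AE x in surface_measure Om. \<bar>normal_trace Om \<beta> x\<bar> = normal_trace Om \<beta> x * (1 - 2 * \<xi> x)"
begin

abbreviation bn :: "real ^ 'n => real" where "bn \<equiv> normal_trace Om \<beta>"

abbreviation flux :: "(real ^ 'n) measure" where "flux \<equiv> flux_measure Om \<beta>"

lemma bn_measurable [measurable]: "bn \<in> borel_measurable surf"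
 using bn_sq by (simp add: square_integrable_def)

lemma sets_flux [simp, measurable_cong]: "sets flux = sets surf"
 by (simp add: flux_measure_def)

lemma space_flux: "space flux = frontier Om"
 by (simp add: flux_measure_def)

lemma integral_flux: "h \<in> borel_measurable surf ==> (LINT x|flux. h x) = (LINT x|surf. \<bar>bn x\<bar> * h x)"
 and integrable_flux: "h \<in> borel_measurable surf ==> integrable flux h \<longleftrightarrow> integrable surf (%x. \<bar>bn x\<bar> * h x)"
 for h :: "real ^ 'n => real"
 unfolding flux_measure_def by (simp_all add: integral_density integrable_density)

lemma AE_flux: "(AE x in flux. P x) \<longleftrightarrow> (AE x in surf. bn x ~= 0 --> P x)"
 unfolding flux_measure_def by (subst AE_density) auto

text \<open>As sgn r times |r| is r, the flux of \<open>b\<close> is the measure |b.n| ds with the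
  weight sgn (b.n).\<close>

sublocale boundary_pair Om b D B flux "%x. sgn (bn x)"
proof (intro boundary_pair.intro field_domain.intro boundary_pair_axioms.intro)
 interpret S: finite_measure surf by (rule finite_surf)
 have "integrable surf bn"
  using sqint_mult[OF bn_sq sqint_bounded_fun[OF finite_surf, of "%_. 1" 1]] by simp
 then have "integrable surf (%x. \<bar>bn x\<bar>)" by simp
 then have "(\<integral>\<^sup>+x. ennreal \<bar>bn x\<bar> \<partial>surf) < \<infinity>" by (simp add: integrable_iff_bounded)
 then show "finite_measure flux"
 proof (intro finite_measureI)
  assume f: "(\<integral>\<^sup>+x. ennreal \<bar>bn x\<bar> \<partial>surf) < \<infinity>"
  have "emeasure flux (space flux) = (\<integral>\<^sup>+x. ennreal \<bar>bn x\<bar> * indicator (space surf) x \<partial>surf)"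
   unfolding flux_measure_def space_density by (rule emeasure_density) (use sets.top[of surf] in auto)
  also have "... = (\<integral>\<^sup>+x. ennreal \<bar>bn x\<bar> \<partial>surf)" by (rule nn_integral_cong) simp
  finally show "emeasure flux (space flux) ~= \<infinity>" using f by simp
 qed
 show "(LBINT x. indicator Om x * (b x \<bullet> grad F x + D x * F x)) = (LINT x|flux. sgn (bn x) * F x)" if F: "C_inf F" for F
 proof -
  have [measurable]: "F \<in> borel_measurable surf" by (rule borel_surf[OF C_inf_borel[OF F]])
  have "(LINT x|flux. sgn (bn x) * F x) = (LINT x|surf. \<bar>bn x\<bar> * (sgn (bn x) * F x))" by (rule integral_flux) measurable
  also have "... = (LINT x|surf. bn x * F x)" by (rule Bochner_Integration.integral_cong[OF refl]) (simp add: mult.assoc[symmetric] abs_mult_sgn)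
  finally show ?thesis using bn_div[OF F] by simp
 qed
qed (simp_all add: open_dom bounded_dom bfield sets_surf abs_sgn_eq)

lemma flux_energy:
 "EX c>=0. ALL F. C_inf F --> (LINT x|flux. (F x)\<^sup>2) <= c * ((LBINT x. (indicator Om x * F x)\<^sup>2) + (LBINT x. (indicator Om x * (b x \<bullet> grad F x))\<^sup>2))"
proof -
 have B: "norm (b x) <= B" "\<bar>D x\<bar> <= B" for x using bfield by (auto simp: bounded_field_def)
 have B0: "0 <= B" using B(2)[of 0] by linarith
 obtain K where K: "K >= 0" "!!x. norm (grad \<xi> x) <= K" using grad_bounded[OF \<xi>(1)] by metis
 let ?\<eta> = "%x. 1 - 2 * \<xi> x"
 have C\<eta>: "C_inf ?\<eta>" by (intro C_inf_diff C_inf_mult C_inf_const smooth_csD \<xi>)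
 have g\<eta>: "grad ?\<eta> x = - 2 *\<^sub>R grad \<xi> x" for x using smooth_csD[OF \<xi>(1)] by (simp add: vec_eq_iff C_inf_const C_inf_mult)
 have eta1: "\<bar>?\<eta> x\<bar> <= 1" for x using \<xi>(2,3)[of x] by (simp add: abs_le_iff)
 \<comment> \<open>The 1 comes from 2 F (b.grad F), the term with \<open>2 * K\<close> from the
   gradient of \<open>1 - 2 * \<xi> x\<close>, and the last \<open>B\<close> from the
   divergence.\<close>
 let ?c = "1 + B * (2 * K) + B"
 have "(LINT x|flux. (F x)\<^sup>2) <= ?c * ((LBINT x. (indicator Om x * F x)\<^sup>2) + (LBINT x. (indicator Om x * (b x \<bullet> grad F x))\<^sup>2))" if F: "C_inf F" for F
 proof -
  let ?H = "%x. (F x * F x) * ?\<eta> x"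
  have CFF: "C_inf (%x. F x * F x)" by (intro C_inf_mult F)
  have CH: "C_inf ?H" by (intro C_inf_mult CFF C\<eta>)
  have [measurable]: "F \<in> borel_measurable surf" "\<xi> \<in> borel_measurable surf"
   using borel_surf[OF C_inf_borel[OF F]] borel_surf[OF smooth_cs_measurable[OF \<xi>(1)]] by auto
  have i2: "integrable lborel (%x. (indicator Om x * F x)\<^sup>2)" "integrable lborel (%x. (indicator Om x * (b x \<bullet> grad F x))\<^sup>2)"
   using sqzD(1)[OF sqz_drv(1)[OF F]] sqzD(1)[OF sqz_drv(2)[OF F]] by (simp_all add: square_integrable_def)
  have "(LINT x|flux. (F x)\<^sup>2) = (LINT x|surf. \<bar>bn x\<bar> * (F x)\<^sup>2)" by (rule integral_flux) measurable
  also have "... = (LINT x|surf. bn x * ?H x)"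
   by (rule integral_cong_AE) (use separates in "auto simp: power2_eq_square elim!: eventually_mono")
  also have "... = (LBINT x. indicator Om x * (b x \<bullet> grad ?H x + D x * ?H x))" by (rule bn_div[OF CH, symmetric])
  also have "... <= (LBINT x. ?c * ((indicator Om x * F x)\<^sup>2 + (indicator Om x * (b x \<bullet> grad F x))\<^sup>2))"
  proof (rule Bochner_Integration.integral_mono)
   show "integrable lborel (%x. indicator Om x * (b x \<bullet> grad ?H x + D x * ?H x))"
    by (rule sqz_integrable[OF dom_borel bdd sqz_drv(3)[OF CH]])
   fix x
   have e: "b x \<bullet> grad ?H x + D x * ?H x = 2 * F x * (b x \<bullet> grad F x) * ?\<eta> x + (F x)\<^sup>2 * (b x \<bullet> grad ?\<eta> x) + (F x)\<^sup>2 * (D x * ?\<eta> x)"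
    unfolding grad_mult[OF CFF C\<eta>] grad_mult[OF F F] inner_add_right inner_scaleR_right by (simp add: power2_eq_square algebra_simps)
   have 1: "2 * F x * (b x \<bullet> grad F x) * ?\<eta> x <= ((F x)\<^sup>2 + (b x \<bullet> grad F x)\<^sup>2) * 1"
   proof -
    have "2 * F x * (b x \<bullet> grad F x) * ?\<eta> x <= \<bar>2 * F x * (b x \<bullet> grad F x)\<bar> * \<bar>?\<eta> x\<bar>" by (metis abs_ge_self abs_mult)
    also have "... <= ((F x)\<^sup>2 + (b x \<bullet> grad F x)\<^sup>2) * 1"
     using eta1[of x] sum_squares_bound[of "\<bar>F x\<bar>" "\<bar>b x \<bullet> grad F x\<bar>"] by (intro mult_mono) (auto simp: abs_mult)
    finally show ?thesis .
   qed
   have "\<bar>b x \<bullet> grad ?\<eta> x\<bar> <= norm (b x) * norm (grad ?\<eta> x)" by (rule Cauchy_Schwarz_ineq2)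
   also have "... <= B * (2 * K)" unfolding g\<eta> using B(1) K(2)[of x] B0 by (intro mult_mono) auto
   finally have 2: "(F x)\<^sup>2 * (b x \<bullet> grad ?\<eta> x) <= (F x)\<^sup>2 * (B * (2 * K))" by (intro mult_left_mono) auto
   have "\<bar>D x * ?\<eta> x\<bar> <= B * 1" unfolding abs_mult using B eta1 B0 by (intro mult_mono) auto
   then have 3: "(F x)\<^sup>2 * (D x * ?\<eta> x) <= (F x)\<^sup>2 * B" by (intro mult_left_mono) auto
   have "0 <= (B * (2 * K) + B) * (b x \<bullet> grad F x)\<^sup>2" using B0 K(1) by simp
   with 1 2 3 have "b x \<bullet> grad ?H x + D x * ?H x <= ?c * ((F x)\<^sup>2 + (b x \<bullet> grad F x)\<^sup>2)" unfolding e by (simp add: distrib_left distrib_right mult_ac)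
   then show "indicator Om x * (b x \<bullet> grad ?H x + D x * ?H x) <= ?c * ((indicator Om x * F x)\<^sup>2 + (indicator Om x * (b x \<bullet> grad F x))\<^sup>2)"
    by (simp add: indicator_def)
  qed (use i2 in simp)
  also have "... = ?c * ((LBINT x. (indicator Om x * F x)\<^sup>2) + (LBINT x. (indicator Om x * (b x \<bullet> grad F x))\<^sup>2))" using i2 by simp
  finally show ?thesis .
 qed
 then show ?thesis using B0 K(1) by (intro exI[of _ ?c]) simp
qed

lemma graph_repI:
 assumes v: "rep Om v v'" "sqz Om v'" and f: "sqz Om f" "adv Om b D v' f"
 shows "v \<in> graph_space Om \<beta>" "rep Om (advection Om \<beta> v) f"
  "(graph_norm Om \<beta> v)\<^sup>2 = (norm_L2 lborel v')\<^sup>2 + (norm_L2 lborel f)\<^sup>2"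
proof -
 have a: "has_advection Om \<beta> v f"
  using has_advection_rep[OF dom_borel repb repD v(1) rep_self[OF f(1)] f(1)] f(2) by blast
 then have a': "has_advection Om \<beta> v (advection Om \<beta> v)" unfolding advection_def by (rule someI[of "has_advection Om \<beta> v"])
 have "AE x in lebesgue_on Om. f x = advection Om \<beta> v x"
  using a a' by (intro loc_integrable_unique[OF op]) (auto simp: has_advection_def)
 then show r: "rep Om (advection Om \<beta> v) f" by (rule rep_cong[OF rep_self[OF f(1)]])
 show "v \<in> graph_space Om \<beta>"
  using a rep_sqint(1)[OF dom_borel v(1)] rep_sqint(1)[OF dom_borel rep_self[OF f(1)]] v(2) f(1) by (auto simp: graph_space_def sqz_def)
 show "(graph_norm Om \<beta> v)\<^sup>2 = (norm_L2 lborel v')\<^sup>2 + (norm_L2 lborel f)\<^sup>2"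
  by (simp add: graph_norm_def rep_sqint(2)[OF dom_borel v(1)] rep_sqint(2)[OF dom_borel r])
qed

lemma graph_rep:
 assumes "v \<in> graph_space Om \<beta>"
 obtains v' f where "rep Om v v'" "sqz Om v'" "sqz Om f" "adv Om b D v' f"
proof -
 obtain h where h: "has_advection Om \<beta> v h" "square_integrable (lebesgue_on Om) h" and v: "square_integrable (lebesgue_on Om) v"
  using assms by (auto simp: graph_space_def)
 obtain v' where v': "rep Om v v'" "sqz Om v'" using rep_sqz_exists[OF dom_borel v] .
 obtain f where f: "rep Om h f" "sqz Om f" using rep_sqz_exists[OF dom_borel h(2)] .
 show ?thesis using that[OF v' f(2)] has_advection_rep[OF dom_borel repb repD v'(1) f] h(1) by blast
qed

text \<open>Density and traces are used with a one-element family of fields, hence the index set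
  \<open>{()}\<close>. Since some trace exists, the chosen one satisfies
  \<open>is_graph_trace\<close>, and its own approximating sequence gives Green's formula and the
  energy identity.\<close>

lemma graph_trace_props:
 assumes v: "rep Om v v'" "sqz Om v'" and f: "sqz Om f" "adv Om b D v' f"
 shows "square_integrable flux (graph_trace Om \<beta> v)" "green v' f (graph_trace Om \<beta> v)"
  "2 * (LBINT x. f x * v' x) + (LBINT x. v' x * (D x * v' x)) = (LINT x|flux. graph_trace Om \<beta> v x * (sgn (bn x) * graph_trace Om \<beta> v x))"
proof -
 have iff: "is_graph_trace Om \<beta> v t \<longleftrightarrow> (EX F. approx {()} (%_. b) flux F v' (%_. f) t)" for t
 proof -
  have key: "(%k. graph_norm Om \<beta> (%x. F k x - v x)) ----> 0 \<longleftrightarrow>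
    (%k. norm_L2 lborel (%x. indicator Om x * F k x - v' x)) ----> 0 &
    (ALL i:{()}. (%k. norm_L2 lborel (%x. indicator Om x * (b x \<bullet> grad (F k) x) - f x)) ----> 0)"
   if "ALL k. C_inf (F k)" for F
  proof (rule norm_null_iff)
   fix k
   have F: "C_inf (F k)" for k using that by blast
   have "rep Om (%x. F k x - v x) (%x. indicator Om x * F k x - v' x)"
    using rep_lin[OF rep_borel[OF dom_sets C_inf_borel[OF F[of k]]] v(1), of 1 "-1"] by simp
   from graph_repI(3)[OF this sqz_diff[OF sqz_drv(1)[OF F] v(2)] sqz_diff[OF sqz_drv(2)[OF F] f(1)] adv_diff_smooth[OF v(2) f F]]
   show "(graph_norm Om \<beta> (%x. F k x - v x))\<^sup>2 = (norm_L2 lborel (%x. indicator Om x * F k x - v' x))\<^sup>2 +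
     (\<Sum>i\<in>{()}. (norm_L2 lborel (%x. indicator Om x * (b x \<bullet> grad (F k) x) - f x))\<^sup>2)" by simp
  qed (simp_all add: graph_norm_def)
  show ?thesis unfolding is_graph_trace_def approx_def by (rule ex_conj_iff[OF key graph_repI(1)[OF v f]])
 qed
 obtain c where c: "c >= 0" "!!F. C_inf F ==> (LINT x|flux. (F x)\<^sup>2) <= c * ((LBINT x. (indicator Om x * F x)\<^sup>2) +
   (\<Sum>m\<in>{()}. \<integral>x. (indicator Om x * (b x \<bullet> grad F x))\<^sup>2 \<partial>lborel))" using flux_energy by auto
 have "EX F t. approx {()} (%_. b) flux F v' (%_. f) t"
  using trace_exists[OF sqint_smooth(1) space_flux c(2,1) _ v(2), of "%_. D" "%_. B" "%_. f"] bfield bLip f by blast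
 then have "is_graph_trace Om \<beta> v (graph_trace Om \<beta> v)" unfolding graph_trace_def iff[symmetric] by (metis someI_ex iff)
 then obtain F where F: "approx {()} (%_. b) flux F v' (%_. f) (graph_trace Om \<beta> v)" using iff by blast
 then show sq: "square_integrable flux (graph_trace Om \<beta> v)" by (simp add: approx_def)
 have l: "!!k. C_inf (F k)" "(%k. norm_L2 lborel (%x. indicator Om x * F k x - v' x)) ----> 0"
   "(%k. norm_L2 lborel (%x. indicator Om x * (b x \<bullet> grad (F k) x) - f x)) ----> 0"
   "(%k. norm_L2 flux (%x. F k x - graph_trace Om \<beta> v x)) ----> 0" using F by (auto simp: approx_def)
 from green_limit[OF v(2) f(1) sq l] show "green v' f (graph_trace Om \<beta> v)"
  "2 * (LBINT x. f x * v' x) + (LBINT x. v' x * (D x * v' x)) = (LINT x|flux. graph_trace Om \<beta> v x * (sgn (bn x) * graph_trace Om \<beta> v x))" .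
qed

end

section \<open>Well-posedness of the transport problem\<close>

context transport
begin

text \<open>The density of the negative part of b.n with respect to |b.n| ds: 1 on the inflow and 0
  on the outflow. The value 1/2 is taken only where b.n = 0, on a null set of that measure.\<close>

definition inflow_weight :: "real ^ 'n => real" where "inflow_weight x = (1 - sgn (bn x)) / 2"

lemma inflow_weight_props [simp]:
 "inflow_weight \<in> borel_measurable flux" "0 <= inflow_weight x" "inflow_weight x <= 1" "\<bar>inflow_weight x\<bar> <= 1"
 by (auto simp: inflow_weight_def[abs_def] sgn_if)

lemma integral_neg_part:
 assumes "h \<in> borel_measurable flux"
 shows "(LINT x|surf. neg_part (bn x) * h x) = (LINT x|flux. inflow_weight x * h x)"
proof -
 have m: "(%x. inflow_weight x * h x) \<in> borel_measurable surf" using assms inflow_weight_props(1) by (simp cong: measurable_cong_sets)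
 show ?thesis unfolding integral_flux[OF m]
  by (rule Bochner_Integration.integral_cong[OF refl]) (simp add: neg_part_def inflow_weight_def sgn_if)
qed

lemma sqint_weight: "square_integrable flux h ==> square_integrable flux (%x. inflow_weight x * h x)"
 by (rule sqint_mult_bounded[where C = 1]) (auto intro: AE_I2)

lemma sqz_zero_order: "sqz Om v ==> sqz Om (%x. (D x / 2 + \<epsilon>) * v x)"
 by (rule sqz_mult_bounded[where C = "B + \<bar>\<epsilon>\<bar>"]) (use bm(2,4) in \<open>auto intro!: order_trans[OF abs_triangle_ineq] add_mono simp: abs_divide\<close>, smt (verit) bm(4))

lemma transport_form_rep:
 assumes v: "rep Om \<gamma> v" "sqz Om v" "sqz Om f" "adv Om b D v f" and w: "rep Om \<omega> w" "sqz Om w" "sqz Om h" "adv Om b D w h"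
 shows "transport_form Om \<beta> (%x. weak_div Om \<beta> x / 2 + \<epsilon>) \<gamma> \<omega> =
  (LBINT x. (f x + (D x / 2 + \<epsilon>) * v x) * w x) + (LINT x|flux. inflow_weight x * (graph_trace Om \<beta> \<gamma> x * graph_trace Om \<beta> \<omega> x))"
proof -
 have m: "(%x. D x / 2 * v x + \<epsilon> * v x) \<in> borel_measurable borel" using bm(2) v(2) sqzD(2) by measurable
 have "rep Om (%x. 1 * advection Om \<beta> \<gamma> x + 1 * ((weak_div Om \<beta> x / 2 + \<epsilon>) * \<gamma> x)) (%x. 1 * f x + 1 * ((D x / 2 + \<epsilon>) * v x))"
  by (rule rep_lin[OF graph_repI(2)[OF v] rep_compose2[OF repD v(1), of "%x p q. (p / 2 + \<epsilon>) * q"]])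
   (use m v(2) in "simp_all add: distrib_right sqzD")
 from rep_lebesgue_on(1)[OF dom_borel rep_mult[OF this w(1)]]
 have "(\<integral>x. (advection Om \<beta> \<gamma> x + (weak_div Om \<beta> x / 2 + \<epsilon>) * \<gamma> x) * \<omega> x \<partial>lebesgue_on Om) = (LBINT x. (f x + (D x / 2 + \<epsilon>) * v x) * w x)" by simp
 moreover have "(%x. graph_trace Om \<beta> \<gamma> x * graph_trace Om \<beta> \<omega> x) \<in> borel_measurable flux"
  using sqint_mult[OF graph_trace_props(1)[OF v] graph_trace_props(1)[OF w]] by simp
 ultimately show ?thesis unfolding transport_form_def by (simp add: integral_neg_part[symmetric] mult.assoc)
qed

text \<open>The difference of the solutions is tested with itself. Its trace is a choice of its own,
  and Green's formula shows that it is the difference of the two traces. The boundary terms of the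
  energy identity and of the form add up to half the integral of t^2 |b.n|; this is nonnegative, so
  \<open>\<epsilon>\<close> times the squared norm in the domain is at most 0.\<close>

lemma transport_unique:
 assumes e: "\<epsilon> > 0" and s: "weak_transport_solution Om \<beta> (%x. weak_div Om \<beta> x / 2 + \<epsilon>) \<gamma>\<^sub>0 \<gamma>1"
  "weak_transport_solution Om \<beta> (%x. weak_div Om \<beta> x / 2 + \<epsilon>) \<gamma>\<^sub>0 \<gamma>2"
 shows "AE x in lebesgue_on Om. \<gamma>1 x = \<gamma>2 x"
proof -
 obtain v1 f1 where 1: "rep Om \<gamma>1 v1" "sqz Om v1" "sqz Om f1" "adv Om b D v1 f1"
  using graph_rep s(1) by (auto simp: weak_transport_solution_def)
 obtain v2 f2 where 2: "rep Om \<gamma>2 v2" "sqz Om v2" "sqz Om f2" "adv Om b D v2 f2"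
  using graph_rep s(2) by (auto simp: weak_transport_solution_def)
 let ?d = "%x. \<gamma>1 x - \<gamma>2 x" and ?v = "%x. v1 x - v2 x" and ?f = "%x. f1 x - f2 x"
 let ?t1 = "graph_trace Om \<beta> \<gamma>1" and ?t2 = "graph_trace Om \<beta> \<gamma>2" and ?t = "graph_trace Om \<beta> (%x. \<gamma>1 x - \<gamma>2 x)"
 have i: "integrable lborel (%x. v x * (b x \<bullet> grad Ph x + D x * Ph x))" if "sqz Om v" "Ph \<in> test_functions Om" for v Ph
  using integrable_green(1)[OF that(1)] that(2) by (simp add: test_functions_iff smooth_csD)
 have d: "rep Om ?d ?v" "sqz Om ?v" "sqz Om ?f" "adv Om b D ?v ?f"
  using rep_lin[OF 1(1) 2(1), of 1 "-1"] adv_lin[OF i[OF 1(2)] i[OF 2(2)] sqzD(1)[OF 1(3)] sqzD(1)[OF 2(3)] 1(4) 2(4), of 1 "-1"]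
  by (simp_all add: sqz_diff 1 2)
 note t1 = graph_trace_props[OF 1] and t2 = graph_trace_props[OF 2] and t = graph_trace_props[OF d]
 have "green ?v ?f (%x. ?t1 x - ?t2 x)"
  using green_lin[OF 1(2,3) t1(1,2) 2(2,3) t2(1,2), of 1 "-1"] by simp
 from green_unique[OF t(1) sqint_diff[OF t1(1) t2(1)] t(2) this]
 have tae: "AE x in flux. ?t x = ?t1 x - ?t2 x" unfolding AE_flux by eventually_elim (auto simp: sgn_zero_iff)
 have "transport_form Om \<beta> (%x. weak_div Om \<beta> x / 2 + \<epsilon>) \<gamma>1 ?d = transport_form Om \<beta> (%x. weak_div Om \<beta> x / 2 + \<epsilon>) \<gamma>2 ?d"
  using s graph_repI(1)[OF d] by (simp add: weak_transport_solution_def)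
 note eq = this[unfolded transport_form_rep[OF 1 d] transport_form_rep[OF 2 d]]
 let ?h = "%f v x. f x + (D x / 2 + \<epsilon>) * v x"
 have hs: "sqz Om (?h f v)" if "sqz Om f" "sqz Om v" for f v
  using sqz_lin[OF that(1) sqz_zero_order[OF that(2)], of 1 1] by simp
 have i1: "integrable lborel (%x. ?h f1 v1 x * ?v x)" and i2: "integrable lborel (%x. ?h f2 v2 x * ?v x)"
  using sqint_mult[OF sqzD(1)[OF hs[OF 1(3,2)]] sqzD(1)[OF d(2)]] sqint_mult[OF sqzD(1)[OF hs[OF 2(3,2)]] sqzD(1)[OF d(2)]] by auto
 have ti: "integrable flux (%x. inflow_weight x * (u x * ?t x))" if "square_integrable flux u" for u
  using sqint_mult[OF sqint_weight[OF that] t(1)] by (simp add: mult.assoc)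
 have E1: "(LBINT x. ?h f1 v1 x * ?v x - ?h f2 v2 x * ?v x) = (LBINT x. ?h ?f ?v x * ?v x)"
  by (rule Bochner_Integration.integral_cong[OF refl]) (simp add: left_diff_distrib right_diff_distrib distrib_left distrib_right)
 have E2: "(LINT x|flux. inflow_weight x * (?t1 x * ?t x) - inflow_weight x * (?t2 x * ?t x)) = (LINT x|flux. inflow_weight x * (?t x * ?t x))"
 proof (rule integral_cong_AE)
  show "AE x in flux. inflow_weight x * (?t1 x * ?t x) - inflow_weight x * (?t2 x * ?t x) = inflow_weight x * (?t x * ?t x)"
   using tae by eventually_elim (simp add: left_diff_distrib right_diff_distrib distrib_left)
 qed (use ti[OF t1(1)] ti[OF t2(1)] ti[OF t(1)] in auto)
 have z: "(LBINT x. ?h ?f ?v x * ?v x) + (LINT x|flux. inflow_weight x * (?t x * ?t x)) = 0"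
  using eq unfolding E1[symmetric] E2[symmetric] by (simp add: i1 i2 ti[OF t1(1)] ti[OF t2(1)])
 have vv: "integrable lborel (%x. ?f x * ?v x)" "integrable lborel (%x. ?v x * (D x * ?v x))" "integrable lborel (%x. (?v x)\<^sup>2)"
  using sqint_mult[OF sqzD(1)[OF d(3)] sqzD(1)[OF d(2)]] sqint_mult[OF sqzD(1)[OF d(2)] sqzD(1)[OF sqz_mult_bounded[OF d(2) bm(2) bm(4)]]]
   sqzD(1)[OF d(2)] by (auto simp: square_integrable_def)
 have "(LBINT x. ?h ?f ?v x * ?v x) = (LBINT x. ?f x * ?v x + (1 / 2 * (?v x * (D x * ?v x)) + \<epsilon> * (?v x)\<^sup>2))"
  by (rule Bochner_Integration.integral_cong[OF refl]) (simp add: power2_eq_square field_simps)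
 also have "... = (LBINT x. ?f x * ?v x) + (1 / 2 * (LBINT x. ?v x * (D x * ?v x)) + \<epsilon> * (LBINT x. (?v x)\<^sup>2))"
  using vv by (simp del: integral_divide_zero)
 finally have "1 / 2 * (LINT x|flux. ?t x * (sgn (bn x) * ?t x)) + (LINT x|flux. inflow_weight x * (?t x * ?t x)) + \<epsilon> * (LBINT x. (?v x)\<^sup>2) = 0"
  using z t(3) by linarith
 moreover have "1 / 2 * (LINT x|flux. ?t x * (sgn (bn x) * ?t x)) + (LINT x|flux. inflow_weight x * (?t x * ?t x)) = (LINT x|flux. 1 / 2 * (?t x)\<^sup>2)"
 proof -
  have st: "integrable flux (%x. ?t x * (sgn (bn x) * ?t x))"
   by (rule sqint_mult[OF t(1) sqint_mult_bounded[OF t(1) sN(1) AE_I2[OF sN(2)]]])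
  have "1 / 2 * (LINT x|flux. ?t x * (sgn (bn x) * ?t x)) + (LINT x|flux. inflow_weight x * (?t x * ?t x)) =
    (LINT x|flux. 1 / 2 * (?t x * (sgn (bn x) * ?t x)) + inflow_weight x * (?t x * ?t x))"
   using st ti[OF t(1)] by (simp del: integral_divide_zero)
  \<comment> \<open>Pointwise this is sgn / 2 + (1 - sgn) / 2 = 1/2.\<close>
  also have "... = (LINT x|flux. 1 / 2 * (?t x)\<^sup>2)"
   by (rule Bochner_Integration.integral_cong[OF refl]) (simp add: inflow_weight_def power2_eq_square field_simps)
  finally show ?thesis .
 qed
 moreover have "0 <= (LINT x|flux. 1 / 2 * (?t x)\<^sup>2)" by (rule Bochner_Integration.integral_nonneg) simp
 ultimately have "\<epsilon> * (LBINT x. (?v x)\<^sup>2) <= 0" by linarith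
 then have "(LBINT x. (?v x)\<^sup>2) <= 0" using e mult_pos_pos[of \<epsilon> "\<integral>x. (?v x)\<^sup>2 \<partial>lborel"] by linarith
 then have "norm_L2 lborel ?v = 0" unfolding norm_L2_def by (simp add: antisym)
 from norm_L2_eq_0_AE[OF sqzD(1)[OF d(2)] this] have "AE x in lborel. v1 x = v2 x" by eventually_elim simp
 then show ?thesis by (rule rep_unique[OF dom_borel 1(1) 2(1)])
qed

lemma transport_exists:
 assumes e: "\<epsilon> > 0" and \<gamma>0: "square_integrable flux \<gamma>\<^sub>0"
 shows "\<exists>\<gamma>. weak_transport_solution Om \<beta> (%x. weak_div Om \<beta> x / 2 + \<epsilon>) \<gamma>\<^sub>0 \<gamma>"
proof -
 \<comment> \<open>The formal adjoint - b.grad w + (mu - D) w, with mu = D / 2 +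
   \<open>\<epsilon>\<close>.\<close>
 define A where "A w x = indicator Om x * (\<epsilon> * w x - b x \<bullet> grad w x - D x / 2 * w x)" for w x
 define l where "l w = (LINT x|flux. w x * (inflow_weight x * \<gamma>\<^sub>0 x))" for w
 \<comment> \<open>Vanishing on the outflow is asked for almost everywhere with respect to |b.n| ds,
   because this is all that is known about the cut-off \<open>\<xi>\<close>, whose products with
   smooth functions have to belong to \<open>W\<close>.\<close>
 define W where "W = {w. C_inf w & (AE x in flux. 0 < bn x --> w x = 0)}"
 have \<gamma>w: "square_integrable flux (%x. inflow_weight x * \<gamma>\<^sub>0 x)" by (rule sqint_weight[OF \<gamma>0])
 have bn0: "AE x in flux. bn x ~= 0" by (simp add: AE_flux)
 have A: "A w = (%x. (1 * (\<epsilon> * (indicator Om x * w x) + 1 / 2 * (D x * (indicator Om x * w x))) + - 1 * (indicator Om x * (b x \<bullet> grad w x + D x * w x))))" for w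
  by (simp add: fun_eq_iff A_def indicator_def algebra_simps)
 have Asq: "sqz Om (A w)" if "C_inf w" for w
  unfolding A by (intro sqz_lin sqz_mult_bounded[OF _ bm(2) bm(4)] sqz_drv that)
 have gl: "grad (%x. p * w x + q * w' x) x = p *\<^sub>R grad w x + q *\<^sub>R grad w' x" if "C_inf w" "C_inf w'" for p q w w' x
  using that by (simp add: vec_eq_iff C_inf_mult C_inf_const)
 \<comment> \<open>The adjoint operator is coercive on smooth functions vanishing at the outflow boundary.\<close>
 have bound: "\<bar>l w\<bar> <= (norm_L2 flux (%x. inflow_weight x * \<gamma>\<^sub>0 x) / sqrt (2 * \<epsilon>)) * norm_L2 lborel (A w)" if "w \<in> W" for w
 proof -
  have w: "C_inf w" "AE x in flux. 0 < bn x --> w x = 0" using that by (auto simp: W_def)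
  let ?u = "%x. indicator Om x * w x"
  have half: "1 / 2 * (2 * p + q) = p + 1 / 2 * q" for p q :: real by simp
  have us: "sqz Om ?u" and wt: "square_integrable flux w" by (rule sqz_drv[OF w(1)], rule sqint_smooth[OF w(1)])
  have Du: "sqz Om (%x. D x * ?u x)" by (rule sqz_mult_bounded[OF us bm(2) bm(4)])
  have "2 * (LBINT x. indicator Om x * (b x \<bullet> grad w x) * ?u x) + (LBINT x. ?u x * (D x * ?u x)) = (LINT x|flux. w x * (sgn (bn x) * w x))"
   using green_limit(2)[OF us sqz_drv(2)[OF w(1)] wt w(1)] by (simp add: norm_L2_def)
  moreover have "(LINT x|flux. w x * (sgn (bn x) * w x)) = (LINT x|flux. - (w x)\<^sup>2)"
  proof (rule integral_cong_AE)
   show "AE x in flux. w x * (sgn (bn x) * w x) = - (w x)\<^sup>2"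
    using w(2) bn0 by eventually_elim (auto simp: sgn_if power2_eq_square)
  qed (use wt sN(1) in "auto simp: square_integrable_def")
  moreover have "(LINT x|flux. - (w x)\<^sup>2) = - (norm_L2 flux w)\<^sup>2" by (simp add: norm_L2_sq)
  moreover have "(LBINT x. A w x * ?u x) = \<epsilon> * (norm_L2 lborel ?u)\<^sup>2 - 1 / 2 * (2 * (LBINT x. indicator Om x * (b x \<bullet> grad w x) * ?u x) + (LBINT x. ?u x * (D x * ?u x)))"
  proof -
   have i: "integrable lborel (%x. (?u x)\<^sup>2)" "integrable lborel (%x. indicator Om x * (b x \<bullet> grad w x) * ?u x)" "integrable lborel (%x. ?u x * (D x * ?u x))"
    using sqzD(1)[OF us] sqint_mult[OF sqzD(1)[OF sqz_drv(2)[OF w(1)]] sqzD(1)[OF us]] sqint_mult[OF sqzD(1)[OF us] sqzD(1)[OF Du]]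
    by (auto simp: square_integrable_def)
   have "(LBINT x. A w x * ?u x) = (LBINT x. \<epsilon> * (?u x)\<^sup>2 - (indicator Om x * (b x \<bullet> grad w x) * ?u x + 1 / 2 * (?u x * (D x * ?u x))))"
    by (rule Bochner_Integration.integral_cong[OF refl]) (simp add: A_def indicator_def power2_eq_square algebra_simps)
   also have "... = \<epsilon> * (LBINT x. (?u x)\<^sup>2) - ((LBINT x. indicator Om x * (b x \<bullet> grad w x) * ?u x) + 1 / 2 * (LBINT x. ?u x * (D x * ?u x)))"
    using i by (simp del: integral_divide_zero)
   finally show ?thesis unfolding norm_L2_sq half .
  qed
  moreover have "(LBINT x. A w x * ?u x) <= norm_L2 lborel (A w) * norm_L2 lborel ?u"
   by (rule order_trans[OF abs_ge_self Cauchy_Schwarz_L2[OF sqzD(1)[OF Asq[OF w(1)]] sqzD(1)[OF us]]])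
  moreover have "E <= q ==> X + Y = Z ==> Z = Z' ==> Z' = - n ==> E = p - 1 / 2 * (X + Y) ==> p + n / 2 <= q" for E X Y Z Z' n p q :: real by simp
  ultimately have en: "\<epsilon> * (norm_L2 lborel ?u)\<^sup>2 + (norm_L2 flux w)\<^sup>2 / 2 <= norm_L2 lborel (A w) * norm_L2 lborel ?u" by blast
  \<comment> \<open>The norm of w in the domain is absorbed by \<open>\<epsilon>\<close> times its
    square; what is left controls the boundary norm with the factor 1 / sqrt (2
    \<open>\<epsilon>\<close>).\<close>
  have young: "a * r - \<epsilon> * r\<^sup>2 <= a\<^sup>2 / (4 * \<epsilon>)" for a r :: real
  proof -
   have "0 <= (a - 2 * \<epsilon> * r)\<^sup>2" by simp
   then show ?thesis using e by (simp add: field_simps power2_eq_square)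
  qed
  have "(norm_L2 flux w)\<^sup>2 <= 2 * ((norm_L2 lborel (A w))\<^sup>2 / (4 * \<epsilon>))" using en young[of "norm_L2 lborel (A w)" "norm_L2 lborel ?u"] by linarith
  also have "... = (norm_L2 lborel (A w) / sqrt (2 * \<epsilon>))\<^sup>2" using e by (simp add: power_divide)
  finally have nw: "norm_L2 flux w <= norm_L2 lborel (A w) / sqrt (2 * \<epsilon>)" by (rule power2_le_imp_le) (use e in simp)
  have "\<bar>l w\<bar> <= norm_L2 flux w * norm_L2 flux (%x. inflow_weight x * \<gamma>\<^sub>0 x)" unfolding l_def by (rule Cauchy_Schwarz_L2[OF wt \<gamma>w])
  also have "... <= (norm_L2 lborel (A w) / sqrt (2 * \<epsilon>)) * norm_L2 flux (%x. inflow_weight x * \<gamma>\<^sub>0 x)" using nw by (intro mult_right_mono) simp_all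
  finally show ?thesis by (simp add: mult.commute)
 qed
 \<comment> \<open>The functional lives on the range of \<open>A\<close> and is given by its graph;
   that equal values of \<open>A\<close> carry equal values of \<open>l\<close> follows from
   linearity and \<open>bound\<close>.\<close>
 let ?P = "{(A w, l w) | w. w \<in> W}"
 obtain \<gamma>' where \<gamma>': "square_integrable lborel \<gamma>'" "!!h c. (h, c) \<in> ?P ==> (LBINT x. \<gamma>' x * h x) = c"
 proof (rule Riesz_L2)
  have "(%x. 0) \<in> W" by (simp add: W_def C_inf_const)
  then show "(A (%x. 0), l (%x. 0)) \<in> ?P" by blast
  show "square_integrable lborel h" if "(h, c) \<in> ?P" for h c using that Asq sqzD(1) by (auto simp: W_def)
  show "\<bar>c\<bar> <= (norm_L2 flux (%x. inflow_weight x * \<gamma>\<^sub>0 x) / sqrt (2 * \<epsilon>)) * norm_L2 lborel h" if "(h, c) \<in> ?P" for h c using that bound by blast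
  show "(%x. p * h x + q * h' x, p * c + q * c') \<in> ?P" if "(h, c) \<in> ?P" "(h', c') \<in> ?P" for h c h' c' p q
  proof -
   obtain w w' where w: "w \<in> W" "h = A w" "c = l w" "w' \<in> W" "h' = A w'" "c' = l w'" using \<open>(h, c) \<in> ?P\<close> \<open>(h', c') \<in> ?P\<close> by blast
   then have C: "C_inf w" "C_inf w'" by (simp_all add: W_def)
   have "AE x in flux. 0 < bn x --> w x = 0" "AE x in flux. 0 < bn x --> w' x = 0" using w by (simp_all add: W_def)
   then have "AE x in flux. 0 < bn x --> p * w x + q * w' x = 0" by eventually_elim simp
   then have "(%x. p * w x + q * w' x) \<in> W" using C by (simp add: W_def C_inf_add C_inf_mult C_inf_const)
   moreover have "A (%x. p * w x + q * w' x) = (%x. p * h x + q * h' x)"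
    unfolding w A_def[abs_def] gl[OF C] by (simp add: fun_eq_iff inner_add_right algebra_simps)
   moreover have "l (%x. p * w x + q * w' x) = p * c + q * c'"
    using sqint_mult[OF sqint_smooth(1)[OF C(1)] \<gamma>w] sqint_mult[OF sqint_smooth(1)[OF C(2)] \<gamma>w] unfolding w l_def by (simp add: distrib_right mult.assoc)
   ultimately show ?thesis by (intro CollectI exI[of _ "%x. p * w x + q * w' x"]) simp
  qed
 qed (rule that)
 \<comment> \<open>The representing function lives on the whole space. Cutting it off outside the
   domain leaves its integrals against \<open>A w\<close> unchanged, as \<open>A w\<close> vanishes
   there.\<close>
 define v where "v x = indicator Om x * \<gamma>' x" for x
 \<comment> \<open>The equation solved for b.grad v. The summand with factor 0 only gives the term
   the form of a linear combination as in \<open>sqz_lin\<close>.\<close>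
 define f where "f x = - 1 * ((D x / 2 + \<epsilon>) * v x) + 0 * v x" for x
 have vs: "sqz Om v" using sqint_mult_bounded[OF \<gamma>'(1), of "indicator Om" 1] by (simp add: sqz_def v_def[abs_def])
 have fs: "sqz Om f" unfolding f_def[abs_def] by (intro sqz_lin sqz_zero_order vs)
 have vA: "(LBINT x. v x * (b x \<bullet> grad w x + D x * w x)) + (LBINT x. f x * w x) = - (LBINT x. \<gamma>' x * A w x)" if w: "C_inf w" for w
 proof -
  have "(LBINT x. v x * (b x \<bullet> grad w x + D x * w x)) + (LBINT x. f x * w x) = (LBINT x. v x * (b x \<bullet> grad w x + D x * w x) + f x * w x)"
   using integrable_green(1)[OF vs w] integrable_green(2)[OF fs w] by simp
  also have "... = (LBINT x. - (\<gamma>' x * A w x))"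
   by (rule Bochner_Integration.integral_cong[OF refl]) (simp add: v_def f_def A_def indicator_def algebra_simps)
  finally show ?thesis by simp
 qed
 have lA: "(LBINT x. \<gamma>' x * A w x) = l w" if "w \<in> W" for w using \<gamma>'(2) that by blast
 have adv: "adv Om b D v f"
  unfolding adv_def
 proof
  fix Ph assume Ph: "Ph \<in> test_functions Om"
  then have C: "C_inf Ph" "closure {x. Ph x ~= 0} \<subseteq> Om" by (simp_all add: test_functions_iff smooth_csD)
  have z: "Ph x = 0" if "x \<in> space flux" for x
   using that C(2) closure_subset[of "{x. Ph x ~= 0}"] op by (auto simp: space_flux frontier_def interior_open)
  then have "Ph \<in> W" using C(1) by (auto simp: W_def intro: AE_I2)
  moreover have "l Ph = (LINT x|flux. 0)" unfolding l_def by (rule Bochner_Integration.integral_cong[OF refl]) (simp add: z)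
  ultimately show "(LBINT x. f x * Ph x) = - (LBINT x. v x * (b x \<bullet> grad Ph x + D x * Ph x))" using vA[OF C(1)] lA by simp
 qed
 note v = rep_self[OF vs] vs fs adv
 let ?t = "graph_trace Om \<beta> v"
 note t = graph_trace_props(1,2)[OF v]
 have inflow: "AE x in flux. inflow_weight x * (?t x - \<gamma>\<^sub>0 x) = 0"
 proof (rule smooth_dense_boundary)
  have np: "square_integrable flux (%x. inflow_weight x * (?t x - \<gamma>\<^sub>0 x))" by (intro sqint_weight sqint_diff t(1) \<gamma>0)
  then show "(%x. inflow_weight x * (?t x - \<gamma>\<^sub>0 x)) \<in> borel_measurable flux" by (simp add: square_integrable_def)
  show "integrable flux (%x. inflow_weight x * (?t x - \<gamma>\<^sub>0 x))" using sqint_mult[OF np sqint_smooth(1)[OF C_inf_const[of 1]]] by simp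
  fix Ps :: "real ^ 'n => real" assume "smooth_cs Ps"
  then have C: "C_inf (%x. \<xi> x * Ps x)" "C_inf Ps" by (simp_all add: smooth_csD C_inf_mult \<xi>)
  have sep: "AE x in flux. \<bar>bn x\<bar> = bn x * (1 - 2 * \<xi> x)" unfolding AE_flux using separates by eventually_elim simp
  \<comment> \<open>Wherever the flux is not 0, the cut-off coincides with the inflow weight. So
    \<open>\<xi> x * Ps x\<close> is an admissible test function for every smooth \<open>Ps\<close>
    and agrees with \<open>Ps\<close> on the inflow boundary.\<close>
  have xi: "AE x in flux. \<xi> x = inflow_weight x" using sep bn0
  proof eventually_elim
   case (elim x)
   then have "bn x * sgn (bn x) = bn x * (1 - 2 * \<xi> x)" by (simp only: abs_sgn)
   then have "sgn (bn x) = 1 - 2 * \<xi> x" using elim(2) by simp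
   then show ?case by (simp add: inflow_weight_def)
  qed
  have "AE x in flux. 0 < bn x --> \<xi> x * Ps x = 0" using xi by eventually_elim (auto simp: inflow_weight_def)
  then have "(%x. \<xi> x * Ps x) \<in> W" using C by (simp add: W_def)
  then have eq: "(LINT x|flux. ?t x * (sgn (bn x) * (\<xi> x * Ps x))) = - (LINT x|flux. (\<xi> x * Ps x) * (inflow_weight x * \<gamma>\<^sub>0 x))"
   using t(2) vA[OF C(1)] lA C(1) by (simp add: green_def l_def)
  have i: "integrable flux (%x. ?t x * (sgn (bn x) * (\<xi> x * Ps x)))" "integrable flux (%x. (\<xi> x * Ps x) * (inflow_weight x * \<gamma>\<^sub>0 x))"
   by (rule sqint_mult[OF t(1) sqint_smooth(2)[OF C(1)]], rule sqint_mult[OF sqint_smooth(1)[OF C(1)] \<gamma>w])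
  have "(LINT x|flux. inflow_weight x * (?t x - \<gamma>\<^sub>0 x) * Ps x) = (LINT x|flux. - (?t x * (sgn (bn x) * (\<xi> x * Ps x))) - (\<xi> x * Ps x) * (inflow_weight x * \<gamma>\<^sub>0 x))"
  proof (rule integral_cong_AE)
   show "AE x in flux. inflow_weight x * (?t x - \<gamma>\<^sub>0 x) * Ps x = - (?t x * (sgn (bn x) * (\<xi> x * Ps x))) - (\<xi> x * Ps x) * (inflow_weight x * \<gamma>\<^sub>0 x)"
    using xi bn0 by eventually_elim (auto simp: inflow_weight_def sgn_if field_simps)
   show "(%x. inflow_weight x * (?t x - \<gamma>\<^sub>0 x) * Ps x) \<in> borel_measurable flux" using sqint_mult[OF np sqint_smooth(1)[OF C(2)]] by simp
  qed (use i in auto)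
  also have "... = 0" using i eq by simp
  finally show "(LINT x|flux. inflow_weight x * (?t x - \<gamma>\<^sub>0 x) * Ps x) = 0" .
 qed
 have "weak_transport_solution Om \<beta> (%x. weak_div Om \<beta> x / 2 + \<epsilon>) \<gamma>\<^sub>0 v"
  unfolding weak_transport_solution_def
 proof (intro conjI ballI graph_repI(1)[OF v])
  fix w assume "w \<in> graph_space Om \<beta>"
  then obtain w' h where w: "rep Om w w'" "sqz Om w'" "sqz Om h" "adv Om b D w' h" by (rule graph_rep)
  note tw = graph_trace_props(1)[OF w]
  have m: "(%x. \<gamma>\<^sub>0 x * graph_trace Om \<beta> w x) \<in> borel_measurable flux" using sqint_mult[OF \<gamma>0 tw] by simp
  have "transport_form Om \<beta> (%x. weak_div Om \<beta> x / 2 + \<epsilon>) v w = (LINT x|flux. inflow_weight x * (?t x * graph_trace Om \<beta> w x))"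
   unfolding transport_form_rep[OF v w] by (simp add: f_def)
  also have "... = (LINT x|flux. inflow_weight x * (\<gamma>\<^sub>0 x * graph_trace Om \<beta> w x))"
  proof (rule integral_cong_AE)
   show "AE x in flux. inflow_weight x * (?t x * graph_trace Om \<beta> w x) = inflow_weight x * (\<gamma>\<^sub>0 x * graph_trace Om \<beta> w x)"
    using inflow by eventually_elim (auto simp: algebra_simps)
  qed (use t(1) tw \<gamma>0 in "auto simp: square_integrable_def intro!: borel_measurable_times")
  also have "... = (LINT x|surf. neg_part (bn x) * \<gamma>\<^sub>0 x * graph_trace Om \<beta> w x)"
   by (simp add: integral_neg_part[OF m, symmetric] mult.assoc)
  finally show "transport_form Om \<beta> (%x. weak_div Om \<beta> x / 2 + \<epsilon>) v w = (LINT x|surf. neg_part (bn x) * \<gamma>\<^sub>0 x * graph_trace Om \<beta> w x)" .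
 qed
 then show ?thesis by blast
qed

end

section \<open>Regularity of the data\<close>

text \<open>The list \<open>is @ [i]\<close> enumerates the multi-index of \<open>i # is\<close>, so
  that both weak derivatives are tested with the same partial derivatives of \<open>Ph\<close> and a
  single sign remains.\<close>

lemma wder_rep:
 assumes op: "open Om" and h: "has_weak_deriv Om (count_list is) u p0" "has_weak_deriv Om (count_list (i # is)) u q0"
  and r: "rep Om p0 p" "rep Om q0 q"
 shows "wder Om i p q"
 unfolding wder_iff
proof
 fix Ph assume Ph: "Ph \<in> test_functions Om"
 have Ob: "Om \<in> sets borel" using op by simp
 have m: "Ph \<in> borel_measurable borel" "pd i Ph \<in> borel_measurable borel"
  using Ph test_functions_pd[OF Ph, of i] by (auto simp: test_functions_iff smooth_cs_measurable)
 let ?s = "(- 1 :: real) ^ length is"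
 have "(\<integral>x. u x * partials (is @ [i]) Ph x \<partial>lebesgue_on Om) = - ?s * (LBINT x. q x * Ph x)"
  using h(2)[unfolded has_weak_deriv_def] Ph rep_lebesgue_on(1)[OF Ob rep_mult_borel[OF r(2) m(1)]] by (simp add: mi_order_count)
 moreover have "(\<integral>x. u x * partials is (pd i Ph) x \<partial>lebesgue_on Om) = ?s * (LBINT x. p x * pd i Ph x)"
  using h(1)[unfolded has_weak_deriv_def] test_functions_pd[OF Ph, of i] rep_lebesgue_on(1)[OF Ob rep_mult_borel[OF r(1) m(2)]] by (simp add: mi_order_count)
 ultimately have "?s * (LBINT x. p x * pd i Ph x) = ?s * - (LBINT x. q x * Ph x)" by (simp add: partials_snoc)
 then show "(LBINT x. q x * Ph x) = - (LBINT x. p x * pd i Ph x)" by (simp only: mult_cancel_left) simp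
qed

lemma mi_unit_eq: "mi_unit i = count_list [i]"
 by (auto simp: fun_eq_iff mi_unit_def)

lemma weak_deriv_sqint:
 assumes "open Om" "has_weak_deriv Om (count_list is) u v" "square_integrable (lebesgue_on Om) v"
 shows "has_weak_deriv Om (count_list is) u (weak_deriv Om (count_list is) u)" "square_integrable (lebesgue_on Om) (weak_deriv Om (count_list is) u)"
proof -
 show h: "has_weak_deriv Om (count_list is) u (weak_deriv Om (count_list is) u)"
  unfolding weak_deriv_def by (rule someI[of "has_weak_deriv Om (count_list is) u", OF assms(2)])
 show "square_integrable (lebesgue_on Om) (weak_deriv Om (count_list is) u)"
  by (rule sqint_cong_AE[OF assms(3)])
   (use weak_deriv_eq[OF assms(1,2)] loc_integrable_measurable[OF assms(1)] h in "auto simp: has_weak_deriv_def elim: eventually_mono")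
qed

lemma rep_imp_sqz: "Om \<in> sets borel ==> rep Om F G ==> square_integrable (lebesgue_on Om) F ==> sqz Om G"
 using rep_sqint(1)[of Om F G] by (auto simp: sqz_def rep_def)

lemma W_inf_sqint:
 assumes op: "open Om" "bounded Om" and u: "u \<in> sobolev_W_inf k Om" and l: "length is <= k"
 shows "EX v. has_weak_deriv Om (count_list is) u v & square_integrable (lebesgue_on Om) v"
proof -
 let ?v = "weak_deriv Om (count_list is) u"
 have "EX v. has_weak_deriv Om (count_list is) u v" using u l by (simp add: sobolev_W_inf_def mi_order_count)
 then obtain v where v: "has_weak_deriv Om (count_list is) u v" ..
 have h: "has_weak_deriv Om (count_list is) u ?v"
  unfolding weak_deriv_def by (rule someI[of "has_weak_deriv Om (count_list is) u", OF v])
 then have m: "?v \<in> borel_measurable (lebesgue_on Om)" using loc_integrable_measurable[OF op(1)] by (auto simp: has_weak_deriv_def)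
 let ?E = "esssup (lebesgue_on Om) (%x. ereal \<bar>?v x\<bar>)"
 have "?E <= norm_W_inf k Om u" unfolding norm_W_inf_def by (rule SUP_upper) (use l in "simp add: mi_order_count")
 also have "... < \<infinity>" using u by (simp add: sobolev_W_inf_def)
 finally have "?E < \<infinity>" .
 then obtain K :: real where K: "?E <= ereal K" by (cases ?E) auto
 have "AE x in lebesgue_on Om. ereal \<bar>?v x\<bar> <= ?E" by (rule esssup_AE)
 then have "AE x in lebesgue_on Om. \<bar>?v x\<bar> <= K"
 proof eventually_elim
  case (elim x)
  from order_trans[OF elim K] show ?case by simp
 qed
 moreover have "finite_measure (lebesgue_on Om)"
 proof (rule finite_measureI)
  have "emeasure (lebesgue_on Om) (space (lebesgue_on Om)) = emeasure lborel Om"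
   using op(1) by (simp add: emeasure_restrict_space space_restrict_space)
  then show "emeasure (lebesgue_on Om) (space (lebesgue_on Om)) ~= \<infinity>" using emeasure_bounded_finite[OF op(2)] by simp
 qed
 ultimately show ?thesis using sqint_bounded_fun[OF _ m] h by blast
qed

lemma (in smooth_domain) sobolev_rep:
 assumes n: "CARD('a) <= 3" and U: "U \<in> sobolev_H 5 Om"
 obtains w K where "!!is. length is <= 2 ==> rep Om (weak_deriv Om (count_list is) U) (w is)" "!!is. length is <= 2 ==> sqz Om (w is)"
  "!!is i. length is <= 1 ==> wder Om i (w is) (w (i # is))" "0 <= K" "!!is x. \<bar>w is x\<bar> <= K"
proof -
 have ex: "EX v. has_weak_deriv Om (count_list is) U v & square_integrable (lebesgue_on Om) v" if "length is <= 5" for "is"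
  using U that by (simp add: sobolev_H_def mi_order_count)
 then have W: "has_weak_deriv Om (count_list is) U (weak_deriv Om (count_list is) U)" "square_integrable (lebesgue_on Om) (weak_deriv Om (count_list is) U)"
  if "length is <= 5" for "is" using weak_deriv_sqint[OF open_dom] that by blast+
 have "EX p. length is <= 5 --> rep Om (weak_deriv Om (count_list is) U) p" for "is"
  using rep_sqz_exists[OF dom_sets W(2)] by metis
 then obtain p where p: "!!is. length is <= 5 ==> rep Om (weak_deriv Om (count_list is) U) (p is)" by metis
 have pz: "sqz Om (p is)" if "length is <= 5" for "is" by (rule rep_imp_sqz[OF dom_sets p[OF that] W(2)[OF that]])
 \<comment> \<open>The embedding consumes two orders beyond those of \<open>js\<close>, at most four
   in all of the five available.\<close>
 have "EX K. AE x in lborel. \<bar>p js x\<bar> <= K" if js: "length js <= 2" for js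
 proof -
  have "deriv_tower Om 2 (%is. p (is @ js))"
   unfolding deriv_tower_def using js by (auto intro!: pz wder_rep[OF open_dom W(1) W(1) p p])
  from Sobolev_bounded[OF n this] show ?thesis by simp
 qed
 then obtain K where K: "!!js. length js <= 2 ==> AE x in lborel. \<bar>p js x\<bar> <= K js" by metis
 let ?J = "{js :: 'a list. set js \<subseteq> UNIV & length js <= 2}"
 define M where "M = (\<Sum>js\<in>?J. \<bar>K js\<bar>)"
 have M0: "0 <= M" by (simp add: M_def)
 have KM: "K js <= M" if "length js <= 2" for js
  using member_le_sum[of js ?J "%js. \<bar>K js\<bar>"] finite_lists_length_le[of "UNIV :: 'a set" 2] that by (simp add: M_def)
 \<comment> \<open>Clipping at \<open>M\<close> changes the derivatives up to second order on null
   sets only and makes the bound hold at every point, as \<open>bounded_field\<close>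
   demands.\<close>
 define w where "w is x = max (- M) (min M (p is x))" for "is" x
 have r: "rep Om (weak_deriv Om (count_list is) U) (w is)" if l: "length is <= 2" for "is"
 proof (rule rep_cong_right[OF dom_sets p])
  show "AE x in lborel. p is x = w is x" using K[OF l] by eventually_elim (use KM[OF l] in "simp add: w_def")
  show "w is \<in> borel_measurable borel" unfolding w_def[abs_def] using sqzD(2)[OF pz[of "is"]] l by simp
  show "w is x = 0" if "x \<notin> Om" for x using sqzD(3)[OF pz[of "is"] that] l M0 by (simp add: w_def)
 qed (use l in simp)
 show ?thesis
 proof (rule that[of w M])
  show "sqz Om (w is)" if "length is <= 2" for "is" by (rule rep_imp_sqz[OF dom_sets r[OF that] W(2)]) (use that in simp)
  show "wder Om i (w is) (w (i # is))" if "length is <= 1" for "is" i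
   by (rule wder_rep[OF open_dom W(1) W(1) r r]) (use that in auto)
  show "\<bar>w is x\<bar> <= M" for "is" x using M0 by (auto simp: w_def abs_le_iff)
 qed (use r M0 in auto)
qed

text \<open>The distance is infinite if one of the sets is empty; choosing a finite d below it first
  avoids a case distinction. No point is closer than d/2 to both sets, so their closures are
  disjoint.\<close>

lemma separated_cutoff:
 fixes g :: "real ^ 'n::finite => real"
 assumes "bounded Om" and sep: "inf_dist_sets (inflow Om g) (outflow Om g) > 0"
 obtains \<xi> where "smooth_cs \<xi>" "!!x. 0 <= \<xi> x" "!!x. \<xi> x <= 1" "!!x. x \<in> inflow Om g ==> \<xi> x = 1" "!!x. x \<in> outflow Om g ==> \<xi> x = 0"
proof -
 obtain d where d: "d > 0" "ereal d < inf_dist_sets (inflow Om g) (outflow Om g)" using ereal_dense2[OF sep] by (metis ereal_less(2) less_ereal.simps(1))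
 have dd: "d <= dist x y" if "x \<in> inflow Om g" "y \<in> outflow Om g" for x y
 proof -
  have "inf_dist_sets (inflow Om g) (outflow Om g) <= ereal (dist x y)"
   unfolding inf_dist_sets_def using that by (intro INF_lower2[of "(x, y)"]) auto
  from less_le_trans[OF d(2) this] show ?thesis by simp
 qed
 have "inflow Om g \<subseteq> closure Om" by (auto simp: inflow_def frontier_def)
 then have "bounded (inflow Om g)" using bounded_subset[OF bounded_closure[OF assms(1)]] by blast
 then have K: "compact (closure (inflow Om g))" by simp
 have "closure (inflow Om g) \<subseteq> - closure (outflow Om g)"
 proof
  fix x assume x: "x \<in> closure (inflow Om g)"
  have "x \<notin> closure (outflow Om g)"
  proof
   assume x': "x \<in> closure (outflow Om g)"
   obtain a where a: "a \<in> inflow Om g" "dist a x < d / 2" using x d(1) by (meson closure_approachable half_gt_zero)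
   obtain c where c: "c \<in> outflow Om g" "dist c x < d / 2" using x' d(1) by (meson closure_approachable half_gt_zero)
   have "dist a c <= dist a x + dist c x" by (rule dist_triangle2)
   then show False using dd[OF a(1) c(1)] a c by linarith
  qed
  then show "x \<in> - closure (outflow Om g)" by simp
 qed
 from smooth_Urysohn[OF K open_Compl[OF closed_closure] this] obtain \<xi> where
  \<xi>: "smooth_cs \<xi>" "!!x. 0 <= \<xi> x" "!!x. \<xi> x <= 1" "!!x. x \<in> closure (inflow Om g) ==> \<xi> x = 1" "closure {x. \<xi> x ~= 0} \<subseteq> - closure (outflow Om g)"
  by metis
 have "\<xi> x = 0" if "x \<in> outflow Om g" for x
  using \<xi>(5) closure_subset[of "outflow Om g"] closure_subset[of "{x. \<xi> x ~= 0}"] that by blast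
 moreover have "\<xi> x = 1" if "x \<in> inflow Om g" for x using \<xi>(4) closure_subset that by blast
 ultimately show ?thesis using that[OF \<xi>(1,2,3)] by blast
qed

text \<open>In the collar of width \<open>\<eta>\<close> the coefficient agrees with
  \<open>\<sigma>0\<close>, which inherits the lower bound \<open>k1\<close> there; lower bounds
  near the boundary pass to traces.\<close>

lemma (in smooth_domain) sigma_trace:
 assumes "\<eta> > 0" and s0: "\<sigma>0 \<in> sobolev_W_inf 2 Om" and adm: "\<sigma> \<in> admissible Om \<eta> \<sigma>0 k1 k2"
 shows "AE x in surf. k1 <= bdry_trace Om \<sigma>0 x" "square_integrable surf (bdry_trace Om \<sigma>0)"
proof -
 have W: "has_weak_deriv Om (count_list is) \<sigma>0 (weak_deriv Om (count_list is) \<sigma>0)" "square_integrable (lebesgue_on Om) (weak_deriv Om (count_list is) \<sigma>0)"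
  if "length is <= 2" for "is" using weak_deriv_sqint[OF open_dom] W_inf_sqint[OF open_dom bounded_dom s0 that] by blast+
 have "EX p. length is <= 2 --> rep Om (weak_deriv Om (count_list is) \<sigma>0) p" for "is"
  using rep_sqz_exists[OF dom_sets W(2)] by metis
 then obtain p where p: "!!is. length is <= 2 ==> rep Om (weak_deriv Om (count_list is) \<sigma>0) (p is)" by metis
 have pz: "sqz Om (p is)" if "length is <= 2" for "is" by (rule rep_imp_sqz[OF dom_sets p[OF that] W(2)[OF that]])
 have "has_weak_deriv Om (count_list []) \<sigma>0 \<sigma>0" using W(1)[of "[]"] by (intro has_weak_deriv_0) (simp add: has_weak_deriv_def)
 from weak_deriv_eq[OF open_dom this] have r: "rep Om \<sigma>0 (p [])" using rep_cong[OF p[of "[]"]] by simp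
 have wd: "wder Om i (p []) (p [i])" for i by (rule wder_rep[OF open_dom W(1) W(1) p p]) auto
 note props = bdry_trace_props[where v = \<sigma>0 and g = "%i. p [i]", OF r pz pz wd]
 show "square_integrable surf (bdry_trace Om \<sigma>0)" by (rule props(1)) auto
 let ?G = "{x. infdist x (frontier Om) < \<eta>}"
 have G: "open ?G" by (intro open_Collect_less continuous_intros)
 have cl: "closure (inner_domain \<eta> Om) \<subseteq> {x. \<eta> <= infdist x (frontier Om)}"
  by (rule closure_minimal) (auto simp: inner_domain_def intro!: closed_Collect_le continuous_intros)
 have sb: "Om - closure (inner_domain \<eta> Om) \<in> sets borel" by simp
 have "AE x in lborel. x \<in> Om - closure (inner_domain \<eta> Om) --> \<sigma> x = \<sigma>0 x" "AE x in lborel. x \<in> Om --> k1 <= \<sigma> x"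
  using adm unfolding admissible_def AE_lebesgue_on_iff[OF sb] AE_lebesgue_on_iff[OF dom_sets] by auto
 then have ae: "AE x in lborel. x \<in> Om \<inter> ?G --> k1 <= p [] x" using rep_AE[OF dom_sets r]
  by eventually_elim (use cl in force)
 show "AE x in surf. k1 <= bdry_trace Om \<sigma>0 x" by (rule props(3)[OF _ _ G _ ae]) (use assms(1) in auto)
qed

theorem theorem2p1:
  fixes \<Omega> :: "(real ^ 'n::finite) set"
    and \<sigma>0 \<sigma> g u U :: "real ^ 'n \<Rightarrow> real"
    and \<eta> k1 k2 \<delta> :: real
  assumes dim: "CARD('n) = 2 \<or> CARD('n) = 3"
    and domain: "C_k_bounded_domain 6 \<Omega>"
    and eta: "0 < \<eta>" "\<eta> < diameter \<Omega>"
    and sigma0: "\<sigma>0 \<in> sobolev_W_inf 2 \<Omega>"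
    and k: "0 < k1" "k1 < k2"
    and sigma: "\<sigma> \<in> admissible \<Omega> \<eta> \<sigma>0 k1 k2"
    and g: "g \<in> boundary_H 6 3 (1/2) \<Omega>" "(\<integral>x. g x \<partial>surface_measure \<Omega>) = 0"
    and u: "u \<in> sobolev_H 5 \<Omega>" "solves_neumann \<Omega> \<sigma> g u"
    and separated: "inf_dist_sets (inflow \<Omega> g) (outflow \<Omega> g) > 0"
    and delta: "0 < \<delta>" "\<delta> < 1"
    and U: "noisy_data \<Omega> \<sigma>0 g u \<delta> U"
  shows "\<forall>\<epsilon>. 0 < \<epsilon> \<and> \<epsilon> < 1 \<longrightarrow>
    (let \<beta> = weak_grad \<Omega> U;
         \<mu> = (\<lambda>x. weak_laplacian \<Omega> U x / 2 + \<epsilon>);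
         \<gamma>\<^sub>0 = (\<lambda>x. sqrt (bdry_trace \<Omega> \<sigma>0 x))
     in \<exists>\<gamma>. weak_transport_solution \<Omega> \<beta> \<mu> \<gamma>\<^sub>0 \<gamma> \<and>
          (\<forall>\<gamma>'. weak_transport_solution \<Omega> \<beta> \<mu> \<gamma>\<^sub>0 \<gamma>' \<longrightarrow>
             (AE x in lebesgue_on \<Omega>. \<gamma>' x = \<gamma> x)))"
proof -
 obtain C R s \<tau> e \<phi> where "smooth_domain \<Omega> C R s \<tau> e \<phi>" using smooth_domain_exists[OF domain] by force
 then interpret smooth_domain \<Omega> C R s \<tau> e \<phi> .
 have UH: "U \<in> sobolev_H 5 \<Omega>" and Ug: "AE x in surf. bdry_trace \<Omega> \<sigma>0 x * normal_trace \<Omega> (weak_grad \<Omega> U) x = g x"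
  using U by (simp_all add: noisy_data_def normal_deriv_def)
 have n3: "CARD('n) <= 3" using dim by auto
 obtain w K where w: "!!is. length is <= 2 ==> rep \<Omega> (weak_deriv \<Omega> (count_list is) U) (w is)" "!!is. length is <= 2 ==> sqz \<Omega> (w is)"
  "!!is i. length is <= 1 ==> wder \<Omega> i (w is) (w (i # is))" "0 <= K" "!!is x. \<bar>w is x\<bar> <= K"
  by (rule sobolev_rep[OF n3 UH]) blast
 let ?\<beta> = "weak_grad \<Omega> U"
 define b where "b x = (\<chi> j. w [j] x)" for x
 define D where "D x = (\<Sum>j\<in>UNIV. w [j, j] x)" for x
 let ?B = "real CARD('n) * K"
 have s1: "sqz \<Omega> (w [i])" and s2: "sqz \<Omega> (w [i, j])" for i j by (rule w(2), simp)+
 have d1: "wder \<Omega> i (w [j]) (w [i, j])" for i j using w(3)[of "[j]" i] by simp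
 have repb: "rep \<Omega> (%x. ?\<beta> x $ i) (w [i])" for i using w(1)[of "[i]"] by (simp add: weak_grad_def mi_unit_eq)
 \<comment> \<open>\<open>weak_div\<close> differentiates the components of
   \<open>weak_grad\<close>, which are choices themselves. Uniqueness of weak derivatives identifies
   the result with the entries \<open>w [i, i]\<close>.\<close>
 have repD: "rep \<Omega> (weak_div \<Omega> ?\<beta>) D"
  unfolding weak_div_def D_def[abs_def] mi_unit_eq
 proof (rule rep_sum)
  fix i
  have "has_weak_deriv \<Omega> (count_list [i]) (%y. ?\<beta> y $ i) (w [i, i])"
   using has_weak_deriv_unit_rep[OF dom_sets repb s1 rep_self[OF s2] s2] d1 unfolding mi_unit_eq by blast
  from weak_deriv_eq[OF open_dom this] have "AE x in lebesgue_on \<Omega>. w [i, i] x = weak_deriv \<Omega> (count_list [i]) (%y. ?\<beta> y $ i) x"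
   by eventually_elim simp
  then show "rep \<Omega> (weak_deriv \<Omega> (count_list [i]) (%y. ?\<beta> y $ i)) (w [i, i])" by (rule rep_cong[OF rep_self[OF s2]])
 qed
 have sum: "b x \<bullet> grad \<psi> x + D x * \<psi> x = (\<Sum>i\<in>UNIV. w [i] x * pd i \<psi> x + w [i, i] x * \<psi> x)" for \<psi> x
  by (simp add: b_def D_def inner_vec_def sum.distrib sum_distrib_right)
 have bfield: "bounded_field \<Omega> b D ?B"
  unfolding bounded_field_def
 proof (intro conjI allI ballI)
  show "b \<in> borel_measurable borel"
   by (subst borel_measurable_euclidean_space) (use sqzD(2)[OF s1] in "auto simp: b_def[abs_def] Basis_vec_def inner_axis")
  show "D \<in> borel_measurable borel" unfolding D_def[abs_def] using sqzD(2)[OF s2] by measurable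
  show "norm (b x) <= ?B" for x
   by (rule order_trans[OF norm_le_l1_cart]) (rule sum_bounded_above, simp add: b_def w(5))
  show "\<bar>D x\<bar> <= ?B" for x
   unfolding D_def by (rule order_trans[OF sum_abs]) (rule sum_bounded_above, simp add: w(5))
  fix \<psi> assume \<psi>: "\<psi> \<in> test_functions \<Omega>"
  then have q: "square_integrable lborel \<psi>" "square_integrable lborel (pd i \<psi>)" for i
   using test_functions_pd[OF \<psi>, of i] by (auto simp: test_functions_iff smooth_cs_sqint)
  show "(LBINT x. b x \<bullet> grad \<psi> x + D x * \<psi> x) = 0"
   unfolding sum using \<psi> d1 sqint_mult[OF sqzD(1)[OF s1] q(2)] sqint_mult[OF sqzD(1)[OF s2] q(1)] by (simp add: wder_iff)
 qed
 have bLip: "cone_Lipschitz b" unfolding b_def[abs_def] by (rule cone_Lipschitz_intro[OF s1 s2 d1, where K = K]) (use w(5) in simp)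
 interpret S: boundary_pair \<Omega> "%_. axis i 1" "%_. 0" 1 surf "%z. outward_normal \<Omega> z $ i" for i by (rule surf_pair)
 let ?t = "%i. bdry_trace \<Omega> (%y. ?\<beta> y $ i)"
 have tr: "square_integrable surf (?t j)" "S.green i (w [j]) (w [i, j]) (?t j)" for i j
  using bdry_trace_props(1,2)[OF repb s1 s2 d1] by auto
 have bn: "normal_trace \<Omega> ?\<beta> = (%x. \<Sum>i\<in>UNIV. outward_normal \<Omega> x $ i * ?t i x)"
  by (simp add: fun_eq_iff normal_trace_def inner_vec_def mult.commute)
 have bn_sq: "square_integrable surf (normal_trace \<Omega> ?\<beta>)"
  unfolding bn by (intro sqint_sum sqint_mult_bounded[OF tr(1) S.sN(1) AE_I2[OF S.sN(2)]])
 \<comment> \<open>Green's formula for the i-th component of the field in direction i, summed over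
   i.\<close>
 have bn_div: "(LBINT x. indicator \<Omega> x * (b x \<bullet> grad F x + D x * F x)) = (LINT x|surf. normal_trace \<Omega> ?\<beta> x * F x)" if F: "C_inf F" for F
 proof -
  have i: "integrable lborel (%x. w [i] x * pd i F x)" "integrable lborel (%x. w [i, i] x * F x)" "integrable surf (%x. ?t i x * (outward_normal \<Omega> x $ i * F x))" for i
   using S.integrable_green(1)[OF s1 F] S.integrable_green(2)[OF s2 F] sqint_mult[OF tr(1) S.sqint_smooth(2)[OF F]] by (simp_all add: inner_axis')
  have z: "w [i] x = 0" "w [i, j] x = 0" if "x \<notin> \<Omega>" for x i j using sqzD(3)[OF s1 that] sqzD(3)[OF s2 that] by auto
  have "(LBINT x. indicator \<Omega> x * (b x \<bullet> grad F x + D x * F x)) = (LBINT x. (\<Sum>i\<in>UNIV. w [i] x * pd i F x + w [i, i] x * F x))"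
   by (rule Bochner_Integration.integral_cong[OF refl]) (use z in "auto simp: sum indicator_def")
  also have "... = (\<Sum>i\<in>UNIV. \<integral>x. ?t i x * (outward_normal \<Omega> x $ i * F x) \<partial>surf)"
   using tr(2) F i by (simp add: S.green_def inner_axis')
  also have "... = (LINT x|surf. (\<Sum>i\<in>UNIV. ?t i x * (outward_normal \<Omega> x $ i * F x)))" using i by simp
  finally show ?thesis by (simp add: bn sum_distrib_right sum_distrib_left mult_ac)
 qed
 note st = sigma_trace[OF eta(1) sigma0 sigma]
 obtain \<xi> where \<xi>: "smooth_cs \<xi>" "!!x. 0 <= \<xi> x" "!!x. \<xi> x <= 1" "!!x. x \<in> inflow \<Omega> g ==> \<xi> x = 1" "!!x. x \<in> outflow \<Omega> g ==> \<xi> x = 0"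
  using separated_cutoff[OF bounded_dom separated] by blast
 \<comment> \<open>The trace of \<open>\<sigma>0\<close> is positive and its product with the flux
   is g, so the flux has the sign of g almost everywhere; where the flux vanishes, both sides are
   0.\<close>
 have sep: "AE x in surf. \<bar>normal_trace \<Omega> ?\<beta> x\<bar> = normal_trace \<Omega> ?\<beta> x * (1 - 2 * \<xi> x)"
  using Ug st(1) AE_space
 proof eventually_elim
  case (elim x)
  let ?n = "normal_trace \<Omega> ?\<beta> x"
  have p: "bdry_trace \<Omega> \<sigma>0 x > 0" using elim(2) k(1) by linarith
  consider "?n = 0" | "?n < 0" | "?n > 0" by linarith
  then show ?case
  proof cases
   case 2
   then have "g x < 0" using elim(1) p by (metis mult_pos_neg)
   then show ?thesis using \<xi>(4)[of x] 2 elim(3) by (simp add: inflow_def)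
  next
   case 3
   then have "g x > 0" using elim(1) p by (metis mult_pos_pos)
   then show ?thesis using \<xi>(5)[of x] 3 elim(3) by (simp add: outflow_def)
  qed simp
 qed
 have "transport \<Omega> C R s \<tau> e \<phi> ?\<beta> b D ?B \<xi>"
  by (intro transport.intro smooth_domain_axioms transport_axioms.intro) (use repb repD bfield bLip bn_sq bn_div \<xi> sep in "simp_all add: b_def")
 then interpret transport \<Omega> C R s \<tau> e \<phi> ?\<beta> b D ?B \<xi> .
 \<comment> \<open>The square of the boundary datum is the trace of \<open>\<sigma>0\<close>; its
   product with the flux is integrable because both factors are square integrable on the
   boundary.\<close>
 have \<gamma>0: "square_integrable flux (%x. sqrt (bdry_trace \<Omega> \<sigma>0 x))"
 proof -
  have m [measurable]: "bdry_trace \<Omega> \<sigma>0 \<in> borel_measurable surf" using st(2) by (simp add: square_integrable_def)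
  have "integrable surf (%x. \<bar>bn x * bdry_trace \<Omega> \<sigma>0 x\<bar>)" using sqint_mult[OF bn_sq st(2)] by simp
  then have "integrable surf (%x. \<bar>bn x\<bar> * (sqrt (bdry_trace \<Omega> \<sigma>0 x))\<^sup>2)"
  proof (rule Bochner_Integration.integrable_cong_AE_imp)
   show "AE x in surf. \<bar>bn x * bdry_trace \<Omega> \<sigma>0 x\<bar> = \<bar>bn x\<bar> * (sqrt (bdry_trace \<Omega> \<sigma>0 x))\<^sup>2"
    using st(1) by eventually_elim (use k(1) in "simp add: abs_mult")
  qed measurable
  then show ?thesis by (simp add: square_integrable_def integrable_flux)
 qed
 show ?thesis
  using transport_exists[OF _ \<gamma>0] transport_unique unfolding Let_def weak_laplacian_def by blast
qed

end
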